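(* Let $(R,\mathfrak m)$ be an $F$-finite standard graded ring of characteristic $p>0$ with homogeneous maximal ideal $\mathfrak m$, let $J$ be a homogeneous proper ideal (not necessarily of finite colength), and let $M$ be a finitely generated $\mathbb Z$-graded $R$-module of dimension $d$. Assume $d\ge2$. For $s\in\mathbb R$ and $q=p^n$, set $$\tilde g_{n,M,J,d-1}(s)=\frac{1}{q^{d-1}}\,l\big([M/J^{[q]}M]_{\lfloor sq\rfloor}\big).$$ Then: (1) The sequence $(\tilde g_{n,M,J,d-1}(s))_n$ converges uniformly on every compact subset of $\mathbb R$. The limiting function is continuous. (2) $h_{M,\mathfrak m,J}$ is continuously differentiable on $\mathbb R$, the density function $f_{M,\mathfrak m,J}(s)$ exists for all $s\in\mathbb R$, and for $s\in\mathbb R$, $$h'_{M,\mathfrak m,J}(s)=f_{M,\mathfrak m,J}(s)=\lim_{n\to\infty}\tilde g_{n,M,J,d-1}(s).$$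
   Context: $F$-finite means the Frobenius endomorphism is finite. $l$ is length, $[N]_j$ is the degree $j$ part of a graded module $N$, and $J^{[q]}$ is the ideal generated by the $q$-th powers of elements of $J$. Nonpositive powers of an ideal are the unit ideal. For $s\in\mathbb R$, $h_{n,M,\mathfrak m,J}(s)=l\big(M/(\mathfrak m^{\lceil sq\rceil}+J^{[q]})M\big)$, and $h_{M,\mathfrak m,J}(s)=\lim_{n\to\infty}h_{n,M,\mathfrak m,J}(s)/q^d$ (this limit exists for all $s$). Let $f_{n,M,\mathfrak m,J}(s)=h_{n,M,\mathfrak m,J}(s+\frac1q)-h_{n,M,\mathfrak m,J}(s)$; the density function at $s$ is $f_{M,\mathfrak m,J}(s)=\lim_{n\to\infty}f_{n,M,\mathfrak m,J}(s)/q^{d-1}$ whenever this limit exists. *)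

theory Defs
  imports
    "HOL-Analysis.Analysis"
    "HOL-Library.Extended_Nat"
    "HOL-Algebra.Module"
    "HOL-Algebra.QuotRing"
    "HOL-Algebra.Ideal_Product"
    "HOL-Algebra.Generated_Rings"
    "HOL-Algebra.Multiplicative_Group"
begin

section \<open>Graded rings and modules\<close>

definition direct_sum_decomposition :: "('b, 'm) ring_scheme \<Rightarrow> ('i \<Rightarrow> 'b set) \<Rightarrow> bool" where
  "direct_sum_decomposition G A \<longleftrightarrow>
     (\<forall>i. additive_subgroup (A i) G) \<and>
     (\<forall>x \<in> carrier G. \<exists>!c. (\<forall>i. c i \<in> A i) \<and> finite {i. c i \<noteq> \<zero>\<^bsub>G\<^esub>} \<and>
        x = finsum G c {i. c i \<noteq> \<zero>\<^bsub>G\<^esub>})"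

locale graded_ring = cring R for R (structure) +
  fixes Rg :: "nat \<Rightarrow> 'a set"
  assumes ring_decomposition: "direct_sum_decomposition R Rg"
    and one_degree: "\<one> \<in> Rg 0"
    and mult_degree: "\<lbrakk>x \<in> Rg i; y \<in> Rg j\<rbrakk> \<Longrightarrow> x \<otimes> y \<in> Rg (i + j)"

text \<open>Standard graded: the degree-zero part is a field, over which the ring is generated as an
  algebra by finitely many elements of degree one.\<close>

locale standard_graded_ring = graded_ring +
  assumes degree_zero_field: "subfield (Rg 0) R"
    and degree_one_generated:
      "\<exists>X. finite X \<and> X \<subseteq> Rg 1 \<and> generate_ring R (Rg 0 \<union> X) = carrier R"

text \<open>The name of the algebraic locale is qualified because \<open>HOL.Modules\<close> has a different locale
  of the same name.\<close>

locale graded_module = Module.module R M + graded_ring R Rg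
  for R :: "('a, 'r) ring_scheme" (structure) and Rg :: "nat \<Rightarrow> 'a set"
    and M :: "('a, 'b, 'm) module_scheme" (structure) +
  fixes Mg :: "int \<Rightarrow> 'b set"
  assumes module_decomposition: "direct_sum_decomposition M Mg"
    and smult_degree:
      "\<lbrakk>r \<in> Rg i; x \<in> Mg j\<rbrakk> \<Longrightarrow> r \<odot>\<^bsub>M\<^esub> x \<in> Mg (int i + j)"

definition homogeneous_ideal :: "('a, 'r) ring_scheme \<Rightarrow> (nat \<Rightarrow> 'a set) \<Rightarrow> 'a set \<Rightarrow> bool" where
  "homogeneous_ideal R Rg I \<longleftrightarrow> ideal I R \<and> I = Idl\<^bsub>R\<^esub> {x \<in> I. \<exists>i. x \<in> Rg i}"

definition finitely_generated_module ::
    "('a, 'r) ring_scheme \<Rightarrow> ('a, 'b, 'm) module_scheme \<Rightarrow> bool" where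
  "finitely_generated_module R M \<longleftrightarrow>
     (\<exists>X. finite X \<and> X \<subseteq> carrier M \<and>
        (\<forall>x \<in> carrier M. \<exists>c \<in> X \<rightarrow> carrier R. x = (\<Oplus>\<^bsub>M\<^esub>v \<in> X. c v \<odot>\<^bsub>M\<^esub> v)))"

section \<open>Characteristic and the Frobenius endomorphism\<close>

text \<open>\<^const>\<open>group.ord\<close> is \<open>0\<close> for elements of infinite order.\<close>

definition ring_char :: "('a, 'r) ring_scheme \<Rightarrow> nat" where
  "ring_char R = group.ord (add_monoid R) \<one>\<^bsub>R\<^esub>"

definition finite_ring_hom ::
    "('a, 'r) ring_scheme \<Rightarrow> ('b, 's) ring_scheme \<Rightarrow> ('a \<Rightarrow> 'b) \<Rightarrow> bool" where
  "finite_ring_hom A B f \<longleftrightarrow> f \<in> ring_hom A B \<and>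
     (\<exists>X. finite X \<and> X \<subseteq> carrier B \<and>
        (\<forall>y \<in> carrier B. \<exists>c \<in> X \<rightarrow> carrier A. y = (\<Oplus>\<^bsub>B\<^esub>x \<in> X. f (c x) \<otimes>\<^bsub>B\<^esub> x)))"

definition F_finite :: "('a, 'r) ring_scheme \<Rightarrow> nat \<Rightarrow> bool" where
  "F_finite R p \<longleftrightarrow> finite_ring_hom R R (\<lambda>x. x [^]\<^bsub>R\<^esub> p)"

section \<open>Dimension and length\<close>

text \<open>The zero ring has no prime ideals and gets dimension \<open>0\<close> here.\<close>

definition krull_dim :: "('a, 'r) ring_scheme \<Rightarrow> enat" where
  "krull_dim A =
     Sup {enat n | n. \<exists>P :: nat \<Rightarrow> 'a set.
       (\<forall>i \<le> n. primeideal (P i) A) \<and> (\<forall>i < n. P i \<subset> P (Suc i))}"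

definition annihilator :: "('a, 'r) ring_scheme \<Rightarrow> ('a, 'b, 'm) module_scheme \<Rightarrow> 'a set" where
  "annihilator R M = {r \<in> carrier R. \<forall>x \<in> carrier M. r \<odot>\<^bsub>M\<^esub> x = \<zero>\<^bsub>M\<^esub>}"

definition module_dim :: "('a, 'r) ring_scheme \<Rightarrow> ('a, 'b, 'm) module_scheme \<Rightarrow> enat" where
  "module_dim R M = krull_dim (R Quot annihilator R M)"

definition module_length :: "('a, 'r) ring_scheme \<Rightarrow> ('a, 'b, 'm) module_scheme \<Rightarrow> enat" where
  "module_length R M =
     Sup {enat n | n. \<exists>N :: nat \<Rightarrow> 'b set.
       (\<forall>i \<le> n. submodule (N i) R M) \<and> (\<forall>i < n. N i \<subset> N (Suc i))}"

text \<open>Library modules carry the (meaningless) ring fields \<open>mult\<close> and \<open>one\<close>, which are left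
  unspecified in the quotient.\<close>

definition quotient_module ::
    "('a, 'b, 'm) module_scheme \<Rightarrow> 'b set \<Rightarrow> ('a, 'b set) module" where
  "quotient_module M N =
     \<lparr>carrier = a_rcosets\<^bsub>M\<^esub> N, mult = undefined, one = undefined, zero = N, add = set_add M,
      smult = (\<lambda>r X. \<Union>x \<in> X. N +>\<^bsub>M\<^esub> (r \<odot>\<^bsub>M\<^esub> x))\<rparr>"

text \<open>For a homogeneous submodule \<open>N\<close>, the degree \<open>j\<close> part of \<open>M/N\<close> is the image of that of \<open>M\<close>;
  it is a module over the degree-zero part of the ring.\<close>

definition quotient_degree_part ::
    "('a, 'b, 'm) module_scheme \<Rightarrow> (int \<Rightarrow> 'b set) \<Rightarrow> 'b set \<Rightarrow> int \<Rightarrow> ('a, 'b set) module" where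
  "quotient_degree_part M Mg N j =
     (quotient_module M N)\<lparr>carrier := (\<lambda>x. N +>\<^bsub>M\<^esub> x) ` Mg j\<rparr>"

section \<open>Powers of ideals and products with modules\<close>

text \<open>\<^const>\<open>nat\<close> sends nonpositive exponents to \<open>0\<close>, giving the unit ideal.\<close>

definition ideal_power :: "('a, 'r) ring_scheme \<Rightarrow> 'a set \<Rightarrow> int \<Rightarrow> 'a set" where
  "ideal_power R I k = I [^]\<^bsub>ideals_set R\<^esub> nat k"

definition frobenius_power :: "('a, 'r) ring_scheme \<Rightarrow> 'a set \<Rightarrow> nat \<Rightarrow> 'a set" where
  "frobenius_power R J q = Idl\<^bsub>R\<^esub> ((\<lambda>x. x [^]\<^bsub>R\<^esub> q) ` J)"

definition ideal_smult ::
    "('a, 'r) ring_scheme \<Rightarrow> 'a set \<Rightarrow> ('a, 'b, 'm) module_scheme \<Rightarrow> 'b set" where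
  "ideal_smult R I M =
     \<Inter>{N. submodule N R M \<and> {a \<odot>\<^bsub>M\<^esub> x | a x. a \<in> I \<and> x \<in> carrier M} \<subseteq> N}"

section \<open>The h-function and the density function\<close>

text \<open>All lengths below are finite when \<open>R\<close> is standard graded, \<open>\<mm>\<close> is its homogeneous maximal ideal
  and \<open>M\<close> is finitely generated, so that \<^const>\<open>the_enat\<close> loses nothing.  The parameter \<open>d\<close> is the
  dimension of \<open>M\<close>.\<close>

definition h_seq :: "('a, 'r) ring_scheme \<Rightarrow> ('a, 'b, 'm) module_scheme \<Rightarrow> 'a set \<Rightarrow> 'a set \<Rightarrow>
    nat \<Rightarrow> nat \<Rightarrow> real \<Rightarrow> real" where
  "h_seq R M \<mm> J p n s =
     real (the_enat (module_length R (quotient_module M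
       (ideal_smult R
         (ideal_power R \<mm> \<lceil>s * real (p ^ n)\<rceil> <+>\<^bsub>R\<^esub> frobenius_power R J (p ^ n)) M))))"

definition h_fun :: "('a, 'r) ring_scheme \<Rightarrow> ('a, 'b, 'm) module_scheme \<Rightarrow> 'a set \<Rightarrow> 'a set \<Rightarrow>
    nat \<Rightarrow> nat \<Rightarrow> real \<Rightarrow> real" where
  "h_fun R M \<mm> J p d s = lim (\<lambda>n. h_seq R M \<mm> J p n s / real (p ^ n) ^ d)"

definition f_seq :: "('a, 'r) ring_scheme \<Rightarrow> ('a, 'b, 'm) module_scheme \<Rightarrow> 'a set \<Rightarrow> 'a set \<Rightarrow>
    nat \<Rightarrow> nat \<Rightarrow> real \<Rightarrow> real" where
  "f_seq R M \<mm> J p n s = h_seq R M \<mm> J p n (s + 1 / real (p ^ n)) - h_seq R M \<mm> J p n s"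

definition density_exists :: "('a, 'r) ring_scheme \<Rightarrow> ('a, 'b, 'm) module_scheme \<Rightarrow> 'a set \<Rightarrow> 'a set \<Rightarrow>
    nat \<Rightarrow> nat \<Rightarrow> real \<Rightarrow> bool" where
  "density_exists R M \<mm> J p d s \<longleftrightarrow>
     convergent (\<lambda>n. f_seq R M \<mm> J p n s / real (p ^ n) ^ (d - 1))"

definition density_fun :: "('a, 'r) ring_scheme \<Rightarrow> ('a, 'b, 'm) module_scheme \<Rightarrow> 'a set \<Rightarrow> 'a set \<Rightarrow>
    nat \<Rightarrow> nat \<Rightarrow> real \<Rightarrow> real" where
  "density_fun R M \<mm> J p d s = lim (\<lambda>n. f_seq R M \<mm> J p n s / real (p ^ n) ^ (d - 1))"

definition g_tilde :: "('a, 'r) ring_scheme \<Rightarrow> (nat \<Rightarrow> 'a set) \<Rightarrow> ('a, 'b, 'm) module_scheme \<Rightarrow>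
    (int \<Rightarrow> 'b set) \<Rightarrow> 'a set \<Rightarrow> nat \<Rightarrow> nat \<Rightarrow> nat \<Rightarrow> real \<Rightarrow> real" where
  "g_tilde R Rg M Mg J p e n s =
     1 / real (p ^ n) ^ e *
     real (the_enat (module_length (R\<lparr>carrier := Rg 0\<rparr>)
       (quotient_degree_part M Mg (ideal_smult R (frobenius_power R J (p ^ n)) M)
         \<lfloor>s * real (p ^ n)\<rfloor>)))"

end

theory Submission
  imports Defs "HOL-Algebra.Free_Abelian_Groups"
begin

text \<open>Write \<open>\<psi>\<^sub>n(j)\<close> for the length of the degree \<open>j\<close> part of \<open>M / J\<^bsup>[q]\<^esup> M\<close> with \<open>q = p\<^bsup>n\<^esup>\<close>.  Filtering
  modules by shifted cyclic modules \<open>R / P\<close> with \<open>P\<close> a homogeneous prime, and multiplying by a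
  homogeneous element outside the primes of maximal dimension, bounds \<open>\<psi>\<^sub>n(j + 1) - \<psi>\<^sub>n(j)\<close> by a
  constant times \<open>(\<bar>j\<bar> + q)\<^bsup>d - 2\<^esup>\<close>; so the functions in question are equi-Lipschitz up to \<open>1 / q\<close>, and
  only pointwise convergence is needed.  The pushforward of \<open>R / P\<close> under Frobenius is, up to pieces
  of smaller dimension, a sum of \<open>c\<close> copies of \<open>R / P\<close>, which gives
  \<open>\<kappa> \<psi>\<^sub>n\<^sub>+\<^sub>1(p j) = c \<psi>\<^sub>n(j) + O((\<bar>j\<bar> + q)\<^bsup>d - 2\<^esup>)\<close> with \<open>\<kappa> = [k : k\<^bsup>p\<^esup>]\<close>: a bounded sequence that is
  geometric up to a geometric error converges.  A general \<open>M\<close> reduces to these by pushing forward along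
  an iterate of Frobenius that kills the nilradical.  Finally, a step of \<open>h\<^sub>n\<close> in \<open>s q\<close> differs from
  \<open>\<psi>\<^sub>n\<close> by \<open>O(q\<^bsup>d - 2\<^esup>)\<close>, so \<open>h\<close> is the integral of the limit.\<close>

section \<open>Subgroups and lengths of intervals\<close>

text \<open>Rings and modules are encoded as subgroups of a single commutative ring type, taken
  modulo \<open>K\<close>: a graded piece is an interval between two subgroups, its length the
  supremum of the lengths of chains, and a pushforward changes only the exponent in the action and
  the indexing of degrees. Kernels, filtrations and pushforwards thus live in one type. In return,
  the given ring and module must be presented inside such a type, through a monoid ring mapping onto
  the idealization of the module. Since J may have infinite colength, all estimates are made degree
  by degree. A homomorphism with kernel and cokernel of dimension at most d - 1 changes the length
  modulo J^[q] in degree j by parts of the kernel and cokernel near degree j, and by parts of the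
  cokernel in degrees near j - q e, where e runs over the degrees of generators of J. Hence the
  scale (|j| + q)^(d-2); with d = k + 2 its exponent is \<open>k\<close>. The number c is never
  computed. If c / (\<kappa> p^(d-1)) exceeded 1, boundedness would force the limit 0; below 1 the
  limit is 0 as well; at 1 the differences are summable.\<close>

definition sgp :: "'a::ab_group_add set \<Rightarrow> bool" where
  "sgp A \<longleftrightarrow> 0 \<in> A \<and> (\<forall>x\<in>A. \<forall>y\<in>A. x - y \<in> A)"

lemma sgp_zero: "sgp A \<Longrightarrow> 0 \<in> A"
  and sgp_diff: "sgp A \<Longrightarrow> x \<in> A \<Longrightarrow> y \<in> A \<Longrightarrow> x - y \<in> A"
  by (auto simp: sgp_def)

lemma sgp_minus: "sgp A \<Longrightarrow> x \<in> A \<Longrightarrow> - x \<in> A"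
  using sgp_diff[of A 0 x] by (simp add: sgp_zero)

lemma sgp_add: "sgp A \<Longrightarrow> x \<in> A \<Longrightarrow> y \<in> A \<Longrightarrow> x + y \<in> A"
  using sgp_diff[of A x "- y"] by (simp add: sgp_minus)

lemma sgp_sum: "sgp A \<Longrightarrow> (\<And>i. i \<in> I \<Longrightarrow> f i \<in> A) \<Longrightarrow> sum f I \<in> A"
  by (induction I rule: infinite_finite_induct) (auto simp: sgp_zero sgp_add)

lemma sgp_cong: "sgp A \<Longrightarrow> x - y \<in> A \<Longrightarrow> x \<in> A \<longleftrightarrow> y \<in> A"
  using sgp_add[of A "x - y" y] sgp_diff[of A x "x - y"] by auto

lemma sgp_Int: "sgp A \<Longrightarrow> sgp B \<Longrightarrow> sgp (A \<inter> B)"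
  by (auto simp: sgp_def)

lemma sgp_plus:
  assumes "sgp A" "sgp B" shows "sgp (A + B)"
  unfolding sgp_def
proof (intro conjI ballI)
  show "0 \<in> A + B" using set_plus_intro[of 0 A 0 B] assms by (simp add: sgp_zero)
  fix x y assume "x \<in> A + B" "y \<in> A + B"
  then obtain a b a' b' where *: "x = a + b" "y = a' + b'" "a \<in> A" "b \<in> B" "a' \<in> A" "b' \<in> B"
    by (auto elim!: set_plus_elim)
  have "x - y = (a - a') + (b - b')" by (simp add: *)
  moreover have "a - a' \<in> A" "b - b' \<in> B" using * assms by (auto intro: sgp_diff)
  ultimately show "x - y \<in> A + B" by (metis set_plus_intro)
qed

lemma subset_plus_left: "sgp B \<Longrightarrow> A \<subseteq> A + B"
  and subset_plus_right: "sgp B \<Longrightarrow> A \<subseteq> B + A"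
  using set_zero_plus2[of B A] by (auto simp: sgp_zero add.commute)

lemma plus_subset: "sgp C \<Longrightarrow> A \<subseteq> C \<Longrightarrow> B \<subseteq> C \<Longrightarrow> A + B \<subseteq> C"
  by (auto elim!: set_plus_elim intro: sgp_add)

lemma plus_absorb: "sgp C \<Longrightarrow> sgp A \<Longrightarrow> A \<subseteq> C \<Longrightarrow> C + A = C"
  by (meson equalityI order_refl plus_subset subset_plus_left)

lemma modular_law:
  assumes "sgp A" "C \<subseteq> A"
  shows "A \<inter> (B + C) = (A \<inter> B) + C"
proof
  show "A \<inter> (B + C) \<subseteq> A \<inter> B + C"
  proof
    fix x assume x: "x \<in> A \<inter> (B + C)"
    then obtain b c where *: "x = b + c" "b \<in> B" "c \<in> C" by (auto elim!: set_plus_elim)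
    have "x - c \<in> A" using x * assms by (blast intro: sgp_diff)
    then have "b \<in> A" using * by simp
    then show "x \<in> A \<inter> B + C" using * by auto
  qed
  show "A \<inter> B + C \<subseteq> A \<inter> (B + C)"
    using assms by (auto elim!: set_plus_elim intro: sgp_add)
qed

text \<open>A chain need not begin at \<open>B\<close> or end at \<open>A\<close>. This is the shape
  of \<open>module_length\<close>, which becomes the case of the bounds \<open>{}\<close> and
  \<open>UNIV\<close>.\<close>

definition len :: "('a set \<Rightarrow> bool) \<Rightarrow> 'a set \<Rightarrow> 'a set \<Rightarrow> enat" where
  "len L B A = Sup {enat n | n. \<exists>W :: nat \<Rightarrow> 'a set.
     (\<forall>i\<le>n. L (W i) \<and> B \<subseteq> W i \<and> W i \<subseteq> A) \<and> (\<forall>i<n. W i \<subset> W (Suc i))}"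

lemma enat_le_SupD:
  assumes "enat n \<le> Sup {enat m | m. P m}" "n > 0"
  shows "\<exists>m\<ge>n. P m"
proof (rule ccontr)
  assume "\<not> ?thesis"
  then have "Sup {enat m | m. P m} \<le> enat (n - 1)"
  proof (intro Sup_least, clarify)
    fix m assume "P m"
    then have "\<not> n \<le> m" using \<open>\<not> (\<exists>m\<ge>n. P m)\<close> by blast
    then show "enat m \<le> enat (n - 1)" by simp
  qed
  from order.trans[OF assms(1) this] show False using assms(2) by simp
qed

lemma len_geI:
  assumes "\<And>i. i \<le> n \<Longrightarrow> L (W i) \<and> B \<subseteq> W i \<and> W i \<subseteq> A" "\<And>i. i < n \<Longrightarrow> W i \<subset> W (Suc i)"
  shows "enat n \<le> len L B A"
  unfolding len_def by (rule Sup_upper) (use assms in blast)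

lemma len_geD:
  assumes "enat n \<le> len L B A" "n > 0"
  shows "\<exists>W. (\<forall>i\<le>n. L (W i) \<and> B \<subseteq> W i \<and> W i \<subseteq> A) \<and> (\<forall>i<n. W i \<subset> W (Suc i))"
  using enat_le_SupD[OF assms(1)[unfolded len_def] assms(2)] by (meson le_trans less_le_trans)

lemma len_leI:
  assumes "\<And>n W. n > 0 \<Longrightarrow> (\<And>i. i \<le> n \<Longrightarrow> L (W i) \<and> B \<subseteq> W i \<and> W i \<subseteq> A) \<Longrightarrow>
     (\<And>i. i < n \<Longrightarrow> W i \<subset> W (Suc i)) \<Longrightarrow> enat n \<le> x"
  shows "len L B A \<le> x"
  unfolding len_def
proof (rule Sup_least, clarify)
  fix n W assume "\<forall>i\<le>n. L (W i) \<and> B \<subseteq> W i \<and> W i \<subseteq> A" "\<forall>i<n. W i \<subset> W (Suc i)"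
  then show "enat n \<le> x" using assms[of n W] by (cases "n = 0") (auto simp: zero_enat_def[symmetric])
qed

text \<open>Equalities of lengths are obtained from two such maps in opposite directions; they need
  not be inverse to each other.\<close>

lemma len_mono_map:
  assumes "\<And>W. L W \<Longrightarrow> B \<subseteq> W \<Longrightarrow> W \<subseteq> A \<Longrightarrow> L' (F W) \<and> B' \<subseteq> F W \<and> F W \<subseteq> A'"
    and "\<And>V W. L V \<Longrightarrow> L W \<Longrightarrow> B \<subseteq> V \<Longrightarrow> V \<subset> W \<Longrightarrow> W \<subseteq> A \<Longrightarrow> F V \<subset> F W"
  shows "len L B A \<le> len L' B' A'"
proof (rule len_leI)
  fix n :: nat and W
  assume W: "\<And>i. i \<le> n \<Longrightarrow> L (W i) \<and> B \<subseteq> W i \<and> W i \<subseteq> A" "\<And>i. i < n \<Longrightarrow> W i \<subset> W (Suc i)"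
  show "enat n \<le> len L' B' A'"
    by (rule len_geI[where W = "\<lambda>i. F (W i)"]) (use assms W in \<open>simp_all add: Suc_leI\<close>)
qed

lemma len_same: "len L A A = 0"
proof -
  have "len L A A \<le> 0"
  proof (rule len_leI)
    fix n :: nat and W
    assume n: "n > 0" and W: "\<And>i. i \<le> n \<Longrightarrow> L (W i) \<and> A \<subseteq> W i \<and> W i \<subseteq> A"
      "\<And>i. i < n \<Longrightarrow> W i \<subset> W (Suc i)"
    have "W 0 = A" "W (Suc 0) = A" using W(1)[of 0] W(1)[of "Suc 0"] n by auto
    then show "enat n \<le> 0" using W(2)[of 0] n by auto
  qed
  then show ?thesis by simp
qed

lemma len_pos: "L A \<Longrightarrow> L B \<Longrightarrow> B \<subset> A \<Longrightarrow> 1 \<le> len L B A"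
  unfolding one_enat_def by (rule len_geI[where W = "\<lambda>i. if i = 0 then B else A"]) auto

lemma len_zeroD: "L A \<Longrightarrow> L B \<Longrightarrow> B \<subseteq> A \<Longrightarrow> len L B A = 0 \<Longrightarrow> B = A"
  using len_pos[of L A B] by auto

text \<open>Intersecting a chain with a subgroup, or adding a subgroup to it, may make steps
  collapse. Deleting the repetitions keeps exactly the strict steps.\<close>

lemma strict_subchain:
  assumes "\<And>i. i < n \<Longrightarrow> W i \<subseteq> W (Suc i)"
  shows "\<exists>V. V 0 = W 0 \<and> V (card {i. i < n \<and> W i \<subset> W (Suc i)}) = W n \<and>
     (\<forall>i \<le> card {i. i < n \<and> W i \<subset> W (Suc i)}. V i \<in> W ` {..n}) \<and>
     (\<forall>i < card {i. i < n \<and> W i \<subset> W (Suc i)}. V i \<subset> V (Suc i))"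
  using assms
proof (induction n)
  case 0 then show ?case by auto
next
  case (Suc n)
  let ?S = "{i. i < n \<and> W i \<subset> W (Suc i)}"
  have "\<And>i. i < n \<Longrightarrow> W i \<subseteq> W (Suc i)" by (rule Suc.prems) simp
  from Suc.IH[OF this] obtain V where V: "V 0 = W 0" "V (card ?S) = W n"
     "\<forall>i \<le> card ?S. V i \<in> W ` {..n}" "\<forall>i < card ?S. V i \<subset> V (Suc i)" by blast
  show ?case
  proof (cases "W n \<subset> W (Suc n)")
    case True
    then have eq: "{i. i < Suc n \<and> W i \<subset> W (Suc i)} = insert n ?S" by (auto simp: less_Suc_eq)
    have c: "card (insert n ?S) = Suc (card ?S)" by (subst card_insert_disjoint) auto
    let ?V = "V(Suc (card ?S) := W (Suc n))"
    have "?V i \<in> W ` {..Suc n}" if "i \<le> Suc (card ?S)" for i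
    proof (cases "i = Suc (card ?S)")
      case False
      then have "V i \<in> W ` {..n}" using V(3) that by (metis le_SucE)
      then show ?thesis using False by auto
    qed auto
    moreover have "?V i \<subset> ?V (Suc i)" if "i < Suc (card ?S)" for i
      using V(2) V(4)[rule_format, of i] True that by (cases "i = card ?S") auto
    ultimately show ?thesis unfolding eq c
      by (intro exI[of _ ?V] conjI) (use V(1) in simp_all)
  next
    case False
    then have W: "W (Suc n) = W n" using Suc.prems[of n] by auto
    have eq: "{i. i < Suc n \<and> W i \<subset> W (Suc i)} = ?S" using False by (auto simp: less_Suc_eq)
    have "V i \<in> W ` {..Suc n}" if "i \<le> card ?S" for i using V(3) that by (auto simp: atMost_Suc)
    then show ?thesis unfolding eq using V W by (intro exI[of _ V]) simp
  qed
qed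

lemma len_ge_card:
  assumes "\<And>i. i \<le> n \<Longrightarrow> L (W i) \<and> B \<subseteq> W i \<and> W i \<subseteq> A" "\<And>i. i < n \<Longrightarrow> W i \<subseteq> W (Suc i)"
  shows "enat (card {i. i < n \<and> W i \<subset> W (Suc i)}) \<le> len L B A"
proof -
  obtain V where V: "\<forall>i \<le> card {i. i < n \<and> W i \<subset> W (Suc i)}. V i \<in> W ` {..n}"
     "\<forall>i < card {i. i < n \<and> W i \<subset> W (Suc i)}. V i \<subset> V (Suc i)"
    using strict_subchain[of n W] assms(2) by blast
  show ?thesis by (rule len_geI[of _ _ V]) (use V assms(1) in fastforce)+
qed

section \<open>Additivity of length and the isomorphism theorems\<close>

locale sublattice =
  fixes L :: "'a::ab_group_add set \<Rightarrow> bool"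
  assumes L_sgp: "L A \<Longrightarrow> sgp A" and L_Int: "L A \<Longrightarrow> L B \<Longrightarrow> L (A \<inter> B)"
    and L_plus: "L A \<Longrightarrow> L B \<Longrightarrow> L (A + B)"
begin

text \<open>Along a chain from \<open>C\<close> to \<open>A\<close>, the modular law makes each strict step strict for \<open>\<inter> B\<close> or for
  \<open>+ B\<close>.\<close>

lemma len_add:
  assumes L: "L A" "L B" "L C" and sub: "C \<subseteq> B" "B \<subseteq> A"
  shows "len L C A = len L C B + len L B A"
proof (rule antisym)
  show "len L C A \<le> len L C B + len L B A"
  proof (rule len_leI)
    fix n :: nat and W
    assume W: "\<And>i. i \<le> n \<Longrightarrow> L (W i) \<and> C \<subseteq> W i \<and> W i \<subseteq> A" and
      st: "\<And>i. i < n \<Longrightarrow> W i \<subset> W (Suc i)"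
    let ?U = "\<lambda>i. W i \<inter> B" and ?V = "\<lambda>i. W i + B"
    have st': "W i \<subseteq> W (Suc i)" if "i < n" for i using st[OF that] by auto
    have U: "enat (card {i. i < n \<and> ?U i \<subset> ?U (Suc i)}) \<le> len L C B"
    proof (rule len_ge_card)
      fix i assume "i < n"
      then show "?U i \<subseteq> ?U (Suc i)" using st' by blast
    qed (use W L sub in \<open>auto intro: L_Int\<close>)
    have V: "enat (card {i. i < n \<and> ?V i \<subset> ?V (Suc i)}) \<le> len L B A"
    proof (rule len_ge_card)
      fix i assume "i \<le> n"
      from W[OF this] show "L (W i + B) \<and> B \<subseteq> W i + B \<and> W i + B \<subseteq> A"
        using L sub by (intro conjI L_plus subset_plus_right plus_subset L_sgp) auto
    next
      fix i assume "i < n"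
      then show "W i + B \<subseteq> W (Suc i) + B" using st' by (intro set_plus_mono2) auto
    qed
    have "i \<in> {i. i < n \<and> ?U i \<subset> ?U (Suc i)} \<union> {i. i < n \<and> ?V i \<subset> ?V (Suc i)}" if i: "i < n" for i
    proof (rule ccontr)
      assume "\<not> ?thesis"
      moreover have "?V i \<subseteq> ?V (Suc i)" using st'[OF i] by (intro set_plus_mono2) auto
      ultimately have eq: "?U i = ?U (Suc i)" "?V i = ?V (Suc i)" using i st'[OF i] by blast+
      have s: "sgp (W i)" "sgp (W (Suc i))" "sgp B" using W[of i] W[of "Suc i"] i L L_sgp by auto
      have "W (Suc i) = W (Suc i) \<inter> (B + W (Suc i))" using subset_plus_right[OF s(3)] by blast
      also have "\<dots> = W (Suc i) \<inter> (B + W i)" using eq(2) by (simp add: add.commute)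
      also have "\<dots> = W (Suc i) \<inter> B + W i" using st[OF i] s by (intro modular_law) auto
      also have "\<dots> \<subseteq> W i" using eq(1) s by (intro plus_subset) auto
      finally show False using st[OF i] by auto
    qed
    then have "{..<n} \<subseteq> {i. i < n \<and> ?U i \<subset> ?U (Suc i)} \<union> {i. i < n \<and> ?V i \<subset> ?V (Suc i)}"
      by blast
    from card_mono[OF _ this] have "n \<le> card ({i. i < n \<and> ?U i \<subset> ?U (Suc i)} \<union> {i. i < n \<and> ?V i \<subset> ?V (Suc i)})"
      by simp
    also have "\<dots> \<le> card {i. i < n \<and> ?U i \<subset> ?U (Suc i)} + card {i. i < n \<and> ?V i \<subset> ?V (Suc i)}"
      by (rule card_Un_le)
    finally have "enat n \<le> enat (card {i. i < n \<and> ?U i \<subset> ?U (Suc i)}) + enat (card {i. i < n \<and> ?V i \<subset> ?V (Suc i)})"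
      by simp
    also have "\<dots> \<le> len L C B + len L B A" by (rule add_mono[OF U V])
    finally show "enat n \<le> len L C B + len L B A" .
  qed
next
  have *: "enat (m + n) \<le> len L C A" if m: "enat m \<le> len L C B" and n: "enat n \<le> len L B A" for m n
  proof -
    have "\<exists>V. (\<forall>i\<le>m. L (V i) \<and> C \<subseteq> V i \<and> V i \<subseteq> B) \<and> (\<forall>i<m. V i \<subset> V (Suc i))"
      using len_geD[OF m] L sub by (cases "m = 0") auto
    then obtain V where V: "\<And>i. i\<le>m \<Longrightarrow> L (V i) \<and> C \<subseteq> V i \<and> V i \<subseteq> B" "\<And>i. i<m \<Longrightarrow> V i \<subset> V (Suc i)"
      by blast
    have "\<exists>W. (\<forall>i\<le>n. L (W i) \<and> B \<subseteq> W i \<and> W i \<subseteq> A) \<and> (\<forall>i<n. W i \<subset> W (Suc i))"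
      using len_geD[OF n] L sub by (cases "n = 0") auto
    then obtain W where W: "\<And>i. i\<le>n \<Longrightarrow> L (W i) \<and> B \<subseteq> W i \<and> W i \<subseteq> A" "\<And>i. i<n \<Longrightarrow> W i \<subset> W (Suc i)"
      by blast
    \<comment> \<open>The last set of the lower chain is replaced by the first set of the upper one;
      \<open>V m \<subseteq> B \<subseteq> W 0\<close> keeps the junction strict.\<close>
    show ?thesis
    proof (rule len_geI[where W = "\<lambda>i. if i < m then V i else W (i - m)"])
      fix i assume i: "i \<le> m + n"
      show "L (if i < m then V i else W (i - m)) \<and> C \<subseteq> (if i < m then V i else W (i - m)) \<and>
         (if i < m then V i else W (i - m)) \<subseteq> A"
      proof (cases "i < m")
        case True
        then have "L (V i)" "C \<subseteq> V i" "V i \<subseteq> A" using V(1)[OF less_imp_le[OF True]] sub by blast+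
        then show ?thesis using True by simp
      next
        case False
        then have "i - m \<le> n" using i by simp
        from W(1)[OF this] have "L (W (i - m))" "C \<subseteq> W (i - m)" "W (i - m) \<subseteq> A" using sub by blast+
        then show ?thesis using False by simp
      qed
    next
      fix i assume i: "i < m + n"
      consider "Suc i < m" | "Suc i = m" | "i \<ge> m" by linarith
      then show "(if i < m then V i else W (i - m)) \<subset> (if Suc i < m then V (Suc i) else W (Suc i - m))"
      proof cases
        case 1 then show ?thesis using V(2)[of i] by auto
      next
        case 2
        then show ?thesis using V(2)[of i] V(1)[of m] W(1)[of 0] by auto
      next
        case 3 then show ?thesis using W(2)[of "i - m"] i by (auto simp: Suc_diff_le)
      qed
    qed
  qed
  show "len L C B + len L B A \<le> len L C A"
  proof (cases "len L C B"; cases "len L B A")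
    fix m n assume "len L C B = enat m" "len L B A = enat n"
    then show ?thesis using *[of m n] by simp
  next
    fix m assume "len L C B = enat m" and i: "len L B A = \<infinity>"
    have "enat n \<le> len L C A" for n using *[of 0 n] i by (simp add: zero_enat_def[symmetric])
    then have "len L C A = \<infinity>" by (metis enat.exhaust enat_ord_simps(1) Suc_n_not_le_n)
    then show ?thesis by simp
  next
    fix n assume i: "len L C B = \<infinity>"
    have "enat n \<le> len L C A" for n using *[of n 0] i by (simp add: zero_enat_def[symmetric])
    then have "len L C A = \<infinity>" by (metis enat.exhaust enat_ord_simps(1) Suc_n_not_le_n)
    then show ?thesis by simp
  next
    assume i: "len L C B = \<infinity>"
    have "enat n \<le> len L C A" for n using *[of n 0] i by (simp add: zero_enat_def[symmetric])
    then have "len L C A = \<infinity>" by (metis enat.exhaust enat_ord_simps(1) Suc_n_not_le_n)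
    then show ?thesis by simp
  qed
qed

lemma len_sub_mono:
  assumes "L A" "L B" "L A'" "L B'" "B' \<subseteq> B" "B \<subseteq> A" "A \<subseteq> A'"
  shows "len L B A \<le> len L B' A'"
  by (rule len_mono_map[where F = id]) (use assms in auto)

text \<open>The lengths of the \<open>W n\<close> above \<open>B\<close> are bounded natural
  numbers. From an index where they are maximal, every later step has length zero.\<close>

lemma len_finite_stable:
  assumes L: "L A" "L B" and fin: "len L B A \<le> enat N"
    and W: "\<And>n. L (W n)" "\<And>n. B \<subseteq> W n" "\<And>n. W n \<subseteq> A" "\<And>n. W n \<subseteq> W (Suc n)"
  shows "\<exists>n. \<forall>m\<ge>n. W m = W n"
proof -
  have le: "len L B (W n) \<le> enat N" for n
    by (rule order_trans[OF len_sub_mono fin]) (use L W in auto)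
  have "\<exists>l\<le>N. len L B (W n) = enat l" for n using le[of n] by (cases "len L B (W n)") auto
  then obtain f where f: "\<And>n. f n \<le> N" "\<And>n. len L B (W n) = enat (f n)" by metis
  obtain n where n: "\<forall>m. f m \<le> f n"
    using ex_has_greatest_nat[of "\<lambda>_. True" 0 f "Suc N"] f(1) by (auto simp: less_Suc_eq_le)
  have "W m = W n" if "n \<le> m" for m
  proof -
    have mn: "W n \<subseteq> W m" by (rule lift_Suc_mono_le[of W, OF W(4) that])
    have "enat (f m) = enat (f n) + len L (W n) (W m)"
      unfolding f(2)[symmetric] by (rule len_add[OF W(1) W(1) L(2) W(2) mn])
    then have "len L (W n) (W m) = 0" using n[rule_format, of m] by (cases "len L (W n) (W m)") (auto simp: zero_enat_def)
    then show ?thesis using len_zeroD[of L "W m" "W n", OF W(1,1) mn] by simp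
  qed
  then show ?thesis by blast
qed

text \<open>A member \<open>W\<close> of the upper interval is recovered from
  \<open>W \<inter> A\<close> by adding \<open>C\<close>, so intersecting with \<open>A\<close> is
  strict.\<close>

lemma len_plus_right:
  assumes L: "L A" "L B" "L C" and sub: "B \<subseteq> A"
  shows "len L (B + C) (A + C) \<le> len L B A"
proof (rule len_mono_map[where F = "\<lambda>W. W \<inter> A"])
  fix W assume W: "L W" "B + C \<subseteq> W" "W \<subseteq> A + C"
  then show "L (W \<inter> A) \<and> B \<subseteq> W \<inter> A \<and> W \<inter> A \<subseteq> A"
    using L sub subset_plus_left[of C B] by (auto intro: L_Int L_sgp)
next
  fix V W assume VW: "L V" "L W" "B + C \<subseteq> V" "V \<subset> W" "W \<subseteq> A + C"
  have C: "C \<subseteq> V" using VW subset_plus_right[of B C] L by (auto intro: L_sgp)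
  have *: "U = U \<inter> A + C" if "L U" "C \<subseteq> U" "U \<subseteq> A + C" for U
    using modular_law[of U C A] that L_sgp by blast
  have "V = V \<inter> A + C" "W = W \<inter> A + C" using *[of V] *[of W] VW C by auto
  then have "V \<inter> A \<noteq> W \<inter> A" using VW by (metis psubset_eq)
  then show "V \<inter> A \<subset> W \<inter> A" using VW by auto
qed

text \<open>The second isomorphism theorem, for A / (A \<inter> B) and (A + B) / B.\<close>

lemma len_Int_eq:
  assumes L: "L A" "L B"
  shows "len L (A \<inter> B) A = len L B (A + B)"
proof (rule antisym)
  have s: "sgp A" "sgp B" using L L_sgp by auto
  show "len L B (A + B) \<le> len L (A \<inter> B) A"
    using len_plus_right[of A "A \<inter> B" B] L plus_absorb[of B "A \<inter> B"] s
    by (simp add: L_Int sgp_Int add.commute)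
  show "len L (A \<inter> B) A \<le> len L B (A + B)"
  proof (rule len_mono_map[where F = "\<lambda>W. W + B"])
    fix W assume W: "L W" "A \<inter> B \<subseteq> W" "W \<subseteq> A"
    show "L (W + B) \<and> B \<subseteq> W + B \<and> W + B \<subseteq> A + B"
      using L W by (intro conjI L_plus subset_plus_right L_sgp set_plus_mono2) auto
  next
    fix V W assume VW: "L V" "L W" "A \<inter> B \<subseteq> V" "V \<subset> W" "W \<subseteq> A"
    have *: "U = A \<inter> (U + B)" if "L U" "A \<inter> B \<subseteq> U" "U \<subseteq> A" for U
    proof -
      have "A \<inter> (B + U) = A \<inter> B + U" using that s by (intro modular_law) auto
      also have "\<dots> = U" using plus_absorb[of U "A \<inter> B"] that s L_sgp by (simp add: sgp_Int add.commute)
      finally show ?thesis by (simp add: add.commute)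
    qed
    have "V + B \<noteq> W + B" using *[of V] *[of W] VW by fastforce
    moreover have "V + B \<subseteq> W + B" using VW by (intro set_plus_mono2) auto
    ultimately show "V + B \<subset> W + B" by auto
  qed
qed

lemma len_plus_left_le:
  assumes "L A" "L B" "L Z" "Z \<subseteq> A \<inter> B"
  shows "len L A (A + B) \<le> len L Z B"
proof -
  have "len L A (A + B) = len L (A \<inter> B) B" using len_Int_eq[of B A] assms by (simp add: add.commute Int_commute)
  also have "\<dots> \<le> len L Z B" using assms by (intro len_sub_mono) (auto intro: L_Int)
  finally show ?thesis .
qed

lemma len_plus_le:
  assumes "L A" "L B" "L A'" "L B'" "B \<subseteq> A" "B' \<subseteq> A'"
  shows "len L (B + B') (A + A') \<le> len L B A + len L B' A'"
proof -
  have "len L (B + B') (A + A') = len L (B + B') (A + B') + len L (A + B') (A + A')"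
    using assms by (intro len_add L_plus set_plus_mono2) auto
  also have "\<dots> \<le> len L B A + len L B' A'"
    using len_plus_right[of A B B'] len_plus_right[of A' B' A] assms
    by (intro add_mono) (auto simp: add.commute)
  finally show ?thesis .
qed

text \<open>The direct sum of the quotients maps onto the quotient of the sums. \<open>Z\<close> is
  a common summand, as in \<open>JN\<close> below; closedness and inclusion travel along for the
  induction.\<close>

lemma len_plus_sum_le:
  assumes "finite I" "\<And>i. i \<in> I \<Longrightarrow> L (A i) \<and> L (B i) \<and> B i \<subseteq> A i" "L Z"
  shows "len L (Z + (\<Sum>i\<in>I. B i)) (Z + (\<Sum>i\<in>I. A i)) \<le> (\<Sum>i\<in>I. len L (B i) (A i)) \<and>
     L (Z + (\<Sum>i\<in>I. B i)) \<and> L (Z + (\<Sum>i\<in>I. A i)) \<and> Z + (\<Sum>i\<in>I. B i) \<subseteq> Z + (\<Sum>i\<in>I. A i)"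
  using assms(1,2)
proof (induction I rule: finite_induct)
  case empty
  have "Z + {0} = Z" by (metis add_0_right set_zero)
  then show ?case using assms(3) by (simp add: len_same)
next
  case (insert i I)
  have IH: "len L (Z + (\<Sum>i\<in>I. B i)) (Z + (\<Sum>i\<in>I. A i)) \<le> (\<Sum>i\<in>I. len L (B i) (A i))"
    "L (Z + (\<Sum>i\<in>I. B i))" "L (Z + (\<Sum>i\<in>I. A i))" "Z + (\<Sum>i\<in>I. B i) \<subseteq> Z + (\<Sum>i\<in>I. A i)"
    using insert by auto
  have eq: "Z + (\<Sum>i\<in>insert i I. X i) = X i + (Z + (\<Sum>i\<in>I. X i))" for X :: "_ \<Rightarrow> 'a set"
    using insert by (simp add: add.left_commute)
  have i: "L (A i)" "L (B i)" "B i \<subseteq> A i" using insert by auto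
  have "len L (B i + (Z + (\<Sum>i\<in>I. B i))) (A i + (Z + (\<Sum>i\<in>I. A i))) \<le>
      len L (B i) (A i) + (\<Sum>i\<in>I. len L (B i) (A i))"
    using len_plus_le[OF i(1,2) IH(3,2) i(3) IH(4)] IH(1) by (meson add_left_mono order_trans)
  moreover have "B i + (Z + (\<Sum>i\<in>I. B i)) \<subseteq> A i + (Z + (\<Sum>i\<in>I. A i))"
    by (rule set_plus_mono2[OF i(3) IH(4)])
  ultimately show ?case unfolding eq using IH i insert(1,2) by (simp add: L_plus)
qed

end

section \<open>Graded families over a standard graded ring of characteristic p\<close>

text \<open>\<open>K\<close> is an ideal of the whole type and equality is replaced by congruence
  modulo \<open>K\<close>. Only the quotient has characteristic p: in the application the type
  itself is a monoid ring over the integers.\<close>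

locale frobenius_mod =
  fixes K :: "'r::comm_ring_1 set" and p :: nat
  assumes sgp_K: "sgp K" and K_ideal: "k \<in> K \<Longrightarrow> r * k \<in> K"
    and prime_p: "prime p" and p_K: "of_nat p \<in> K"
begin

lemma K_ideal': "k \<in> K \<Longrightarrow> k * r \<in> K" using K_ideal[of k r] by (simp add: mult.commute)

lemma K_trans: "x - y \<in> K \<Longrightarrow> y - z \<in> K \<Longrightarrow> x - z \<in> K"
  using sgp_add[OF sgp_K, of "x - y" "y - z"] by simp

lemma K_sym: "x - y \<in> K \<Longrightarrow> y - x \<in> K"
  using sgp_minus[OF sgp_K, of "x - y"] by simp

lemma K_times: "x - y \<in> K \<Longrightarrow> z * x - z * y \<in> K"
  using K_ideal[of "x - y" z] by (simp add: algebra_simps)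

lemma K_times': "x - y \<in> K \<Longrightarrow> x * z - y * z \<in> K"
  using K_times[of x y z] by (simp add: mult.commute)

lemma K_power: "x - y \<in> K \<Longrightarrow> x ^ n - y ^ n \<in> K"
proof (induction n)
  case (Suc n)
  have "x * x ^ n - x * y ^ n \<in> K" using Suc by (intro K_times) auto
  from K_trans[OF this K_times'[OF Suc.prems]] show ?case by simp
qed (simp add: sgp_zero[OF sgp_K])

lemma power_K: "k \<in> K \<Longrightarrow> n > 0 \<Longrightarrow> k ^ n \<in> K"
  by (cases n) (auto intro: K_ideal')

lemma frobenius_p: "(x + y) ^ p - (x ^ p + y ^ p) \<in> K"
proof -
  have p0: "p > 0" using prime_p prime_gt_0_nat by blast
  have "(x + y) ^ p = (\<Sum>k\<in>{0,p}. of_nat (p choose k) * x ^ k * y ^ (p - k)) +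
      (\<Sum>k\<in>{..p} - {0,p}. of_nat (p choose k) * x ^ k * y ^ (p - k))"
    unfolding binomial_ring by (rule sum.subset_diff[of "{0,p}" "{..p}", simplified add.commute]) auto
  also have "(\<Sum>k\<in>{0,p}. of_nat (p choose k) * x ^ k * y ^ (p - k)) = x ^ p + y ^ p"
    using p0 by simp
  finally have "(x + y) ^ p - (x ^ p + y ^ p) =
      (\<Sum>k\<in>{..p} - {0,p}. of_nat (p choose k) * x ^ k * y ^ (p - k))" by simp
  also have "\<dots> \<in> K"
  proof (rule sgp_sum[OF sgp_K])
    fix k assume "k \<in> {..p} - {0, p}"
    then have "p dvd (p choose k)" using prime_p by (intro dvd_choose_prime) auto
    then obtain m where "p choose k = m * p" by (metis dvd_def mult.commute)
    then have "of_nat (p choose k) = of_nat m * (of_nat p :: 'r)" by simp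
    then have "of_nat (p choose k) \<in> K" using K_ideal[OF p_K] by metis
    then show "of_nat (p choose k) * x ^ k * y ^ (p - k) \<in> K" by (intro K_ideal')
  qed
  finally show ?thesis .
qed

definition ppow :: "nat \<Rightarrow> bool" where "ppow Q \<longleftrightarrow> (\<exists>e. Q = p ^ e)"

lemma ppow_1: "ppow 1" and ppow_p: "ppow p" and ppow_power: "ppow (p ^ e)"
  unfolding ppow_def by (metis power_0, metis power_one_right, blast)

lemma ppow_mult: "ppow Q \<Longrightarrow> ppow Q' \<Longrightarrow> ppow (Q * Q')"
  unfolding ppow_def by (metis power_add)

lemma ppow_pos: "ppow Q \<Longrightarrow> Q > 0"
  unfolding ppow_def using prime_p prime_gt_0_nat by auto

lemma frobenius_add:
  assumes "ppow Q" shows "(x + y) ^ Q - (x ^ Q + y ^ Q) \<in> K"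
proof -
  have "(x + y) ^ (p ^ e) - (x ^ (p ^ e) + y ^ (p ^ e)) \<in> K" for e
  proof (induction e)
    case (Suc e)
    have "((x + y) ^ (p ^ e)) ^ p - (x ^ (p ^ e) + y ^ (p ^ e)) ^ p \<in> K" by (rule K_power[OF Suc])
    from K_trans[OF this frobenius_p] show ?case by (simp add: power_mult[symmetric] mult.commute)
  qed (simp add: sgp_zero[OF sgp_K])
  then show ?thesis using assms by (auto simp: ppow_def)
qed

lemma frobenius_diff:
  assumes "ppow Q" shows "(x - y) ^ Q - (x ^ Q - y ^ Q) \<in> K"
  using K_sym[OF frobenius_add[OF assms, of "x - y" y]] by (simp add: algebra_simps)

lemma frobenius_sum:
  assumes "ppow Q" "finite I" shows "(\<Sum>i\<in>I. f i) ^ Q - (\<Sum>i\<in>I. f i ^ Q) \<in> K"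
  using assms(2)
proof (induction I rule: finite_induct)
  case empty then show ?case using ppow_pos[OF assms(1)] sgp_zero[OF sgp_K] by (simp add: power_0_left)
next
  case (insert i I)
  have "(f i + (\<Sum>i\<in>I. f i)) ^ Q - (f i ^ Q + (\<Sum>i\<in>I. f i) ^ Q) \<in> K"
    by (rule frobenius_add[OF assms(1)])
  moreover have "(f i ^ Q + (\<Sum>i\<in>I. f i) ^ Q) - (f i ^ Q + (\<Sum>i\<in>I. f i ^ Q)) \<in> K"
    using insert by simp
  ultimately have "(f i + (\<Sum>i\<in>I. f i)) ^ Q - (f i ^ Q + (\<Sum>i\<in>I. f i ^ Q)) \<in> K" by (rule K_trans)
  then show ?case using insert by simp
qed

end

text \<open>The ring is presented as a quotient by \<open>K\<close> of a subring of a type, and its graded pieces are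
  indexed by all integers, with \<open>R i = K\<close> for negative \<open>i\<close>.  Modules are subquotients \<open>N / Z\<close> of the
  same type on which \<open>r\<close> acts as multiplication by \<open>r ^ Q\<close>; for \<open>Q = p ^ e\<close> this encodes the
  pushforward along the \<open>e\<close>-th iterate of the Frobenius endomorphism.\<close>

locale fring = frobenius_mod K p
  for R :: "int \<Rightarrow> 'r::comm_ring_1 set" and K :: "'r set" and p :: nat and X Y :: "'r set" +
  assumes sgp_R: "sgp (R i)" and K_R: "K \<subseteq> R i" and R_neg: "i < 0 \<Longrightarrow> R i = K"
    and one_R: "1 \<in> R 0" and one_K: "1 \<notin> K"
    and R_mult: "r \<in> R i \<Longrightarrow> s \<in> R j \<Longrightarrow> r * s \<in> R (i + j)"
    and inv_R0: "r \<in> R 0 \<Longrightarrow> r \<notin> K \<Longrightarrow> \<exists>s\<in>R 0. r * s - 1 \<in> K"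
    and finite_X: "finite X" and X_R: "X \<subseteq> R 1"
    and gen_R: "0 \<le> i \<Longrightarrow> r \<in> R (i + 1) \<Longrightarrow> \<exists>c. (\<forall>x\<in>X. c x \<in> R i) \<and> r - (\<Sum>x\<in>X. c x * x) \<in> K"
    and finite_Y: "finite Y" and Y_R: "Y \<subseteq> R 0"
    and gen_R0: "r \<in> R 0 \<Longrightarrow> \<exists>c. (\<forall>y\<in>Y. c y \<in> R 0) \<and> r - (\<Sum>y\<in>Y. c y ^ p * y) \<in> K"
begin

lemma power_R: "r \<in> R i \<Longrightarrow> r ^ n \<in> R (int n * i)"
proof (induction n)
  case (Suc n)
  then have "r * r ^ n \<in> R (i + int n * i)" by (intro R_mult) auto
  then show ?case by (simp add: algebra_simps)
qed (simp add: one_R)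

subsection \<open>Stable subgroups\<close>

text \<open>The subspaces over the field k = \<open>R 0\<close> / \<open>K\<close>, which acts
  through Q-th powers. For \<open>Q\<close> a power of p, lengths between such sets containing
  \<open>K\<close> are dimensions over the subfield of Q-th powers.\<close>

definition kst :: "nat \<Rightarrow> 'r set \<Rightarrow> bool" where
  "kst Q A \<longleftrightarrow> sgp A \<and> (\<forall>r\<in>R 0. \<forall>x\<in>A. r ^ Q * x \<in> A)"

sublocale sublattice "kst Q" for Q
proof
  fix A B assume A: "kst Q A" and B: "kst Q B"
  show "kst Q (A \<inter> B)" using A B by (auto simp: kst_def intro: sgp_Int)
  have "r ^ Q * x \<in> A + B" if r: "r \<in> R 0" and x: "x \<in> A + B" for r x
  proof -
    obtain a b where ab: "a \<in> A" "b \<in> B" "x = a + b" using x by (rule set_plus_elim)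
    have "r ^ Q * a \<in> A" "r ^ Q * b \<in> B" using ab r A B by (auto simp: kst_def)
    then show ?thesis unfolding ab(3) distrib_left by (rule set_plus_intro)
  qed
  then show "kst Q (A + B)" using A B by (auto simp: kst_def intro: sgp_plus)
qed (simp add: kst_def)

lemma kst_mult: "kst Q A \<Longrightarrow> r \<in> R 0 \<Longrightarrow> x \<in> A \<Longrightarrow> r ^ Q * x \<in> A"
  by (simp add: kst_def)

lemma kst_twist: "kst Q A \<Longrightarrow> kst (Q * m) A"
  unfolding kst_def
proof (intro conjI ballI, simp)
  fix r x assume *: "sgp A \<and> (\<forall>r\<in>R 0. \<forall>x\<in>A. r ^ Q * x \<in> A)" "r \<in> R 0" "x \<in> A"
  have "r ^ m \<in> R 0" using power_R[OF *(2), of m] by simp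
  then have "(r ^ m) ^ Q * x \<in> A" using * by blast
  then show "r ^ (Q * m) * x \<in> A" by (simp add: power_mult[symmetric] mult.commute)
qed

lemma kst_zero: "kst Q {0}" by (simp add: kst_def sgp_def)

lemma plus_zero_set: "A + {0} = (A :: 'r set)" by (metis add_0_right set_zero)

lemma subset_image_plus:
  assumes "0 \<in> B" "0 < n" shows "A \<subseteq> (\<lambda>x. x ^ n * t) ` B + (A :: 'r set)"
proof
  fix a assume "a \<in> A"
  then have "0 ^ n * t + a \<in> (\<lambda>x. x ^ n * t) ` B + A" using assms(1) by (intro set_plus_intro imageI)
  then show "a \<in> (\<lambda>x. x ^ n * t) ` B + A" using assms(2) by (simp add: power_0_left)
qed

text \<open>The maps \<open>x \<mapsto> x ^ m * t\<close>, additive modulo \<open>K\<close> when \<open>m\<close> is a power of \<open>p\<close>, are the only module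
  homomorphisms that are needed.\<close>

context
  fixes m :: nat and t :: 'r and Z :: "'r set" and Q1 Q2 :: nat
  assumes Q: "Q2 = Q1 * m" and Z: "kst Q2 Z"
    and ad: "\<And>x y. (x - y) ^ m * t - (x ^ m * t - y ^ m * t) \<in> Z"
begin

lemma kst_preimage:
  assumes W: "kst Q2 W" "Z \<subseteq> W" and A: "kst Q1 A"
  shows "kst Q1 {x \<in> A. x ^ m * t \<in> W}"
  unfolding kst_def sgp_def
proof (intro conjI ballI)
  have sW: "sgp W" and sA: "sgp A" using W A L_sgp by auto
  have "(0 - 0) ^ m * t - (0 ^ m * t - 0 ^ m * t) \<in> W" using ad W by blast
  then show "0 \<in> {x \<in> A. x ^ m * t \<in> W}" using sA by (simp add: sgp_zero)
  fix x y assume "x \<in> {x \<in> A. x ^ m * t \<in> W}" "y \<in> {x \<in> A. x ^ m * t \<in> W}"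
  then have xy: "x \<in> A" "y \<in> A" "x ^ m * t - y ^ m * t \<in> W" using sW by (auto intro: sgp_diff)
  have "(x - y) ^ m * t - (x ^ m * t - y ^ m * t) \<in> W" using ad W by blast
  then have "(x - y) ^ m * t \<in> W" using sgp_cong[OF sW] xy by blast
  then show "x - y \<in> {x \<in> A. x ^ m * t \<in> W}" using xy sA by (simp add: sgp_diff)
next
  fix r x assume r: "r \<in> R 0" and x: "x \<in> {x \<in> A. x ^ m * t \<in> W}"
  have "(r ^ Q1 * x) ^ m * t = r ^ Q2 * (x ^ m * t)"
    by (simp add: Q power_mult power_mult_distrib mult.assoc)
  then show "r ^ Q1 * x \<in> {x \<in> A. x ^ m * t \<in> W}" using r x W A by (auto simp: kst_mult)
qed

lemma kst_image:
  assumes A: "kst Q1 A"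
  shows "kst Q2 ((\<lambda>x. x ^ m * t) ` A + Z)"
  unfolding kst_def sgp_def
proof (intro conjI ballI)
  have sZ: "sgp Z" and sA: "sgp A" using Z A L_sgp by auto
  have "(0 - 0) ^ m * t - (0 ^ m * t - 0 ^ m * t) \<in> Z" by (rule ad)
  then have "- (0 ^ m * t) \<in> Z" using sgp_minus[OF sZ] by simp
  then have "0 ^ m * t + (- (0 ^ m * t)) \<in> (\<lambda>x. x ^ m * t) ` A + Z"
    using sgp_zero[OF sA] by blast
  then show "0 \<in> (\<lambda>x. x ^ m * t) ` A + Z" by simp
  fix u v assume "u \<in> (\<lambda>x. x ^ m * t) ` A + Z" "v \<in> (\<lambda>x. x ^ m * t) ` A + Z"
  then obtain x y z w where *: "x \<in> A" "y \<in> A" "z \<in> Z" "w \<in> Z" "u = x ^ m * t + z" "v = y ^ m * t + w"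
    by (auto elim!: set_plus_elim)
  have "z - w - ((x - y) ^ m * t - (x ^ m * t - y ^ m * t)) \<in> Z"
    by (rule sgp_diff[OF sZ sgp_diff[OF sZ *(3,4)] ad])
  then have "(x - y) ^ m * t + (z - w - ((x - y) ^ m * t - (x ^ m * t - y ^ m * t))) \<in> (\<lambda>x. x ^ m * t) ` A + Z"
    using * sgp_diff[OF sA] by blast
  then show "u - v \<in> (\<lambda>x. x ^ m * t) ` A + Z" by (simp add: * algebra_simps)
next
  fix r u assume r: "r \<in> R 0" and "u \<in> (\<lambda>x. x ^ m * t) ` A + Z"
  then obtain x z where *: "x \<in> A" "z \<in> Z" "u = x ^ m * t + z" by (auto elim!: set_plus_elim)
  have "r ^ Q2 * u = (r ^ Q1 * x) ^ m * t + r ^ Q2 * z"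
    by (simp add: * Q power_mult power_mult_distrib mult.assoc distrib_left)
  then show "r ^ Q2 * u \<in> (\<lambda>x. x ^ m * t) ` A + Z"
    using * r A Z by (auto simp: kst_mult)
qed

lemma Z_subset:
  assumes "0 \<in> B" and W: "kst Q2 W" "(\<lambda>x. x ^ m * t) ` B + Z \<subseteq> W" shows "Z \<subseteq> W"
proof
  fix z assume z: "z \<in> Z"
  then have "0 ^ m * t + z \<in> W" "0 ^ m * t \<in> W" using assms subset_plus_left[OF L_sgp[OF Z]] by blast+
  from sgp_diff[OF L_sgp[OF W(1)] this] show "z \<in> W" by simp
qed

text \<open>Every element of the upper image is hit modulo \<open>Z\<close>, which lies in every
  member of the interval; so taking preimages in \<open>A\<close> is strict.\<close>

lemma len_image_le:
  assumes A: "kst Q1 A" and B: "kst Q1 B" "B \<subseteq> A"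
  shows "len (kst Q2) ((\<lambda>x. x ^ m * t) ` B + Z) ((\<lambda>x. x ^ m * t) ` A + Z) \<le> len (kst Q1) B A"
proof (rule len_mono_map[where F = "\<lambda>W. {x \<in> A. x ^ m * t \<in> W}"])
  have sZ: "sgp Z" using Z L_sgp by auto
  fix W assume W: "kst Q2 W" "(\<lambda>x. x ^ m * t) ` B + Z \<subseteq> W" "W \<subseteq> (\<lambda>x. x ^ m * t) ` A + Z"
  have BW: "(\<lambda>x. x ^ m * t) ` B \<subseteq> W" using W subset_plus_left[OF sZ] by blast
  then show "kst Q1 {x \<in> A. x ^ m * t \<in> W} \<and> B \<subseteq> {x \<in> A. x ^ m * t \<in> W} \<and> {x \<in> A. x ^ m * t \<in> W} \<subseteq> A"
    using W Z_subset[OF sgp_zero[OF L_sgp[OF B(1)]] W(1,2)] A B kst_preimage by auto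
next
  fix V W assume VW: "kst Q2 V" "kst Q2 W" "(\<lambda>x. x ^ m * t) ` B + Z \<subseteq> V" "V \<subset> W"
    "W \<subseteq> (\<lambda>x. x ^ m * t) ` A + Z"
  have ZV: "Z \<subseteq> V" by (rule Z_subset[OF sgp_zero[OF L_sgp[OF B(1)]] VW(1,3)])
  obtain w where w: "w \<in> W" "w \<notin> V" using VW by blast
  then obtain x z where x: "x \<in> A" "z \<in> Z" "w = x ^ m * t + z" using VW by (blast elim: set_plus_elim)
  have "w - z \<in> W" using w x ZV VW by (meson L_sgp psubsetE sgp_diff subsetD)
  then have "x ^ m * t \<in> W" using x by simp
  moreover have "x ^ m * t \<notin> V"
  proof
    assume "x ^ m * t \<in> V"
    then have "x ^ m * t + z \<in> V" using x ZV VW by (meson L_sgp sgp_add subsetD)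
    then show False using w x by simp
  qed
  ultimately show "{x \<in> A. x ^ m * t \<in> V} \<subset> {x \<in> A. x ^ m * t \<in> W}" using x VW by blast
qed

text \<open>By \<open>ker\<close>, \<open>B\<close> is the full preimage of its image and so
  contains the kernel of the map into the quotient by \<open>Z\<close>; therefore subgroups between
  \<open>B\<close> and \<open>A\<close> keep distinct images.\<close>

lemma len_image_eq:
  assumes A: "kst Q1 A" and B: "kst Q1 B" "B \<subseteq> A"
    and ker: "\<And>x. x \<in> A \<Longrightarrow> x ^ m * t \<in> (\<lambda>x. x ^ m * t) ` B + Z \<Longrightarrow> x \<in> B"
  shows "len (kst Q2) ((\<lambda>x. x ^ m * t) ` B + Z) ((\<lambda>x. x ^ m * t) ` A + Z) = len (kst Q1) B A"
proof (rule antisym[OF len_image_le[OF A B]])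
  have sZ: "sgp Z" using Z L_sgp by auto
  show "len (kst Q1) B A \<le> len (kst Q2) ((\<lambda>x. x ^ m * t) ` B + Z) ((\<lambda>x. x ^ m * t) ` A + Z)"
  proof (rule len_mono_map[where F = "\<lambda>V. (\<lambda>x. x ^ m * t) ` V + Z"])
    fix W assume "kst Q1 W" "B \<subseteq> W" "W \<subseteq> A"
    then show "kst Q2 ((\<lambda>x. x ^ m * t) ` W + Z) \<and> (\<lambda>x. x ^ m * t) ` B + Z \<subseteq> (\<lambda>x. x ^ m * t) ` W + Z \<and>
        (\<lambda>x. x ^ m * t) ` W + Z \<subseteq> (\<lambda>x. x ^ m * t) ` A + Z"
      by (intro conjI kst_image set_plus_mono2 image_mono) auto
  next
    fix V W assume VW: "kst Q1 V" "kst Q1 W" "B \<subseteq> V" "V \<subset> W" "W \<subseteq> A"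
    have *: "x \<in> V" if xA: "x \<in> A" and xV: "x ^ m * t \<in> (\<lambda>x. x ^ m * t) ` V + Z" for x
    proof -
      obtain v z where v: "v \<in> V" "z \<in> Z" "x ^ m * t = v ^ m * t + z" using xV by (auto elim!: set_plus_elim)
      have "(x - v) ^ m * t - (x ^ m * t - v ^ m * t) \<in> Z" by (rule ad)
      moreover have "x ^ m * t - v ^ m * t \<in> Z" using v by simp
      ultimately have z: "(x - v) ^ m * t \<in> Z" using sgp_cong[OF sZ] by blast
      have "(0 - 0) ^ m * t - (0 ^ m * t - 0 ^ m * t) \<in> Z" by (rule ad)
      then have "(x - v) ^ m * t - 0 ^ m * t \<in> Z" using sgp_diff[OF sZ z] by simp
      moreover have "0 \<in> B" using B L_sgp sgp_zero by blast
      ultimately have "0 ^ m * t + ((x - v) ^ m * t - 0 ^ m * t) \<in> (\<lambda>x. x ^ m * t) ` B + Z" by blast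
      then have im: "(x - v) ^ m * t \<in> (\<lambda>x. x ^ m * t) ` B + Z" by simp
      have "v \<in> A" using v(1) VW(4,5) by blast
      then have "x - v \<in> A" by (rule sgp_diff[OF L_sgp[OF A] xA])
      from ker[OF this im] have "x - v \<in> V" using VW(3) by (rule subsetD[rotated])
      then have "x - v + v \<in> V" by (rule sgp_add[OF L_sgp[OF VW(1)] _ v(1)])
      then show ?thesis by simp
    qed
    obtain w where w: "w \<in> W" "w \<notin> V" using VW(4) by blast
    have "w ^ m * t \<in> (\<lambda>x. x ^ m * t) ` W + Z"
      by (rule subsetD[OF subset_plus_left[OF sZ] imageI[OF w(1)]])
    moreover have "w ^ m * t \<notin> (\<lambda>x. x ^ m * t) ` V + Z" using *[of w] w VW(5) by blast
    moreover have "(\<lambda>x. x ^ m * t) ` V + Z \<subseteq> (\<lambda>x. x ^ m * t) ` W + Z"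
      using VW by (intro set_plus_mono2 image_mono) auto
    ultimately show "(\<lambda>x. x ^ m * t) ` V + Z \<subset> (\<lambda>x. x ^ m * t) ` W + Z" by blast
  qed
qed

end

lemma ad_ppow: "ppow m \<Longrightarrow> K \<subseteq> Z \<Longrightarrow> (x - y) ^ m * t - (x ^ m * t - y ^ m * t) \<in> Z"
  using K_times'[OF frobenius_diff[of m x y], of t] by (auto simp: algebra_simps)

lemma ad_one: "(x - y) ^ 1 * t - (x ^ 1 * t - y ^ 1 * t) \<in> {0::'r}"
  by (simp add: algebra_simps)

end

context fring begin

subsection \<open>Graded submodules\<close>

text \<open>An element of degree i multiplies by its Q-th power but raises the degree by i only: the
  degrees of a pushforward are the original ones divided by the power of p.\<close>

definition cl :: "nat \<Rightarrow> (int \<Rightarrow> 'r set) \<Rightarrow> bool" where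
  "cl Q U \<longleftrightarrow> (\<forall>j. sgp (U j) \<and> K \<subseteq> U j) \<and> (\<forall>i j. \<forall>r\<in>R i. \<forall>x\<in>U j. r ^ Q * x \<in> U (i + j))"

definition gm :: "nat \<Rightarrow> (int \<Rightarrow> 'r set) \<Rightarrow> (int \<Rightarrow> 'r set) \<Rightarrow> bool" where
  "gm Q N Z \<longleftrightarrow> cl Q N \<and> cl Q Z \<and> Z \<le> N"

lemma cl_sgp: "cl Q U \<Longrightarrow> sgp (U j)" and cl_K: "cl Q U \<Longrightarrow> K \<subseteq> U j"
  and cl_mult: "cl Q U \<Longrightarrow> r \<in> R i \<Longrightarrow> x \<in> U j \<Longrightarrow> r ^ Q * x \<in> U (i + j)"
  by (auto simp: cl_def)

lemma cl_mult': "cl Q U \<Longrightarrow> r \<in> R i \<Longrightarrow> x \<in> U j \<Longrightarrow> k = i + j \<Longrightarrow> r ^ Q * x \<in> U k"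
  using cl_mult by simp

lemma cl_kst: "cl Q U \<Longrightarrow> kst Q (U j)"
  using cl_mult[of Q U _ 0 _ j] by (auto simp: kst_def cl_sgp)

lemma cl_cong: "cl Q U \<Longrightarrow> x - y \<in> K \<Longrightarrow> x \<in> U j \<longleftrightarrow> y \<in> U j"
  using sgp_cong[OF cl_sgp, of Q U x y j] cl_K[of Q U j] by blast

lemma cl_R: "cl 1 R"
  by (auto simp: cl_def sgp_R K_R[THEN subsetD] R_mult)

lemma cl_Kfam: "Q > 0 \<Longrightarrow> cl Q (\<lambda>_. K)"
  by (auto simp: cl_def sgp_K K_ideal)

lemma cl_plus: "cl Q U \<Longrightarrow> cl Q V \<Longrightarrow> cl Q (\<lambda>j. U j + V j)"
  unfolding cl_def
proof (intro conjI allI ballI)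
  fix j assume U: "(\<forall>j. sgp (U j) \<and> K \<subseteq> U j) \<and> (\<forall>i j. \<forall>r\<in>R i. \<forall>x\<in>U j. r ^ Q * x \<in> U (i + j))"
    and V: "(\<forall>j. sgp (V j) \<and> K \<subseteq> V j) \<and> (\<forall>i j. \<forall>r\<in>R i. \<forall>x\<in>V j. r ^ Q * x \<in> V (i + j))"
  show "sgp (U j + V j)" "K \<subseteq> U j + V j" using U V subset_plus_left[of "V j" "U j"] by (auto intro: sgp_plus)
  fix i r x assume r: "r \<in> R i" and x: "x \<in> U j + V j"
  obtain a b where ab: "a \<in> U j" "b \<in> V j" "x = a + b" using x by (rule set_plus_elim)
  have "r ^ Q * a \<in> U (i + j)" "r ^ Q * b \<in> V (i + j)" using ab r U V by auto
  then show "r ^ Q * x \<in> U (i + j) + V (i + j)" unfolding ab(3) distrib_left by (rule set_plus_intro)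
qed

lemma cl_preimage:
  assumes "cl Q N" "cl Q U"
  shows "cl Q (\<lambda>j. {n \<in> N j. x * n \<in> U (j + a)})"
  unfolding cl_def
proof (intro conjI allI ballI)
  fix j
  show "sgp {n \<in> N j. x * n \<in> U (j + a)}"
    using cl_sgp[OF assms(1), of j] cl_sgp[OF assms(2), of "j + a"]
    by (auto simp: sgp_def right_diff_distrib)
  show "K \<subseteq> {n \<in> N j. x * n \<in> U (j + a)}"
    using cl_K[OF assms(1), of j] cl_K[OF assms(2), of "j + a"] K_ideal by blast
  fix i r n assume r: "r \<in> R i" and n: "n \<in> {n \<in> N j. x * n \<in> U (j + a)}"
  have "r ^ Q * (x * n) \<in> U (i + (j + a))" using cl_mult[OF assms(2) r] n by blast
  then show "r ^ Q * n \<in> {n \<in> N (i + j). x * n \<in> U (i + j + a)}"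
    using cl_mult[OF assms(1) r] n by (simp add: mult.left_commute add.assoc)
qed

lemma cl_Int: "cl Q U \<Longrightarrow> cl Q V \<Longrightarrow> cl Q (\<lambda>j. U j \<inter> V j)"
  by (auto simp: cl_def sgp_Int)

text \<open>The submodule generated by one element \<open>u\<close> of degree \<open>a\<close>.\<close>

definition rsp :: "nat \<Rightarrow> 'r \<Rightarrow> int \<Rightarrow> int \<Rightarrow> 'r set" where
  "rsp Q u a j = (\<lambda>r. r ^ Q * u) ` R (j - a) + K"

lemma cl_rsp:
  assumes "ppow Q" shows "cl Q (rsp Q u a)"
  unfolding cl_def
proof (intro conjI allI ballI)
  fix j
  have *: "kst Q ((\<lambda>r. r ^ Q * u) ` R (j - a) + K)"
    by (rule kst_image[where ?Q1.0 = 1, OF _ _ ad_ppow[OF assms order_refl] cl_kst[OF cl_R]])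
      (use cl_kst[OF cl_Kfam[OF ppow_pos[OF assms]]] in auto)
  then show "sgp (rsp Q u a j)" by (simp add: rsp_def L_sgp)
  show "K \<subseteq> rsp Q u a j" unfolding rsp_def by (intro subset_image_plus sgp_zero[OF sgp_R] ppow_pos[OF assms])
  fix i r x assume r: "r \<in> R i" and x: "x \<in> rsp Q u a j"
  then obtain s k where *: "s \<in> R (j - a)" "k \<in> K" "x = s ^ Q * u + k"
    by (auto simp: rsp_def elim!: set_plus_elim)
  have "r * s \<in> R (i + j - a)" using R_mult[OF r *(1)] by (simp add: algebra_simps)
  moreover have "r ^ Q * x = (r * s) ^ Q * u + r ^ Q * k"
    by (simp add: * power_mult_distrib algebra_simps)
  ultimately show "r ^ Q * x \<in> rsp Q u a (i + j)"
    using K_ideal[OF *(2)] by (auto simp: rsp_def)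
qed

lemma rsp_self: "ppow Q \<Longrightarrow> u \<in> rsp Q u a a"
  using set_plus_intro[of u "(\<lambda>r. r ^ Q * u) ` R 0" 0 K] one_R sgp_zero[OF sgp_K]
  by (force simp: rsp_def image_iff)

lemma rsp_le: "cl Q U \<Longrightarrow> u \<in> U a \<Longrightarrow> rsp Q u a \<le> U"
proof (rule le_funI, rule subsetI)
  fix j x assume U: "cl Q U" "u \<in> U a" and x: "x \<in> rsp Q u a j"
  then obtain s k where *: "s \<in> R (j - a)" "k \<in> K" "x = s ^ Q * u + k"
    by (auto simp: rsp_def elim!: set_plus_elim)
  have "s ^ Q * u \<in> U j" using cl_mult'[OF U(1) *(1) U(2)] by simp
  then show "x \<in> U j" using * cl_K[OF U(1), of j] by (auto intro: sgp_add cl_sgp[OF U(1)])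
qed

lemma gmD: "gm Q N Z \<Longrightarrow> cl Q N" "gm Q N Z \<Longrightarrow> cl Q Z" "gm Q N Z \<Longrightarrow> Z j \<subseteq> N j"
  by (auto simp: gm_def le_fun_def)

lemma gmI: "cl Q N \<Longrightarrow> cl Q Z \<Longrightarrow> (\<And>j. Z j \<subseteq> N j) \<Longrightarrow> gm Q N Z"
  by (auto simp: gm_def le_fun_def)

subsection \<open>Restriction of scalars to p-th powers\<close>

definition \<kappa> :: enat where "\<kappa> = len (kst p) K (R 0)"

text \<open>Adjoining one element outside \<open>B\<close> adds a copy of the field k: elements of
  \<open>R 0\<close> outside \<open>K\<close> are invertible, so only \<open>K\<close> is sent into
  \<open>B\<close>. Over p-th powers the same interval becomes k over its subfield of p-th
  powers.\<close>

lemma simple_len: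
  assumes A: "kst Q A" "kst Q B" and K: "K \<subseteq> B" and Q: "ppow Q" and x: "x \<in> A" "x \<notin> B"
  defines "B' \<equiv> (\<lambda>r. r ^ Q * x) ` R 0 + B"
  shows "kst Q B'" "B \<subseteq> B'" "B' \<subseteq> A + B" "x \<in> B'" "len (kst Q) B B' = 1" "len (kst (Q * p)) B B' = \<kappa>"
proof -
  have sB: "sgp B" "sgp A" using A L_sgp by auto
  have ad: "(y - z) ^ Q * x - (y ^ Q * x - z ^ Q * x) \<in> B" for y z by (rule ad_ppow[OF Q K])
  show kB: "kst Q B'" unfolding B'_def
    by (rule kst_image[where ?Q1.0 = 1, OF _ A(2) ad cl_kst[OF cl_R]]) simp
  show BB': "B \<subseteq> B'" unfolding B'_def by (intro subset_image_plus sgp_zero[OF sgp_R] ppow_pos[OF Q])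
  show "B' \<subseteq> A + B" unfolding B'_def using A x by (intro set_plus_mono2) (auto simp: kst_mult)
  have "1 ^ Q * x + 0 \<in> B'" unfolding B'_def using one_R sgp_zero[OF sB(1)] by blast
  then show xB': "x \<in> B'" by simp
  have zero: "(\<lambda>r. r ^ Q * x) ` K + B = B"
  proof
    show "(\<lambda>r. r ^ Q * x) ` K + B \<subseteq> B"
      using K power_K[OF _ ppow_pos[OF Q]] by (intro plus_subset sB) (auto intro: K_ideal')
    show "B \<subseteq> (\<lambda>r. r ^ Q * x) ` K + B" by (intro subset_image_plus sgp_zero[OF sgp_K] ppow_pos[OF Q])
  qed
  have ker: "r \<in> K" if r: "r \<in> R 0" "r ^ Q * x \<in> B" for r
  proof (rule ccontr)
    assume "r \<notin> K"
    then obtain s where s: "s \<in> R 0" "r * s - 1 \<in> K" using inv_R0 r by blast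
    have "(r * s) ^ Q * x - 1 ^ Q * x \<in> K" by (intro K_times' K_power s)
    moreover have "s ^ Q * (r ^ Q * x) \<in> B" using A s r by (auto simp: kst_mult)
    then have "(r * s) ^ Q * x \<in> B" by (simp add: power_mult_distrib mult_ac)
    ultimately show False using x K sgp_cong[OF sB(1), of "(r * s) ^ Q * x" x] by auto
  qed
  have "len (kst (p * Q)) ((\<lambda>r. r ^ Q * x) ` K + B) ((\<lambda>r. r ^ Q * x) ` R 0 + B) = len (kst p) K (R 0)"
  proof (rule len_image_eq[OF _ _ ad])
    show "kst (p * Q) B" using kst_twist[OF A(2), of p] by (simp add: mult.commute)
    show "kst p (R 0)" using kst_twist[OF cl_kst[OF cl_R, of 0], of p] by simp
    show "kst p K" using prime_p cl_kst[OF cl_Kfam] prime_gt_0_nat by blast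
  qed (use K_R ker zero in auto)
  then show "len (kst (Q * p)) B B' = \<kappa>" unfolding zero by (simp add: \<kappa>_def B'_def mult.commute)
  show "len (kst Q) B B' = 1"
  proof (rule antisym)
    show "1 \<le> len (kst Q) B B'" using kB A BB' xB' x by (intro len_pos) auto
    show "len (kst Q) B B' \<le> 1"
    proof (rule len_leI)
      fix n :: nat and W
      assume n: "n > 0" and W: "\<And>i. i \<le> n \<Longrightarrow> kst Q (W i) \<and> B \<subseteq> W i \<and> W i \<subseteq> B'"
        and st: "\<And>i. i < n \<Longrightarrow> W i \<subset> W (Suc i)"
      have "W 1 \<noteq> B" using st[of 0] W[of 0] n by auto
      then obtain w where w: "w \<in> W 1" "w \<notin> B" using W[of 1] n by auto
      have W1: "kst Q (W 1)" "B \<subseteq> W 1" "sgp (W 1)" using W[of 1] n L_sgp by auto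
      have "w \<in> B'" using w W[of 1] n by auto
      then obtain r b where rb: "r \<in> R 0" "b \<in> B" "w = r ^ Q * x + b"
        by (auto simp: B'_def elim!: set_plus_elim)
      have "r \<notin> K"
      proof
        assume "r \<in> K"
        then have "r ^ Q * x \<in> K" using power_K[OF _ ppow_pos[OF Q]] by (auto intro: K_ideal')
        then show False using rb w K sgp_add[OF sB(1)] by blast
      qed
      then obtain s where s: "s \<in> R 0" "r * s - 1 \<in> K" using inv_R0 rb by blast
      have "w - b \<in> W 1" using w rb W1 sgp_diff by blast
      then have "s ^ Q * (r ^ Q * x) \<in> W 1" using rb s W1 by (simp add: kst_mult)
      then have "(r * s) ^ Q * x \<in> W 1" by (simp add: power_mult_distrib mult_ac)
      moreover have "(r * s) ^ Q * x - 1 ^ Q * x \<in> K" by (intro K_times' K_power s)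
      ultimately have xW: "x \<in> W 1" using W1 K sgp_cong[OF W1(3), of "(r * s) ^ Q * x" x] by auto
      have "(\<lambda>r. r ^ Q * x) ` R 0 \<subseteq> W 1" using W1 xW by (auto simp: kst_mult)
      then have "B' \<subseteq> W 1" unfolding B'_def using W1 by (intro plus_subset) auto
      then have "n < 2" using st[of 1] W[of 2] n by (cases "n < 2") (auto simp: numeral_2_eq_2)
      then show "enat n \<le> 1" by (simp add: one_enat_def)
    qed
  qed
qed

text \<open>Each simple step of a composition series has length \<kappa> after restriction to p-th
  powers.\<close>

lemma len_frobenius:
  assumes "kst Q A" "kst Q B" "K \<subseteq> B" "B \<subseteq> A" "ppow Q" "len (kst Q) B A = enat n"
  shows "len (kst (Q * p)) B A = \<kappa> * enat n"
  using assms
proof (induction n arbitrary: B)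
  case 0
  then have "B = A" using len_zeroD[of "kst Q" A B] by (simp add: zero_enat_def)
  then show ?case by (simp add: len_same zero_enat_def[symmetric])
next
  case (Suc n)
  have "B \<noteq> A" using Suc.prems(6) by (auto simp: len_same zero_enat_def)
  then obtain x where x: "x \<in> A" "x \<notin> B" using Suc.prems by auto
  define B' where "B' = (\<lambda>r. r ^ Q * x) ` R 0 + B"
  note s = simple_len[OF Suc.prems(1,2,3,5) x, folded B'_def]
  have "A + B = A" using plus_absorb[of A B] Suc.prems L_sgp by auto
  then have B'A: "B' \<subseteq> A" using s(3) by simp
  have "enat (Suc n) = 1 + len (kst Q) B' A"
    using len_add[OF Suc.prems(1) s(1) Suc.prems(2) s(2) B'A] s(5) Suc.prems(6) by simp
  then have "len (kst Q) B' A = enat n"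
    by (cases "len (kst Q) B' A") (auto simp: one_enat_def)
  then have "len (kst (Q * p)) B' A = \<kappa> * enat n"
    using Suc.prems s B'A by (intro Suc.IH) auto
  then have "len (kst (Q * p)) B A = \<kappa> + \<kappa> * enat n"
    using len_add[of "Q * p" A B' B] kst_twist Suc.prems s B'A by simp
  also have "\<dots> = \<kappa> * enat (Suc n)"
    by (metis distrib_left eSuc_enat mult.right_neutral plus_1_eSuc(1))
  finally show ?case .
qed

lemma \<kappa>_pos: "\<kappa> \<noteq> 0"
proof
  assume "\<kappa> = 0"
  moreover have "kst p (R 0)" using kst_twist[OF cl_kst[OF cl_R, of 0], of p] by simp
  moreover have "kst p K" using prime_p cl_kst[OF cl_Kfam] prime_gt_0_nat by blast
  ultimately have "K = R 0" unfolding \<kappa>_def using len_zeroD K_R by blast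
  then show False using one_R one_K by blast
qed

section \<open>Finiteness of the degree of k over its p-th powers\<close>

lemma len_rsp_le_1: assumes Q: "ppow Q" shows "len (kst Q) K (rsp Q y a a) \<le> 1"
proof (cases "y \<in> K")
  case True
  note c = cl_Kfam[OF ppow_pos[OF Q]]
  have "rsp Q y a a = K" using le_funD[OF rsp_le[OF c True], of a a] cl_K[OF cl_rsp[OF Q]] by blast
  then show ?thesis by (simp add: len_same)
next
  case False
  have "kst Q UNIV" by (auto simp: kst_def sgp_def)
  from simple_len(5)[OF this cl_kst[OF cl_Kfam[OF ppow_pos[OF Q]]] order_refl Q UNIV_I False]
  show ?thesis by (simp add: rsp_def)
qed

text \<open>\<open>rsp Q y 0 0\<close> is the line through \<open>y\<close>: its coefficients come
  from \<open>R 0\<close>, whatever degree \<open>y\<close> itself has.\<close>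

definition lspan :: "nat \<Rightarrow> 'r set \<Rightarrow> 'r set" where
  "lspan Q I = K + (\<Sum>y\<in>I. rsp Q y 0 0)"

lemma lspan:
  assumes I: "finite I" and Q: "ppow Q"
  shows "kst Q (lspan Q I)" "K \<subseteq> lspan Q I" "len (kst Q) K (lspan Q I) \<le> enat (card I)"
    and "y \<in> I \<Longrightarrow> rsp Q y 0 0 \<subseteq> lspan Q I"
proof -
  have kK: "kst Q K" and kr: "kst Q (rsp Q y 0 0)" "K \<subseteq> rsp Q y 0 0" for y
    using cl_kst[OF cl_Kfam[OF ppow_pos[OF Q]]] cl_kst[OF cl_rsp[OF Q]] cl_K[OF cl_rsp[OF Q]] by auto
  have K_eq: "K + (\<Sum>y\<in>S. K) = K" if "finite S" for S
    using that by induction (simp_all add: add.assoc[symmetric] plus_absorb[OF sgp_K sgp_K order_refl])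
  have len: "len (kst Q) K (lspan Q S) \<le> (\<Sum>y\<in>S. len (kst Q) K (rsp Q y 0 0)) \<and> kst Q (lspan Q S) \<and> K \<subseteq> lspan Q S"
    if S: "finite S" for S
    using len_plus_sum_le[of S Q "\<lambda>y. rsp Q y 0 0" "\<lambda>_. K" K] kK kr S unfolding K_eq[OF S] lspan_def by simp
  then show "kst Q (lspan Q I)" "K \<subseteq> lspan Q I" using I by auto
  have "(\<Sum>y\<in>I. len (kst Q) K (rsp Q y 0 0)) \<le> of_nat (card I) * 1" by (rule sum_bounded_above[OF len_rsp_le_1[OF Q]])
  then show "len (kst Q) K (lspan Q I) \<le> enat (card I)" using order_trans[OF conjunct1[OF len[OF I]]] by (simp add: of_nat_eq_enat)
  assume y: "y \<in> I"
  have eq: "lspan Q I = rsp Q y 0 0 + lspan Q (I - {y})"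
    unfolding lspan_def sum.remove[OF I y] by (simp only: add.left_commute)
  have "sgp (lspan Q (I - {y}))" using len[of "I - {y}"] I L_sgp by blast
  then show "rsp Q y 0 0 \<subseteq> lspan Q I" unfolding eq by (rule subset_plus_left)
qed

text \<open>By \<open>gen_R0\<close>, which expresses F-finiteness in degree 0, the finite set
  \<open>Y\<close> spans \<open>R 0\<close> over p-th powers.\<close>

lemma \<kappa>_finite: "\<kappa> \<noteq> \<infinity>"
proof -
  note S = lspan[OF finite_Y ppow_p]
  note sS = L_sgp[OF S(1)]
  have "R 0 \<subseteq> lspan p Y"
  proof
    fix r assume "r \<in> R 0"
    then obtain c where c: "\<forall>y\<in>Y. c y \<in> R 0" "r - (\<Sum>y\<in>Y. c y ^ p * y) \<in> K" using gen_R0 by blast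
    have "c y ^ p * y \<in> lspan p Y" if y: "y \<in> Y" for y
    proof -
      have "c y ^ p * y \<in> rsp p y 0 0"
        using cl_mult[OF cl_rsp[OF ppow_p], of "c y" 0 y y 0 0] rsp_self[OF ppow_p] c(1) y by auto
      then show ?thesis using S(4)[OF y] by blast
    qed
    then have "(\<Sum>y\<in>Y. c y ^ p * y) \<in> lspan p Y" by (rule sgp_sum[OF sS])
    then show "r \<in> lspan p Y" using sgp_cong[OF sS] c(2) S(2) by blast
  qed
  moreover have "kst p (R 0)" using kst_twist[OF cl_kst[OF cl_R, of 0], of p] by simp
  moreover have kK: "kst p K" using prime_p cl_kst[OF cl_Kfam] prime_gt_0_nat by blast
  ultimately have "\<kappa> \<le> len (kst p) K (lspan p Y)"
    unfolding \<kappa>_def using K_R by (intro len_sub_mono S) auto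
  also have "\<dots> \<le> enat (card Y)" by (rule S(3))
  finally show ?thesis by (cases \<kappa>) auto
qed

end

section \<open>Frobenius powers of an ideal\<close>

text \<open>\<open>F\<close> lists homogeneous generators of the ideal with their degrees.\<close>

locale fring_ideal = fring R K p X Y
  for R :: "int \<Rightarrow> 'r::comm_ring_1 set" and K :: "'r set" and p :: nat and X Y :: "'r set" +
  fixes F :: "('r \<times> int) set"
  assumes finite_F: "finite F" and F_R: "fe \<in> F \<Longrightarrow> fst fe \<in> R (snd fe)"
begin

text \<open>\<open>JN Q q N Z\<close> is \<open>Z + J\<^bsup>[q]\<^esup> N\<close> and \<open>\<phi> Q q N Z j\<close> is the length of the degree \<open>j\<close> part of
  \<open>N / (Z + J\<^bsup>[q]\<^esup> N)\<close>.\<close>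

definition JN :: "nat \<Rightarrow> nat \<Rightarrow> (int \<Rightarrow> 'r set) \<Rightarrow> (int \<Rightarrow> 'r set) \<Rightarrow> int \<Rightarrow> 'r set" where
  "JN Q q N Z j = Z j + (\<Sum>fe\<in>F. (\<lambda>x. fst fe ^ (q * Q) * x) ` N (j - int q * snd fe))"

definition \<phi> :: "nat \<Rightarrow> nat \<Rightarrow> (int \<Rightarrow> 'r set) \<Rightarrow> (int \<Rightarrow> 'r set) \<Rightarrow> int \<Rightarrow> enat" where
  "\<phi> Q q N Z j = len (kst Q) (JN Q q N Z j) (N j)"

lemma kst_mult_image: "kst Q A \<Longrightarrow> kst Q ((\<lambda>x. f * x) ` A)"
  using kst_image[of Q Q 1 "{0}", OF _ kst_zero ad_one, of A f] by (simp add: plus_zero_set mult.commute)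

lemma len_mult_image:
  assumes "kst Q A" "kst Q B" "B \<subseteq> A"
  shows "len (kst Q) ((\<lambda>x. f * x) ` B) ((\<lambda>x. f * x) ` A) \<le> len (kst Q) B A"
  using len_image_le[of Q Q 1 "{0}", OF _ kst_zero ad_one assms, of f] by (simp add: plus_zero_set mult.commute)

lemma sum_sets_subset:
  assumes "finite I" "sgp C" "\<And>i. i \<in> I \<Longrightarrow> A i \<subseteq> C"
  shows "(\<Sum>i\<in>I. A i) \<subseteq> (C :: 'r set)"
  using assms
proof (induction I rule: finite_induct)
  case empty then show ?case by (simp add: sgp_zero)
next
  case (insert i I) then show ?case by (simp add: plus_subset)
qed

lemma JN_subset:
  assumes "sgp C" "Z j \<subseteq> C" "\<And>fe x. fe \<in> F \<Longrightarrow> x \<in> N (j - int q * snd fe) \<Longrightarrow> fst fe ^ (q * Q) * x \<in> C"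
  shows "JN Q q N Z j \<subseteq> C"
  unfolding JN_def by (intro plus_subset assms(1,2) sum_sets_subset finite_F image_subsetI assms(3))

lemma JN_memD:
  assumes "x \<in> JN Q q N Z j"
  shows "\<exists>z c. z \<in> Z j \<and> (\<forall>fe\<in>F. c fe \<in> N (j - int q * snd fe)) \<and> x = z + (\<Sum>fe\<in>F. fst fe ^ (q * Q) * c fe)"
proof -
  obtain z s where zs: "z \<in> Z j" "s \<in> (\<Sum>fe\<in>F. (\<lambda>x. fst fe ^ (q * Q) * x) ` N (j - int q * snd fe))" "x = z + s"
    using assms unfolding JN_def by (rule set_plus_elim)
  from zs(2) obtain c where c: "s = (\<Sum>fe\<in>F. c fe)" "\<forall>fe\<in>F. c fe \<in> (\<lambda>x. fst fe ^ (q * Q) * x) ` N (j - int q * snd fe)"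
    unfolding set_sum_alt[OF finite_F] by auto
  from c(2) have "\<forall>fe\<in>F. \<exists>y. y \<in> N (j - int q * snd fe) \<and> c fe = fst fe ^ (q * Q) * y" by auto
  from bchoice[OF this] obtain d where "\<forall>fe\<in>F. d fe \<in> N (j - int q * snd fe) \<and> c fe = fst fe ^ (q * Q) * d fe" by blast
  then show ?thesis using zs c by (intro exI[of _ z] exI[of _ d]) auto
qed

lemma JN_sum_kst:
  assumes "cl Q N" "kst Q Z"
  shows "kst Q (Z + (\<Sum>fe\<in>F. (\<lambda>x. fst fe ^ (q * Q) * x) ` N (j - int q * snd fe)))"
  using len_plus_sum_le[of F Q "\<lambda>fe. (\<lambda>x. fst fe ^ (q * Q) * x) ` N (j - int q * snd fe)"
      "\<lambda>fe. (\<lambda>x. fst fe ^ (q * Q) * x) ` N (j - int q * snd fe)" Z]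
    finite_F kst_mult_image cl_kst[OF assms(1)] assms(2) by simp

lemma JN_memI:
  assumes "z \<in> Z j" "\<And>fe. fe \<in> F \<Longrightarrow> c fe \<in> N (j - int q * snd fe)"
  shows "z + (\<Sum>fe\<in>F. fst fe ^ (q * Q) * c fe) \<in> JN Q q N Z j"
  unfolding JN_def set_sum_alt[OF finite_F] using assms by (intro set_plus_intro) auto

context
  fixes Q N Z assumes g: "gm Q N Z"
begin

lemma JN_kst: "kst Q (JN Q q N Z j)"
  unfolding JN_def by (rule JN_sum_kst[OF gmD(1)[OF g] cl_kst[OF gmD(2)[OF g]]])

lemma JN_sgp: "sgp (JN Q q N Z j)" using JN_kst L_sgp by blast

lemma JN_Z: "Z j \<subseteq> JN Q q N Z j"
proof
  fix z assume "z \<in> Z j"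
  then have "z + (\<Sum>fe\<in>F. fst fe ^ (q * Q) * 0) \<in> JN Q q N Z j"
    by (rule JN_memI) (auto intro: sgp_zero cl_sgp gmD(1)[OF g])
  then show "z \<in> JN Q q N Z j" by simp
qed

lemma JN_F:
  assumes "fe \<in> F" "x \<in> N (j - int q * snd fe)"
  shows "fst fe ^ (q * Q) * x \<in> JN Q q N Z j"
proof -
  have s: "0 \<in> N i" "0 \<in> Z i" for i using sgp_zero cl_sgp gmD(1,2)[OF g] by auto
  have "0 + (\<Sum>fe'\<in>F. fst fe' ^ (q * Q) * (if fe' = fe then x else 0)) \<in> JN Q q N Z j"
    by (rule JN_memI) (use s assms in auto)
  also have "(\<Sum>fe'\<in>F. fst fe' ^ (q * Q) * (if fe' = fe then x else 0)) =
      (\<Sum>fe'\<in>F. if fe' = fe then fst fe ^ (q * Q) * x else 0)"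
    by (intro sum.cong) auto
  finally show ?thesis using assms finite_F by simp
qed

lemma F_mult_N:
  assumes "fe \<in> F" "x \<in> N (j - int q * snd fe)"
  shows "fst fe ^ (q * Q) * x \<in> N j"
proof -
  have "(fst fe ^ q) ^ Q * x \<in> N j"
    by (rule cl_mult'[OF gmD(1)[OF g] power_R[OF F_R[OF assms(1)]] assms(2)]) simp
  then show ?thesis by (simp add: power_mult)
qed

lemma F_mult_Z:
  assumes "fe \<in> F" "x \<in> Z (j - int q * snd fe)"
  shows "fst fe ^ (q * Q) * x \<in> Z j"
proof -
  have "(fst fe ^ q) ^ Q * x \<in> Z j"
    by (rule cl_mult'[OF gmD(2)[OF g] power_R[OF F_R[OF assms(1)]] assms(2)]) simp
  then show ?thesis by (simp add: power_mult)
qed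

lemma JN_N: "JN Q q N Z j \<subseteq> N j"
  by (rule JN_subset) (use gmD(1,3)[OF g] cl_sgp F_mult_N in auto)

lemma JN_K: "K \<subseteq> JN Q q N Z j"
  using JN_Z[of j q] cl_K[OF gmD(2)[OF g], of j] by blast

end

lemma \<phi>_le: "gm Q N Z \<Longrightarrow> \<phi> Q q N Z j \<le> len (kst Q) (Z j) (N j)"
  unfolding \<phi>_def
  by (intro len_sub_mono JN_kst JN_N JN_Z cl_kst order_refl) (auto dest: gmD)

lemma \<phi>_zero: "cl Q Z \<Longrightarrow> \<phi> Q q Z Z j = 0"
  using JN_Z[of Q Z Z j q] JN_N[of Q Z Z q j] by (simp add: \<phi>_def len_same gm_def)

text \<open>The q p^e-th Frobenius power of J acts on a module exactly as the q-th one acts on its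
  e-th pushforward. Both sides measure the same interval of sets; only the scalars shrink, once for
  every factor p.\<close>

lemma \<phi>_twist:
  assumes g: "gm Q N Z" and Q: "ppow Q" and fin: "\<phi> Q (q * p ^ e) N Z (int (p ^ e) * j) = enat n"
  shows "\<phi> (Q * p ^ e) q (\<lambda>j. N (int (p ^ e) * j)) (\<lambda>j. Z (int (p ^ e) * j)) j = \<kappa> ^ e * enat n"
proof -
  have eq: "JN (Q * p ^ e) q (\<lambda>j. N (int (p ^ e) * j)) (\<lambda>j. Z (int (p ^ e) * j)) j =
      JN Q (q * p ^ e) N Z (int (p ^ e) * j)"
    unfolding JN_def by (simp add: algebra_simps)
  let ?B = "JN Q (q * p ^ e) N Z (int (p ^ e) * j)" and ?A = "N (int (p ^ e) * j)"
  have k: "kst Q ?A" "kst Q ?B" "K \<subseteq> ?B" "?B \<subseteq> ?A"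
    using JN_kst[OF g] JN_K[OF g] JN_N[OF g] cl_kst[OF gmD(1)[OF g]] by auto
  \<comment> \<open>Finiteness is part of the induction because \<open>len_frobenius\<close> starts
    from a finite length.\<close>
  have "len (kst (Q * p ^ i)) ?B ?A = \<kappa> ^ i * enat n \<and> len (kst (Q * p ^ i)) ?B ?A \<noteq> \<infinity>" for i
  proof (induction i)
    case 0
    show ?case using fin unfolding \<phi>_def by (simp add: one_enat_def)
  next
    case (Suc i)
    from conjunct2[OF Suc] obtain m where m: "len (kst (Q * p ^ i)) ?B ?A = enat m"
      unfolding not_infinity_eq by blast
    have e: "Q * p ^ Suc i = Q * p ^ i * p" by (simp add: mult_ac)
    have l: "len (kst (Q * p ^ Suc i)) ?B ?A = \<kappa> * enat m"
      unfolding e using k by (intro len_frobenius kst_twist m ppow_mult Q ppow_power) auto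
    have "\<kappa> * enat m = \<kappa> ^ Suc i * enat n"
      using conjunct1[OF Suc] unfolding m by (simp add: mult.assoc)
    moreover have "\<kappa> * enat m \<noteq> \<infinity>" using \<kappa>_finite by auto
    ultimately show ?case unfolding l by blast
  qed
  then show ?thesis unfolding \<phi>_def eq by simp
qed

subsection \<open>Comparison of modules along a homomorphism\<close>

context
  fixes Q1 Q2 m :: nat and N1 Z1 N2 Z2 :: "int \<Rightarrow> 'r set" and t :: 'r and a :: int
  assumes g1: "gm Q1 N1 Z1" and g2: "gm Q2 N2 Z2" and m: "ppow m" and Q2: "Q2 = Q1 * m"
    and hN: "\<And>j x. x \<in> N1 j \<Longrightarrow> x ^ m * t \<in> N2 (j + a)"
    and hZ: "\<And>j x. x \<in> Z1 j \<Longrightarrow> x ^ m * t \<in> Z2 (j + a)"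
begin

private definition "ker j = {x \<in> N1 j. x ^ m * t \<in> Z2 (j + a)}"
private definition "img j = (\<lambda>x. x ^ m * t) ` N1 (j - a) + Z2 j"

private lemma ad: "K \<subseteq> Z \<Longrightarrow> (x - y) ^ m * t - (x ^ m * t - y ^ m * t) \<in> Z"
  by (rule ad_ppow[OF m])

private lemma kst_img: "kst Q2 (img j)"
  unfolding img_def
  by (rule kst_image[OF Q2 cl_kst[OF gmD(2)[OF g2]] ad[OF cl_K[OF gmD(2)[OF g2]]] cl_kst[OF gmD(1)[OF g1]]])

private lemma img_N2: "img j \<subseteq> N2 j"
  unfolding img_def
proof (rule plus_subset[OF cl_sgp[OF gmD(1)[OF g2]] _ gmD(3)[OF g2]])
  show "(\<lambda>x. x ^ m * t) ` N1 (j - a) \<subseteq> N2 j" using hN[of _ "j - a"] by auto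
qed

private lemma f_comm: "(f ^ (q * Q1) * x) ^ m * t = f ^ (q * Q2) * (x ^ m * t)"
  by (simp add: Q2 power_mult power_mult_distrib mult.assoc)

text \<open>Let \<open>W\<close> be the preimage in \<open>N1\<close> of Z2 + J^[q] N2. Both lengths
  contain that of N1 / W. The second exceeds it by at most the cokernel in degree j + a. The first
  exceeds it by W modulo Z1 + J^[q] N1, which consists of a part from the kernel and a part that
  embeds into J^[q] N2 modulo J^[q] times the image; the latter is bounded by the cokernels in
  degrees j + a - q e, one for each generator of degree e.\<close>

lemma comparison:
  shows "\<phi> Q1 q N1 Z1 j \<le> \<phi> Q2 q N2 Z2 (j + a) + (len (kst Q1) (Z1 j) {x \<in> N1 j. x ^ m * t \<in> Z2 (j + a)} +
     (\<Sum>fe\<in>F. len (kst Q2) ((\<lambda>x. x ^ m * t) ` N1 (j - int q * snd fe) + Z2 (j + a - int q * snd fe)) (N2 (j + a - int q * snd fe))))"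
     (is "_ \<le> _ + (?E1 + ?E2)")
    and "\<phi> Q2 q N2 Z2 (j + a) \<le> \<phi> Q1 q N1 Z1 j + len (kst Q2) ((\<lambda>x. x ^ m * t) ` N1 j + Z2 (j + a)) (N2 (j + a))"
     (is "_ \<le> _ + ?E3")
proof -
  let ?J1 = "JN Q1 q N1 Z1 j" and ?J2 = "JN Q2 q N2 Z2 (j + a)"
  let ?t = "\<lambda>x. x ^ m * t"
  define W where "W = {x \<in> N1 j. ?t x \<in> ?J2}"
  note kJ1 = JN_kst[OF g1, of q j] and kJ2 = JN_kst[OF g2, of q "j + a"]
  note kN1 = cl_kst[OF gmD(1)[OF g1]] and kN2 = cl_kst[OF gmD(1)[OF g2]]
  note kZ1 = cl_kst[OF gmD(2)[OF g1]] and kZ2 = cl_kst[OF gmD(2)[OF g2]]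
  note KJ2 = JN_K[OF g2, of q "j + a"] and KZ2 = cl_K[OF gmD(2)[OF g2]]
  note adJ = ad[OF KJ2] and adZ = ad[OF KZ2]
  have kW: "kst Q1 W" unfolding W_def by (rule kst_preimage[OF Q2 kJ2 adJ kJ2 order_refl kN1])
  have kker: "kst Q1 (ker j)" unfolding ker_def by (rule kst_preimage[OF Q2 kZ2 adZ kZ2 order_refl kN1])
  have sW: "sgp W" by (rule L_sgp[OF kW])
  have WN: "W \<subseteq> N1 j" by (auto simp: W_def)
  have J1W: "?J1 \<subseteq> W"
  proof (rule JN_subset[OF sW])
    show "Z1 j \<subseteq> W" using hZ gmD(3)[OF g1] JN_Z[OF g2, of "j + a" q] by (auto simp: W_def)
    fix fe x assume fe: "fe \<in> F" and x: "x \<in> N1 (j - int q * snd fe)"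
    have "?t x \<in> N2 (j + a - int q * snd fe)" using hN[OF x] by (simp add: algebra_simps)
    then have "fst fe ^ (q * Q2) * ?t x \<in> ?J2" by (rule JN_F[OF g2 fe])
    then show "fst fe ^ (q * Q1) * x \<in> W"
      using F_mult_N[OF g1 fe x] by (simp add: W_def f_comm)
  qed
  have kerW: "ker j \<subseteq> W" using JN_Z[OF g2, of "j + a" q] by (auto simp: ker_def W_def)
  have tW: "?t ` W + ?J2 = ?J2"
  proof
    show "?t ` W + ?J2 \<subseteq> ?J2" using L_sgp[OF kJ2] by (intro plus_subset) (auto simp: W_def)
    show "?J2 \<subseteq> ?t ` W + ?J2" by (intro subset_image_plus sgp_zero[OF sW] ppow_pos[OF m])
  qed
  have W_eq: "len (kst Q1) W (N1 j) = len (kst Q2) ?J2 (?t ` N1 j + ?J2)"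
    using len_image_eq[OF Q2 kJ2 adJ kN1[of j] kW WN] unfolding tW by (auto simp: W_def)
  have tN_J2: "kst Q2 (?t ` N1 j + ?J2)" by (rule kst_image[OF Q2 kJ2 adJ kN1])
  have tN_N2: "?t ` N1 j + ?J2 \<subseteq> N2 (j + a)"
    using hN JN_N[OF g2] by (intro plus_subset L_sgp[OF kN2]) auto
  have J2_sub: "?J2 \<subseteq> ?t ` N1 j + ?J2" by (intro subset_image_plus sgp_zero[OF L_sgp[OF kN1]] ppow_pos[OF m])
  have p2: "\<phi> Q2 q N2 Z2 (j + a) = len (kst Q1) W (N1 j) + len (kst Q2) (?t ` N1 j + ?J2) (N2 (j + a))"
    unfolding \<phi>_def W_eq by (rule len_add[OF kN2 tN_J2 kJ2 J2_sub tN_N2])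
  have p1: "\<phi> Q1 q N1 Z1 j = len (kst Q1) ?J1 W + len (kst Q1) W (N1 j)"
    unfolding \<phi>_def by (rule len_add[OF kN1 kW kJ1 J1W WN])
  have "len (kst Q2) (?t ` N1 j + ?J2) (N2 (j + a)) \<le> ?E3"
  proof (rule len_sub_mono[OF kN2 tN_J2 kN2 _ _ tN_N2 order_refl])
    show "kst Q2 (?t ` N1 j + Z2 (j + a))" using kst_img[of "j + a"] by (simp add: img_def)
    show "?t ` N1 j + Z2 (j + a) \<subseteq> ?t ` N1 j + ?J2" by (intro set_plus_mono2 JN_Z[OF g2] order_refl)
  qed
  then show "\<phi> Q2 q N2 Z2 (j + a) \<le> \<phi> Q1 q N1 Z1 j + ?E3"
    unfolding p2 p1 by (intro add_mono) (simp_all add: add_increasing)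
  \<comment> \<open>Adding the kernel makes the map injective on \<open>W\<close> modulo
    \<open>?B\<close>, so that this quotient can be measured inside \<open>?J2\<close>.\<close>
  let ?B = "?J1 + ker j"
  have kB: "kst Q1 ?B" by (rule L_plus[OF kJ1 kker])
  have BW: "?B \<subseteq> W" by (rule plus_subset[OF sW J1W kerW])
  have J1B: "?J1 \<subseteq> ?B" by (rule subset_plus_left[OF L_sgp[OF kker]])
  have Z1ker: "Z1 j \<subseteq> ?J1 \<inter> ker j"
    using JN_Z[OF g1, of j q] gmD(3)[OF g1, of j] hZ by (auto simp: ker_def)
  have s1: "len (kst Q1) ?J1 W = len (kst Q1) ?J1 ?B + len (kst Q1) ?B W"
    by (rule len_add[OF kW kB kJ1 J1B BW])
  have s2: "len (kst Q1) ?J1 ?B \<le> ?E1"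
    using len_plus_left_le[OF kJ1 kker kZ1 Z1ker] by (simp add: ker_def)
  let ?Z2 = "Z2 (j + a)"
  have s3: "len (kst Q1) ?B W = len (kst Q2) (?t ` ?B + ?Z2) (?t ` W + ?Z2)"
  proof (rule len_image_eq[OF Q2 kZ2 adZ kW kB BW, symmetric])
    fix x assume x: "x \<in> W" "?t x \<in> ?t ` ?B + ?Z2"
    from x(2) obtain y z where yz: "y \<in> ?t ` ?B" "z \<in> ?Z2" "?t x = y + z" by (rule set_plus_elim)
    from yz(1) obtain b where b: "b \<in> ?B" "y = ?t b" by blast
    have "?t x - ?t b \<in> ?Z2" using yz b by simp
    then have "?t (x - b) \<in> ?Z2" using sgp_cong[OF L_sgp[OF kZ2] adZ] by blast
    moreover have "x - b \<in> N1 j" using x b BW WN sgp_diff[OF L_sgp[OF kN1]] by blast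
    ultimately have "x - b \<in> ker j" by (simp add: ker_def)
    then have "x - b \<in> ?B" using subset_plus_right[OF L_sgp[OF kJ1], of "ker j"] by blast
    from sgp_add[OF L_sgp[OF kB] this b(1)] show "x \<in> ?B" by simp
  qed
  \<comment> \<open>\<open>?I\<close> is Z2 + J^[q] times the image. It lies below the image of
    \<open>?B\<close>, since J^[q] N1 lies in \<open>?J1\<close>, and it differs from
    \<open>?J2\<close> only through the cokernel.\<close>
  let ?I = "?Z2 + (\<Sum>fe\<in>F. (\<lambda>x. fst fe ^ (q * Q2) * x) ` img (j + a - int q * snd fe))"
  have st: "len (kst Q2) ?I (?Z2 + (\<Sum>fe\<in>F. (\<lambda>x. fst fe ^ (q * Q2) * x) ` N2 (j + a - int q * snd fe))) \<le>
      (\<Sum>fe\<in>F. len (kst Q2) ((\<lambda>x. fst fe ^ (q * Q2) * x) ` img (j + a - int q * snd fe)) ((\<lambda>x. fst fe ^ (q * Q2) * x) ` N2 (j + a - int q * snd fe))) \<and>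
     kst Q2 ?I"
    using len_plus_sum_le[of F Q2 "\<lambda>fe. (\<lambda>x. fst fe ^ (q * Q2) * x) ` N2 (j + a - int q * snd fe)"
      "\<lambda>fe. (\<lambda>x. fst fe ^ (q * Q2) * x) ` img (j + a - int q * snd fe)" ?Z2]
      finite_F kZ2 by (simp add: kst_mult_image kst_img kN2 img_N2 image_mono)
  have "(\<Sum>fe\<in>F. len (kst Q2) ((\<lambda>x. fst fe ^ (q * Q2) * x) ` img (j + a - int q * snd fe)) ((\<lambda>x. fst fe ^ (q * Q2) * x) ` N2 (j + a - int q * snd fe)))
     \<le> (\<Sum>fe\<in>F. len (kst Q2) (img (j + a - int q * snd fe)) (N2 (j + a - int q * snd fe)))"
    by (intro sum_mono len_mult_image kst_img kN2 img_N2)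
  also have "\<dots> = ?E2" by (simp add: img_def algebra_simps)
  finally have IJ: "len (kst Q2) ?I ?J2 \<le> ?E2" using order_trans[OF conjunct1[OF st]] unfolding JN_def by simp
  have kI: "kst Q2 ?I" by (rule conjunct2[OF st])
  have ktB: "kst Q2 (?t ` ?B + ?Z2)" and ktW: "kst Q2 (?t ` W + ?Z2)"
    by (rule kst_image[OF Q2 kZ2 adZ kB], rule kst_image[OF Q2 kZ2 adZ kW])
  have Z2tB: "?Z2 \<subseteq> ?t ` ?B + ?Z2" by (intro subset_image_plus sgp_zero[OF L_sgp[OF kB]] ppow_pos[OF m])
  have ItB: "?I \<subseteq> ?t ` ?B + ?Z2"
  proof (rule plus_subset[OF L_sgp[OF ktB] Z2tB sum_sets_subset[OF finite_F L_sgp[OF ktB] image_subsetI]])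
    fix fe y assume fe: "fe \<in> F" and y: "y \<in> img (j + a - int q * snd fe)"
    from y obtain u z where uz: "u \<in> ?t ` N1 (j + a - int q * snd fe - a)" "z \<in> Z2 (j + a - int q * snd fe)" "y = u + z"
      unfolding img_def by (rule set_plus_elim)
    from uz(1) obtain x where x: "x \<in> N1 (j - int q * snd fe)" "u = ?t x" by (auto simp: algebra_simps)
    have "fst fe ^ (q * Q1) * x \<in> ?B" using JN_F[OF g1 fe x(1)] J1B by blast
    then have "?t (fst fe ^ (q * Q1) * x) + fst fe ^ (q * Q2) * z \<in> ?t ` ?B + ?Z2"
      using F_mult_Z[OF g2 fe uz(2)] by (intro set_plus_intro imageI)
    then show "fst fe ^ (q * Q2) * y \<in> ?t ` ?B + ?Z2" by (simp add: uz x f_comm distrib_left)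
  qed
  have tWJ2: "?t ` W + ?Z2 \<subseteq> ?J2"
    using JN_Z[OF g2] by (intro plus_subset[OF L_sgp[OF kJ2]]) (auto simp: W_def)
  have "len (kst Q2) (?t ` ?B + ?Z2) (?t ` W + ?Z2) \<le> len (kst Q2) ?I ?J2"
    using BW by (intro len_sub_mono[OF ktW ktB kJ2 kI ItB _ tWJ2] set_plus_mono2 image_mono) auto
  then have s4: "len (kst Q1) ?B W \<le> ?E2" using s3 IJ by simp
  have "\<phi> Q1 q N1 Z1 j \<le> (?E1 + ?E2) + len (kst Q1) W (N1 j)"
    unfolding p1 s1 by (intro add_mono s2 s4 order_refl)
  also have "\<dots> \<le> (?E1 + ?E2) + \<phi> Q2 q N2 Z2 (j + a)" unfolding p2 by (intro add_mono order_refl) simp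
  finally show "\<phi> Q1 q N1 Z1 j \<le> \<phi> Q2 q N2 Z2 (j + a) + (?E1 + ?E2)" by (simp add: add.commute)
qed

end

end

section \<open>The ascending chain condition\<close>

context fring begin

definition noeth :: "nat \<Rightarrow> (int \<Rightarrow> 'r set) \<Rightarrow> (int \<Rightarrow> 'r set) \<Rightarrow> bool" where
  "noeth Q N Z \<longleftrightarrow> (\<forall>U :: nat \<Rightarrow> int \<Rightarrow> 'r set.
     (\<forall>n. cl Q (U n) \<and> Z \<le> U n \<and> U n \<le> N \<and> U n \<le> U (Suc n)) \<longrightarrow> (\<exists>n. \<forall>m\<ge>n. U m = U n))"

lemma noeth_sub: "noeth Q N Z \<Longrightarrow> Z \<le> Z' \<Longrightarrow> N' \<le> N \<Longrightarrow> noeth Q N' Z'"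
  unfolding noeth_def by (meson order_trans)

lemma noeth_maximal:
  assumes "noeth Q N Z" "\<And>U. P U \<Longrightarrow> cl Q U \<and> Z \<le> U \<and> U \<le> N" "P V0"
  shows "\<exists>U. P U \<and> (\<forall>V. P V \<longrightarrow> U \<le> V \<longrightarrow> V = U)"
proof (rule ccontr)
  assume "\<not> ?thesis"
  then have *: "\<exists>V. P V \<and> U \<le> V \<and> V \<noteq> U" if "P U" for U using that by blast
  have "\<exists>f. \<forall>n. P (f n) \<and> (f n \<le> f (Suc n) \<and> f (Suc n) \<noteq> f n)"
    by (rule dependent_nat_choice) (use assms(3) * in auto)
  then obtain f where f: "\<And>n. P (f n)" "\<And>n. f n \<le> f (Suc n)" "\<And>n. f (Suc n) \<noteq> f n" by blast
  then obtain n where "\<forall>m\<ge>n. f m = f n" using assms(1,2) unfolding noeth_def by metis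
  then show False using f(3)[of n] by (metis le_SucI order_refl)
qed

text \<open>Hilbert's basis theorem, by induction on the number of acting variables.\<close>

definition clx :: "nat \<Rightarrow> 'r set \<Rightarrow> (int \<Rightarrow> 'r set) \<Rightarrow> bool" where
  "clx Q S U \<longleftrightarrow> (\<forall>j. sgp (U j) \<and> K \<subseteq> U j \<and> (\<forall>r\<in>R 0. \<forall>v\<in>U j. r ^ Q * v \<in> U j) \<and>
     (\<forall>s\<in>S. \<forall>v\<in>U j. s ^ Q * v \<in> U (j + 1)))"

definition noethx :: "nat \<Rightarrow> 'r set \<Rightarrow> (int \<Rightarrow> 'r set) \<Rightarrow> bool" where
  "noethx Q S N \<longleftrightarrow> (\<forall>U :: nat \<Rightarrow> int \<Rightarrow> 'r set.
     (\<forall>n. clx Q S (U n) \<and> U n \<le> N \<and> U n \<le> U (Suc n)) \<longrightarrow> (\<exists>n. \<forall>m\<ge>n. U m = U n))"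

definition spn :: "nat \<Rightarrow> 'r set \<Rightarrow> ('r \<times> int) set \<Rightarrow> int \<Rightarrow> 'r set" where
  "spn Q S G j = \<Inter>{U j | U. clx Q S U \<and> (\<forall>ga\<in>G. fst ga \<in> U (snd ga))}"

lemma clxD:
  assumes "clx Q S U"
  shows "sgp (U j)" "K \<subseteq> U j" "r \<in> R 0 \<Longrightarrow> v \<in> U j \<Longrightarrow> r ^ Q * v \<in> U j"
    "s \<in> S \<Longrightarrow> v \<in> U j \<Longrightarrow> s ^ Q * v \<in> U (j + 1)"
  using assms by (auto simp: clx_def)

lemma clx_spn: "clx Q S (spn Q S G)"
  unfolding clx_def
proof (intro allI conjI ballI)
  fix j
  show "sgp (spn Q S G j)" unfolding sgp_def spn_def by (auto dest: clxD(1) intro: sgp_zero sgp_diff)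
  show "K \<subseteq> spn Q S G j" by (auto simp: spn_def dest: clxD(2))
  show "r ^ Q * v \<in> spn Q S G j" if "r \<in> R 0" "v \<in> spn Q S G j" for r v
    using that by (auto simp: spn_def intro: clxD(3))
  show "s ^ Q * v \<in> spn Q S G (j + 1)" if "s \<in> S" "v \<in> spn Q S G j" for s v
    using that by (fastforce simp: spn_def intro: clxD(4))
qed

lemma spn_gen: "(g, a) \<in> G \<Longrightarrow> g \<in> spn Q S G a"
  by (force simp: spn_def)

lemma spn_le: "clx Q S U \<Longrightarrow> (\<And>ga. ga \<in> G \<Longrightarrow> fst ga \<in> U (snd ga)) \<Longrightarrow> spn Q S G \<le> U"
  unfolding spn_def by (intro le_funI Inter_lower) blast

lemma noethx_mono: "noethx Q S N \<Longrightarrow> N' \<le> N \<Longrightarrow> noethx Q S N'"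
  unfolding noethx_def by (meson order_trans)

lemma chain_le: "(\<And>n. U n \<le> (U (Suc n) :: int \<Rightarrow> 'r set)) \<Longrightarrow> m \<le> n \<Longrightarrow> U m \<le> U n"
  using lift_Suc_mono_le by metis

text \<open>With no variables acting, the generated family is finite dimensional in the finitely
  many degrees that occur in \<open>G\<close> and equals \<open>K\<close> elsewhere. Chains
  stabilize in each degree, hence at a common index.\<close>

lemma noethx_base:
  assumes G: "finite G" and Q: "ppow Q" shows "noethx Q {} (spn Q {} G)"
proof (rule noethx_mono)
  define I where "I j = fst ` {ga \<in> G. snd ga = j}" for j
  define E where "E j = lspan Q (I j)" for j
  have fI: "finite (I j)" for j using G by (simp add: I_def)
  note L = lspan[OF fI Q, folded E_def]
  have clx: "clx Q {} E" using L(1,2) by (auto simp: clx_def kst_def)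
  show "spn Q {} G \<le> E"
  proof (rule spn_le[OF clx])
    fix ga assume "ga \<in> G"
    then have "fst ga \<in> I (snd ga)" by (auto simp: I_def)
    then show "fst ga \<in> E (snd ga)" using L(4) rsp_self[OF Q] by blast
  qed
  show "noethx Q {} E"
    unfolding noethx_def
  proof (intro allI impI)
    fix U :: "nat \<Rightarrow> int \<Rightarrow> 'r set"
    assume U: "\<forall>n. clx Q {} (U n) \<and> U n \<le> E \<and> U n \<le> U (Suc n)"
    have "\<exists>n. \<forall>m\<ge>n. U m j = U n j" for j
      by (rule len_finite_stable[OF L(1) cl_kst[OF cl_Kfam[OF ppow_pos[OF Q]]] L(3)])
        (use U in \<open>auto simp: clx_def kst_def le_fun_def\<close>)
    then obtain N where N: "\<And>j m. N j \<le> m \<Longrightarrow> U m j = U (N j) j" by metis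
    define n where "n = Max (insert 0 (N ` snd ` G))"
    have "U m j = U n j" if m: "n \<le> m" for m j
    proof (cases "j \<in> snd ` G")
      case True
      then have "N j \<le> n" using G by (simp add: n_def)
      then show ?thesis using N[of j m] N[of j n] m by simp
    next
      case False
      then have "I j = {}" by (force simp: I_def)
      then have "E j = K" by (simp add: E_def lspan_def)
      then have "U i j = K" for i using U by (simp add: clx_def le_fun_def) blast
      then show ?thesis by simp
    qed
    then show "\<exists>n. \<forall>m\<ge>n. U m = U n" by blast
  qed
qed

text \<open>The degree j part of K + A + x^Q A + ... + x^(Q (n-1)) A: polynomials in x of degree
  below n with coefficients in \<open>A\<close>. Starting from \<open>K\<close> instead of
  \<open>A\<close> makes the last summand of step n + 1 the term of degree n.\<close>

primrec hil :: "nat \<Rightarrow> 'r \<Rightarrow> (int \<Rightarrow> 'r set) \<Rightarrow> nat \<Rightarrow> int \<Rightarrow> 'r set" where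
  "hil Q x A 0 j = K"
| "hil Q x A (Suc n) j = hil Q x A n j + (\<lambda>v. x ^ (Q * n) * v) ` A (j - int n)"

context
  fixes Q :: nat and S :: "'r set" and A :: "int \<Rightarrow> 'r set" and x :: 'r
  assumes A: "clx Q S A" and Q: "ppow Q"
begin

private abbreviation "T \<equiv> hil Q x A"

private lemma T_step: "u \<in> T n j \<Longrightarrow> v \<in> A (j - int n) \<Longrightarrow> u + x ^ (Q * n) * v \<in> T (Suc n) j"
  by (auto intro!: set_plus_intro)

private lemma T_cases:
  assumes "y \<in> T (Suc n) j" obtains u v where "u \<in> T n j" "v \<in> A (j - int n)" "y = u + x ^ (Q * n) * v"
  using assms by (auto elim!: set_plus_elim)

private lemma T_clx: "clx Q S (T n)"
proof (induction n)
  case 0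
  then show ?case by (auto simp: clx_def sgp_K K_ideal)
next
  case (Suc n)
  show ?case unfolding clx_def
  proof (intro allI conjI ballI)
    fix j
    show "sgp (T (Suc n) j)" unfolding sgp_def
    proof (intro conjI ballI)
      show "0 \<in> T (Suc n) j" using T_step[of 0 n j 0] Suc A by (simp add: clxD(1) sgp_zero)
      fix y z assume y: "y \<in> T (Suc n) j" and z: "z \<in> T (Suc n) j"
      obtain u v where uv: "u \<in> T n j" "v \<in> A (j - int n)" "y = u + x ^ (Q * n) * v" using y by (rule T_cases)
      obtain u' v' where uv': "u' \<in> T n j" "v' \<in> A (j - int n)" "z = u' + x ^ (Q * n) * v'" using z by (rule T_cases)
      have "(u - u') + x ^ (Q * n) * (v - v') \<in> T (Suc n) j"
        by (rule T_step) (use uv uv' clxD(1)[OF Suc] clxD(1)[OF A] in \<open>auto intro: sgp_diff\<close>)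
      then show "y - z \<in> T (Suc n) j" unfolding uv uv' by (simp add: algebra_simps)
    qed
    have "k + x ^ (Q * n) * 0 \<in> T (Suc n) j" if "k \<in> K" for k
      by (rule T_step) (use that clxD(2)[OF Suc] clxD(1)[OF A] in \<open>auto intro: sgp_zero\<close>)
    then show "K \<subseteq> T (Suc n) j" by auto
    show "r ^ Q * y \<in> T (Suc n) j" if r: "r \<in> R 0" and y: "y \<in> T (Suc n) j" for r y
    proof -
      obtain u v where uv: "u \<in> T n j" "v \<in> A (j - int n)" "y = u + x ^ (Q * n) * v" using y by (rule T_cases)
      have "r ^ Q * u + x ^ (Q * n) * (r ^ Q * v) \<in> T (Suc n) j"
        by (rule T_step[OF clxD(3)[OF Suc r uv(1)] clxD(3)[OF A r uv(2)]])
      then show ?thesis unfolding uv by (simp add: distrib_left mult.left_commute)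
    qed
    show "s ^ Q * y \<in> T (Suc n) (j + 1)" if s: "s \<in> S" and y: "y \<in> T (Suc n) j" for s y
    proof -
      obtain u v where uv: "u \<in> T n j" "v \<in> A (j - int n)" "y = u + x ^ (Q * n) * v" using y by (rule T_cases)
      have "s ^ Q * v \<in> A (j + 1 - int n)" using clxD(4)[OF A s uv(2)] by (simp add: algebra_simps)
      then have "s ^ Q * u + x ^ (Q * n) * (s ^ Q * v) \<in> T (Suc n) (j + 1)"
        by (rule T_step[OF clxD(4)[OF Suc s uv(1)]])
      then show ?thesis unfolding uv by (simp add: distrib_left mult.left_commute)
    qed
  qed
qed

private lemma T_Suc: "T n j \<subseteq> T (Suc n) j"
proof
  fix u assume "u \<in> T n j"
  then have "u + x ^ (Q * n) * 0 \<in> T (Suc n) j" by (rule T_step) (simp add: clxD(1)[OF A] sgp_zero)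
  then show "u \<in> T (Suc n) j" by simp
qed

private lemma T_mono: "m \<le> n \<Longrightarrow> T m j \<subseteq> T n j"
  by (rule lift_Suc_mono_le[of "\<lambda>n. T n j"]) (use T_Suc in auto)

private lemma T_x: "u \<in> T n j \<Longrightarrow> x ^ Q * u \<in> T (Suc n) (j + 1)"
proof (induction n arbitrary: u)
  case 0
  then have "x ^ Q * u \<in> T 0 (j + 1)" by (simp add: K_ideal)
  then show ?case using T_Suc by blast
next
  case (Suc n)
  from Suc.prems obtain w v where uv: "w \<in> T n j" "v \<in> A (j - int n)" "u = w + x ^ (Q * n) * v" by (rule T_cases)
  have "x ^ Q * w + x ^ (Q * Suc n) * v \<in> T (Suc (Suc n)) (j + 1)"
    by (rule T_step[OF Suc.IH[OF uv(1)]]) (use uv in simp)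
  then show ?case unfolding uv by (simp add: distrib_left power_add mult.assoc)
qed

text \<open>Leading coefficients of the members of \<open>U\<close> that are polynomials of degree
  at most n in x. Such an expression need not be unique; one expression is enough.\<close>

private definition "lead U n j = {a \<in> A j. \<exists>w \<in> T n (j + int n). x ^ (Q * n) * a + w \<in> U (j + int n)}"

private lemma lead_clx:
  assumes U: "clx Q (insert x S) U" shows "clx Q S (lead U n)"
  unfolding clx_def
proof (intro allI conjI ballI)
  note Tn = clxD[OF T_clx[of n]]
  fix j
  show "sgp (lead U n j)" unfolding sgp_def
  proof (intro conjI ballI)
    show "0 \<in> lead U n j" using clxD(1)[OF U] clxD(1)[OF A] Tn(1)
      by (auto simp: lead_def intro!: bexI[of _ 0] sgp_zero)
    fix a b assume "a \<in> lead U n j" "b \<in> lead U n j"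
    then obtain w w' where *: "a \<in> A j" "w \<in> T n (j + int n)" "x ^ (Q * n) * a + w \<in> U (j + int n)"
      "b \<in> A j" "w' \<in> T n (j + int n)" "x ^ (Q * n) * b + w' \<in> U (j + int n)" by (auto simp: lead_def)
    have "(x ^ (Q * n) * a + w) - (x ^ (Q * n) * b + w') \<in> U (j + int n)"
      by (rule sgp_diff[OF clxD(1)[OF U] *(3,6)])
    then have "x ^ (Q * n) * (a - b) + (w - w') \<in> U (j + int n)" by (simp add: algebra_simps)
    moreover have "w - w' \<in> T n (j + int n)" "a - b \<in> A j" using * Tn(1) clxD(1)[OF A] by (auto intro: sgp_diff)
    ultimately show "a - b \<in> lead U n j" unfolding lead_def by blast
  qed
  show "K \<subseteq> lead U n j"
  proof
    fix k assume "k \<in> K"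
    then have "x ^ (Q * n) * k \<in> K" by (rule K_ideal)
    then have "k \<in> A j" "x ^ (Q * n) * k + 0 \<in> U (j + int n)" "0 \<in> T n (j + int n)"
      using \<open>k \<in> K\<close> clxD(2)[OF A, of j] clxD(2)[OF U, of "j + int n"] Tn(1) by (auto simp: sgp_zero)
    then show "k \<in> lead U n j" unfolding lead_def by blast
  qed
  show "r ^ Q * a \<in> lead U n j" if r: "r \<in> R 0" and a: "a \<in> lead U n j" for r a
  proof -
    obtain w where *: "a \<in> A j" "w \<in> T n (j + int n)" "x ^ (Q * n) * a + w \<in> U (j + int n)"
      using a by (auto simp: lead_def)
    have "x ^ (Q * n) * (r ^ Q * a) + r ^ Q * w \<in> U (j + int n)"
      using clxD(3)[OF U r *(3)] by (simp add: distrib_left mult.left_commute)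
    then show ?thesis unfolding lead_def using clxD(3)[OF A r *(1)] Tn(3)[OF r *(2)] by blast
  qed
  show "s ^ Q * a \<in> lead U n (j + 1)" if s: "s \<in> S" and a: "a \<in> lead U n j" for s a
  proof -
    obtain w where *: "a \<in> A j" "w \<in> T n (j + int n)" "x ^ (Q * n) * a + w \<in> U (j + int n)"
      using a by (auto simp: lead_def)
    have "s ^ Q * (x ^ (Q * n) * a + w) \<in> U (j + int n + 1)" using clxD(4)[OF U _ *(3)] s by blast
    then have "x ^ (Q * n) * (s ^ Q * a) + s ^ Q * w \<in> U (j + 1 + int n)"
      by (simp add: distrib_left mult.left_commute add_ac)
    moreover have "s ^ Q * w \<in> T n (j + 1 + int n)" using Tn(4)[OF s *(2)] by (simp add: add_ac)
    ultimately show ?thesis unfolding lead_def using clxD(4)[OF A s *(1)] by blast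
  qed
qed

private lemma lead_Suc:
  assumes U: "clx Q (insert x S) U" shows "lead U n \<le> lead U (Suc n)"
proof (rule le_funI, rule subsetI)
  fix j a assume "a \<in> lead U n j"
  then obtain w where *: "a \<in> A j" "w \<in> T n (j + int n)" "x ^ (Q * n) * a + w \<in> U (j + int n)"
    by (auto simp: lead_def)
  have "x ^ Q * (x ^ (Q * n) * a + w) \<in> U (j + int n + 1)" using clxD(4)[OF U _ *(3)] by blast
  then have "x ^ (Q * Suc n) * a + x ^ Q * w \<in> U (j + int (Suc n))"
    by (simp add: distrib_left power_add mult.assoc add_ac)
  moreover have "x ^ Q * w \<in> T (Suc n) (j + int (Suc n))" using T_x[OF *(2)] by (simp add: add_ac)
  ultimately show "a \<in> lead U (Suc n) j" unfolding lead_def using *(1) by blast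
qed

private lemma lead_mono: "U \<le> V \<Longrightarrow> lead U n \<le> lead V n"
  by (auto simp: lead_def le_fun_def)

text \<open>Cancellation of leading terms: a member of \<open>V\<close> shares its leading
  coefficient with some member of \<open>U\<close>, and their difference has smaller degree in
  x.\<close>

private lemma lead_eq:
  assumes U: "clx Q (insert x S) U" and V: "clx Q (insert x S) V" and "U \<le> V"
    and VT: "\<And>j. V j \<subseteq> (\<Union>n. T n j)" and eq: "\<And>n. lead U n = lead V n"
  shows "U = V"
proof (rule antisym[OF assms(3)], rule le_funI)
  fix j
  have "V j \<inter> T n j \<subseteq> U j" for n
  proof (induction n)
    case 0 then show ?case using clxD(2)[OF U] by auto
  next
    case (Suc n)
    show ?case
    proof
      fix y assume y: "y \<in> V j \<inter> T (Suc n) j"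
      then have "y \<in> T (Suc n) j" by blast
      then obtain w a where wa: "w \<in> T n j" "a \<in> A (j - int n)" "y = w + x ^ (Q * n) * a" by (rule T_cases)
      then have "a \<in> lead V n (j - int n)" using y by (auto simp: lead_def add.commute intro!: bexI[of _ w])
      then have "a \<in> lead U n (j - int n)" using eq by simp
      then obtain w' where w': "w' \<in> T n j" "x ^ (Q * n) * a + w' \<in> U j" by (auto simp: lead_def)
      have "y - (x ^ (Q * n) * a + w') \<in> V j"
        using y w' assms(3) by (intro sgp_diff[OF clxD(1)[OF V]]) (auto simp: le_fun_def)
      moreover have e: "y - (x ^ (Q * n) * a + w') = w - w'" by (simp add: wa)
      moreover have "w - w' \<in> T n j" by (rule sgp_diff[OF clxD(1)[OF T_clx] wa(1) w'(1)])
      ultimately have "w - w' \<in> U j" using Suc by auto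
      from sgp_add[OF clxD(1)[OF U] this w'(2)] show "y \<in> U j" by (simp add: wa algebra_simps)
    qed
  qed
  then show "V j \<subseteq> U j" using VT[of j] by blast
qed

text \<open>The families of leading coefficients increase both along the chain and with the degree
  in x. Stability of the diagonal from \<open>n1\<close> on settles all degrees at least
  \<open>n1\<close> at once; the finitely many smaller degrees are settled one by one.\<close>

private lemma hilbert_step:
  assumes "noethx Q S A" shows "noethx Q (insert x S) (\<lambda>j. \<Union>n. T n j)"
  unfolding noethx_def
proof (intro allI impI)
  fix U :: "nat \<Rightarrow> int \<Rightarrow> 'r set"
  assume U: "\<forall>n. clx Q (insert x S) (U n) \<and> U n \<le> (\<lambda>j. \<Union>n. T n j) \<and> U n \<le> U (Suc n)"
  have mono: "U m \<le> U n" if "m \<le> n" for m n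
    by (rule chain_le[of U, OF _ that]) (use U in blast)
  have Uc: "clx Q (insert x S) (U n)" for n using U by auto
  have lm: "lead (U n) i \<le> lead (U n) i'" if "i \<le> i'" for n i i'
    by (rule chain_le[of "lead (U n)", OF lead_Suc[OF Uc] that])
  have lA: "lead V i \<le> A" for V i by (auto simp: lead_def le_fun_def)
  have both: "lead (U n) i \<le> lead (U n') i'" if "n \<le> n'" "i \<le> i'" for n n' i i'
    using lead_mono[OF mono[OF that(1)]] lm[OF that(2)] order_trans by blast
  have stab: "\<exists>n. \<forall>m\<ge>n. V m = V n" if "\<And>n. clx Q S (V n)" "\<And>n. V n \<le> A" "\<And>n. V n \<le> V (Suc n)" for V
    using assms that unfolding noethx_def by blast
  obtain n1 where n1: "\<And>m. m \<ge> n1 \<Longrightarrow> lead (U m) m = lead (U n1) n1"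
    using stab[of "\<lambda>n. lead (U n) n", OF lead_clx[OF Uc] lA both] by auto
  have "\<exists>c. \<forall>m\<ge>c. lead (U m) i = lead (U c) i" for i
    using stab[of "\<lambda>n. lead (U n) i", OF lead_clx[OF Uc] lA both] by auto
  then obtain c where c: "\<And>i m. m \<ge> c i \<Longrightarrow> lead (U m) i = lead (U (c i)) i" by metis
  define n2 where "n2 = Max (insert n1 (c ` {..<n1}))"
  have n2: "n1 \<le> n2" "i < n1 \<Longrightarrow> c i \<le> n2" for i by (auto simp: n2_def)
  have "U n2 = U m" if m: "m \<ge> n2" for m
  proof (rule lead_eq[OF Uc Uc mono[OF m]])
    fix j show "U m j \<subseteq> (\<Union>n. T n j)" using U by (auto simp: le_fun_def)
  next
    fix i
    show "lead (U n2) i = lead (U m) i"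
    proof (cases "i < n1")
      case True
      then show ?thesis using c[of i m] c[of i n2] n2(2)[of i] m by auto
    next
      case False
      have "lead (U m) i \<le> lead (U (max m i)) (max m i)" by (rule both) auto
      also have "\<dots> = lead (U n1) n1" using n2 m by (intro n1) auto
      also have "\<dots> \<le> lead (U n2) i" using n2 False by (intro both) auto
      finally show ?thesis using both[OF m order_refl, of i] by (intro antisym)
    qed
  qed
  then show "\<exists>n. \<forall>m\<ge>n. U m = U n" by metis
qed

lemma hilbert_insert:
  assumes "noethx Q S A" and "A = spn Q S G"
  shows "noethx Q (insert x S) (spn Q (insert x S) G)"
proof (rule noethx_mono[OF hilbert_step[OF assms(1)]], rule spn_le)
  show "clx Q (insert x S) (\<lambda>j. \<Union>n. T n j)"
    unfolding clx_def
  proof (intro allI conjI ballI)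
    fix j
    show "sgp (\<Union>n. T n j)" unfolding sgp_def
    proof (intro conjI ballI)
      show "0 \<in> (\<Union>n. T n j)" using clxD(1)[OF T_clx] sgp_zero by blast
      fix u v assume "u \<in> (\<Union>n. T n j)" "v \<in> (\<Union>n. T n j)"
      then obtain m n where "u \<in> T m j" "v \<in> T n j" by blast
      then have "u \<in> T (max m n) j" "v \<in> T (max m n) j"
        using T_mono[of m "max m n" j] T_mono[of n "max m n" j] by auto
      then show "u - v \<in> (\<Union>n. T n j)" using sgp_diff[OF clxD(1)[OF T_clx]] by blast
    qed
    show "K \<subseteq> (\<Union>n. T n j)" using clxD(2)[OF T_clx[of 0]] by blast
    show "r ^ Q * v \<in> (\<Union>n. T n j)" if r: "r \<in> R 0" and v: "v \<in> (\<Union>n. T n j)" for r v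
    proof -
      obtain n where "v \<in> T n j" using v by blast
      from clxD(3)[OF T_clx r this] show ?thesis by blast
    qed
    show "s ^ Q * v \<in> (\<Union>n. T n (j + 1))" if s: "s \<in> insert x S" and v: "v \<in> (\<Union>n. T n j)" for s v
    proof -
      obtain n where n: "v \<in> T n j" using v by blast
      show ?thesis
      proof (cases "s = x")
        case True
        then have "s ^ Q * v \<in> T (Suc n) (j + 1)" using T_x[OF n] by simp
        then show ?thesis by blast
      next
        case False
        then have "s ^ Q * v \<in> T n (j + 1)" using clxD(4)[OF T_clx _ n] s by blast
        then show ?thesis by blast
      qed
    qed
  qed
  fix ga assume "ga \<in> G"
  then have "fst ga \<in> A (snd ga)" using assms(2) spn_gen[of "fst ga" "snd ga"] by simp
  then have "0 + x ^ (Q * 0) * fst ga \<in> T (Suc 0) (snd ga)"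
    by (intro T_step) (auto simp: sgp_K sgp_zero)
  then show "fst ga \<in> (\<Union>n. T n (snd ga))" by (simp del: hil.simps) blast
qed

end

lemma hilbert: "finite S \<Longrightarrow> finite G \<Longrightarrow> ppow Q \<Longrightarrow> noethx Q S (spn Q S G)"
proof (induction S rule: finite_induct)
  case empty then show ?case by (simp add: noethx_base)
next
  case (insert x S)
  then show ?case using hilbert_insert[OF clx_spn] by blast
qed

text \<open>\<open>R\<close> is generated over \<open>R 0\<close> by the degree one elements
  \<open>X\<close>, and Q-th powers are additive modulo \<open>K\<close>; so stability under
  \<open>R 0\<close> and \<open>X\<close> spreads to all degrees.\<close>

lemma clx_cl:
  assumes U: "clx Q X U" and Q: "ppow Q" shows "cl Q U"
proof -
  have "r ^ Q * v \<in> U (int n + j)" if "r \<in> R (int n)" "v \<in> U j" for n r v j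
    using that
  proof (induction n arbitrary: r)
    case 0 then show ?case using clxD(3)[OF U] by simp
  next
    case (Suc n)
    then obtain c where c: "\<forall>x\<in>X. c x \<in> R (int n)" "r - (\<Sum>x\<in>X. c x * x) \<in> K"
      using gen_R[of "int n" r] by (auto simp: add.commute)
    have "r ^ Q - (\<Sum>x\<in>X. c x * x) ^ Q \<in> K" by (rule K_power[OF c(2)])
    from K_trans[OF this frobenius_sum[OF Q finite_X]]
    have "r ^ Q * v - (\<Sum>x\<in>X. (c x * x) ^ Q) * v \<in> K" by (rule K_times')
    moreover have "(\<Sum>x\<in>X. (c x * x) ^ Q) * v \<in> U (int (Suc n) + j)"
      unfolding sum_distrib_right
    proof (rule sgp_sum[OF clxD(1)[OF U]])
      fix x assume x: "x \<in> X"
      have "x ^ Q * (c x ^ Q * v) \<in> U (int n + j + 1)"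
        by (intro clxD(4)[OF U x] Suc.IH) (use c x Suc in auto)
      then show "(c x * x) ^ Q * v \<in> U (int (Suc n) + j)"
        by (simp add: power_mult_distrib mult_ac add_ac)
    qed
    ultimately show ?case using sgp_cong[OF clxD(1)[OF U]] clxD(2)[OF U] by blast
  qed
  moreover have "r ^ Q * v \<in> U (i + j)" if "r \<in> R i" "i < 0" for r v i j
    using that R_neg[of i] power_K[OF _ ppow_pos[OF Q], of r] K_ideal' clxD(2)[OF U] by blast
  ultimately have "r ^ Q * v \<in> U (i + j)" if "r \<in> R i" "v \<in> U j" for r v i j
    using that by (cases "i < 0") (auto simp: not_less dest: zero_le_imp_eq_int)
  then show ?thesis using clxD(1,2)[OF U] unfolding cl_def by blast
qed

lemma cl_clx: "cl Q U \<Longrightarrow> clx Q X U"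
  unfolding clx_def
proof (intro allI conjI ballI)
  fix j assume U: "cl Q U"
  show "sgp (U j)" "K \<subseteq> U j" by (rule cl_sgp[OF U], rule cl_K[OF U])
  show "r ^ Q * v \<in> U j" if "r \<in> R 0" "v \<in> U j" for r v by (rule cl_mult'[OF U that]) simp
  show "s ^ Q * v \<in> U (j + 1)" if "s \<in> X" "v \<in> U j" for s v
    by (rule cl_mult'[OF U subsetD[OF X_R that(1)] that(2)]) simp
qed

section \<open>Finite generation and the ascending chain condition\<close>

definition fg :: "nat \<Rightarrow> (int \<Rightarrow> 'r set) \<Rightarrow> (int \<Rightarrow> 'r set) \<Rightarrow> bool" where
  "fg Q N Z \<longleftrightarrow> (\<exists>G. finite G \<and> (\<forall>ga\<in>G. fst ga \<in> N (snd ga)) \<and>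
     (\<forall>U. cl Q U \<longrightarrow> Z \<le> U \<longrightarrow> (\<forall>ga\<in>G. fst ga \<in> U (snd ga)) \<longrightarrow> N \<le> U))"

lemma fg_R: "fg 1 R (\<lambda>_. K)"
  unfolding fg_def
proof (intro exI[of _ "{(1, 0)}"] conjI allI impI)
  fix U assume U: "cl 1 U" "\<forall>ga\<in>{(1, 0)}. fst ga \<in> U (snd ga)"
  show "R \<le> U"
  proof (rule le_funI, rule subsetI)
    fix j r assume "r \<in> R j"
    from cl_mult'[OF U(1) this, of 1 0 j] U(2) show "r \<in> U j" by simp
  qed
qed (auto simp: one_R)

text \<open>Modulo \<open>Z\<close>, the family \<open>A\<close> spanned by the generators contains
  \<open>N\<close>. By the modular law, a member of a chain between \<open>Z\<close> and
  \<open>N\<close> is determined by its trace on \<open>A\<close>, where \<open>hilbert\<close>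
  applies.\<close>

lemma fg_noeth:
  assumes "fg Q N Z" "ppow Q" "cl Q Z" shows "noeth Q N Z"
proof -
  obtain G where G: "finite G" "\<And>U. cl Q U \<Longrightarrow> Z \<le> U \<Longrightarrow> (\<forall>ga\<in>G. fst ga \<in> U (snd ga)) \<Longrightarrow> N \<le> U"
    using assms(1) unfolding fg_def by blast
  define A where "A = spn Q X G"
  have A: "cl Q A" unfolding A_def by (rule clx_cl[OF clx_spn assms(2)])
  have nA: "noethx Q X A" unfolding A_def by (rule hilbert[OF finite_X G(1) assms(2)])
  have "N \<le> (\<lambda>j. Z j + A j)"
  proof (rule G(2)[OF cl_plus[OF assms(3) A]])
    show "Z \<le> (\<lambda>j. Z j + A j)" by (intro le_funI subset_plus_left cl_sgp[OF A])
    show "\<forall>ga\<in>G. fst ga \<in> Z (snd ga) + A (snd ga)"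
      using spn_gen[of _ _ G Q X] subset_plus_right[OF cl_sgp[OF assms(3)]] unfolding A_def by (metis prod.collapse subsetD)
  qed
  then have NA: "N j \<subseteq> Z j + A j" for j by (auto simp: le_fun_def)
  show ?thesis unfolding noeth_def
  proof (intro allI impI)
    fix U :: "nat \<Rightarrow> int \<Rightarrow> 'r set"
    assume U: "\<forall>n. cl Q (U n) \<and> Z \<le> U n \<and> U n \<le> N \<and> U n \<le> U (Suc n)"
    have "\<exists>n. \<forall>m\<ge>n. (\<lambda>j. U m j \<inter> A j) = (\<lambda>j. U n j \<inter> A j)"
    proof (rule nA[unfolded noethx_def, rule_format])
      fix n
      have "clx Q X (U n)" using U cl_clx by blast
      then have "clx Q X (\<lambda>j. U n j \<inter> A j)" using cl_clx[OF A] unfolding clx_def by (auto intro: sgp_Int)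
      moreover have "U n \<le> U (Suc n)" using U by auto
      ultimately show "clx Q X (\<lambda>j. U n j \<inter> A j) \<and> (\<lambda>j. U n j \<inter> A j) \<le> A \<and>
          (\<lambda>j. U n j \<inter> A j) \<le> (\<lambda>j. U (Suc n) j \<inter> A j)"
        unfolding le_fun_def by blast
    qed
    then obtain n where n: "\<And>m j. m \<ge> n \<Longrightarrow> U m j \<inter> A j = U n j \<inter> A j" by metis
    have "U m j = U m j \<inter> A j + Z j" for m j
    proof -
      have "cl Q (U m)" "Z j \<subseteq> U m j" "U m j \<subseteq> N j" using U by (auto simp: le_fun_def)
      then show ?thesis using modular_law[OF cl_sgp, of Q "U m" "Z j" j "A j"] NA[of j] by (simp add: add.commute) blast
    qed
    then have "U m = U n" if "m \<ge> n" for m using n[OF that] by (metis ext)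
    then show "\<exists>n. \<forall>m\<ge>n. U m = U n" by blast
  qed
qed

subsection \<open>Finite generation of Frobenius pushforwards\<close>

text \<open>What the elements (y m)^Q u generate over p-th powers together with \<open>Z\<close>,
  where y is 1 or in \<open>Y\<close>, m is a monomial in \<open>X\<close> with exponents below p,
  and u is a generator. Degrees are still counted in the original module, so a scalar from degree i
  raises them by p i.\<close>

inductive tw :: "nat \<Rightarrow> (int \<Rightarrow> 'r set) \<Rightarrow> ('r \<times> int) set \<Rightarrow> 'r \<Rightarrow> int \<Rightarrow> bool"
  for Q Z G where
  tw_Z: "v \<in> Z m \<Longrightarrow> tw Q Z G v m"
| tw_G: "y \<in> insert 1 Y \<Longrightarrow> \<beta> \<in> PiE X (\<lambda>_. {..<p}) \<Longrightarrow> (u, a) \<in> G \<Longrightarrow>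
    tw Q Z G ((y * (\<Prod>x\<in>X. x ^ \<beta> x)) ^ Q * u) (a + (\<Sum>x\<in>X. int (\<beta> x)))"
| tw_diff: "tw Q Z G v m \<Longrightarrow> tw Q Z G w m \<Longrightarrow> tw Q Z G (v - w) m"
| tw_mult: "r \<in> R i \<Longrightarrow> tw Q Z G v m \<Longrightarrow> tw Q Z G (r ^ (Q * p) * v) (int p * i + m)"

context
  fixes Q :: nat and Z :: "int \<Rightarrow> 'r set" and G :: "('r \<times> int) set"
  assumes Z: "cl Q Z" and Q: "ppow Q"
begin

lemma tw_0: "tw Q Z G 0 m" by (rule tw_Z) (simp add: sgp_zero cl_sgp[OF Z])

lemma tw_add: "tw Q Z G v m \<Longrightarrow> tw Q Z G w m \<Longrightarrow> tw Q Z G (v + w) m"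
proof -
  assume v: "tw Q Z G v m" and w: "tw Q Z G w m"
  from tw_diff[OF v tw_diff[OF tw_0 w]] show ?thesis by simp
qed

lemma tw_sum: "(\<And>i. i \<in> I \<Longrightarrow> tw Q Z G (f i) m) \<Longrightarrow> tw Q Z G (sum f I) m"
  by (induction I rule: infinite_finite_induct) (auto intro: tw_0 tw_add)

lemma tw_cong: "x - y \<in> K \<Longrightarrow> tw Q Z G y m \<Longrightarrow> tw Q Z G x m"
proof -
  assume "x - y \<in> K" and y: "tw Q Z G y m"
  then have "tw Q Z G (x - y) m" using cl_K[OF Z, of m] by (intro tw_Z) auto
  from tw_add[OF this y] show ?thesis by simp
qed

text \<open>\<open>gen_R0\<close> rewrites the product of a scalar with a member of \<open>Y\<close>
  as a combination of members of \<open>Y\<close> whose coefficients are p-th powers; these are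
  scalars for \<open>tw_mult\<close>.\<close>

lemma tw_R0: "tw Q Z G v m \<Longrightarrow> c \<in> R 0 \<Longrightarrow> tw Q Z G (c ^ Q * v) m"
proof (induction rule: tw.induct)
  case (tw_Z v m)
  show ?case by (rule tw.tw_Z, rule cl_mult'[OF Z tw_Z(2,1)]) simp
next
  case (tw_G y \<beta> u a)
  let ?M = "\<Prod>x\<in>X. x ^ \<beta> x"
  have "y \<in> R 0" using tw_G(1) Y_R one_R by auto
  then have "c * y \<in> R 0" using R_mult[OF tw_G(4), of y 0] by simp
  then obtain d where d: "\<forall>y\<in>Y. d y \<in> R 0" "c * y - (\<Sum>y\<in>Y. d y ^ p * y) \<in> K" using gen_R0 by blast
  have "(c * y) ^ Q - (\<Sum>y\<in>Y. (d y ^ p * y) ^ Q) \<in> K"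
    by (rule K_trans[OF K_power[OF d(2)] frobenius_sum[OF Q finite_Y]])
  then have "(c * y) ^ Q * (?M ^ Q * u) - (\<Sum>y\<in>Y. (d y ^ p * y) ^ Q) * (?M ^ Q * u) \<in> K" by (rule K_times')
  moreover have "tw Q Z G ((\<Sum>y\<in>Y. (d y ^ p * y) ^ Q) * (?M ^ Q * u)) (a + (\<Sum>x\<in>X. int (\<beta> x)))"
    unfolding sum_distrib_right
  proof (rule tw_sum)
    fix z assume z: "z \<in> Y"
    have "tw Q Z G (d z ^ (Q * p) * ((z * ?M) ^ Q * u)) (int p * 0 + (a + (\<Sum>x\<in>X. int (\<beta> x))))"
      by (intro tw.tw_mult tw.tw_G) (use z d tw_G in auto)
    then show "tw Q Z G ((d z ^ p * z) ^ Q * (?M ^ Q * u)) (a + (\<Sum>x\<in>X. int (\<beta> x)))"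
      by (simp add: power_mult_distrib power_mult[symmetric] mult_ac)
  qed
  ultimately have "tw Q Z G ((c * y) ^ Q * (?M ^ Q * u)) (a + (\<Sum>x\<in>X. int (\<beta> x)))" by (rule tw_cong)
  then show ?case by (simp add: power_mult_distrib mult_ac)
next
  case (tw_diff v m w)
  then show ?case using tw.tw_diff by (simp add: right_diff_distrib)
next
  case (tw_mult r i v m)
  have e: "c ^ Q * (r ^ (Q * p) * v) = r ^ (Q * p) * (c ^ Q * v)" by (simp add: mult_ac)
  show ?case unfolding e using tw.tw_mult[OF tw_mult(1) tw_mult.IH[OF tw_mult.prems]] by simp
qed

text \<open>When an exponent reaches p it is reset to 0, and the p-th power of the variable becomes
  a scalar for \<open>tw_mult\<close>.\<close>

lemma tw_X: "tw Q Z G v m \<Longrightarrow> s \<in> X \<Longrightarrow> tw Q Z G (s ^ Q * v) (m + 1)"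
proof (induction rule: tw.induct)
  case (tw_Z v m)
  have "s \<in> R 1" using tw_Z X_R by auto
  show ?case by (rule tw.tw_Z, rule cl_mult'[OF Z \<open>s \<in> R 1\<close> tw_Z(1)]) simp
next
  case (tw_G y \<beta> u a)
  let ?M = "\<Prod>x\<in>X. x ^ \<beta> x"
  have M: "(\<Prod>x\<in>X. x ^ \<gamma> x) = s ^ \<gamma> s * (\<Prod>x\<in>X - {s}. x ^ \<gamma> x)" for \<gamma> :: "'r \<Rightarrow> nat"
    by (rule prod.remove[OF finite_X tw_G(4)])
  have S: "(\<Sum>x\<in>X. int (\<gamma> x)) = int (\<gamma> s) + (\<Sum>x\<in>X - {s}. int (\<gamma> x))" for \<gamma>
    by (rule sum.remove[OF finite_X tw_G(4)])
  have M': "(\<Prod>x\<in>X - {s}. x ^ (\<beta>(s := n)) x) = (\<Prod>x\<in>X - {s}. x ^ \<beta> x)" for n by (intro prod.cong) auto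
  have S': "(\<Sum>x\<in>X - {s}. int ((\<beta>(s := n)) x)) = (\<Sum>x\<in>X - {s}. int (\<beta> x))" for n by (intro sum.cong) auto
  have \<beta>s: "\<beta> s < p" using tw_G(2,4) by auto
  show ?case
  proof (cases "Suc (\<beta> s) < p")
    case True
    let ?\<gamma> = "\<beta>(s := Suc (\<beta> s))"
    have "tw Q Z G ((y * (\<Prod>x\<in>X. x ^ ?\<gamma> x)) ^ Q * u) (a + (\<Sum>x\<in>X. int (?\<gamma> x)))"
      by (rule tw.tw_G[OF tw_G(1) _ tw_G(3)]) (use tw_G(2,4) True in \<open>auto simp: PiE_def extensional_def\<close>)
    then show ?thesis unfolding M[of ?\<gamma>] M[of \<beta>] S[of ?\<gamma>] S[of \<beta>] M' S'
      by (simp add: power_mult_distrib mult_ac add_ac)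
  next
    case False
    let ?\<gamma> = "\<beta>(s := 0)"
    have sp: "Suc (\<beta> s) = p" using False \<beta>s by simp
    have "tw Q Z G (s ^ (Q * p) * ((y * (\<Prod>x\<in>X. x ^ ?\<gamma> x)) ^ Q * u)) (int p * 1 + (a + (\<Sum>x\<in>X. int (?\<gamma> x))))"
      by (rule tw.tw_mult[OF _ tw.tw_G[OF tw_G(1) _ tw_G(3)]])
        (use tw_G(2,4) X_R prime_gt_0_nat[OF prime_p] in \<open>auto simp: PiE_def extensional_def\<close>)
    moreover have "s ^ (Q * p) = s ^ Q * (s ^ \<beta> s) ^ Q"
      unfolding sp[symmetric] by (simp add: power_mult[symmetric] power_add mult.commute)
    moreover have "int p = int (\<beta> s) + 1" using sp by simp
    ultimately show ?thesis unfolding M[of ?\<gamma>] M[of \<beta>] S[of ?\<gamma>] S[of \<beta>] M' S'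
      by (simp add: power_mult_distrib mult_ac add_ac)
  qed
next
  case (tw_diff v m w)
  then show ?case using tw.tw_diff by (simp add: right_diff_distrib)
next
  case (tw_mult r i v m)
  have e: "s ^ Q * (r ^ (Q * p) * v) = r ^ (Q * p) * (s ^ Q * v)" by (simp add: mult_ac)
  show ?case unfolding e using tw.tw_mult[OF tw_mult(1) tw_mult.IH[OF tw_mult.prems]] by (simp add: add_ac)
qed

end

lemma prod_R: "finite S \<Longrightarrow> S \<subseteq> X \<Longrightarrow> (\<Prod>x\<in>S. x ^ \<beta> x) \<in> R (\<Sum>x\<in>S. int (\<beta> x))"
proof (induction S rule: finite_induct)
  case (insert x S)
  have "x ^ \<beta> x \<in> R (int (\<beta> x))" using power_R[of x 1 "\<beta> x"] insert X_R by auto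
  then show ?case using insert R_mult by auto
qed (simp add: one_R)

text \<open>The pushforward keeps only the degrees divisible by p. Since scalars change degrees by
  multiples of p, an element of such a degree is built from generators of such degrees alone, and
  finitely many of these remain.\<close>

lemma fg_twist1:
  assumes "fg Q N Z" and g: "gm Q N Z" and Q: "ppow Q"
  shows "fg (Q * p) (\<lambda>j. N (int p * j)) (\<lambda>j. Z (int p * j))"
proof -
  obtain G where G: "finite G" "\<forall>ga\<in>G. fst ga \<in> N (snd ga)"
    "\<And>U. cl Q U \<Longrightarrow> Z \<le> U \<Longrightarrow> (\<forall>ga\<in>G. fst ga \<in> U (snd ga)) \<Longrightarrow> N \<le> U"
    using assms(1) unfolding fg_def by blast
  note Zc = gmD(2)[OF g]
  have p0: "p > 0" using prime_p prime_gt_0_nat by blast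
  define B where "B = PiE X (\<lambda>_. {..<p})"
  define deg where "deg z = (case z of (y, \<beta>, u, a) \<Rightarrow> a + (\<Sum>x\<in>X. int (\<beta> x)))" for z :: "'r \<times> ('r \<Rightarrow> nat) \<times> 'r \<times> int"
  define val where "val z = (case z of (y, \<beta>, u, a) \<Rightarrow> (y * (\<Prod>x\<in>X. x ^ \<beta> x)) ^ Q * u)" for z :: "'r \<times> ('r \<Rightarrow> nat) \<times> 'r \<times> int"
  define D where "D = {z \<in> insert 1 Y \<times> B \<times> G. int p dvd deg z}"
  define G' where "G' = (\<lambda>z. (val z, deg z div int p)) ` D"
  have "finite B" unfolding B_def by (rule finite_PiE[OF finite_X]) simp
  then have "finite (insert 1 Y \<times> B \<times> G)" using finite_Y G(1) by simp
  then have "finite D" by (rule rev_finite_subset) (auto simp: D_def)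
  then have "finite G'" by (simp add: G'_def)
  moreover have "\<forall>ga\<in>G'. fst ga \<in> N (int p * snd ga)"
  proof
    fix ga assume "ga \<in> G'"
    then obtain y \<beta> u a where z: "(y, \<beta>, u, a) \<in> D" "ga = (val (y, \<beta>, u, a), deg (y, \<beta>, u, a) div int p)"
      by (auto simp: G'_def)
    have u: "u \<in> N a" using G(2) z by (auto simp: D_def)
    have "y \<in> R 0" using z Y_R one_R by (auto simp: D_def)
    from R_mult[OF this prod_R[OF finite_X order_refl, of \<beta>]]
    have "y * (\<Prod>x\<in>X. x ^ \<beta> x) \<in> R (\<Sum>x\<in>X. int (\<beta> x))" by simp
    from cl_mult'[OF gmD(1)[OF g] this u, of "deg (y, \<beta>, u, a)"]
    have "val (y, \<beta>, u, a) \<in> N (deg (y, \<beta>, u, a))" by (simp add: val_def deg_def add.commute)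
    moreover have "int p * (deg (y, \<beta>, u, a) div int p) = deg (y, \<beta>, u, a)" using z by (auto simp: D_def)
    ultimately show "fst ga \<in> N (int p * snd ga)" using z(2) by simp
  qed
  moreover have "(\<lambda>j. N (int p * j)) \<le> U" if U: "cl (Q * p) U" "(\<lambda>j. Z (int p * j)) \<le> U" "\<forall>ga\<in>G'. fst ga \<in> U (snd ga)" for U
  proof -
    have *: "v \<in> U b" if "tw Q Z G v m" "m = int p * b" for v m b
      using that
    proof (induction arbitrary: b rule: tw.induct)
      case (tw_Z v m)
      then show ?case using U(2) by (auto simp: le_fun_def)
    next
      case (tw_G y \<beta> u a)
      have "(y, \<beta>, u, a) \<in> D" using tw_G by (auto simp: D_def B_def deg_def)
      moreover have "deg (y, \<beta>, u, a) div int p = b" using tw_G p0 by (simp add: deg_def)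
      ultimately have "(val (y, \<beta>, u, a), b) \<in> G'" by (force simp: G'_def)
      then show ?case using U(3) by (force simp: val_def)
    next
      case (tw_diff v m w)
      then show ?case using sgp_diff[OF cl_sgp[OF U(1)]] by auto
    next
      case (tw_mult r i v m)
      have "m = int p * (b - i)" using tw_mult by (simp add: algebra_simps)
      from cl_mult'[OF U(1) tw_mult(1) tw_mult.IH[OF this]] show ?case by simp
    qed
    have "cl Q (\<lambda>m. {v. tw Q Z G v m})"
    proof (rule clx_cl[OF _ Q], unfold clx_def, intro allI conjI ballI)
      fix j
      show "sgp {v. tw Q Z G v j}" by (auto simp: sgp_def tw_0[OF Zc Q] tw_diff)
      show "K \<subseteq> {v. tw Q Z G v j}" using cl_K[OF Zc, of j] tw_Z[of _ Z j] by blast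
    qed (use tw_R0[OF Zc Q] tw_X[OF Zc Q] in auto)
    moreover have "Z \<le> (\<lambda>m. {v. tw Q Z G v m})" by (auto simp: le_fun_def tw_Z)
    moreover have "\<forall>ga\<in>G. fst ga \<in> {v. tw Q Z G v (snd ga)}"
    proof
      fix ga assume "ga \<in> G"
      then have "tw Q Z G ((1 * (\<Prod>x\<in>X. x ^ (\<lambda>x\<in>X. 0) x)) ^ Q * fst ga) (snd ga + (\<Sum>x\<in>X. int ((\<lambda>x\<in>X. 0) x)))"
        by (intro tw_G) (use p0 in auto)
      also have "(\<Prod>x\<in>X. x ^ (\<lambda>x\<in>X. 0) x) = 1" by (intro prod.neutral) auto
      also have "(\<Sum>x\<in>X. int ((\<lambda>x\<in>X. 0) x)) = 0" by (intro sum.neutral) auto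
      finally show "fst ga \<in> {v. tw Q Z G v (snd ga)}" by simp
    qed
    ultimately have "N \<le> (\<lambda>m. {v. tw Q Z G v m})" by (rule G(3))
    then have "tw Q Z G v m" if "v \<in> N m" for v m using that by (auto simp: le_fun_def)
    then show ?thesis using * by (auto simp: le_fun_def)
  qed
  ultimately show ?thesis unfolding fg_def by blast
qed

section \<open>Homogeneous primes and Hilbert functions\<close>

text \<open>Primality is tested on homogeneous elements; \<open>hp_prime\<close> extends it to all
  elements of the total ideal.\<close>

definition hp :: "(int \<Rightarrow> 'r set) \<Rightarrow> bool" where
  "hp P \<longleftrightarrow> cl 1 P \<and> P \<le> R \<and> 1 \<notin> P 0 \<and>
     (\<forall>i j. \<forall>a\<in>R i. \<forall>b\<in>R j. a * b \<in> P (i + j) \<longrightarrow> a \<in> P i \<or> b \<in> P j)"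

lemma hpD:
  assumes "hp P"
  shows "cl 1 P" "P j \<subseteq> R j" "1 \<notin> P 0" "a \<in> R i \<Longrightarrow> b \<in> R j \<Longrightarrow> a * b \<in> P (i + j) \<Longrightarrow> a \<in> P i \<or> b \<in> P j"
    "r \<in> R i \<Longrightarrow> a \<in> P j \<Longrightarrow> r * a \<in> P (i + j)"
  using assms cl_mult[of 1 P r i a j] unfolding hp_def le_fun_def by auto

definition ann :: "nat \<Rightarrow> 'r \<Rightarrow> int \<Rightarrow> (int \<Rightarrow> 'r set) \<Rightarrow> int \<Rightarrow> 'r set" where
  "ann Q u a U i = {r \<in> R i. r ^ Q * u \<in> U (i + a)}"

lemma cl_ann:
  assumes U: "cl Q U" and Q: "ppow Q" shows "cl 1 (ann Q u a U)"
  unfolding cl_def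
proof (intro conjI allI ballI)
  fix j
  have k: "kst 1 {r \<in> R j. r ^ Q * u \<in> U (j + a)}"
    by (rule kst_preimage[where Z = "U (j + a)" and ?Q2.0 = Q, OF _ cl_kst[OF U] ad_ppow[OF Q cl_K[OF U]] cl_kst[OF U] order_refl cl_kst[OF cl_R]])
      simp
  then show "sgp (ann Q u a U j)" by (simp add: ann_def L_sgp)
  show "K \<subseteq> ann Q u a U j"
    using K_R[of j] power_K[OF _ ppow_pos[OF Q]] K_ideal' cl_K[OF U] by (auto simp: ann_def subset_iff)
  fix i r s assume r: "r \<in> R i" and s: "s \<in> ann Q u a U j"
  have "r ^ Q * (s ^ Q * u) \<in> U (i + j + a)"
    by (rule cl_mult'[OF U r, of _ "j + a"]) (use s in \<open>auto simp: ann_def\<close>)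
  then show "r ^ 1 * s \<in> ann Q u a U (i + j)"
    using R_mult[OF r] s by (simp add: ann_def power_mult_distrib mult.assoc)
qed

lemma noeth_R: "noeth 1 R (\<lambda>_. K)"
  by (rule fg_noeth[OF fg_R ppow_1 cl_Kfam]) simp

lemma adjoin:
  fixes u :: 'r and a :: int
  assumes Q: "ppow Q" and U: "cl Q U"
  defines "V \<equiv> \<lambda>j. U j + rsp Q u a j"
  shows "cl Q V" "U j \<subseteq> V j" "u \<in> V a" "cl Q N \<Longrightarrow> U \<le> N \<Longrightarrow> u \<in> N a \<Longrightarrow> V \<le> N"
proof -
  show "cl Q V" unfolding V_def by (rule cl_plus[OF U cl_rsp[OF Q]])
  show "U j \<subseteq> V j" unfolding V_def by (rule subset_plus_left[OF cl_sgp[OF cl_rsp[OF Q]]])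
  show "u \<in> V a" unfolding V_def by (rule subsetD[OF subset_plus_right[OF cl_sgp[OF U]] rsp_self[OF Q]])
  assume N: "cl Q N" "U \<le> N" "u \<in> N a"
  show "V \<le> N" unfolding V_def
    using N(2) rsp_le[OF N(1,3)] by (intro le_funI plus_subset cl_sgp[OF N(1)]) (auto simp: le_fun_def)
qed

text \<open>Existence of an associated prime of N / U: among the annihilators of its nonzero
  homogeneous elements there is a maximal one by \<open>noeth_R\<close>, and maximality makes it
  prime.\<close>

lemma exists_prime:
  assumes N: "cl Q N" and U: "cl Q U" and Q: "ppow Q" and ne: "\<not> N \<le> U"
  shows "\<exists>a u. u \<in> N a \<and> u \<notin> U a \<and> hp (ann Q u a U)"
proof -
  define Pr where "Pr A \<longleftrightarrow> (\<exists>u a. u \<in> N a \<and> u \<notin> U a \<and> A = ann Q u a U)" for A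
  obtain u0 a0 where u0: "u0 \<in> N a0" "u0 \<notin> U a0" using ne by (auto simp: le_fun_def)
  have "cl 1 A \<and> (\<lambda>_. K) \<le> A \<and> A \<le> R" if PA: "Pr A" for A
  proof -
    obtain u a where A: "A = ann Q u a U" using PA by (auto simp: Pr_def)
    have "A \<le> R" by (auto simp: A le_fun_def ann_def)
    then show ?thesis using cl_ann[OF U Q] cl_K[OF cl_ann[OF U Q]] by (simp add: A le_fun_def)
  qed
  from noeth_maximal[OF noeth_R this, of Pr "ann Q u0 a0 U"] u0
  obtain A where "Pr A" and max: "\<And>B. Pr B \<Longrightarrow> A \<le> B \<Longrightarrow> B = A" by (auto simp: Pr_def)
  then obtain u a where u: "u \<in> N a" "u \<notin> U a" "A = ann Q u a U" by (auto simp: Pr_def)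
  have "hp A" unfolding hp_def
  proof (intro conjI allI ballI impI)
    show "cl 1 A" using cl_ann[OF U Q] u by simp
    show "A \<le> R" by (auto simp: u le_fun_def ann_def)
    show "1 \<notin> A 0" using u by (simp add: ann_def)
    fix i j r s assume r: "r \<in> R i" and s: "s \<in> R j" and rs: "r * s \<in> A (i + j)"
    show "r \<in> A i \<or> s \<in> A j"
    proof (rule disjCI)
      assume "s \<notin> A j"
      let ?u = "s ^ Q * u"
      have u': "?u \<in> N (j + a)" "?u \<notin> U (j + a)"
        using cl_mult[OF N s u(1)] \<open>s \<notin> A j\<close> s by (auto simp: u ann_def)
      have "A \<le> ann Q ?u (j + a) U"
      proof (rule le_funI, rule subsetI)
        fix i t assume "t \<in> A i"
        then have t: "t \<in> R i" "t ^ Q * u \<in> U (i + a)" by (auto simp: u ann_def)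
        have "s ^ Q * (t ^ Q * u) \<in> U (i + (j + a))" by (rule cl_mult'[OF U s t(2)]) simp
        then show "t \<in> ann Q ?u (j + a) U i" using t by (simp add: ann_def mult.left_commute)
      qed
      then have "ann Q ?u (j + a) U = A" using u' by (intro max) (auto simp: Pr_def)
      moreover have "r \<in> ann Q ?u (j + a) U i"
        using r rs by (simp add: u ann_def power_mult_distrib mult_ac add_ac)
      ultimately show "r \<in> A i" by simp
    qed
  qed
  then show ?thesis using u by blast
qed

lemma len_rsp:
  assumes U: "cl Q U" and Q: "ppow Q"
  shows "len (kst Q) (U j) (U j + rsp Q u a j) = len (kst 1) (ann Q u a U (j - a)) (R (j - a))"
proof -
  let ?t = "\<lambda>x. x ^ Q * u"
  have ad: "(x - y) ^ Q * u - (x ^ Q * u - y ^ Q * u) \<in> U j" for x y by (rule ad_ppow[OF Q cl_K[OF U]])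
  have s: "sgp (U j)" "K \<subseteq> U j" by (rule cl_sgp[OF U], rule cl_K[OF U])
  have 1: "?t ` ann Q u a U (j - a) + U j = U j"
  proof
    show "?t ` ann Q u a U (j - a) + U j \<subseteq> U j" by (intro plus_subset s) (auto simp: ann_def)
    show "U j \<subseteq> ?t ` ann Q u a U (j - a) + U j"
      by (intro subset_image_plus sgp_zero[OF cl_sgp[OF cl_ann[OF U Q]]] ppow_pos[OF Q])
  qed
  have 2: "?t ` R (j - a) + U j = U j + rsp Q u a j"
  proof -
    have "U j + rsp Q u a j = ?t ` R (j - a) + (U j + K)" unfolding rsp_def by (simp only: add_ac)
    then show ?thesis using plus_absorb[OF s(1) sgp_K s(2)] by simp
  qed
  have 3: "ann Q u a U (j - a) \<subseteq> R (j - a)" by (auto simp: ann_def)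
  show ?thesis
    using len_image_eq[OF _ cl_kst[OF U] ad cl_kst[OF cl_R] cl_kst[OF cl_ann[OF U Q]] 3]
    unfolding 1 2 by (auto simp: ann_def)
qed

text \<open>\<open>cb l P\<close> says that \<open>R / P\<close> has dimension at most \<open>l\<close>.\<close>

definition cb :: "nat \<Rightarrow> (int \<Rightarrow> 'r set) \<Rightarrow> bool" where
  "cb l P \<longleftrightarrow> (\<forall>n (C :: nat \<Rightarrow> int \<Rightarrow> 'r set).
     C 0 = P \<longrightarrow> (\<forall>i\<le>n. hp (C i)) \<longrightarrow> (\<forall>i<n. C i < C (Suc i)) \<longrightarrow> n \<le> l)"

lemma cb_step:
  assumes "cb l P" "hp P" "hp P'" "P < P'"
  shows "\<exists>k. l = Suc k \<and> cb k P'"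
proof -
  have *: "Suc n \<le> l" if C: "C 0 = P'" "\<forall>i\<le>n. hp (C i)" "\<forall>i<n. C i < C (Suc i)" for n and C :: "nat \<Rightarrow> int \<Rightarrow> 'r set"
  proof (rule assms(1)[unfolded cb_def, rule_format, of "\<lambda>i. if i = 0 then P else C (i - 1)"])
    fix i assume "i < Suc n"
    then show "(if i = 0 then P else C (i - 1)) < (if Suc i = 0 then P else C (Suc i - 1))"
      using C assms(4) by (cases i) auto
  qed (use C assms in auto)
  have "Suc 0 \<le> l" using *[of "\<lambda>_. P'" 0] assms by simp
  then obtain k where "l = Suc k" by (cases l) auto
  then show ?thesis using * by (auto simp: cb_def)
qed

text \<open>The growth of the Hilbert function of a graded module of dimension at most l: degree l -
  1 for positive l, and for l = 0 vanishing outside a bounded range of degrees.\<close>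

primrec bnd :: "nat \<Rightarrow> (int \<Rightarrow> enat) \<Rightarrow> bool" where
  "bnd 0 H \<longleftrightarrow> (\<exists>C B. \<forall>j. H j \<le> enat (if nat \<bar>j\<bar> \<le> B then C else 0))"
| "bnd (Suc l) H \<longleftrightarrow> (\<exists>C. \<forall>j. H j \<le> enat (C * (nat \<bar>j\<bar> + 1) ^ l))"

lemma bnd_mono: "bnd l H \<Longrightarrow> (\<And>j. H' j \<le> H j) \<Longrightarrow> bnd l H'"
proof (cases l)
  case 0
  assume "bnd l H" "\<And>j. H' j \<le> H j"
  then show ?thesis unfolding 0 bnd.simps by (meson order_trans)
next
  case (Suc k)
  assume "bnd l H" "\<And>j. H' j \<le> H j"
  then show ?thesis unfolding Suc bnd.simps by (meson order_trans)
qed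

lemma bnd0I: "(\<And>j. H j \<le> enat (if nat \<bar>j\<bar> \<le> B then C else 0)) \<Longrightarrow> bnd 0 H"
  unfolding bnd.simps by blast

lemma bnd_zero: "bnd l (\<lambda>_. 0)"
  by (cases l) (auto simp: zero_enat_def[symmetric])

lemma bnd_add:
  assumes "bnd l H" "bnd l H'" shows "bnd l (\<lambda>j. H j + H' j)"
proof (cases l)
  case 0
  then obtain C B C' B' where *: "\<And>j. H j \<le> enat (if nat \<bar>j\<bar> \<le> B then C else 0)"
    "\<And>j. H' j \<le> enat (if nat \<bar>j\<bar> \<le> B' then C' else 0)" using assms by auto
  have "H j + H' j \<le> enat (if nat \<bar>j\<bar> \<le> max B B' then C + C' else 0)" for j
  proof -
    have "H j + H' j \<le> enat ((if nat \<bar>j\<bar> \<le> B then C else 0) + (if nat \<bar>j\<bar> \<le> B' then C' else 0))"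
      unfolding plus_enat_simps(1)[symmetric] by (intro add_mono *)
    also have "\<dots> \<le> enat (if nat \<bar>j\<bar> \<le> max B B' then C + C' else 0)" by auto
    finally show ?thesis .
  qed
  then show ?thesis unfolding 0 by (rule bnd0I)
next
  case (Suc k)
  then obtain C C' where *: "\<And>j. H j \<le> enat (C * (nat \<bar>j\<bar> + 1) ^ k)"
    "\<And>j. H' j \<le> enat (C' * (nat \<bar>j\<bar> + 1) ^ k)" using assms by auto
  have "H j + H' j \<le> enat ((C + C') * (nat \<bar>j\<bar> + 1) ^ k)" for j
    unfolding distrib_right plus_enat_simps(1)[symmetric] by (intro add_mono *)
  then show ?thesis using Suc by auto
qed

lemma bnd_shift:
  assumes "bnd l H" shows "bnd l (\<lambda>j. H (j - a))"
proof (cases l)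
  case 0
  then obtain C B where *: "\<And>j. H j \<le> enat (if nat \<bar>j\<bar> \<le> B then C else 0)" using assms by auto
  have "H (j - a) \<le> enat (if nat \<bar>j\<bar> \<le> B + nat \<bar>a\<bar> then C else 0)" for j
    by (rule order_trans[OF *]) auto
  then show ?thesis unfolding 0 by (rule bnd0I)
next
  case (Suc k)
  then obtain C where *: "\<And>j. H j \<le> enat (C * (nat \<bar>j\<bar> + 1) ^ k)" using assms by auto
  have "H (j - a) \<le> enat ((C * (nat \<bar>a\<bar> + 1) ^ k) * (nat \<bar>j\<bar> + 1) ^ k)" for j
  proof (rule order_trans[OF *])
    have "nat \<bar>j - a\<bar> + 1 \<le> (nat \<bar>a\<bar> + 1) + nat \<bar>j\<bar>" by simp
    also have "\<dots> \<le> (nat \<bar>a\<bar> + 1) * (nat \<bar>j\<bar> + 1)" by simp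
    finally have "(nat \<bar>j - a\<bar> + 1) ^ k \<le> ((nat \<bar>a\<bar> + 1) * (nat \<bar>j\<bar> + 1)) ^ k" by (rule power_mono) simp
    then have "C * (nat \<bar>j - a\<bar> + 1) ^ k \<le> C * ((nat \<bar>a\<bar> + 1) * (nat \<bar>j\<bar> + 1)) ^ k" by (rule mult_left_mono) simp
    then show "enat (C * (nat \<bar>j - a\<bar> + 1) ^ k) \<le> enat ((C * (nat \<bar>a\<bar> + 1) ^ k) * (nat \<bar>j\<bar> + 1) ^ k)"
      by (simp only: enat_ord_simps power_mult_distrib mult.assoc)
  qed
  then show ?thesis using Suc by auto
qed

lemma bnd_sum:
  assumes H': "bnd l H'" and le: "\<And>j. H j \<le> H (j - 1) + H' j" and neg: "\<And>j. j < 0 \<Longrightarrow> H j = 0"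
  shows "bnd (Suc l) H"
proof -
  have *: "\<exists>C. \<forall>n. H (int n) \<le> enat (C * (n + 1) ^ l)"
  proof (cases l)
    case 0
    then obtain C B where *: "\<And>j. H' j \<le> enat (if nat \<bar>j\<bar> \<le> B then C else 0)" using H' by auto
    \<comment> \<open>\<open>min n B + 1\<close> counts the degrees from 0 to n in which
      \<open>H'\<close> can be nonzero.\<close>
    have "H (int n) \<le> enat (C * (min n B + 1))" for n
    proof (induction n)
      case 0
      show ?case using le[of 0] neg[of "-1"] *[of 0] by simp
    next
      case (Suc n)
      have "H (int (Suc n)) \<le> H (int n) + H' (int (Suc n))" using le[of "int (Suc n)"] by simp
      also have "\<dots> \<le> enat (C * (min n B + 1)) + enat (if Suc n \<le> B then C else 0)"
        using *[of "int (Suc n)"] by (intro add_mono Suc) (auto simp: nat_add_distrib)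
      also have "\<dots> \<le> enat (C * (min (Suc n) B + 1))" by (auto simp: min_def)
      finally show ?case .
    qed
    moreover have "enat (C * (min n B + 1)) \<le> enat (C * (B + 1) * (n + 1) ^ 0)" for n by simp
    ultimately have "H (int n) \<le> enat (C * (B + 1) * (n + 1) ^ 0)" for n by (rule order_trans)
    then show ?thesis unfolding 0 by blast
  next
    case (Suc k)
    then obtain C where *: "\<And>j. H' j \<le> enat (C * (nat \<bar>j\<bar> + 1) ^ k)" using H' by auto
    have "H (int n) \<le> enat (C * (n + 1) ^ Suc k)" for n
    proof (induction n)
      case 0
      show ?case using le[of 0] neg[of "-1"] *[of 0] by simp
    next
      case (Suc n)
      have "H (int (Suc n)) \<le> H (int n) + H' (int (Suc n))" using le[of "int (Suc n)"] by simp
      also have "\<dots> \<le> enat (C * (n + 1) ^ Suc k) + enat (C * (n + 2) ^ k)"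
        using *[of "int (Suc n)"] by (intro add_mono Suc) (simp add: nat_add_distrib)
      also have "\<dots> = enat (C * ((n + 1) * (n + 1) ^ k + (n + 2) ^ k))" by (simp add: distrib_left)
      also have "\<dots> \<le> enat (C * ((n + 1) * (n + 2) ^ k + (n + 2) ^ k))"
        unfolding enat_ord_simps by (intro mult_left_mono add_mono power_mono) auto
      also have "\<dots> = enat (C * (Suc n + 1) ^ Suc k)" by (simp add: algebra_simps)
      finally show ?case .
    qed
    then show ?thesis using Suc by auto
  qed
  then obtain C where C: "\<And>n. H (int n) \<le> enat (C * (n + 1) ^ l)" by blast
  have "H j \<le> enat (C * (nat \<bar>j\<bar> + 1) ^ l)" for j
    using C[of "nat j"] neg[of j] by (cases "j < 0") auto
  then show ?thesis by auto
qed

text \<open>A prime filtration in disguise. A maximal submodule satisfying the bound must be all of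
  \<open>N\<close>: otherwise an associated prime of the remaining quotient provides one more cyclic
  factor whose length is bounded by \<open>pr\<close>.\<close>

lemma filtration_bound:
  assumes g: "gm Q N Z" and n: "noeth Q N Z" and Q: "ppow Q"
    and pr: "\<And>u a U. cl Q U \<Longrightarrow> Z \<le> U \<Longrightarrow> U \<le> N \<Longrightarrow> u \<in> N a \<Longrightarrow> u \<notin> U a \<Longrightarrow> hp (ann Q u a U) \<Longrightarrow>
      bnd l (\<lambda>j. len (kst 1) (ann Q u a U j) (R j))"
  shows "bnd l (\<lambda>j. len (kst Q) (Z j) (N j))"
proof -
  define Pr where "Pr U \<longleftrightarrow> cl Q U \<and> Z \<le> U \<and> U \<le> N \<and> bnd l (\<lambda>j. len (kst Q) (Z j) (U j))" for U
  note Nc = gmD(1)[OF g] and Zc = gmD(2)[OF g]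
  have "Pr Z" using Zc g by (simp add: Pr_def len_same bnd_zero gm_def)
  then obtain U where U: "Pr U" and max: "\<And>V. Pr V \<Longrightarrow> U \<le> V \<Longrightarrow> V = U"
    using noeth_maximal[OF n, of Pr Z] by (auto simp: Pr_def)
  have Uc: "cl Q U" "Z \<le> U" "U \<le> N" using U by (auto simp: Pr_def)
  have "N \<le> U"
  proof (rule ccontr)
    assume "\<not> N \<le> U"
    from exists_prime[OF Nc Uc(1) Q this] obtain a u where u: "u \<in> N a" "u \<notin> U a" "hp (ann Q u a U)" by blast
    define V where "V = (\<lambda>j. U j + rsp Q u a j)"
    note adj = adjoin[OF Q Uc(1), where u = u and a = a]
    note V = adj(1)[folded V_def] and VN = adj(4)[OF Nc Uc(3) u(1), folded V_def]
    have UV: "U j \<subseteq> V j" for j unfolding V_def by (rule adj(2))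
    have uV: "u \<in> V a" unfolding V_def by (rule adj(3))
    have "len (kst Q) (Z j) (V j) = len (kst Q) (Z j) (U j) + len (kst 1) (ann Q u a U (j - a)) (R (j - a))" for j
      unfolding len_rsp[OF Uc(1) Q, symmetric] V_def[symmetric]
      using len_add[OF cl_kst[OF V] cl_kst[OF Uc(1)] cl_kst[OF Zc] _ UV[of j]] Uc(2) by (simp add: le_fun_def V_def)
    moreover have "bnd l (\<lambda>j. len (kst Q) (Z j) (U j) + len (kst 1) (ann Q u a U (j - a)) (R (j - a)))"
      using U bnd_shift[OF pr[OF Uc u]] by (intro bnd_add) (auto simp: Pr_def)
    moreover have "Z \<le> V" using order_trans[OF Uc(2), of V] UV by (simp add: le_fun_def)
    ultimately have "Pr V" unfolding Pr_def using V VN by simp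
    then have "V = U" using max UV by (simp add: le_fun_def)
    then show False using u uV by simp
  qed
  then have "N = U" using Uc by simp
  then show ?thesis using U by (simp add: Pr_def)
qed

lemma hp_R_subset:
  assumes P: "hp P" and 1: "R 1 \<subseteq> P 1" and j0: "j \<noteq> 0"
  shows "R j \<subseteq> P j"
proof (cases "j < 0")
  case True then show ?thesis using R_neg cl_K[OF hpD(1)[OF P]] by simp
next
  case False
  show ?thesis
  proof
    fix r assume "r \<in> R j"
    then obtain c where c: "\<forall>x\<in>X. c x \<in> R (j - 1)" "r - (\<Sum>x\<in>X. c x * x) \<in> K"
      using gen_R[of "j - 1" r] False j0 by auto
    have "c x * x \<in> P j" if "x \<in> X" for x
      using hpD(5)[OF P, of "c x" "j - 1" x 1] c that X_R 1 by auto
    then have "(\<Sum>x\<in>X. c x * x) \<in> P j" by (intro sgp_sum cl_sgp[OF hpD(1)[OF P]])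
    then show "r \<in> P j" using cl_cong[OF hpD(1)[OF P] c(2)] by blast
  qed
qed

lemma hp_irrelevant:
  assumes P: "hp P" and 1: "R 1 \<subseteq> P 1"
  shows "len (kst 1) (P j) (R j) \<le> (if j = 0 then 1 else 0)"
proof -
  note Pc = hpD(1)[OF P]
  have "len (kst 1) (P j) (R j) = 0" if "j \<noteq> 0"
    using hp_R_subset[OF P 1 that] hpD(2)[OF P, of j] by (auto simp: len_same)
  moreover have "len (kst 1) (P 0) (R 0) \<le> 1"
  proof -
    note s = simple_len[OF cl_kst[OF cl_R] cl_kst[OF Pc] cl_K[OF Pc] ppow_1 one_R hpD(3)[OF P]]
    have "R 0 \<subseteq> (\<lambda>r. r ^ 1 * 1) ` R 0 + P 0" using subset_plus_left[OF cl_sgp[OF Pc], of "R 0"] by simp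
    then have "len (kst 1) (P 0) (R 0) \<le> len (kst 1) (P 0) ((\<lambda>r. r ^ 1 * 1) ` R 0 + P 0)"
      by (intro len_sub_mono[OF cl_kst[OF cl_R] cl_kst[OF Pc] s(1) cl_kst[OF Pc] order_refl hpD(2)[OF P]])
    then show ?thesis using s(5) by simp
  qed
  ultimately show ?thesis by auto
qed

text \<open>Take x of degree one outside \<open>P\<close>. Multiplication by x embeds R / P into
  itself with a shift by one, so the Hilbert function has the Hilbert function of R / (P + x) as its
  difference. The primes met in a filtration of that quotient contain \<open>P\<close> strictly, and
  the induction hypothesis bounds it. If no such x exists, R / P lives in degree 0.\<close>

lemma hp_bound: "hp P \<Longrightarrow> cb l P \<Longrightarrow> bnd l (\<lambda>j. len (kst 1) (P j) (R j))"
proof (induction l arbitrary: P)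
  have irr: "bnd l (\<lambda>j. len (kst 1) (P j) (R j))" if "hp P" "R 1 \<subseteq> P 1" for l P
  proof -
    have "bnd l (\<lambda>j. if j = 0 then 1 else 0)"
    proof (cases l)
      case 0
      show ?thesis unfolding 0
        by (rule bnd0I[where B = 0 and C = 1]) (auto simp: one_enat_def zero_enat_def)
    next
      case (Suc k)
      show ?thesis unfolding Suc bnd.simps
        by (rule exI[of _ 1]) (auto simp: one_enat_def zero_enat_def)
    qed
    then show ?thesis by (rule bnd_mono) (rule hp_irrelevant[OF that])
  qed
  have big: "P < ann 1 u a U \<and> x \<in> ann 1 u a U 1"
    if "hp P" "x \<in> R 1" "x \<notin> P 1" "cl 1 U" "(\<lambda>j. P j + rsp 1 x 1 j) \<le> U" "u \<in> R a" for P x u a U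
  proof -
    have PU: "P j \<subseteq> U j" and xU: "rsp 1 x 1 j \<subseteq> U j" for j
      using that(5) subset_plus_left[OF cl_sgp[OF cl_rsp[OF ppow_1]], of "P j" x 1 j]
        subset_plus_right[OF cl_sgp[OF hpD(1)[OF that(1)]], of "rsp 1 x 1 j" j]
      by (auto simp: le_fun_def)
    have "P \<le> ann 1 u a U"
    proof (rule le_funI, rule subsetI)
      fix j r assume r: "r \<in> P j"
      have "u * r \<in> P (a + j)" by (rule hpD(5)[OF that(1,6) r])
      then show "r \<in> ann 1 u a U j" using hpD(2)[OF that(1)] r PU by (auto simp: ann_def mult.commute add.commute)
    qed
    moreover have "x \<in> U 1" using xU rsp_self[OF ppow_1] by blast
    from cl_mult[OF that(4,6) this] have x: "x \<in> ann 1 u a U 1"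
      using that(2) by (simp add: ann_def mult.commute add.commute)
    ultimately show ?thesis using that(3) by (auto simp: less_le)
  qed
  {
    case 0
    show ?case
    proof (cases "R 1 \<subseteq> P 1")
      case False
      then obtain x where x: "x \<in> R 1" "x \<notin> P 1" by blast
      define U where "U = (\<lambda>j. P j + rsp 1 x 1 j)"
      have U: "cl 1 U" unfolding U_def by (rule cl_plus[OF hpD(1)[OF 0(1)] cl_rsp[OF ppow_1]])
      \<comment> \<open>x has degree one, so its multiples contribute only \<open>K\<close> in
        degree 0. Hence a prime lies strictly above \<open>P\<close>, which contradicts dimension
        0.\<close>
      have "1 \<notin> U 0"
      proof
        assume "1 \<in> U 0"
        then obtain a b where ab: "a \<in> P 0" "b \<in> rsp 1 x 1 0" "1 = a + b" unfolding U_def by (rule set_plus_elim)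
        have e: "R (0 - 1) = K" by (rule R_neg) simp
        have "rsp 1 x 1 0 \<subseteq> K" unfolding rsp_def e
          by (intro plus_subset sgp_K image_subsetI K_ideal') auto
        then have "b \<in> P 0" using ab cl_K[OF hpD(1)[OF 0(1)]] by blast
        then have "a + b \<in> P 0" using ab by (intro sgp_add[OF cl_sgp[OF hpD(1)[OF 0(1)]]])
        then show False using ab hpD(3)[OF 0(1)] by simp
      qed
      then have "\<not> R \<le> U" using one_R by (auto simp: le_fun_def)
      from exists_prime[OF cl_R U ppow_1 this] obtain a u where u: "u \<in> R a" "hp (ann 1 u a U)" by blast
      have "P < ann 1 u a U" using big[OF 0(1) x U _ u(1)] by (simp add: U_def)
      from cb_step[OF 0(2,1) u(2) this] show ?thesis by simp
    qed (use irr[OF 0(1)] in blast)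
  next
    case (Suc l)
    show ?case
    proof (cases "R 1 \<subseteq> P 1")
      case False
      then obtain x where x: "x \<in> R 1" "x \<notin> P 1" by blast
      note Pc = hpD(1)[OF Suc.prems(1)]
      define Z where "Z = (\<lambda>j. P j + rsp 1 x 1 j)"
      have Z: "cl 1 Z" unfolding Z_def by (rule cl_plus[OF Pc cl_rsp[OF ppow_1]])
      have ZR: "Z j \<subseteq> R j" for j unfolding Z_def
        using rsp_le[OF cl_R x(1)] by (intro plus_subset sgp_R hpD(2)[OF Suc.prems(1)]) (simp add: le_fun_def)
      have g: "gm 1 R Z" by (rule gmI[OF cl_R Z ZR])
      have PZ: "P j \<subseteq> Z j" for j unfolding Z_def by (rule subset_plus_left[OF cl_sgp[OF cl_rsp[OF ppow_1]]])
      have nZ: "noeth 1 R Z" by (rule noeth_sub[OF noeth_R]) (auto simp: le_fun_def cl_K[OF Z, THEN subsetD])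
      have b: "bnd l (\<lambda>j. len (kst 1) (Z j) (R j))"
      proof (rule filtration_bound[OF g nZ ppow_1])
        fix u a U assume U: "cl 1 U" "Z \<le> U" "u \<in> R a" and h: "hp (ann 1 u a U)"
        have "P < ann 1 u a U" using big[OF Suc.prems(1) x U(1) _ U(3)] U(2) by (simp add: Z_def)
        from cb_step[OF Suc.prems(2,1) h this] have "cb l (ann 1 u a U)" by simp
        then show "bnd l (\<lambda>j. len (kst 1) (ann 1 u a U j) (R j))" by (rule Suc.IH[OF h])
      qed
      have "ann 1 x 1 P j = P j" for j
        using hpD(2)[OF Suc.prems(1), of j] hpD(4)[OF Suc.prems(1) _ x(1)] x
          cl_mult'[OF Pc x(1), of _ j "j + 1"] by (auto simp: ann_def mult.commute)
      then have "len (kst 1) (P j) (Z j) = len (kst 1) (P (j - 1)) (R (j - 1))" for j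
        using len_rsp[OF Pc ppow_1, of j x 1] by (simp add: Z_def)
      then have eqH: "len (kst 1) (P j) (R j) = len (kst 1) (P (j - 1)) (R (j - 1)) + len (kst 1) (Z j) (R j)" for j
        using len_add[OF cl_kst[OF cl_R] cl_kst[OF Z] cl_kst[OF Pc] PZ ZR, of j] by simp
      have neg: "len (kst 1) (P j) (R j) = 0" if "j < 0" for j
      proof -
        have "P j = R j" using R_neg[OF that] hpD(2)[OF Suc.prems(1), of j] cl_K[OF Pc, of j] by auto
        then show ?thesis by (simp add: len_same)
      qed
      show ?thesis by (rule bnd_sum[OF b eq_refl[OF eqH] neg])
    qed (use irr[OF Suc.prems(1)] in blast)
  }
qed

section \<open>Primes of top dimension and elements avoiding them\<close>

lemma cb_mono: "cb l P \<Longrightarrow> l \<le> l' \<Longrightarrow> cb l' P"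
  unfolding cb_def by (blast intro: order_trans)

lemma hp_zero:
  assumes P: "hp P" shows "P 0 \<subseteq> K"
proof
  fix r assume r: "r \<in> P 0"
  show "r \<in> K"
  proof (rule ccontr)
    assume "r \<notin> K"
    then obtain s where s: "s \<in> R 0" "r * s - 1 \<in> K" using inv_R0 r hpD(2)[OF P] by blast
    have "s * r \<in> P (0 + 0)" by (rule hpD(5)[OF P s(1) r])
    then have "r * s \<in> P 0" by (simp add: mult.commute)
    then show False using cl_cong[OF hpD(1)[OF P] s(2)] hpD(3)[OF P] by blast
  qed
qed

lemma cb_irrelevant:
  assumes P: "hp P" and 1: "R 1 \<subseteq> P 1" shows "cb 0 P"
  unfolding cb_def
proof (intro allI impI)
  fix n and C :: "nat \<Rightarrow> int \<Rightarrow> 'r set"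
  assume C: "C 0 = P" "\<forall>i\<le>n. hp (C i)" "\<forall>i<n. C i < C (Suc i)"
  show "n \<le> 0"
  proof (rule ccontr)
    assume n: "\<not> n \<le> 0"
    then have h: "hp (C 1)" and l: "P < C 1" using C by auto
    have "C 1 j \<subseteq> P j" for j
    proof (cases "j = 0")
      case True
      then show ?thesis using hp_zero[OF h] cl_K[OF hpD(1)[OF P]] by auto
    next
      case False
      then show ?thesis using hp_R_subset[OF P 1 False] hpD(2)[OF h] by blast
    qed
    then have "C 1 \<le> P" by (simp add: le_fun_def)
    then show False using l by simp
  qed
qed

text \<open>The product of one element from each member of \<open>S\<close> outside
  \<open>P'\<close>; primality keeps it outside \<open>P'\<close>.\<close>

lemma prime_avoid:
  assumes "finite S" "\<And>P. P \<in> S \<Longrightarrow> hp P" and P': "hp P'" and "\<And>P. P \<in> S \<Longrightarrow> \<not> P \<le> P'"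
  shows "\<exists>i y. y \<in> R i \<and> y \<notin> P' i \<and> (\<forall>P\<in>S. y \<in> P i)"
  using assms(1,2,4)
proof (induction S rule: finite_induct)
  case empty
  then show ?case using one_R hpD(3)[OF P'] by blast
next
  case (insert P S)
  then obtain i y where y: "y \<in> R i" "y \<notin> P' i" "\<forall>P\<in>S. y \<in> P i" by blast
  have "hp P" "\<not> P \<le> P'" using insert by auto
  then obtain j z where z: "z \<in> P j" "z \<notin> P' j" by (auto simp: le_fun_def)
  have zR: "z \<in> R j" using hpD(2)[OF \<open>hp P\<close>] z by blast
  have "y * z \<notin> P' (i + j)" using hpD(4)[OF P' y(1) zR] y z by blast
  moreover have "y * z \<in> P (i + j)" by (rule hpD(5)[OF \<open>hp P\<close> y(1) z(1)])
  moreover have "y * z \<in> T (i + j)" if "T \<in> S" for T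
    using hpD(5)[OF _ zR, of T y i] insert.prems(1)[of T] y that by (simp add: mult.commute add.commute)
  ultimately show ?case using R_mult[OF y(1) zR] by blast
qed

lemma hp_power: "hp P \<Longrightarrow> x \<in> R i \<Longrightarrow> x \<notin> P i \<Longrightarrow> x ^ n \<notin> P (int n * i)"
proof (induction n)
  case (Suc n)
  then have "x * x ^ n \<notin> P (i + int n * i)" using hpD(4)[OF Suc(2,3) power_R[OF Suc(3)], of n] by blast
  then show ?case by (simp add: algebra_simps)
qed (simp add: hpD(3))

definition annN :: "nat \<Rightarrow> (int \<Rightarrow> 'r set) \<Rightarrow> (int \<Rightarrow> 'r set) \<Rightarrow> int \<Rightarrow> 'r set" where
  "annN Q N Z i = {r \<in> R i. \<forall>j. \<forall>x\<in>N j. r ^ Q * x \<in> Z (i + j)}"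

lemma annN_ann: "Z \<le> U \<Longrightarrow> u \<in> N a \<Longrightarrow> annN Q N Z \<le> ann Q u a U"
  by (auto simp: annN_def ann_def le_fun_def)

lemma annN_mono: "Z \<le> Z' \<Longrightarrow> N' \<le> N \<Longrightarrow> annN Q N Z \<le> annN Q N' Z'"
  unfolding annN_def le_fun_def by blast

text \<open>For finitely generated N / Z, the primes containing \<open>annN\<close> form the
  support. Under \<open>topset D B\<close> the members of \<open>B\<close> have dimension exactly D
  + 1, so the two conditions say that N / Z has dimension at most D + 1 and that \<open>B\<close>
  lists all its components of that dimension.\<close>

definition cover :: "nat \<Rightarrow> (int \<Rightarrow> 'r set) set \<Rightarrow> nat \<Rightarrow> (int \<Rightarrow> 'r set) \<Rightarrow> (int \<Rightarrow> 'r set) \<Rightarrow> bool" where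
  "cover D B Q N Z \<longleftrightarrow> (\<forall>P. hp P \<longrightarrow> annN Q N Z \<le> P \<longrightarrow> cb D P \<or> P \<in> B)"

definition topset :: "nat \<Rightarrow> (int \<Rightarrow> 'r set) set \<Rightarrow> bool" where
  "topset D B \<longleftrightarrow> finite B \<and> (\<forall>P\<in>B. hp P \<and> cb (Suc D) P \<and> \<not> cb D P)"

lemma cover_mono: "cover D B Q N Z \<Longrightarrow> Z \<le> Z' \<Longrightarrow> N' \<le> N \<Longrightarrow> cover D B Q N' Z'"
  unfolding cover_def using annN_mono order_trans by blast

lemma cover_prime:
  assumes "topset D B" "P \<in> B" "P \<le> annN Q N Z" shows "cover D {P} Q N Z"
  unfolding cover_def
proof (intro allI impI)
  fix A assume A: "hp A" "annN Q N Z \<le> A"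
  have "P \<le> A" using assms A by (meson order_trans)
  moreover have P: "hp P" "cb (Suc D) P" using assms by (auto simp: topset_def)
  moreover have "cb D A" if "P < A" using cb_step[OF P(2,1) A(1) that] by auto
  ultimately show "cb D A \<or> A \<in> {P}" by (auto simp: less_le)
qed

text \<open>By \<open>w\<close>, N / Z vanishes locally at every member of \<open>B\<close>. No
  member of \<open>B\<close> is then the annihilator of a nonzero element of a quotient of N / Z, so
  only primes of dimension at most D enter the filtration.\<close>

lemma small_bound:
  assumes g: "gm Q N Z" and n: "noeth Q N Z" and Q: "ppow Q" and c: "cover D B Q N Z" and B: "topset D B"
    and w: "\<And>P u a. P \<in> B \<Longrightarrow> u \<in> N a \<Longrightarrow> \<exists>i w. w \<in> R i \<and> w \<notin> P i \<and> w ^ Q * u \<in> Z (i + a)"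
  shows "bnd D (\<lambda>j. len (kst Q) (Z j) (N j))"
proof (rule filtration_bound[OF g n Q])
  fix u a U assume U: "cl Q U" "Z \<le> U" "U \<le> N" "u \<in> N a" "u \<notin> U a" and h: "hp (ann Q u a U)"
  have "ann Q u a U \<noteq> P" if P: "P \<in> B" for P
  proof -
    obtain i w where w: "w \<in> R i" "w \<notin> P i" "w ^ Q * u \<in> Z (i + a)" using w[OF P U(4)] by blast
    then have "w \<in> ann Q u a U i" using U(2) by (auto simp: ann_def le_fun_def)
    then show ?thesis using w by auto
  qed
  moreover have "cb D (ann Q u a U) \<or> ann Q u a U \<in> B"
    using c h annN_ann[of Z U u N a Q, OF U(2) U(4)] by (auto simp: cover_def)
  ultimately have "cb D (ann Q u a U)" by blast
  then show "bnd D (\<lambda>j. len (kst 1) (ann Q u a U j) (R j))" by (rule hp_bound[OF h])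
qed

lemma cover_bound:
  assumes g: "gm Q N Z" and n: "noeth Q N Z" and Q: "ppow Q" and c: "cover D B Q N Z" and B: "topset D B"
  shows "bnd (Suc D) (\<lambda>j. len (kst Q) (Z j) (N j))"
proof (rule filtration_bound[OF g n Q])
  fix u a U assume U: "cl Q U" "Z \<le> U" "U \<le> N" "u \<in> N a" "u \<notin> U a" and h: "hp (ann Q u a U)"
  have "cb D (ann Q u a U) \<or> ann Q u a U \<in> B"
    using c h annN_ann[of Z U u N a Q, OF U(2) U(4)] by (auto simp: cover_def)
  then have "cb (Suc D) (ann Q u a U)" using B cb_mono[of D _ "Suc D"] by (auto simp: topset_def)
  then show "bnd (Suc D) (\<lambda>j. len (kst 1) (ann Q u a U j) (R j))" by (rule hp_bound[OF h])
qed

text \<open>The members of \<open>B\<close> are incomparable, all having dimension exactly D + 1. So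
  each P has an element \<open>y P\<close> outside P lying in all the others, and an
  \<open>x P\<close> of degree one outside P. Multiplying \<open>y P\<close> by powers of
  \<open>x P\<close> reaches any sufficiently large degree; the sum over P of these products avoids
  every member of \<open>B\<close>.\<close>

lemma exists_shift:
  assumes B: "topset D B"
  shows "\<exists>\<Delta>0. \<forall>\<Delta>\<ge>\<Delta>0. \<exists>x\<in>R \<Delta>. \<forall>P\<in>B. x \<notin> P \<Delta>"
proof -
  have fin: "finite B" and h: "hp P" "cb (Suc D) P" "\<not> cb D P" if "P \<in> B" for P
    using B that by (auto simp: topset_def)
  have finB: "finite B" using B by (simp add: topset_def)
  have inc: "\<not> P' \<le> P" if "P \<in> B" "P' \<in> B - {P}" for P P'
  proof
    assume "P' \<le> P"
    then have "P' < P" using that by (auto simp: less_le)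
    from cb_step[OF h(2,1) h(1) this] that h(3)[of P] show False by auto
  qed
  have "\<exists>i y x. y \<in> R i \<and> y \<notin> P i \<and> (\<forall>P'\<in>B - {P}. y \<in> P' i) \<and> x \<in> R 1 \<and> x \<notin> P 1" if P: "P \<in> B" for P
  proof -
    have "\<not> R 1 \<subseteq> P 1" using cb_irrelevant[OF h(1)[OF P]] cb_mono[of 0 P D] h(3)[OF P] by auto
    then obtain x where "x \<in> R 1" "x \<notin> P 1" by blast
    moreover obtain i y where "y \<in> R i" "y \<notin> P i" "\<forall>P'\<in>B - {P}. y \<in> P' i"
      using prime_avoid[of "B - {P}" P] finB h P inc[OF P] by blast
    ultimately show ?thesis by blast
  qed
  then obtain dg y x where yx: "\<And>P. P \<in> B \<Longrightarrow> y P \<in> R (dg P)" "\<And>P. P \<in> B \<Longrightarrow> y P \<notin> P (dg P)"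
    "\<And>P P'. P \<in> B \<Longrightarrow> P' \<in> B - {P} \<Longrightarrow> y P \<in> P' (dg P)" "\<And>P. P \<in> B \<Longrightarrow> x P \<in> R 1" "\<And>P. P \<in> B \<Longrightarrow> x P \<notin> P 1"
    by metis
  define \<Delta>0 where "\<Delta>0 = Max (insert 0 (dg ` B))"
  have dg: "dg P \<le> \<Delta>0" if "P \<in> B" for P unfolding \<Delta>0_def using that finB by simp
  have "\<exists>x\<in>R \<Delta>. \<forall>P\<in>B. x \<notin> P \<Delta>" if \<Delta>: "\<Delta> \<ge> \<Delta>0" for \<Delta>
  proof -
    define t where "t P = y P * x P ^ nat (\<Delta> - dg P)" for P
    have eq: "dg P + int (nat (\<Delta> - dg P)) * 1 = \<Delta>" if "P \<in> B" for P using dg[OF that] \<Delta> by simp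
    have tR: "t P \<in> R \<Delta>" if P: "P \<in> B" for P
      using R_mult[OF yx(1)[OF P] power_R[OF yx(4)[OF P], of "nat (\<Delta> - dg P)"]] unfolding eq[OF P] t_def .
    have tP: "t P \<notin> P \<Delta>" if P: "P \<in> B" for P
      using hpD(4)[OF h(1)[OF P] yx(1)[OF P] power_R[OF yx(4)[OF P], of "nat (\<Delta> - dg P)"]] yx(2)[OF P]
        hp_power[OF h(1)[OF P] yx(4)[OF P] yx(5)[OF P], of "nat (\<Delta> - dg P)"] unfolding eq[OF P] t_def by blast
    have tP': "t P' \<in> P \<Delta>" if P: "P \<in> B" and P': "P' \<in> B - {P}" for P P'
    proof -
      have "x P' ^ nat (\<Delta> - dg P') * y P' \<in> P (int (nat (\<Delta> - dg P')) * 1 + dg P')"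
        using P P' by (intro hpD(5)[OF h(1)[OF P]] power_R yx) auto
      then show ?thesis using eq[of P'] P' by (simp add: t_def mult.commute add.commute)
    qed
    have "(\<Sum>P\<in>B. t P) \<notin> P \<Delta>" if P: "P \<in> B" for P
    proof
      assume *: "(\<Sum>P\<in>B. t P) \<in> P \<Delta>"
      note s = cl_sgp[OF hpD(1)[OF h(1)[OF P]], of \<Delta>]
      have "(\<Sum>P'\<in>B - {P}. t P') \<in> P \<Delta>" by (rule sgp_sum[OF s tP'[OF P]])
      from sgp_diff[OF s * this] have "t P \<in> P \<Delta>" using sum.remove[OF finB P, of t] by simp
      then show False using tP[OF P] by simp
    qed
    moreover have "(\<Sum>P\<in>B. t P) \<in> R \<Delta>" by (rule sgp_sum[OF sgp_R tR])
    ultimately show ?thesis by blast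
  qed
  then show ?thesis by blast
qed

text \<open>A prime filtration with l steps uses finitely many primes. An element lying in all of
  them moves each step into the previous one, so its l-th power kills N / Z.\<close>

lemma filtration_primes:
  assumes g: "gm 1 N Z" and n: "noeth 1 N Z"
  shows "\<exists>S l. finite S \<and> (\<forall>P\<in>S. hp P \<and> annN 1 N Z \<le> P) \<and>
    (\<forall>i r. r \<in> R i \<longrightarrow> (\<forall>P\<in>S. r \<in> P i) \<longrightarrow> r ^ l \<in> annN 1 N Z (int l * i))"
proof -
  define Pr where "Pr U \<longleftrightarrow> cl 1 U \<and> Z \<le> U \<and> U \<le> N \<and> (\<exists>S l. finite S \<and> (\<forall>P\<in>S. hp P \<and> annN 1 N Z \<le> P) \<and>
    (\<forall>i r. r \<in> R i \<longrightarrow> (\<forall>P\<in>S. r \<in> P i) \<longrightarrow> (\<forall>j. \<forall>x\<in>U j. r ^ l * x \<in> Z (int l * i + j))))" for U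
  note Nc = gmD(1)[OF g] and Zc = gmD(2)[OF g]
  have "Pr Z" unfolding Pr_def using Zc g
    by (intro conjI exI[of _ "{}"] exI[of _ "0::nat"]) (auto simp: gm_def)
  then obtain U where U: "Pr U" and max: "\<And>V. Pr V \<Longrightarrow> U \<le> V \<Longrightarrow> V = U"
    using noeth_maximal[OF n, of Pr Z] by (auto simp: Pr_def)
  have Uc: "cl 1 U" "Z \<le> U" "U \<le> N" using U by (auto simp: Pr_def)
  obtain S l where S0: "finite S" "\<forall>P\<in>S. hp P \<and> annN 1 N Z \<le> P"
    "\<forall>i r. r \<in> R i \<longrightarrow> (\<forall>P\<in>S. r \<in> P i) \<longrightarrow> (\<forall>j. \<forall>x\<in>U j. r ^ l * x \<in> Z (int l * i + j))"
    using U unfolding Pr_def by blast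
  then have S: "finite S" "\<forall>P\<in>S. hp P \<and> annN 1 N Z \<le> P"
    "\<And>i r j x. r \<in> R i \<Longrightarrow> \<forall>P\<in>S. r \<in> P i \<Longrightarrow> x \<in> U j \<Longrightarrow> r ^ l * x \<in> Z (int l * i + j)" by blast+
  have "N \<le> U"
  proof (rule ccontr)
    assume "\<not> N \<le> U"
    from exists_prime[OF Nc Uc(1) ppow_1 this] obtain a u where u: "u \<in> N a" "u \<notin> U a" "hp (ann 1 u a U)" by blast
    define V where "V = (\<lambda>j. U j + rsp 1 u a j)"
    note adj = adjoin[OF ppow_1 Uc(1), where u = u and a = a]
    note V = adj(1)[folded V_def] and VN = adj(4)[OF Nc Uc(3) u(1), folded V_def]
    have UV: "U j \<subseteq> V j" for j unfolding V_def by (rule adj(2))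
    have uV: "u \<in> V a" unfolding V_def by (rule adj(3))
    have kill: "r ^ Suc l * x \<in> Z (int (Suc l) * i + j)"
      if r: "r \<in> R i" "\<forall>P\<in>insert (ann 1 u a U) S. r \<in> P i" and x: "x \<in> V j" for i r j x
    proof -
      obtain b c where bc: "b \<in> U j" "c \<in> rsp 1 u a j" "x = b + c" using x unfolding V_def by (rule set_plus_elim)
      have "r ^ 1 * b \<in> U (i + j)" by (rule cl_mult[OF Uc(1) r(1) bc(1)])
      moreover have "r ^ 1 * c \<in> U (i + j)"
      proof -
        obtain s k where sk: "s \<in> R (j - a)" "k \<in> K" "c = s * u + k"
          using bc(2) by (auto simp: rsp_def elim!: set_plus_elim)
        have "r * u \<in> U (i + a)" using r by (auto simp: ann_def)
        from cl_mult'[OF Uc(1) sk(1) this, of "i + j"] have "s * (r * u) \<in> U (i + j)" by simp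
        moreover have "r * k \<in> U (i + j)" using K_ideal[OF sk(2)] cl_K[OF Uc(1)] by blast
        ultimately have "s * (r * u) + r * k \<in> U (i + j)" by (rule sgp_add[OF cl_sgp[OF Uc(1)]])
        then show ?thesis by (simp add: sk algebra_simps)
      qed
      ultimately have "r ^ 1 * b + r ^ 1 * c \<in> U (i + j)" by (rule sgp_add[OF cl_sgp[OF Uc(1)]])
      then have "r * x \<in> U (i + j)" by (simp add: bc distrib_left)
      from S(3)[OF r(1) _ this] r(2) show ?thesis by (simp add: algebra_simps)
    qed
    have "Pr V" unfolding Pr_def
    proof (intro conjI exI[of _ "insert (ann 1 u a U) S"] exI[of _ "Suc l"] allI impI ballI)
      show "Z \<le> V" using order_trans[OF Uc(2), of V] UV by (simp add: le_fun_def)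
      fix P assume P: "P \<in> insert (ann 1 u a U) S"
      show "hp P" using P S(2) u(3) by auto
      show "annN 1 N Z \<le> P" using P S(2) annN_ann[of Z U u N a 1, OF Uc(2) u(1)] by auto
    next
      fix i r j x assume "r \<in> R i" "\<forall>P\<in>insert (ann 1 u a U) S. r \<in> P i" "x \<in> V j"
      then show "r ^ Suc l * x \<in> Z (int (Suc l) * i + j)" by (rule kill)
    qed (use V VN S(1) in auto)
    then have "V = U" using max UV by (simp add: le_fun_def)
    then show False using u uV by simp
  qed
  then have "N = U" using Uc by simp
  then have "r ^ l \<in> annN 1 N Z (int l * i)" if "r \<in> R i" "\<forall>P\<in>S. r \<in> P i" for i r
    using S(3)[OF that] power_R[OF that(1)] by (simp add: annN_def)
  then show ?thesis using S(1,2) by blast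
qed

text \<open>The minimal primes, those among them of maximal dimension, and a Frobenius power that kills the
  nilpotent elements.\<close>

lemma minimal_primes:
  assumes g: "gm 1 N Z" and n: "noeth 1 N Z" and d: "\<And>P. hp P \<Longrightarrow> annN 1 N Z \<le> P \<Longrightarrow> cb (Suc D) P"
  shows "\<exists>A e. finite A \<and> (\<forall>P\<in>A. hp P) \<and> (\<forall>P\<in>A. \<forall>P'\<in>A. P \<le> P' \<longrightarrow> P = P') \<and>
    topset D {P \<in> A. \<not> cb D P} \<and> cover D {P \<in> A. \<not> cb D P} 1 N Z \<and>
    (\<forall>i r. r \<in> R i \<longrightarrow> (\<forall>P\<in>A. r \<in> P i) \<longrightarrow> r ^ (p ^ e) \<in> annN 1 N Z (int (p ^ e) * i))"
proof -
  obtain S l where S: "finite S" "\<And>P. P \<in> S \<Longrightarrow> hp P \<and> annN 1 N Z \<le> P"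
    "\<And>i r. r \<in> R i \<Longrightarrow> \<forall>P\<in>S. r \<in> P i \<Longrightarrow> r ^ l \<in> annN 1 N Z (int l * i)"
    using filtration_primes[OF g n] by blast
  define A where "A = {P \<in> S. \<forall>P'\<in>S. P' \<le> P \<longrightarrow> P' = P}"
  have AS: "A \<subseteq> S" "finite A" using S(1) by (auto simp: A_def)
  have min: "\<exists>P'\<in>A. P' \<le> P" if "P \<in> S" for P
    using finite_has_minimal2[OF S(1) that] by (auto simp: A_def)
  have c: "cover D {P \<in> A. \<not> cb D P} 1 N Z" unfolding cover_def
  proof (intro allI impI)
    fix P' assume P': "hp P'" "annN 1 N Z \<le> P'"
    have "\<exists>P\<in>S. P \<le> P'"
    proof (rule ccontr)
      assume "\<not> ?thesis"
      then obtain i y where y: "y \<in> R i" "y \<notin> P' i" "\<forall>P\<in>S. y \<in> P i"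
        using prime_avoid[OF S(1) _ P'(1)] S(2) by blast
      have "y ^ l \<in> P' (int l * i)" using S(3)[OF y(1,3)] P'(2) by (auto simp: le_fun_def)
      then show False using hp_power[OF P'(1) y(1,2)] by blast
    qed
    then obtain P where P: "P \<in> A" "P \<le> P'" using min by (meson order_trans)
    have hP: "hp P" "cb (Suc D) P" using P AS S(2) d by auto
    show "cb D P' \<or> P' \<in> {P \<in> A. \<not> cb D P}"
    proof (cases "P = P'")
      case False
      then have "P < P'" using P by (simp add: less_le)
      from cb_step[OF hP(2,1) P'(1) this] show ?thesis by auto
    qed (use P in auto)
  qed
  have "r ^ (p ^ l) \<in> annN 1 N Z (int (p ^ l) * i)" if r: "r \<in> R i" "\<forall>P\<in>A. r \<in> P i" for i r
  proof -
    have "\<forall>P\<in>S. r \<in> P i" using min r(2) by (meson le_fun_def subsetD)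
    from S(3)[OF r(1) this] have *: "r ^ l * x \<in> Z (int l * i + j)" if "x \<in> N j" for x j
      using that by (auto simp: annN_def)
    \<comment> \<open>The exponent has to be a power of p, to correspond to an iterate of Frobenius;
      any such power that is at least \<open>l\<close> serves.\<close>
    have lp: "l \<le> p ^ l" using less_exp[of l] power_mono[of 2 p l] prime_ge_2_nat[OF prime_p] by linarith
    have "r ^ (p ^ l) * x \<in> Z (int (p ^ l) * i + j)" if x: "x \<in> N j" for x j
    proof -
      have "(r ^ (p ^ l - l)) ^ 1 * (r ^ l * x) \<in> Z (int (p ^ l) * i + j)"
      proof (rule cl_mult'[OF gmD(2)[OF g] power_R[OF r(1)] *[OF x]])
        have "int (p ^ l) = int (p ^ l - l) + int l" using lp by simp
        then show "int (p ^ l) * i + j = int (p ^ l - l) * i + (int l * i + j)" by (simp add: algebra_simps)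
      qed
      then show ?thesis using lp by (simp add: mult.assoc[symmetric] power_add[symmetric])
    qed
    then show ?thesis using power_R[OF r(1), of "p ^ l"] by (simp add: annN_def)
  qed
  moreover have "topset D {P \<in> A. \<not> cb D P}" using AS S(2) d by (auto simp: topset_def)
  ultimately show ?thesis using c AS S(2) by (intro exI[of _ A] exI[of _ l]) (auto simp: A_def)
qed

section \<open>Iterated pushforwards\<close>

lemma fg_mono: "fg Q N Z \<Longrightarrow> Z \<le> Z' \<Longrightarrow> fg Q N Z'"
  unfolding fg_def by (meson order_trans)

lemma gm_twist:
  assumes "gm Q N Z" shows "gm (Q * p ^ e) (\<lambda>j. N (int (p ^ e) * j)) (\<lambda>j. Z (int (p ^ e) * j))"
proof -
  have "cl (Q * p ^ e) (\<lambda>j. U (int (p ^ e) * j))" if U: "cl Q U" for U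
    unfolding cl_def
  proof (intro conjI allI ballI)
    fix i j r x assume r: "r \<in> R i" and x: "x \<in> U (int (p ^ e) * j)"
    have "(r ^ (p ^ e)) ^ Q * x \<in> U (int (p ^ e) * (i + j))"
      by (rule cl_mult'[OF U power_R[OF r] x]) (simp add: distrib_left)
    then show "r ^ (Q * p ^ e) * x \<in> U (int (p ^ e) * (i + j))"
      by (simp add: power_mult[symmetric] mult.commute)
  qed (use U in \<open>auto simp: cl_sgp cl_K[THEN subsetD]\<close>)
  then show ?thesis using assms by (auto simp: gm_def le_fun_def)
qed

lemma fg_twist:
  assumes "fg Q N Z" "gm Q N Z" "ppow Q"
  shows "fg (Q * p ^ e) (\<lambda>j. N (int (p ^ e) * j)) (\<lambda>j. Z (int (p ^ e) * j))"
proof (induction e)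
  case 0 then show ?case using assms by simp
next
  case (Suc e)
  from fg_twist1[OF Suc gm_twist[OF assms(2)] ppow_mult[OF assms(3) ppow_power]] show ?case by (simp add: mult_ac)
qed

end

section \<open>Asymptotic comparison\<close>

text \<open>For j close to s q the allowed error has order q^k, one order below the normalizing
  power q^(k+1).\<close>

definition ale :: "nat \<Rightarrow> (nat \<Rightarrow> int \<Rightarrow> enat) \<Rightarrow> (nat \<Rightarrow> int \<Rightarrow> enat) \<Rightarrow> bool" where
  "ale k f g \<longleftrightarrow> (\<exists>C. \<forall>q j. q \<ge> 1 \<longrightarrow> f q j \<le> g q j + enat (C * (nat \<bar>j\<bar> + q) ^ k))"

definition approx :: "nat \<Rightarrow> (nat \<Rightarrow> int \<Rightarrow> enat) \<Rightarrow> (nat \<Rightarrow> int \<Rightarrow> enat) \<Rightarrow> bool" where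
  "approx k f g \<longleftrightarrow> ale k f g \<and> ale k g f"

lemma aleI: "(\<And>q j. q \<ge> 1 \<Longrightarrow> f q j \<le> g q j + enat (C * (nat \<bar>j\<bar> + q) ^ k)) \<Longrightarrow> ale k f g"
  unfolding ale_def by blast

lemma aleE:
  assumes "ale k f g" obtains C where "\<And>q j. q \<ge> 1 \<Longrightarrow> f q j \<le> g q j + enat (C * (nat \<bar>j\<bar> + q) ^ k)"
  using assms unfolding ale_def by blast

lemma approxI:
  assumes "\<And>q j. q \<ge> 1 \<Longrightarrow> f q j \<le> g q j + enat (C * (nat \<bar>j\<bar> + q) ^ k)"
    "\<And>q j. q \<ge> 1 \<Longrightarrow> g q j \<le> f q j + enat (C' * (nat \<bar>j\<bar> + q) ^ k)"
  shows "approx k f g"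
  using aleI[OF assms(1)] aleI[OF assms(2)] by (simp add: approx_def)

lemma approx_refl: "approx k f f"
  by (rule approxI[where C = 0 and C' = 0]) auto

lemma approx_sym: "approx k f g \<Longrightarrow> approx k g f"
  unfolding approx_def by blast

lemma ale_trans:
  assumes "ale k f g" "ale k g h" shows "ale k f h"
proof -
  obtain C D where C: "\<And>q j. q \<ge> 1 \<Longrightarrow> f q j \<le> g q j + enat (C * (nat \<bar>j\<bar> + q) ^ k)"
    and D: "\<And>q j. q \<ge> 1 \<Longrightarrow> g q j \<le> h q j + enat (D * (nat \<bar>j\<bar> + q) ^ k)" using assms unfolding ale_def by blast
  have "f q j \<le> h q j + enat ((D + C) * (nat \<bar>j\<bar> + q) ^ k)" if q: "q \<ge> 1" for q j
    using order_trans[OF C[OF q] add_right_mono[OF D[OF q]]]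
    by (simp add: distrib_right add.assoc plus_enat_simps(1)[symmetric] del: plus_enat_simps)
  then show ?thesis by (rule aleI)
qed

lemma approx_trans [trans]: "approx k f g \<Longrightarrow> approx k g h \<Longrightarrow> approx k f h"
  unfolding approx_def by (blast intro: ale_trans)

lemma ale_add:
  assumes "ale k f g" "ale k f' g'" shows "ale k (\<lambda>q j. f q j + f' q j) (\<lambda>q j. g q j + g' q j)"
proof -
  obtain C D where C: "\<And>q j. q \<ge> 1 \<Longrightarrow> f q j \<le> g q j + enat (C * (nat \<bar>j\<bar> + q) ^ k)"
    and D: "\<And>q j. q \<ge> 1 \<Longrightarrow> f' q j \<le> g' q j + enat (D * (nat \<bar>j\<bar> + q) ^ k)" using assms unfolding ale_def by blast
  have "f q j + f' q j \<le> g q j + g' q j + enat ((C + D) * (nat \<bar>j\<bar> + q) ^ k)" if q: "q \<ge> 1" for q j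
    using add_mono[OF C[OF q] D[OF q], of j j]
    by (simp add: distrib_right add_ac plus_enat_simps(1)[symmetric] del: plus_enat_simps)
  then show ?thesis by (rule aleI)
qed

lemma approx_add: "approx k f g \<Longrightarrow> approx k f' g' \<Longrightarrow> approx k (\<lambda>q j. f q j + f' q j) (\<lambda>q j. g q j + g' q j)"
  unfolding approx_def by (blast intro: ale_add)

lemma shift_power_le:
  assumes "q \<ge> 1"
  shows "(nat \<bar>j - a\<bar> + q) ^ k \<le> (nat \<bar>a\<bar> + 1) ^ k * (nat \<bar>j\<bar> + q :: nat) ^ k"
proof -
  have "nat \<bar>j - a\<bar> + q \<le> nat \<bar>a\<bar> * 1 + (nat \<bar>j\<bar> + q)" by simp
  also have "\<dots> \<le> nat \<bar>a\<bar> * (nat \<bar>j\<bar> + q) + (nat \<bar>j\<bar> + q)"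
    by (intro add_mono mult_left_mono order_refl) (use assms in auto)
  finally have "nat \<bar>j - a\<bar> + q \<le> (nat \<bar>a\<bar> + 1) * (nat \<bar>j\<bar> + q)" by simp
  then show ?thesis unfolding power_mult_distrib[symmetric] by (intro power_mono) auto
qed

lemma approx_shift:
  assumes "approx k f g" shows "approx k (\<lambda>q j. f q (j - a)) (\<lambda>q j. g q (j - a))"
proof -
  have "ale k (\<lambda>q j. f q (j - a)) (\<lambda>q j. g q (j - a))" if fg: "ale k f g" for f g
  proof -
    obtain C where C: "\<And>q j. q \<ge> 1 \<Longrightarrow> f q j \<le> g q j + enat (C * (nat \<bar>j\<bar> + q) ^ k)" using fg by (rule aleE) blast
    have *: "enat (C * (nat \<bar>j - a\<bar> + q) ^ k) \<le> enat (C * (nat \<bar>a\<bar> + 1) ^ k * (nat \<bar>j\<bar> + q) ^ k)" if "q \<ge> 1" for q j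
      unfolding enat_ord_simps mult.assoc by (intro mult_left_mono shift_power_le that) simp
    show ?thesis by (rule aleI, rule order_trans[OF C], assumption, rule add_left_mono[OF *])
  qed
  then show ?thesis using assms by (simp add: approx_def)
qed

lemma approx_sum_list:
  assumes "\<And>x. x \<in> set L \<Longrightarrow> approx k (f x) (g x)"
  shows "approx k (\<lambda>q j. \<Sum>x\<leftarrow>L. f x q j) (\<lambda>q j. \<Sum>x\<leftarrow>L. g x q j)"
  using assms by (induction L) (auto intro: approx_refl approx_add)

lemma approx_shift_all:
  assumes "approx k f (\<lambda>q j. f q (j + 1))" shows "approx k f (\<lambda>q j. f q (j - a))"
proof -
  have n: "approx k f (\<lambda>q j. f q (j + int n))" for n
  proof (induction n)
    case (Suc n)
    have "approx k (\<lambda>q j. f q (j + int n)) (\<lambda>q j. f q (j + int (Suc n)))"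
      using approx_shift[OF assms, of "- int n"] by (simp add: algebra_simps)
    with Suc show ?case by (rule approx_trans)
  qed (simp add: approx_refl)
  show ?thesis
  proof (cases "a \<le> 0")
    case True then show ?thesis using n[of "nat (- a)"] by simp
  next
    case False
    have "approx k (\<lambda>q j. f q (j - a)) f" using approx_shift[OF n[of "nat a"], of a] False by simp
    then show ?thesis by (rule approx_sym)
  qed
qed

section \<open>Maps with small kernel and cokernel\<close>

context fring_ideal begin

text \<open>The degrees j + b - q e at which \<open>comparison\<close> evaluates its error terms are
  bounded by a constant times |j| + q.\<close>

lemma bnd_err:
  assumes "bnd (Suc k) H"
  shows "\<exists>C. \<forall>q j. q \<ge> 1 \<longrightarrow> H (j + b - int q * e) \<le> enat (C * (nat \<bar>j\<bar> + q) ^ k)"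
proof -
  obtain C where C: "\<And>j. H j \<le> enat (C * (nat \<bar>j\<bar> + 1) ^ k)" using assms by auto
  have "H (j + b - int q * e) \<le> enat (C * (nat \<bar>b\<bar> + nat \<bar>e\<bar> + 1) ^ k * (nat \<bar>j\<bar> + q) ^ k)" if q: "q \<ge> 1" for q j
  proof (rule order_trans[OF C])
    have "\<bar>j + b - int q * e\<bar> \<le> \<bar>j\<bar> + \<bar>b\<bar> + int q * \<bar>e\<bar>"
      using abs_triangle_ineq4[of "j + b" "int q * e"] abs_triangle_ineq[of j b] by (simp add: abs_mult)
    then have "nat \<bar>j + b - int q * e\<bar> \<le> nat \<bar>j\<bar> + nat \<bar>b\<bar> + q * nat \<bar>e\<bar>"
      by (simp add: nat_le_iff)
    then have "nat \<bar>j + b - int q * e\<bar> + 1 \<le> nat \<bar>b\<bar> * 1 + q * nat \<bar>e\<bar> + (nat \<bar>j\<bar> + q)" using q by simp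
    also have "\<dots> \<le> nat \<bar>b\<bar> * (nat \<bar>j\<bar> + q) + (nat \<bar>j\<bar> + q) * nat \<bar>e\<bar> + (nat \<bar>j\<bar> + q)"
      by (intro add_mono mult_left_mono mult_right_mono order_refl) (use q in auto)
    also have "\<dots> = (nat \<bar>b\<bar> + nat \<bar>e\<bar> + 1) * (nat \<bar>j\<bar> + q)" by (simp add: algebra_simps)
    finally have "(nat \<bar>j + b - int q * e\<bar> + 1) ^ k \<le> ((nat \<bar>b\<bar> + nat \<bar>e\<bar> + 1) * (nat \<bar>j\<bar> + q)) ^ k"
      by (rule power_mono) simp
    then show "enat (C * (nat \<bar>j + b - int q * e\<bar> + 1) ^ k) \<le> enat (C * (nat \<bar>b\<bar> + nat \<bar>e\<bar> + 1) ^ k * (nat \<bar>j\<bar> + q) ^ k)"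
      unfolding enat_ord_simps power_mult_distrib mult.assoc by (rule mult_left_mono) simp
  qed
  then show ?thesis by blast
qed

lemma bnd_err_sum:
  assumes "bnd (Suc k) H" "finite G"
  shows "\<exists>C. \<forall>q j. q \<ge> 1 \<longrightarrow> (\<Sum>fe\<in>G. H (j + b - int q * snd fe)) \<le> enat (C * (nat \<bar>j\<bar> + q) ^ k)"
  using assms(2)
proof (induction G rule: finite_induct)
  case empty
  then show ?case by (auto simp: zero_enat_def intro!: exI[of _ 0])
next
  case (insert fe G)
  obtain C where C: "\<And>q j. q \<ge> 1 \<Longrightarrow> (\<Sum>fe\<in>G. H (j + b - int q * snd fe)) \<le> enat (C * (nat \<bar>j\<bar> + q) ^ k)"
    using insert by blast
  obtain D where D: "\<And>q j. q \<ge> 1 \<Longrightarrow> H (j + b - int q * snd fe) \<le> enat (D * (nat \<bar>j\<bar> + q) ^ k)"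
    using bnd_err[OF assms(1)] by blast
  have "(\<Sum>fe\<in>insert fe G. H (j + b - int q * snd fe)) \<le> enat ((D + C) * (nat \<bar>j\<bar> + q) ^ k)" if "q \<ge> 1" for q j
    unfolding sum.insert[OF insert(1,2)] distrib_right plus_enat_simps(1)[symmetric]
    by (intro add_mono C D that)
  then show ?case by blast
qed

lemma comparison_approx:
  assumes g1: "gm Q1 N1 Z1" and g2: "gm Q2 N2 Z2" and m: "ppow m" and Q2: "Q2 = Q1 * m"
    and hN: "\<And>j x. x \<in> N1 j \<Longrightarrow> x ^ m * t \<in> N2 (j + a)"
    and hZ: "\<And>j x. x \<in> Z1 j \<Longrightarrow> x ^ m * t \<in> Z2 (j + a)"
    and ker: "bnd (Suc k) (\<lambda>j. len (kst Q1) (Z1 j) {x \<in> N1 j. x ^ m * t \<in> Z2 (j + a)})"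
    and cok: "bnd (Suc k) (\<lambda>j. len (kst Q2) ((\<lambda>x. x ^ m * t) ` N1 (j - a) + Z2 j) (N2 j))"
  shows "approx k (\<lambda>q. \<phi> Q1 q N1 Z1) (\<lambda>q j. \<phi> Q2 q N2 Z2 (j + a))"
proof -
  obtain C1 where C1: "\<And>q j. q \<ge> 1 \<Longrightarrow>
     len (kst Q1) (Z1 j) {x \<in> N1 j. x ^ m * t \<in> Z2 (j + a)} \<le> enat (C1 * (nat \<bar>j\<bar> + q) ^ k)"
    using bnd_err[OF ker, of 0 0] by auto
  obtain C2 where C2: "\<And>q j. q \<ge> 1 \<Longrightarrow> (\<Sum>fe\<in>F. len (kst Q2) ((\<lambda>x. x ^ m * t) ` N1 (j - int q * snd fe) + Z2 (j + a - int q * snd fe)) (N2 (j + a - int q * snd fe)))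
     \<le> enat (C2 * (nat \<bar>j\<bar> + q) ^ k)"
    using bnd_err_sum[OF cok finite_F, of a] by (auto simp: algebra_simps)
  obtain C3 where C3: "\<And>q j. q \<ge> 1 \<Longrightarrow> len (kst Q2) ((\<lambda>x. x ^ m * t) ` N1 j + Z2 (j + a)) (N2 (j + a)) \<le> enat (C3 * (nat \<bar>j\<bar> + q) ^ k)"
    using bnd_err[OF cok, of a 0] by auto
  note cmp = comparison[OF g1 g2 m Q2 hN hZ]
  show ?thesis
  proof (rule approxI[where C = "C1 + C2" and C' = C3])
    fix q :: nat and j :: int assume q: "q \<ge> 1"
    show "\<phi> Q1 q N1 Z1 j \<le> \<phi> Q2 q N2 Z2 (j + a) + enat ((C1 + C2) * (nat \<bar>j\<bar> + q) ^ k)"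
      unfolding distrib_right plus_enat_simps(1)[symmetric]
      by (rule order_trans[OF cmp(1) add_left_mono[OF add_mono[OF C1[OF q] C2[OF q]]]])
    show "\<phi> Q2 q N2 Z2 (j + a) \<le> \<phi> Q1 q N1 Z1 j + enat (C3 * (nat \<bar>j\<bar> + q) ^ k)"
      by (rule order_trans[OF cmp(2) add_left_mono[OF C3[OF q]]])
  qed
qed

text \<open>Kernel and cokernel of multiplication by \<open>x\<close> are killed by
  \<open>x\<close>, which lies outside all members of \<open>B\<close>; so
  \<open>small_bound\<close> applies to both.\<close>

lemma shift_by:
  assumes g: "gm Q N Z" and n: "noeth Q N Z" and Q: "ppow Q" and c: "cover (Suc k) B Q N Z" and B: "topset (Suc k) B"
    and x: "x \<in> R \<Delta>" "\<And>P. P \<in> B \<Longrightarrow> x \<notin> P \<Delta>"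
  shows "approx k (\<lambda>q. \<phi> Q q N Z) (\<lambda>q j. \<phi> Q q N Z (j + \<Delta>))"
proof -
  note Nc = gmD(1)[OF g] and Zc = gmD(2)[OF g]
  let ?t = "x ^ Q"
  have hN: "v ^ 1 * ?t \<in> N (j + \<Delta>)" if "v \<in> N j" for v j
    using cl_mult'[OF Nc x(1) that, of "j + \<Delta>"] by (simp add: mult.commute)
  have hZ: "v ^ 1 * ?t \<in> Z (j + \<Delta>)" if "v \<in> Z j" for v j
    using cl_mult'[OF Zc x(1) that, of "j + \<Delta>"] by (simp add: mult.commute)
  show ?thesis
  proof (rule comparison_approx[OF g g ppow_1 _ hN hZ])
    let ?K = "\<lambda>j. {v \<in> N j. v ^ 1 * ?t \<in> Z (j + \<Delta>)}"
    have K: "?K = (\<lambda>j. {v \<in> N j. ?t * v \<in> Z (j + \<Delta>)})" by (simp add: mult.commute)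
    have Kc: "cl Q ?K" unfolding K by (rule cl_preimage[OF Nc Zc])
    have KN: "?K \<le> N" and ZK: "Z \<le> ?K" using gmD(3)[OF g] hZ by (auto simp: le_fun_def)
    show "bnd (Suc k) (\<lambda>j. len (kst Q) (Z j) (?K j))"
    proof (rule small_bound[OF _ noeth_sub[OF n order_refl KN] Q cover_mono[OF c order_refl KN] B])
      show "gm Q ?K Z" unfolding gm_def using Kc Zc ZK by blast
      fix P u a assume "P \<in> B" "u \<in> ?K a"
      then have "x ^ Q * u \<in> Z (\<Delta> + a)" by (simp add: mult.commute add.commute)
      then show "\<exists>i w. w \<in> R i \<and> w \<notin> P i \<and> w ^ Q * u \<in> Z (i + a)" using x \<open>P \<in> B\<close> by blast
    qed
    let ?I = "\<lambda>j. (\<lambda>v. v ^ 1 * ?t) ` N (j - \<Delta>) + Z j"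
    have ZI: "Z \<le> ?I" by (intro le_funI subset_image_plus sgp_zero[OF cl_sgp[OF Nc]]) simp
    have Ic: "cl Q ?I" unfolding cl_def
    proof (intro conjI allI ballI)
      fix j
      have "kst Q (?I j)"
        by (rule kst_image[OF _ cl_kst[OF Zc] ad_ppow[OF ppow_1 cl_K[OF Zc]] cl_kst[OF Nc]]) simp
      then show "sgp (?I j)" by (rule L_sgp)
      show "K \<subseteq> ?I j" using cl_K[OF Zc, of j] ZI by (auto simp: le_fun_def)
      fix i r v assume r: "r \<in> R i" and "v \<in> ?I j"
      then obtain b z where bz: "b \<in> N (j - \<Delta>)" "z \<in> Z j" "v = b ^ 1 * ?t + z" by (auto elim!: set_plus_elim)
      have "(r ^ Q * b) ^ 1 * ?t + r ^ Q * z \<in> ?I (i + j)"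
        using cl_mult'[OF Nc r bz(1), of "i + j - \<Delta>"] cl_mult[OF Zc r bz(2)] by (intro set_plus_intro imageI) auto
      then show "r ^ Q * v \<in> ?I (i + j)" by (simp add: bz algebra_simps)
    qed
    have IN: "?I j \<subseteq> N j" for j
      using hN[of _ "j - \<Delta>"] gmD(3)[OF g] by (intro plus_subset cl_sgp[OF Nc]) auto
    show "bnd (Suc k) (\<lambda>j. len (kst Q) (?I j) (N j))"
    proof (rule small_bound[OF gmI[OF Nc Ic IN] noeth_sub[OF n ZI order_refl] Q cover_mono[OF c ZI order_refl] B])
      fix P u a assume P: "P \<in> B" and u: "u \<in> N a"
      have "u ^ 1 * ?t + 0 \<in> ?I (\<Delta> + a)" using u sgp_zero[OF cl_sgp[OF Zc]] by (intro set_plus_intro imageI) auto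
      then have "x ^ Q * u \<in> ?I (\<Delta> + a)" by (simp add: mult.commute[of u])
      then show "\<exists>i w. w \<in> R i \<and> w \<notin> P i \<and> w ^ Q * u \<in> ?I (i + a)"
        by (intro exI[of _ \<Delta>] exI[of _ x] conjI x(1) x(2)[OF P])
    qed
  qed simp
qed

text \<open>Over a finite field a degree one element avoiding all members of \<open>B\<close> need
  not exist. Two elements of consecutive large degrees do exist, and comparing their shifts gives
  the shift by one.\<close>

lemma shift:
  assumes g: "gm Q N Z" and n: "noeth Q N Z" and Q: "ppow Q" and c: "cover (Suc k) B Q N Z" and B: "topset (Suc k) B"
  shows "approx k (\<lambda>q. \<phi> Q q N Z) (\<lambda>q j. \<phi> Q q N Z (j + 1))"
proof -
  obtain \<Delta> where \<Delta>: "\<And>\<Delta>'. \<Delta>' \<ge> \<Delta> \<Longrightarrow> \<exists>x\<in>R \<Delta>'. \<forall>P\<in>B. x \<notin> P \<Delta>'" using exists_shift[OF B] by blast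
  have *: "approx k (\<lambda>q. \<phi> Q q N Z) (\<lambda>q j. \<phi> Q q N Z (j + \<Delta>'))" if "\<Delta>' \<ge> \<Delta>" for \<Delta>'
    using \<Delta>[OF that] shift_by[OF g n Q c B] by blast
  have "approx k (\<lambda>q. \<phi> Q q N Z) (\<lambda>q j. \<phi> Q q N Z (j + (\<Delta> + 1)))" by (rule *) simp
  moreover have "approx k (\<lambda>q j. \<phi> Q q N Z (j + 1)) (\<lambda>q j. \<phi> Q q N Z (j + (\<Delta> + 1)))"
    using approx_shift[OF *[OF order_refl], of "-1"] by (simp add: algebra_simps)
  ultimately show ?thesis using approx_trans approx_sym by blast
qed

lemma \<phi>_finite:
  assumes g: "gm Q N Z" and n: "noeth Q N Z" and Q: "ppow Q" and c: "cover D B Q N Z" and B: "topset D B"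
  shows "\<exists>C. \<forall>q j. \<phi> Q q N Z j \<le> enat (C * (nat \<bar>j\<bar> + 1) ^ D)"
proof -
  obtain C where C: "\<And>j. len (kst Q) (Z j) (N j) \<le> enat (C * (nat \<bar>j\<bar> + 1) ^ D)"
    using cover_bound[OF g n Q c B] by auto
  show ?thesis by (intro exI[of _ C] allI order_trans[OF \<phi>_le[OF g] C])
qed

subsection \<open>Adding a cyclic summand\<close>

lemma rsp_elim:
  assumes "c \<in> rsp Q u a j" obtains s k where "s \<in> R (j - a)" "k \<in> K" "c = s ^ Q * u + k"
  using assms by (auto simp: rsp_def elim!: set_plus_elim)

text \<open>Separates a member of J^[q] (U + R u) into a part from \<open>U\<close> and a multiple
  of u by an element of J^[q]. The latter is written as a single Q-th power, which is how the ring
  acts on u.\<close>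

lemma JN_rspD:
  assumes U: "cl Q U" and Z: "cl Q Z" and Q: "ppow Q" and x: "x \<in> JN Q q (\<lambda>j. U j + rsp Q u a j) Z j"
  shows "\<exists>w c. w \<in> JN Q q U Z j \<and> (\<forall>fe\<in>F. c fe \<in> R (j - a - int q * snd fe)) \<and>
     x = w + (\<Sum>fe\<in>F. fst fe ^ q * c fe) ^ Q * u"
proof -
  obtain z v where zv: "z \<in> Z j" "\<forall>fe\<in>F. v fe \<in> U (j - int q * snd fe) + rsp Q u a (j - int q * snd fe)"
    "x = z + (\<Sum>fe\<in>F. fst fe ^ (q * Q) * v fe)" using JN_memD[OF x] by blast
  have "\<forall>fe\<in>F. \<exists>bsk. fst bsk \<in> U (j - int q * snd fe) \<and> fst (snd bsk) \<in> R (j - int q * snd fe - a) \<and>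
      snd (snd bsk) \<in> K \<and> v fe = fst bsk + (fst (snd bsk) ^ Q * u + snd (snd bsk))"
  proof
    fix fe assume "fe \<in> F"
    then have "v fe \<in> U (j - int q * snd fe) + rsp Q u a (j - int q * snd fe)" using zv by blast
    then obtain b c where b: "b \<in> U (j - int q * snd fe)" "c \<in> rsp Q u a (j - int q * snd fe)" "v fe = b + c" by (rule set_plus_elim)
    from b(2) obtain s k where "s \<in> R (j - int q * snd fe - a)" "k \<in> K" "c = s ^ Q * u + k" by (rule rsp_elim)
    then show "\<exists>bsk. fst bsk \<in> U (j - int q * snd fe) \<and> fst (snd bsk) \<in> R (j - int q * snd fe - a) \<and>
      snd (snd bsk) \<in> K \<and> v fe = fst bsk + (fst (snd bsk) ^ Q * u + snd (snd bsk))"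
      using b by (intro exI[of _ "(b, s, k)"]) simp
  qed
  from bchoice[OF this] obtain h where h: "\<And>fe. fe \<in> F \<Longrightarrow> fst (h fe) \<in> U (j - int q * snd fe)"
    "\<And>fe. fe \<in> F \<Longrightarrow> fst (snd (h fe)) \<in> R (j - int q * snd fe - a)" "\<And>fe. fe \<in> F \<Longrightarrow> snd (snd (h fe)) \<in> K"
    "\<And>fe. fe \<in> F \<Longrightarrow> v fe = fst (h fe) + (fst (snd (h fe)) ^ Q * u + snd (snd (h fe)))" by blast
  define b s k where "b fe = fst (h fe)" and "s fe = fst (snd (h fe))" and "k fe = snd (snd (h fe))" for fe
  let ?f = "\<lambda>fe. fst fe ^ (q * Q)"
  let ?S = "\<Sum>fe\<in>F. fst fe ^ q * s fe"
  \<comment> \<open>\<open>kk\<close> collects the parts from \<open>K\<close> in the cyclic terms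
    and the failure of Q-th powers to be additive. It lies in \<open>K\<close>, so the
    \<open>Z\<close>-component absorbs it.\<close>
  define kk where "kk = (\<Sum>fe\<in>F. ?f fe * k fe) - (?S ^ Q * u - (\<Sum>fe\<in>F. (fst fe ^ q * s fe) ^ Q) * u)"
  have "(\<Sum>fe\<in>F. ?f fe * k fe) \<in> K" by (rule sgp_sum[OF sgp_K]) (use h in \<open>auto simp: k_def intro: K_ideal\<close>)
  then have "kk \<in> K" unfolding kk_def by (intro sgp_diff[OF sgp_K] K_times' frobenius_sum[OF Q finite_F])
  then have "z + kk \<in> Z j" using zv(1) cl_K[OF Z, of j] by (intro sgp_add[OF cl_sgp[OF Z]]) auto
  then have w: "(z + kk) + (\<Sum>fe\<in>F. ?f fe * b fe) \<in> JN Q q U Z j" by (rule JN_memI) (simp add: b_def h)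
  have "(\<Sum>fe\<in>F. ?f fe * v fe) = (\<Sum>fe\<in>F. ?f fe * b fe + ((fst fe ^ q * s fe) ^ Q * u + ?f fe * k fe))"
    by (intro sum.cong refl)
      (simp add: h b_def s_def k_def power_mult_distrib power_mult distrib_left mult.assoc)
  also have "\<dots> = (\<Sum>fe\<in>F. ?f fe * b fe) + ((\<Sum>fe\<in>F. (fst fe ^ q * s fe) ^ Q) * u + (\<Sum>fe\<in>F. ?f fe * k fe))"
    by (simp add: sum.distrib sum_distrib_right)
  finally have "x = ((z + kk) + (\<Sum>fe\<in>F. ?f fe * b fe)) + ?S ^ Q * u"
    unfolding zv(3) kk_def by (simp add: algebra_simps)
  moreover have "\<forall>fe\<in>F. s fe \<in> R (j - a - int q * snd fe)"
    using h(2) by (auto simp: s_def algebra_simps)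
  ultimately show ?thesis using w by blast
qed

lemma JN_rspI:
  assumes U: "cl Q U" and Z: "cl Q Z" and Q: "ppow Q" and c: "\<And>fe. fe \<in> F \<Longrightarrow> c fe \<in> R (j - a - int q * snd fe)"
  shows "(\<Sum>fe\<in>F. fst fe ^ q * c fe) ^ Q * u \<in> JN Q q (\<lambda>j. U j + rsp Q u a j) Z j"
proof -
  let ?S = "\<Sum>fe\<in>F. fst fe ^ q * c fe"
  define kk where "kk = ?S ^ Q * u - (\<Sum>fe\<in>F. (fst fe ^ q * c fe) ^ Q) * u"
  have "kk \<in> K" unfolding kk_def by (intro K_times' frobenius_sum[OF Q finite_F])
  then have kk: "kk \<in> Z j" using cl_K[OF Z] by blast
  have "c fe ^ Q * u \<in> U (j - int q * snd fe) + rsp Q u a (j - int q * snd fe)" if fe: "fe \<in> F" for fe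
  proof -
    have "c fe ^ Q * u + 0 \<in> rsp Q u a (j - int q * snd fe)" unfolding rsp_def
      using c[OF fe] sgp_zero[OF sgp_K] by (intro set_plus_intro imageI) (simp add: algebra_simps)
    then have "0 + (c fe ^ Q * u + 0) \<in> U (j - int q * snd fe) + rsp Q u a (j - int q * snd fe)"
      using sgp_zero[OF cl_sgp[OF U]] by (intro set_plus_intro)
    then show ?thesis by simp
  qed
  then have "kk + (\<Sum>fe\<in>F. fst fe ^ (q * Q) * (c fe ^ Q * u)) \<in> JN Q q (\<lambda>j. U j + rsp Q u a j) Z j"
    by (intro JN_memI kk)
  moreover have "(\<Sum>fe\<in>F. fst fe ^ (q * Q) * (c fe ^ Q * u)) = (\<Sum>fe\<in>F. (fst fe ^ q * c fe) ^ Q) * u"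
    by (simp add: sum_distrib_right power_mult_distrib power_mult mult.assoc)
  ultimately show ?thesis by (simp add: kk_def)
qed

lemma sum_F_R:
  assumes "\<And>fe. fe \<in> F \<Longrightarrow> c fe \<in> R (j - int q * snd fe)"
  shows "(\<Sum>fe\<in>F. fst fe ^ q * c fe) \<in> R j"
proof (rule sgp_sum[OF sgp_R])
  fix fe assume fe: "fe \<in> F"
  from R_mult[OF power_R[OF F_R[OF fe], of q] assms[OF fe]] show "fst fe ^ q * c fe \<in> R j" by simp
qed

text \<open>By \<open>dir\<close> and \<open>kill\<close>, the multiples of u that fall into
  \<open>U\<close> come from \<open>P\<close> and hence already lie in \<open>Z\<close>. So (U + R
  u) / Z is the direct sum of U / Z and a shift of R / P, and lengths modulo J^[q] add without
  error.\<close>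

lemma \<phi>_add_cyclic:
  assumes U: "cl Q U" and Z: "cl Q Z" "Z \<le> U" and Q: "ppow Q" and P: "hp P"
    and dir: "\<And>i r. r \<in> R i \<Longrightarrow> r ^ Q * u \<in> U (i + a) \<Longrightarrow> r \<in> P i"
    and kill: "\<And>i r. r \<in> P i \<Longrightarrow> r ^ Q * u \<in> Z (i + a)"
  shows "\<phi> Q q (\<lambda>j. U j + rsp Q u a j) Z j = \<phi> Q q U Z j + \<phi> 1 q R P (j - a)"
proof -
  define V where "V = (\<lambda>j. U j + rsp Q u a j)"
  note Pc = hpD(1)[OF P]
  have V: "cl Q V" unfolding V_def by (rule cl_plus[OF U cl_rsp[OF Q]])
  have UV: "U i \<subseteq> V i" for i unfolding V_def by (rule subset_plus_left[OF cl_sgp[OF cl_rsp[OF Q]]])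
  have gU: "gm Q U Z" unfolding gm_def using U Z by blast
  have ZV: "Z i \<subseteq> V i" for i using gmD(3)[OF gU, of i] UV[of i] by blast
  have gV: "gm Q V Z" by (rule gmI[OF V Z(1) ZV])
  have gP: "gm 1 R P" by (rule gmI[OF cl_R Pc hpD(2)[OF P]])
  let ?J = "JN Q q V Z j"
  let ?t = "\<lambda>x. x ^ Q * u"
  have JU: "JN Q q U Z j \<subseteq> ?J"
    by (rule JN_subset[OF JN_sgp[OF gV] JN_Z[OF gV]]) (use JN_F[OF gV] UV in blast)
  have JUU: "JN Q q U Z j \<subseteq> U j" by (rule JN_N[OF gU])
  have D: "\<exists>w s. w \<in> JN Q q U Z j \<and> s \<in> JN 1 q R P (j - a) \<and> s \<in> R (j - a) \<and> x = w + ?t s" if xJ: "x \<in> ?J" for x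
  proof -
    obtain w c where wc: "w \<in> JN Q q U Z j" "\<forall>fe\<in>F. c fe \<in> R (j - a - int q * snd fe)"
      "x = w + (\<Sum>fe\<in>F. fst fe ^ q * c fe) ^ Q * u"
      using JN_rspD[OF U Z(1) Q xJ[unfolded V_def]] by blast
    have "0 + (\<Sum>fe\<in>F. fst fe ^ (q * 1) * c fe) \<in> JN 1 q R P (j - a)"
      by (rule JN_memI) (use wc sgp_zero[OF cl_sgp[OF Pc]] in auto)
    moreover have "(\<Sum>fe\<in>F. fst fe ^ q * c fe) \<in> R (j - a)" using wc(2) by (intro sum_F_R) auto
    ultimately show ?thesis using wc by (intro exI[of _ w] exI[of _ "\<Sum>fe\<in>F. fst fe ^ q * c fe"]) simp
  qed
  have tu: "s \<in> P (j - a)" if "s \<in> R (j - a)" "?t s \<in> U j" for s using dir[OF that(1)] that(2) by simp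
  have ku: "?t s \<in> Z j" if "s \<in> P (j - a)" for s using kill[OF that] by simp
  have kJ: "kst Q ?J" "kst Q (U j)" "kst Q (V j)" "kst Q (U j + ?J)" "?J \<subseteq> V j"
    using JN_kst[OF gV] cl_kst[OF U] cl_kst[OF V] L_plus JN_N[OF gV] by auto
  have 1: "?J \<inter> U j = JN Q q U Z j"
  proof
    show "?J \<inter> U j \<subseteq> JN Q q U Z j"
    proof
      fix x assume x: "x \<in> ?J \<inter> U j"
      then obtain w s where ws: "w \<in> JN Q q U Z j" "s \<in> R (j - a)" "x = w + ?t s" using D by blast
      have "x - w \<in> U j" using x ws JUU by (intro sgp_diff[OF cl_sgp[OF U]]) auto
      then have "s \<in> P (j - a)" using ws by (intro tu) auto
      then have "?t s \<in> JN Q q U Z j" using ku JN_Z[OF gU] by blast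
      then show "x \<in> JN Q q U Z j" unfolding ws(3) by (rule sgp_add[OF JN_sgp[OF gU] ws(1)])
    qed
  qed (use JU JUU in blast)
  have UJV: "U j + ?J \<subseteq> V j" by (rule plus_subset[OF cl_sgp[OF V] UV kJ(5)])
  have "\<phi> Q q V Z j = len (kst Q) ?J (U j + ?J) + len (kst Q) (U j + ?J) (V j)"
    unfolding \<phi>_def using len_add[OF kJ(3,4,1) subset_plus_right[OF cl_sgp[OF U]] UJV] .
  also have "len (kst Q) ?J (U j + ?J) = \<phi> Q q U Z j"
    using len_Int_eq[OF kJ(2,1)] 1 by (simp add: \<phi>_def Int_commute)
  also have "len (kst Q) (U j + ?J) (V j) = \<phi> 1 q R P (j - a)"
  proof -
    let ?B = "JN 1 q R P (j - a)"
    have K: "K \<subseteq> U j + ?J" using cl_K[OF U, of j] subset_plus_left[OF L_sgp[OF kJ(1)], of "U j"] by blast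
    note zero = subset_image_plus[OF _ ppow_pos[OF Q]]
    have sJ: "sgp (U j + ?J)" by (rule L_sgp[OF kJ(4)])
    have B: "?t ` ?B + (U j + ?J) = U j + ?J"
    proof
      have tB: "?t s \<in> U j + ?J" if sB: "s \<in> ?B" for s
      proof -
        obtain z c where zc: "z \<in> P (j - a)" "\<forall>fe\<in>F. c fe \<in> R (j - a - int q * snd fe)"
          "s = z + (\<Sum>fe\<in>F. fst fe ^ q * c fe)" using JN_memD[OF sB] by auto
        have "(z + (\<Sum>fe\<in>F. fst fe ^ q * c fe)) ^ Q * u - (z ^ Q + (\<Sum>fe\<in>F. fst fe ^ q * c fe) ^ Q) * u \<in> K"
          by (intro K_times' frobenius_add[OF Q])
        moreover have "?t z \<in> U j" using ku[OF zc(1)] gmD(3)[OF gU] by blast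
        moreover have "?t (\<Sum>fe\<in>F. fst fe ^ q * c fe) \<in> ?J" unfolding V_def
          using zc(2) by (intro JN_rspI U Z Q) auto
        ultimately have "?t s - (?t z + ?t (\<Sum>fe\<in>F. fst fe ^ q * c fe)) \<in> U j + ?J"
          "?t z + ?t (\<Sum>fe\<in>F. fst fe ^ q * c fe) \<in> U j + ?J"
          using K zc(3) by (auto simp: distrib_right)
        then show ?thesis using sgp_cong[OF sJ] by blast
      qed
      show "?t ` ?B + (U j + ?J) \<subseteq> U j + ?J"
        by (rule plus_subset[OF sJ image_subsetI[OF tB] order_refl])
      show "U j + ?J \<subseteq> ?t ` ?B + (U j + ?J)" by (rule zero[OF sgp_zero[OF JN_sgp[OF gP]]])
    qed
    have A: "?t ` R (j - a) + (U j + ?J) = V j"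
    proof
      have tV: "?t s \<in> V j" if "s \<in> R (j - a)" for s
      proof -
        have "?t s + 0 \<in> rsp Q u a j" unfolding rsp_def using that sgp_zero[OF sgp_K] by (intro set_plus_intro imageI)
        then have "0 + (?t s + 0) \<in> V j" unfolding V_def using sgp_zero[OF cl_sgp[OF U]] by (intro set_plus_intro)
        then show ?thesis by simp
      qed
      show "?t ` R (j - a) + (U j + ?J) \<subseteq> V j"
        by (rule plus_subset[OF cl_sgp[OF V] image_subsetI[OF tV] UJV])
      show "V j \<subseteq> ?t ` R (j - a) + (U j + ?J)"
      proof
        fix x assume "x \<in> V j"
        then obtain b c where bc: "b \<in> U j" "c \<in> rsp Q u a j" "x = b + c" unfolding V_def by (rule set_plus_elim)
        from bc(2) obtain s k where sk: "s \<in> R (j - a)" "k \<in> K" "c = s ^ Q * u + k" by (rule rsp_elim)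
        have "b + k \<in> U j" using bc sk cl_K[OF U, of j] by (intro sgp_add[OF cl_sgp[OF U]]) auto
        then have "b + k \<in> U j + ?J" using subset_plus_left[OF L_sgp[OF kJ(1)], of "U j"] by blast
        from set_plus_intro[OF imageI[OF sk(1), of ?t] this]
        have "?t s + (b + k) \<in> ?t ` R (j - a) + (U j + ?J)" .
        then show "x \<in> ?t ` R (j - a) + (U j + ?J)" by (simp add: bc sk add_ac)
      qed
    qed
    have "len (kst Q) (?t ` ?B + (U j + ?J)) (?t ` R (j - a) + (U j + ?J)) = len (kst 1) ?B (R (j - a))"
    proof (rule len_image_eq[OF _ kJ(4) ad_ppow[OF Q K] cl_kst[OF cl_R] JN_kst[OF gP] JN_N[OF gP]])
      fix r assume r: "r \<in> R (j - a)" "?t r \<in> ?t ` ?B + (U j + ?J)"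
      then have "?t r \<in> U j + ?J" using B by simp
      then obtain b y where by': "b \<in> U j" "y \<in> ?J" "?t r = b + y" by (rule set_plus_elim)
      obtain w s where ws: "w \<in> JN Q q U Z j" "s \<in> ?B" "s \<in> R (j - a)" "y = w + ?t s" using D[OF by'(2)] by blast
      have "?t r - ?t s = b + w" using by' ws by simp
      then have "?t r - ?t s \<in> U j" using by' ws JUU sgp_add[OF cl_sgp[OF U], of b j w] by auto
      moreover have "(r - s) ^ Q * u - (?t r - ?t s) \<in> U j" by (rule ad_ppow[OF Q cl_K[OF U]])
      ultimately have "?t (r - s) \<in> U j" using sgp_cong[OF cl_sgp[OF U]] by blast
      then have "r - s \<in> P (j - a)" using r ws by (intro tu sgp_diff[OF sgp_R])
      then have "r - s \<in> ?B" using JN_Z[OF gP] by blast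
      from sgp_add[OF JN_sgp[OF gP] this ws(2)] show "r \<in> ?B" by simp
    qed simp
    then show ?thesis unfolding A B \<phi>_def .
  qed
  finally show ?thesis unfolding V_def .
qed

subsection \<open>Modules killed by the radical\<close>

text \<open>Let \<open>U\<close> be maximal among the submodules that, modulo \<open>Z\<close>, have
  the lengths of a direct sum of shifted R / P with P in \<open>B\<close>. Given P in
  \<open>B\<close> and x in \<open>N\<close>, choose y in all members of \<open>A\<close> other than
  P but not in P. Then u = y^Q x is killed by P, because products with y lie in every member of
  \<open>A\<close>. Either u generates a further direct summand, so that u is in \<open>U\<close> by
  maximality, or a scalar outside P moves u into \<open>U\<close>. So N / U vanishes locally at P
  and is small; finally \<open>shift\<close> removes the degree shifts.\<close>

lemma decomposition:
  assumes g: "gm Q N Z" and n: "noeth Q N Z" and Q: "ppow Q" and c: "cover (Suc k) B Q N Z" and B: "topset (Suc k) B"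
    and A: "finite A" "\<And>P. P \<in> A \<Longrightarrow> hp P" "B \<subseteq> A" "\<And>P P'. P \<in> B \<Longrightarrow> P' \<in> A \<Longrightarrow> P' \<le> P \<Longrightarrow> P' = P"
    and kill: "\<And>i r j x. r \<in> R i \<Longrightarrow> \<forall>P\<in>A. r \<in> P i \<Longrightarrow> x \<in> N j \<Longrightarrow> r ^ Q * x \<in> Z (i + j)"
  shows "\<exists>L. set L \<subseteq> B \<and> approx k (\<lambda>q. \<phi> Q q N Z) (\<lambda>q j. \<Sum>P\<leftarrow>L. \<phi> 1 q R P j)"
proof -
  define Pr where "Pr U \<longleftrightarrow> cl Q U \<and> Z \<le> U \<and> U \<le> N \<and> (\<exists>L :: ((int \<Rightarrow> 'r set) \<times> int) list. fst ` set L \<subseteq> B \<and>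
    (\<forall>q j. \<phi> Q q U Z j = (\<Sum>Pa\<leftarrow>L. \<phi> 1 q R (fst Pa) (j - snd Pa))))" for U
  note Nc = gmD(1)[OF g] and Zc = gmD(2)[OF g]
  have "Pr Z" unfolding Pr_def using Zc g \<phi>_zero[OF Zc] by (intro conjI exI[of _ "[]"]) (auto simp: gm_def)
  then obtain U where U: "Pr U" and max: "\<And>V. Pr V \<Longrightarrow> U \<le> V \<Longrightarrow> V = U"
    using noeth_maximal[OF n, of Pr Z] by (auto simp: Pr_def)
  have Uc: "cl Q U" "Z \<le> U" "U \<le> N" using U by (auto simp: Pr_def)
  obtain L where L: "fst ` set L \<subseteq> B" "\<And>q j. \<phi> Q q U Z j = (\<Sum>Pa\<leftarrow>L. \<phi> 1 q R (fst Pa) (j - snd Pa))"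
    using U by (auto simp: Pr_def)
  have UN: "U j \<subseteq> N j" and ZU: "Z j \<subseteq> U j" for j using Uc by (auto simp: le_fun_def)
  have w: "\<exists>i w. w \<in> R i \<and> w \<notin> P i \<and> w ^ Q * x \<in> U (i + b)" if P: "P \<in> B" and x: "x \<in> N b" for P x b
  proof -
    have hP: "hp P" using B P by (auto simp: topset_def)
    obtain e y where y: "y \<in> R e" "y \<notin> P e" "\<forall>P'\<in>A - {P}. y \<in> P' e"
      using prime_avoid[of "A - {P}" P] A hP P by blast
    define u where "u = y ^ Q * x"
    have u: "u \<in> N (e + b)" unfolding u_def by (rule cl_mult[OF Nc y(1) x])
    have ku: "r ^ Q * u \<in> Z (i + (e + b))" if r: "r \<in> P i" for i r
    proof -
      have rR: "r \<in> R i" using hpD(2)[OF hP] r by blast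
      have "r * y \<in> P' (i + e)" if "P' \<in> A" for P'
      proof (cases "P' = P")
        case True
        have "y * r \<in> P (e + i)" by (rule hpD(5)[OF hP y(1) r])
        then show ?thesis using True by (simp add: mult.commute add.commute)
      next
        case False
        then show ?thesis using hpD(5)[OF A(2)[OF that] rR, of y e] y that by blast
      qed
      then have "(r * y) ^ Q * x \<in> Z (i + e + b)" by (intro kill[OF R_mult[OF rR y(1)]] x) auto
      then show ?thesis by (simp add: u_def power_mult_distrib mult.assoc add.assoc)
    qed
    show ?thesis
    proof (cases "\<forall>i r. r \<in> R i \<longrightarrow> r ^ Q * u \<in> U (i + (e + b)) \<longrightarrow> r \<in> P i")
      case True
      define V where "V = (\<lambda>j. U j + rsp Q u (e + b) j)"
      have V: "cl Q V" unfolding V_def by (rule cl_plus[OF Uc(1) cl_rsp[OF Q]])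
      have UV: "U j \<subseteq> V j" for j unfolding V_def by (rule subset_plus_left[OF cl_sgp[OF cl_rsp[OF Q]]])
      have "V j \<subseteq> N j" for j
        unfolding V_def using UN rsp_le[OF Nc u] by (intro plus_subset cl_sgp[OF Nc]) (auto simp: le_fun_def)
      then have VN: "V \<le> N" by (simp add: le_fun_def)
      have "\<phi> Q q V Z j = (\<Sum>Pa\<leftarrow>(P, e + b) # L. \<phi> 1 q R (fst Pa) (j - snd Pa))" for q j
        using \<phi>_add_cyclic[OF Uc(1) Zc Uc(2) Q hP, of u "e + b" q j] True ku L(2)[of q j]
        by (simp add: V_def add.commute)
      moreover have "fst ` set ((P, e + b) # L) \<subseteq> B" using L P by simp
      moreover have "Z \<le> V" using order_trans[OF Uc(2), of V] UV by (simp add: le_fun_def)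
      ultimately have "Pr V" unfolding Pr_def using V VN by blast
      then have "V = U" using max UV by (simp add: le_fun_def)
      moreover have "u \<in> V (e + b)" unfolding V_def
        by (rule subsetD[OF subset_plus_right[OF cl_sgp[OF Uc(1)]] rsp_self[OF Q]])
      ultimately show ?thesis using y by (auto simp: u_def)
    next
      case False
      then obtain i r where r: "r \<in> R i" "r ^ Q * u \<in> U (i + (e + b))" "r \<notin> P i" by blast
      have "r * y \<notin> P (i + e)" using hpD(4)[OF hP r(1) y(1)] r y by blast
      moreover have "(r * y) ^ Q * x \<in> U (i + e + b)"
        using r(2) by (simp add: u_def power_mult_distrib mult.assoc add.assoc)
      ultimately show ?thesis using R_mult[OF r(1) y(1)] by blast
    qed
  qed
  have gUZ: "gm Q U Z" by (rule gmI[OF Uc(1) Zc ZU])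
  have b: "bnd (Suc k) (\<lambda>j. len (kst Q) (U j) (N j))"
    by (rule small_bound[OF gmI[OF Nc Uc(1) UN] noeth_sub[OF n Uc(2) order_refl] Q cover_mono[OF c Uc(2) order_refl] B w])
  have "approx k (\<lambda>q. \<phi> Q q U Z) (\<lambda>q j. \<phi> Q q N Z (j + 0))"
  proof (rule comparison_approx[OF gUZ g ppow_1, where t = 1])
    have "{x \<in> U j. x ^ 1 * 1 \<in> Z (j + 0)} = Z j" for j using ZU[of j] by auto
    then show "bnd (Suc k) (\<lambda>j. len (kst Q) (Z j) {x \<in> U j. x ^ 1 * 1 \<in> Z (j + 0)})"
      by (simp add: len_same bnd_zero del: bnd.simps)
    have "(\<lambda>x. x ^ 1 * 1) ` U (j - 0) + Z j = U j" for j
      using plus_absorb[OF cl_sgp[OF Uc(1)] cl_sgp[OF Zc] ZU[of j]] by simp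
    then show "bnd (Suc k) (\<lambda>j. len (kst Q) ((\<lambda>x. x ^ 1 * 1) ` U (j - 0) + Z j) (N j))"
      using b by (simp del: bnd.simps)
  qed (use UN in auto)
  then have "approx k (\<lambda>q. \<phi> Q q N Z) (\<lambda>q. \<phi> Q q U Z)" by (simp add: approx_sym)
  also have "(\<lambda>q. \<phi> Q q U Z) = (\<lambda>q j. \<Sum>Pa\<leftarrow>L. \<phi> 1 q R (fst Pa) (j - snd Pa))" using L(2) by (intro ext) simp
  also have "approx k (\<lambda>q j. \<Sum>Pa\<leftarrow>L. \<phi> 1 q R (fst Pa) (j - snd Pa)) (\<lambda>q j. \<Sum>Pa\<leftarrow>L. \<phi> 1 q R (fst Pa) j)"
  proof (rule approx_sum_list)
    fix Pa assume "Pa \<in> set L"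
    then have P: "fst Pa \<in> B" "hp (fst Pa)" using L B by (auto simp: topset_def)
    have gP: "gm 1 R (fst Pa)" by (rule gmI[OF cl_R hpD(1,2)[OF P(2)]])
    have nP: "noeth 1 R (fst Pa)"
      by (rule noeth_sub[OF noeth_R]) (auto simp: le_fun_def cl_K[OF hpD(1)[OF P(2)], THEN subsetD])
    have "fst Pa \<le> annN 1 R (fst Pa)"
    proof (rule le_funI, rule subsetI)
      fix i r assume r: "r \<in> fst Pa i"
      have "r * x \<in> fst Pa (i + j)" if "x \<in> R j" for x j
        using hpD(5)[OF P(2) that r] by (simp add: mult.commute add.commute)
      then show "r \<in> annN 1 R (fst Pa) i" using r hpD(2)[OF P(2)] by (auto simp: annN_def)
    qed
    from cover_prime[OF B P(1) this] have cP: "cover (Suc k) {fst Pa} 1 R (fst Pa)" .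
    have BP: "topset (Suc k) {fst Pa}" using B P by (auto simp: topset_def)
    from approx_shift_all[OF shift[OF gP nP ppow_1 cP BP], of "snd Pa"]
    show "approx k (\<lambda>q j. \<phi> 1 q R (fst Pa) (j - snd Pa)) (\<lambda>q. \<phi> 1 q R (fst Pa))" by (rule approx_sym)
  qed
  finally have "approx k (\<lambda>q. \<phi> Q q N Z) (\<lambda>q j. \<Sum>P\<leftarrow>map fst L. \<phi> 1 q R P j)" by (simp add: comp_def)
  moreover have "set (map fst L) \<subseteq> B" using L by simp
  ultimately show ?thesis by blast
qed

end

section \<open>Limits of almost recursive sequences\<close>

text \<open>At ratio 1 the increments are summable. Below 1 the sequence decays geometrically. Above
  1, a term larger than the accumulated error would start exponential growth, which boundedness
  forbids.\<close>

lemma geometric_recursion_convergent: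
  fixes a :: "nat \<Rightarrow> real"
  assumes r: "0 < r" "r < 1" and B: "\<And>n. \<bar>a n\<bar> \<le> B" and \<mu>: "0 \<le> \<mu>"
    and rec: "\<And>n. \<bar>a (Suc n) - \<mu> * a n\<bar> \<le> C * r ^ n"
  shows "convergent a"
proof -
  have C0: "0 \<le> C" using rec[of 0] by (simp add: order_trans[OF abs_ge_zero])
  consider "\<mu> = 1" | "\<mu> < 1" | "\<mu> > 1" by linarith
  then show ?thesis
  proof cases
    case 1
    have "summable (\<lambda>n. C * r ^ n)" using r by (intro summable_mult summable_geometric) auto
    then have "summable (\<lambda>n. a (Suc n) - a n)"
      by (rule summable_comparison_test'[where N = 0]) (use rec 1 in auto)
    then have "convergent (\<lambda>n. \<Sum>i<n. a (Suc i) - a i)" by (simp add: summable_iff_convergent)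
    then have "convergent (\<lambda>n. a n - a 0)" by (simp add: sum_lessThan_telescope)
    then have "convergent (\<lambda>n. a n - a 0 + a 0)" by (intro convergent_add convergent_const)
    then show ?thesis by simp
  next
    case 2
    \<comment> \<open>One rate strictly above both \<open>\<mu>\<close> and \<open>r\<close> absorbs
      the recursion and its error: \<open>D\<close> is chosen large enough that C \<le> D (\<rho> -
      \<mu>).\<close>
    obtain \<rho> where \<rho>: "\<mu> < \<rho>" "r < \<rho>" "\<rho> < 1" using dense[of "max \<mu> r" 1] 2 r by auto
    define D where "D = max B (C / (\<rho> - \<mu>))"
    have "C / (\<rho> - \<mu>) \<le> D" by (simp add: D_def)
    then have D: "C \<le> D * (\<rho> - \<mu>)" using \<rho> by (simp add: pos_divide_le_eq)
    have bound: "\<bar>a n\<bar> \<le> D * \<rho> ^ n" for n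
    proof (induction n)
      case 0 then show ?case using B[of 0] by (simp add: D_def)
    next
      case (Suc n)
      have "\<bar>a (Suc n)\<bar> \<le> \<mu> * \<bar>a n\<bar> + C * r ^ n"
        using rec[of n] abs_triangle_ineq2[of "a (Suc n)" "\<mu> * a n"] \<mu> by (simp add: abs_mult)
      also have "\<dots> \<le> \<mu> * (D * \<rho> ^ n) + D * (\<rho> - \<mu>) * \<rho> ^ n"
        using \<rho> Suc C0 D r \<mu> by (intro add_mono mult_mono power_mono) auto
      also have "\<dots> = D * \<rho> ^ Suc n" by (simp add: algebra_simps)
      finally show ?case .
    qed
    have "(\<lambda>n. D * \<rho> ^ n) \<longlonglongrightarrow> D * 0" by (intro tendsto_mult_left LIMSEQ_power_zero) (use \<rho> r in auto)
    then have "a \<longlonglongrightarrow> 0" by (intro Lim_null_comparison[of a "\<lambda>n. D * \<rho> ^ n"]) (use bound in auto)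
    then show ?thesis by (auto simp: convergent_def)
  next
    case 3
    \<comment> \<open>Chosen so that C r^n = (\<mu> - 1) e n: the excess of |a n| over
      \<open>e n\<close> then grows at least by the factor \<open>\<mu>\<close> in each
      step.\<close>
    define e where "e n = C * r ^ n / (\<mu> - 1)" for n
    have e: "e (Suc n) \<le> e n" for n
      unfolding e_def using C0 r 3 by (intro divide_right_mono mult_left_mono) (auto simp: mult_le_cancel_right1)
    have step: "\<mu> * (\<bar>a n\<bar> - e n) \<le> \<bar>a (Suc n)\<bar> - e (Suc n)" for n
    proof -
      have "\<mu> * \<bar>a n\<bar> \<le> \<bar>a (Suc n)\<bar> + C * r ^ n"
        using rec[of n] abs_triangle_ineq2_sym[of "\<mu> * a n" "a (Suc n)"] \<mu> abs_triangle_ineq2[of "\<mu> * a n" "a (Suc n)"]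
        by (simp add: abs_mult abs_minus_commute)
      moreover have "C * r ^ n = (\<mu> - 1) * e n" using 3 by (simp add: e_def)
      ultimately show ?thesis using e[of n] by (simp add: algebra_simps)
    qed
    have iter: "\<mu> ^ m * (\<bar>a n\<bar> - e n) \<le> B" for m n
    proof -
      have "\<mu> ^ m * (\<bar>a n\<bar> - e n) \<le> \<bar>a (n + m)\<bar> - e (n + m)"
      proof (induction m)
        case (Suc m)
        have "\<mu> ^ Suc m * (\<bar>a n\<bar> - e n) \<le> \<mu> * (\<bar>a (n + m)\<bar> - e (n + m))"
          using mult_left_mono[OF Suc \<mu>] by (simp add: mult.assoc)
        also have "\<dots> \<le> \<bar>a (n + Suc m)\<bar> - e (n + Suc m)" using step[of "n + m"] by simp
        finally show ?case .
      qed simp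
      also have "\<dots> \<le> B"
      proof -
        have "0 \<le> e (n + m)" unfolding e_def using C0 r 3 by (intro divide_nonneg_nonneg mult_nonneg_nonneg) auto
        then show ?thesis using B[of "n + m"] by linarith
      qed
      finally show ?thesis .
    qed
    have "\<bar>a n\<bar> \<le> e n" for n
    proof (rule ccontr)
      assume "\<not> ?thesis"
      then have pos: "\<bar>a n\<bar> - e n > 0" by simp
      obtain m where "B / (\<bar>a n\<bar> - e n) < \<mu> ^ m" using real_arch_pow[OF 3] by blast
      then have "B < \<mu> ^ m * (\<bar>a n\<bar> - e n)" using pos by (simp add: pos_divide_less_eq)
      then show False using iter[of m n] by simp
    qed
    moreover have "(\<lambda>n. C / (\<mu> - 1) * r ^ n) \<longlonglongrightarrow> C / (\<mu> - 1) * 0"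
      by (intro tendsto_mult_left LIMSEQ_power_zero) (use r in auto)
    then have "e \<longlonglongrightarrow> 0" by (simp add: e_def[abs_def])
    ultimately have "a \<longlonglongrightarrow> 0" by (intro Lim_null_comparison[of a e]) auto
    then show ?thesis by (auto simp: convergent_def)
  qed
qed

section \<open>Functions that are Lipschitz up to 1 / q\<close>

lemma cancel_power: "0 < q \<Longrightarrow> C * (b * q) ^ k * (u * q + 1) / q ^ Suc k = C * b ^ k * (u + 1 / q)" for q :: real
  by (simp add: power_mult_distrib field_simps)

lemma abs_floor_le: "1 \<le> q \<Longrightarrow> \<bar>real_of_int \<lfloor>s * q\<rfloor>\<bar> \<le> (\<bar>s\<bar> + 1) * q" for s q :: real
proof -
  assume q: "1 \<le> q"
  have "\<bar>real_of_int \<lfloor>s * q\<rfloor>\<bar> \<le> \<bar>s * q\<bar> + 1" by linarith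
  also have "\<dots> \<le> (\<bar>s\<bar> + 1) * q" using q by (simp add: abs_mult algebra_simps)
  finally show ?thesis .
qed

lemma shift_iterate:
  fixes \<psi> :: "int \<Rightarrow> real"
  assumes sh: "\<And>j. \<bar>\<psi> (j + 1) - \<psi> j\<bar> \<le> C * (\<bar>real_of_int j\<bar> + q) ^ k" and C: "0 \<le> C" and q: "0 \<le> q"
    and le: "j \<le> j'" and b: "\<bar>real_of_int j\<bar> \<le> b" "\<bar>real_of_int j'\<bar> \<le> b"
  shows "\<bar>\<psi> j' - \<psi> j\<bar> \<le> C * (b + q) ^ k * real_of_int (j' - j)"
proof -
  have "\<bar>\<psi> (j + int m) - \<psi> j\<bar> \<le> C * (b + q) ^ k * real m" if "j + int m \<le> j'" for m
    using that
  proof (induction m)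
    case (Suc m)
    have "\<bar>real_of_int (j + int m)\<bar> \<le> b" using Suc.prems b by linarith
    then have "C * (\<bar>real_of_int (j + int m)\<bar> + q) ^ k \<le> C * (b + q) ^ k"
      using C q by (intro mult_left_mono power_mono) auto
    then have "\<bar>\<psi> (j + int m + 1) - \<psi> (j + int m)\<bar> \<le> C * (b + q) ^ k" using sh[of "j + int m"] by linarith
    moreover have "\<bar>\<psi> (j + int m) - \<psi> j\<bar> \<le> C * (b + q) ^ k * real m" using Suc by simp
    ultimately have "\<bar>\<psi> (j + int m + 1) - \<psi> j\<bar> \<le> C * (b + q) ^ k * real m + C * (b + q) ^ k" by linarith
    then show ?case by (simp add: algebra_simps)
  qed simp
  from this[of "nat (j' - j)"] le show ?thesis by simp
qed

text \<open>\<open>\<psi> n j\<close> stands for the length in degree j at q = p^n, and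
  \<open>k\<close> for d - 2. After division by q^(k+1), \<open>sh\<close> becomes a Lipschitz
  condition up to 1 / q on bounded sets.\<close>

locale density_seq =
  fixes p k :: nat and \<psi> :: "nat \<Rightarrow> int \<Rightarrow> real" and C :: real
  assumes p: "p \<ge> 2" and C: "0 \<le> C"
    and sh: "\<And>n j. \<bar>\<psi> n (j + 1) - \<psi> n j\<bar> \<le> C * (\<bar>real_of_int j\<bar> + real (p ^ n)) ^ k"
begin

definition g :: "nat \<Rightarrow> real \<Rightarrow> real" where
  "g n s = \<psi> n \<lfloor>s * real (p ^ n)\<rfloor> / real (p ^ n) ^ Suc k"

lemma pn: "real (p ^ n) \<ge> 1" "real (p ^ n) > 0"
  using p by auto

lemma inverse_pn: "(\<lambda>n. c / real (p ^ n)) \<longlonglongrightarrow> 0"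
proof -
  have "(\<lambda>n. c * (1 / real p) ^ n) \<longlonglongrightarrow> c * 0"
    using p by (intro tendsto_mult_left LIMSEQ_power_zero) auto
  then show ?thesis by (simp add: power_divide)
qed

lemma lip:
  assumes "\<bar>s\<bar> \<le> B" "\<bar>t\<bar> \<le> B"
  shows "\<bar>g n s - g n t\<bar> \<le> C * (B + 2) ^ k * (\<bar>s - t\<bar> + 1 / real (p ^ n))"
proof -
  have *: "\<bar>g n t - g n s\<bar> \<le> C * (B + 2) ^ k * (\<bar>s - t\<bar> + 1 / real (p ^ n))"
    if st: "s \<le> t" "\<bar>s\<bar> \<le> B" "\<bar>t\<bar> \<le> B" for s t
  proof -
    let ?q = "real (p ^ n)"
    have q: "?q \<ge> 1" "?q > 0" using pn by auto
    have b: "\<bar>real_of_int \<lfloor>x * ?q\<rfloor>\<bar> \<le> (B + 1) * ?q" if "\<bar>x\<bar> \<le> B" for x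
    proof -
      have "(\<bar>x\<bar> + 1) * ?q \<le> (B + 1) * ?q" using that q by (intro mult_right_mono) auto
      then show ?thesis using abs_floor_le[OF q(1), of x] by linarith
    qed
    have fl: "\<lfloor>s * ?q\<rfloor> \<le> \<lfloor>t * ?q\<rfloor>" using st q by (intro floor_mono mult_right_mono) auto
    have "\<bar>\<psi> n \<lfloor>t * ?q\<rfloor> - \<psi> n \<lfloor>s * ?q\<rfloor>\<bar> \<le> C * ((B + 1) * ?q + ?q) ^ k * real_of_int (\<lfloor>t * ?q\<rfloor> - \<lfloor>s * ?q\<rfloor>)"
      by (rule shift_iterate[OF sh C _ fl b b]) (use q st in auto)
    also have "\<dots> \<le> C * ((B + 1) * ?q + ?q) ^ k * ((t - s) * ?q + 1)"
    proof (rule mult_left_mono)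
      have "real_of_int (\<lfloor>t * ?q\<rfloor> - \<lfloor>s * ?q\<rfloor>) \<le> t * ?q - s * ?q + 1" by linarith
      then show "real_of_int (\<lfloor>t * ?q\<rfloor> - \<lfloor>s * ?q\<rfloor>) \<le> (t - s) * ?q + 1" by (simp add: left_diff_distrib)
      show "0 \<le> C * ((B + 1) * ?q + ?q) ^ k" using C q st by (intro mult_nonneg_nonneg zero_le_power) auto
    qed
    also have "(B + 1) * ?q + ?q = (B + 2) * ?q" by (simp add: algebra_simps)
    finally have le: "\<bar>\<psi> n \<lfloor>t * ?q\<rfloor> - \<psi> n \<lfloor>s * ?q\<rfloor>\<bar> \<le> C * ((B + 2) * ?q) ^ k * ((t - s) * ?q + 1)" .
    have "\<bar>g n t - g n s\<bar> = \<bar>\<psi> n \<lfloor>t * ?q\<rfloor> - \<psi> n \<lfloor>s * ?q\<rfloor>\<bar> / ?q ^ Suc k"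
      unfolding g_def diff_divide_distrib[symmetric] using q by (simp add: abs_divide)
    also have "\<dots> \<le> C * ((B + 2) * ?q) ^ k * ((t - s) * ?q + 1) / ?q ^ Suc k"
      using q by (intro divide_right_mono le) auto
    also have "\<dots> = C * (B + 2) ^ k * ((t - s) + 1 / ?q)" by (rule cancel_power[OF q(2)])
    finally show ?thesis using st by simp
  qed
  show ?thesis
  proof (cases "s \<le> t")
    case True then show ?thesis using *[OF True assms] by (simp add: abs_minus_commute)
  next
    case False then show ?thesis using *[of t s] assms by (simp add: abs_minus_commute)
  qed
qed

text \<open>The recursion is available only at degrees divisible by p^e. So s is first replaced by t
  = \<lfloor>s q\<rfloor> / q, for which t p^(n+e) is such a degree; by \<open>lip\<close> this
  costs O(1 / q).\<close>

lemma twist_step: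
  fixes \<xi> :: "nat \<Rightarrow> int \<Rightarrow> real"
  assumes rec: "\<And>n j. \<bar>\<kappa> * \<psi> (n + e) (int (p ^ e) * j) - \<xi> n j\<bar> \<le> D * (\<bar>real_of_int j\<bar> + real (p ^ n)) ^ k"
    and \<kappa>: "0 < \<kappa>" and D: "0 \<le> D"
  shows "\<exists>D'. \<forall>n. \<bar>\<kappa> * real (p ^ e) ^ Suc k * g (n + e) s - \<xi> n \<lfloor>s * real (p ^ n)\<rfloor> / real (p ^ n) ^ Suc k\<bar> \<le> D' / real (p ^ n)"
proof (intro exI allI)
  fix n
  let ?E = "real (p ^ e)" and ?q = "real (p ^ n)" and ?f = "\<lfloor>s * real (p ^ n)\<rfloor>"
  let ?t = "real_of_int ?f / ?q" and ?c = "\<kappa> * ?E ^ Suc k" and ?B = "\<bar>s\<bar> + 1" and ?g = "g (n + e)"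
  have q: "?q \<ge> 1" "?q > 0" and E: "?E \<ge> 1" using pn by auto
  have Eq: "real (p ^ (n + e)) = ?E * ?q" by (simp add: power_add)
  have fb: "\<bar>real_of_int ?f\<bar> \<le> ?B * ?q" by (rule abs_floor_le[OF q(1)])
  have "\<bar>?g s - ?g ?t\<bar> \<le> C * (?B + 2) ^ k * (\<bar>s - ?t\<bar> + 1 / real (p ^ (n + e)))"
    using fb q by (intro lip) (auto simp: abs_divide pos_divide_le_eq)
  also have "\<dots> \<le> C * (?B + 2) ^ k * (2 / ?q)"
  proof (rule mult_left_mono)
    have "s - ?t = (s * ?q - ?f) / ?q" using q by (simp add: field_simps)
    also have "\<bar>\<dots>\<bar> \<le> 1 / ?q" unfolding abs_divide using q by (intro frac_le) linarith+
    finally have "\<bar>s - ?t\<bar> \<le> 1 / ?q" .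
    moreover have "1 / (?E * ?q) \<le> 1 / ?q" using mult_right_mono[OF E, of ?q] q by (intro frac_le) auto
    ultimately show "\<bar>s - ?t\<bar> + 1 / real (p ^ (n + e)) \<le> 2 / ?q"
      unfolding Eq using mult_2[of "1 / ?q"] by simp
  qed (use C in auto)
  finally have "?c * \<bar>?g s - ?g ?t\<bar> \<le> ?c * (C * (?B + 2) ^ k * (2 / ?q))" using \<kappa> by (intro mult_left_mono) auto
  then have 1: "\<bar>?c * ?g s - ?c * ?g ?t\<bar> \<le> ?c * (C * (?B + 2) ^ k * 2) / ?q"
    using \<kappa> by (simp add: right_diff_distrib[symmetric] abs_mult)
  have "?t * real (p ^ (n + e)) = real_of_int (int (p ^ e) * ?f)" unfolding Eq using p by simp
  then have "?g ?t = \<psi> (n + e) (int (p ^ e) * ?f) / (?E ^ Suc k * ?q ^ Suc k)"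
    unfolding g_def by (simp only: floor_of_int Eq power_mult_distrib)
  then have "?c * ?g ?t = \<kappa> * \<psi> (n + e) (int (p ^ e) * ?f) / ?q ^ Suc k" using p by simp
  then have "\<bar>?c * ?g ?t - \<xi> n ?f / ?q ^ Suc k\<bar> = \<bar>\<kappa> * \<psi> (n + e) (int (p ^ e) * ?f) - \<xi> n ?f\<bar> / ?q ^ Suc k"
    using q by (simp add: diff_divide_distrib[symmetric] abs_divide)
  also have "\<dots> \<le> D * ((?B + 1) * ?q) ^ k / ?q ^ Suc k"
  proof (intro divide_right_mono order_trans[OF rec] mult_left_mono power_mono)
    show "\<bar>real_of_int ?f\<bar> + ?q \<le> (?B + 1) * ?q" using fb by (simp add: distrib_right)
  qed (use D q in auto)
  also have "\<dots> = D * (?B + 1) ^ k / ?q" using q by (simp add: power_mult_distrib)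
  finally show "\<bar>?c * ?g s - \<xi> n ?f / ?q ^ Suc k\<bar> \<le> (?c * (C * (?B + 2) ^ k * 2) + D * (?B + 1) ^ k) / ?q"
    using 1 unfolding add_divide_distrib by linarith
qed

lemma recursive_convergent:
  assumes bd: "\<And>n j. \<bar>\<psi> n j\<bar> \<le> A * (\<bar>real_of_int j\<bar> + 1) ^ Suc k" and A: "0 \<le> A"
    and rec: "\<And>n j. \<bar>\<kappa> * \<psi> (Suc n) (int p * j) - c * \<psi> n j\<bar> \<le> D * (\<bar>real_of_int j\<bar> + real (p ^ n)) ^ k"
    and \<kappa>: "0 < \<kappa>" and D: "0 \<le> D" and c: "0 \<le> c"
  shows "convergent (\<lambda>n. g n s)"
proof -
  have "\<bar>\<kappa> * \<psi> (n + 1) (int (p ^ 1) * j) - c * \<psi> n j\<bar> \<le> D * (\<bar>real_of_int j\<bar> + real (p ^ n)) ^ k" for n j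
    using rec[of n j] by simp
  from twist_step[of \<kappa> 1 "\<lambda>n j. c * \<psi> n j", OF this \<kappa> D]
  obtain D' where D': "\<And>n. \<bar>\<kappa> * real p ^ Suc k * g (Suc n) s - c * \<psi> n \<lfloor>s * real (p ^ n)\<rfloor> / real (p ^ n) ^ Suc k\<bar> \<le> D' / real (p ^ n)"
    by auto
  define E where "E = \<kappa> * real p ^ Suc k"
  have E: "E > 0" using \<kappa> p by (simp add: E_def)
  show ?thesis
  proof (rule geometric_recursion_convergent[where r = "1 / real p" and \<mu> = "c / E" and C = "D' / E"])
    show "\<bar>g n s\<bar> \<le> A * (\<bar>s\<bar> + 2) ^ Suc k" for n
    proof -
      let ?q = "real (p ^ n)"
      have q: "?q \<ge> 1" "?q > 0" using pn by auto
      have "\<bar>\<psi> n \<lfloor>s * ?q\<rfloor>\<bar> \<le> A * (\<bar>real_of_int \<lfloor>s * ?q\<rfloor>\<bar> + 1) ^ Suc k" by (rule bd)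
      also have "\<dots> \<le> A * ((\<bar>s\<bar> + 2) * ?q) ^ Suc k"
        using abs_floor_le[OF q(1), of s] q A by (intro mult_left_mono power_mono) (auto simp: algebra_simps)
      finally have "\<bar>\<psi> n \<lfloor>s * ?q\<rfloor>\<bar> \<le> A * (\<bar>s\<bar> + 2) ^ Suc k * ?q ^ Suc k"
        unfolding power_mult_distrib by (simp add: mult.assoc)
      then show ?thesis unfolding g_def abs_divide using q by (simp add: pos_divide_le_eq del: power_Suc)
    qed
    show "\<bar>g (Suc n) s - c / E * g n s\<bar> \<le> D' / E * (1 / real p) ^ n" for n
    proof -
      have "\<bar>E * g (Suc n) s - c * g n s\<bar> \<le> D' / real (p ^ n)"
        using D'[of n] by (simp add: g_def E_def)
      then have "\<bar>E * g (Suc n) s - c * g n s\<bar> / E \<le> D' / real (p ^ n) / E" using E by (intro divide_right_mono) auto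
      moreover have "\<bar>E * g (Suc n) s - c * g n s\<bar> / E = \<bar>g (Suc n) s - c / E * g n s\<bar>"
      proof -
        have "(E * g (Suc n) s - c * g n s) / E = g (Suc n) s - c / E * g n s" using E by (simp add: field_simps)
        then show ?thesis using E by (metis abs_divide abs_of_pos)
      qed
      ultimately show ?thesis by (simp add: power_divide mult.commute)
    qed
  qed (use p E c in auto)
qed

section \<open>The limit function and its integral\<close>

definition G :: "real \<Rightarrow> real" where "G s = lim (\<lambda>n. g n s)"

text \<open>For negative s the interval is empty and the value 0, in agreement with the vanishing of
  \<open>G\<close> there shown in \<open>G_nonpos\<close>.\<close>

definition F :: "real \<Rightarrow> real" where "F s = integral {0..s} G"

context
  assumes conv: "\<And>s. convergent (\<lambda>n. g n s)"
begin

lemma G_tendsto: "(\<lambda>n. g n s) \<longlonglongrightarrow> G s"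
  using conv convergent_LIMSEQ_iff unfolding G_def by blast

lemma G_lip:
  assumes "\<bar>s\<bar> \<le> B" "\<bar>t\<bar> \<le> B"
  shows "\<bar>G s - G t\<bar> \<le> C * (B + 2) ^ k * \<bar>s - t\<bar>"
proof (rule LIMSEQ_le)
  show "(\<lambda>n. \<bar>g n s - g n t\<bar>) \<longlonglongrightarrow> \<bar>G s - G t\<bar>" by (intro tendsto_intros G_tendsto)
  have "(\<lambda>n. C * (B + 2) ^ k * (\<bar>s - t\<bar> + 1 / real (p ^ n))) \<longlonglongrightarrow> C * (B + 2) ^ k * (\<bar>s - t\<bar> + 0)"
    by (intro tendsto_intros inverse_pn)
  then show "(\<lambda>n. C * (B + 2) ^ k * (\<bar>s - t\<bar> + 1 / real (p ^ n))) \<longlonglongrightarrow> C * (B + 2) ^ k * \<bar>s - t\<bar>" by simp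
qed (use lip[OF assms] in blast)

lemma G_cont: "continuous_on S G"
proof -
  have "isCont G x" for x
  proof -
    have "((\<lambda>y. C * (\<bar>x\<bar> + 1 + 2) ^ k * \<bar>y - x\<bar>) \<longlongrightarrow> 0) (at x)" by (auto intro!: tendsto_eq_intros)
    moreover have "\<forall>\<^sub>F y in at x. norm (G y - G x) \<le> C * (\<bar>x\<bar> + 1 + 2) ^ k * \<bar>y - x\<bar>"
      unfolding eventually_at real_norm_def
      by (intro exI[of _ 1] conjI ballI impI zero_less_one G_lip) (auto simp: dist_real_def)
    ultimately have "((\<lambda>y. G y - G x) \<longlongrightarrow> 0) (at x)" by (rule Lim_null_comparison[rotated])
    then show ?thesis using LIM_zero_iff isCont_def by blast
  qed
  then show ?thesis by (simp add: continuous_at_imp_continuous_on)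
qed

text \<open>Pointwise convergence on a finite net suffices: between net points both
  \<open>g n\<close> and \<open>G\<close> vary little, the former up to an error that tends to
  0.\<close>

lemma uniform:
  assumes "compact S" shows "uniform_limit S g G sequentially"
proof (rule uniform_limitI)
  fix e :: real assume e: "e > 0"
  obtain B where B: "\<And>s. s \<in> S \<Longrightarrow> \<bar>s\<bar> \<le> B" and B0: "B > 0"
    using compact_imp_bounded[OF assms] unfolding bounded_pos by auto
  \<comment> \<open>The summand 1 keeps \<open>L\<close> positive when \<open>C\<close> is 0, so
    that the radius e / (4 L) makes sense.\<close>
  define L where "L = C * (B + 2) ^ k + 1"
  have L: "L > 0" unfolding L_def using C B0 by (intro add_nonneg_pos mult_nonneg_nonneg zero_le_power) auto
  obtain X where X: "X \<subseteq> S" "finite X" "S \<subseteq> (\<Union>x\<in>X. ball x (e / (4 * L)))"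
    by (rule compactE_image[OF assms, of S "\<lambda>x. ball x (e / (4 * L))"]) (use e L in auto)
  have "\<forall>\<^sub>F n in sequentially. \<forall>x\<in>X. dist (g n x) (G x) < e / 4"
    using tendstoD[OF G_tendsto, of "e / 4"] e by (intro eventually_ball_finite[OF X(2)]) auto
  moreover have "\<forall>\<^sub>F n in sequentially. L / real (p ^ n) < e / 4"
    using order_tendstoD(2)[OF inverse_pn[of L], of "e / 4"] e by simp
  ultimately show "\<forall>\<^sub>F n in sequentially. \<forall>s\<in>S. dist (g n s) (G s) < e"
  proof eventually_elim
    case (elim n)
    show ?case
    proof
      fix s assume s: "s \<in> S"
      then obtain x where x: "x \<in> X" "\<bar>s - x\<bar> < e / (4 * L)" using X(3) by (auto simp: dist_real_def abs_minus_commute)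
      have b: "\<bar>s\<bar> \<le> B" "\<bar>x\<bar> \<le> B" using B s x X(1) by auto
      have Lsx: "L * \<bar>s - x\<bar> < e / 4" using x(2) L by (simp add: field_simps)
      have CL: "C * (B + 2) ^ k * y \<le> L * y" if "0 \<le> y" for y using that by (simp add: L_def mult_right_mono)
      have "\<bar>g n s - g n x\<bar> \<le> L * (\<bar>s - x\<bar> + 1 / real (p ^ n))"
        by (rule order_trans[OF lip[OF b] CL]) simp
      then have "\<bar>g n s - g n x\<bar> < e / 4 + e / 4"
        using Lsx elim(2) unfolding distrib_left times_divide_eq_right mult_1_right by linarith
      moreover have "\<bar>G s - G x\<bar> < e / 4" by (rule order.strict_trans1[OF order_trans[OF G_lip[OF b] CL] Lsx]) simp
      moreover have "\<bar>g n x - G x\<bar> < e / 4" using elim(1) x(1) by (simp add: dist_real_def)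
      ultimately show "dist (g n s) (G s) < e" unfolding dist_real_def by linarith
    qed
  qed
qed

text \<open>\<open>H n j\<close> stands for the length of M / (m^j + J^[q]) M with q = p^n, whose
  steps in j agree with \<open>\<psi> n j\<close> up to lower order.\<close>

context
  fixes H :: "nat \<Rightarrow> int \<Rightarrow> real" and C' :: real
  assumes H0: "\<And>n j. j \<le> 0 \<Longrightarrow> H n j = 0"
    and Hd: "\<And>n j. \<bar>H n (j + 1) - H n j - \<psi> n j\<bar> \<le> C' * (\<bar>real_of_int j\<bar> + real (p ^ n)) ^ k"
    and C': "0 \<le> C'"
begin

lemma step_error:
  assumes "\<bar>real_of_int j\<bar> \<le> b * real (p ^ n)" "0 \<le> b"
  shows "\<bar>(H n (j + 1) - H n j) / real (p ^ n) ^ Suc k - g n (real_of_int j / real (p ^ n))\<bar> \<le> C' * (b + 1) ^ k / real (p ^ n)"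
proof -
  let ?q = "real (p ^ n)"
  have q: "?q > 0" using pn by auto
  have "C' * (\<bar>real_of_int j\<bar> + ?q) ^ k \<le> C' * ((b + 1) * ?q) ^ k"
    using assms C' q by (intro mult_left_mono power_mono) (auto simp: distrib_right)
  then have le: "\<bar>H n (j + 1) - H n j - \<psi> n j\<bar> \<le> C' * (b + 1) ^ k * ?q ^ k"
    using Hd[of n j] by (simp add: power_mult_distrib)
  have "\<bar>(H n (j + 1) - H n j) / ?q ^ Suc k - g n (real_of_int j / ?q)\<bar> = \<bar>H n (j + 1) - H n j - \<psi> n j\<bar> / ?q ^ Suc k"
    using q by (simp add: g_def diff_divide_distrib[symmetric] abs_divide)
  also have "\<dots> \<le> C' * (b + 1) ^ k * ?q ^ k / ?q ^ Suc k" using q by (intro divide_right_mono le) auto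
  also have "\<dots> = C' * (b + 1) ^ k / ?q" using q by simp
  finally show ?thesis .
qed

lemma ceiling_close: "\<bar>real_of_int \<lceil>s * real (p ^ n)\<rceil> / real (p ^ n) - s\<bar> \<le> 1 / real (p ^ n)"
proof -
  let ?q = "real (p ^ n)"
  have q: "?q > 0" using pn by auto
  have "real_of_int \<lceil>s * ?q\<rceil> / ?q - s = (real_of_int \<lceil>s * ?q\<rceil> - s * ?q) / ?q" using q by (simp add: field_simps)
  also have "\<bar>\<dots>\<bar> \<le> 1 / ?q" unfolding abs_divide using q by (intro frac_le) linarith+
  finally show ?thesis .
qed

lemma density_tendsto:
  "(\<lambda>n. (H n (\<lceil>s * real (p ^ n)\<rceil> + 1) - H n \<lceil>s * real (p ^ n)\<rceil>) / real (p ^ n) ^ Suc k) \<longlonglongrightarrow> G s"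
proof -
  define b where "b = \<bar>s\<bar> + 1"
  define E where "E = C' * (b + 1) ^ k + C * (b + 2) ^ k * 2"
  let ?d = "\<lambda>n. (H n (\<lceil>s * real (p ^ n)\<rceil> + 1) - H n \<lceil>s * real (p ^ n)\<rceil>) / real (p ^ n) ^ Suc k"
  have "\<bar>?d n - g n s\<bar> \<le> E / real (p ^ n)" for n
  proof -
    let ?q = "real (p ^ n)" and ?t = "real_of_int \<lceil>s * real (p ^ n)\<rceil> / real (p ^ n)"
    have q: "?q \<ge> 1" "?q > 0" using pn by auto
    have ts: "\<bar>?t - s\<bar> \<le> 1 / ?q" by (rule ceiling_close)
    moreover have "1 / ?q \<le> 1" using q by simp
    ultimately have tb: "\<bar>?t\<bar> \<le> b" unfolding b_def by linarith
    have "\<bar>g n ?t - g n s\<bar> \<le> C * (b + 2) ^ k * (\<bar>?t - s\<bar> + 1 / ?q)"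
      by (rule lip[OF tb]) (simp add: b_def)
    also have "\<dots> \<le> C * (b + 2) ^ k * (1 / ?q + 1 / ?q)"
      using ts C by (intro mult_left_mono add_mono mult_nonneg_nonneg zero_le_power) (auto simp: b_def)
    finally have 1: "\<bar>g n ?t - g n s\<bar> \<le> C * (b + 2) ^ k * 2 / ?q" by simp
    have 2: "\<bar>?d n - g n ?t\<bar> \<le> C' * (b + 1) ^ k / ?q"
      using tb q by (intro step_error) (auto simp: abs_divide pos_divide_le_eq b_def)
    show ?thesis unfolding E_def add_divide_distrib using 1 2 by linarith
  qed
  then have "(\<lambda>n. ?d n - g n s) \<longlonglongrightarrow> 0"
    by (intro Lim_null_comparison[OF _ inverse_pn[of E]]) auto
  from tendsto_add[OF this G_tendsto[of s]] show ?thesis by simp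
qed

text \<open>For s < 0 and 1 / q < -s, \<lceil>s q\<rceil> is at most -1, so both values of
  \<open>H\<close> in the difference quotient vanish. The point 0 follows by continuity.\<close>

lemma G_nonpos: assumes "s \<le> 0" shows "G s = 0"
proof (rule continuous_constant_on_closure[OF G_cont])
  show "s \<in> closure {..<0}" using assms by simp
  fix s :: real assume "s \<in> {..<0}"
  then have "\<forall>\<^sub>F n in sequentially. 1 / real (p ^ n) < - s"
    using order_tendstoD(2)[OF inverse_pn[of 1], of "- s"] by simp
  then have "\<forall>\<^sub>F n in sequentially. (H n (\<lceil>s * real (p ^ n)\<rceil> + 1) - H n \<lceil>s * real (p ^ n)\<rceil>) / real (p ^ n) ^ Suc k = 0"
  proof eventually_elim
    case (elim n)
    then have "s * real (p ^ n) \<le> real_of_int (-1)" using pn(2)[of n] by (simp add: pos_divide_less_eq)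
    then have "\<lceil>s * real (p ^ n)\<rceil> \<le> -1" by (simp add: ceiling_le_iff)
    then have "\<lceil>s * real (p ^ n)\<rceil> \<le> 0" "\<lceil>s * real (p ^ n)\<rceil> + 1 \<le> 0" by linarith+
    from H0[OF this(1)] H0[OF this(2)] show ?case by simp
  qed
  then show "G s = 0" using LIMSEQ_unique[OF density_tendsto tendsto_eventually] by blast
qed

text \<open>The base point of the integral is moved from 0 to -B, to the left of s, so that the
  fundamental theorem also covers s \<le> 0; the added stretch contributes nothing by
  \<open>G_nonpos\<close>.\<close>

lemma F_derivative: "(F has_vector_derivative G s) (at s)"
proof -
  define B where "B = \<bar>s\<bar> + 1"
  have B: "B > 0" "- B < s" "s < B" by (auto simp: B_def)
  have G0: "integral {- B..x} G = 0" if "x \<le> 0" for x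
  proof -
    have "integral {- B..x} G = integral {- B..x} (\<lambda>_. 0)" using that by (intro integral_cong G_nonpos) auto
    then show ?thesis by simp
  qed
  have eq: "integral {0..x} G = integral {- B..x} G" if "- B < x" for x
  proof (cases "x \<ge> 0")
    case True
    have "integral {- B..0} G + integral {0..x} G = integral {- B..x} G"
      using B True by (intro Henstock_Kurzweil_Integration.integral_combine integrable_continuous_interval G_cont) auto
    then show ?thesis using G0[of 0] by simp
  next
    case False
    then show ?thesis using G0[of x] by simp
  qed
  have "((\<lambda>x. integral {- B..x} G) has_vector_derivative G s) (at s within {- B..B})"
    using B by (intro integral_has_vector_derivative G_cont) auto
  then have "((\<lambda>x. integral {- B..x} G) has_vector_derivative G s) (at s)"
    using B by (simp add: at_within_Icc_at)
  then show ?thesis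
  proof (rule has_vector_derivative_transform_within_open[where S = "{- B<..<B}"])
    show "integral {- B..x} G = F x" if "x \<in> {- B<..<B}" for x using eq[of x] that by (simp add: F_def)
  qed (use B in auto)
qed

text \<open>The mean value theorem compares one step of \<open>H\<close> with the increment of \<open>F\<close>.\<close>

lemma F_step:
  assumes e: "\<And>t. \<bar>t\<bar> \<le> b \<Longrightarrow> \<bar>g n t - G t\<bar> \<le> e" and m: "real (Suc m) \<le> b * real (p ^ n)"
  shows "\<bar>(H n (int (Suc m)) - H n (int m)) / real (p ^ n) ^ Suc (Suc k) -
      (F (real (Suc m) / real (p ^ n)) - F (real m / real (p ^ n)))\<bar>
    \<le> (e + (C' * (b + 1) ^ k + C * (b + 2) ^ k) / real (p ^ n)) / real (p ^ n)"
proof -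
  let ?Q = "real (p ^ n)"
  let ?u = "real m / ?Q" and ?v = "real (Suc m) / ?Q" and ?d = "(H n (int m + 1) - H n (int m)) / ?Q ^ Suc k"
  have q: "?Q > 0" using pn by auto
  have uv: "0 \<le> ?u" "?u < ?v" "?v - ?u = 1 / ?Q" using q by (auto simp: divide_strict_right_mono diff_divide_distrib[symmetric])
  have vb: "?v \<le> b" using m q by (simp add: pos_divide_le_eq)
  obtain z where z: "?u < z" "z < ?v" "F ?v - F ?u = (?v - ?u) * G z"
    using MVT2[OF uv(2), of F G] F_derivative by (auto simp: has_real_derivative_iff_has_vector_derivative)
  have b: "\<bar>?u\<bar> \<le> b" "\<bar>z\<bar> \<le> b" "0 \<le> b" using uv(1,2) z(1,2) vb by linarith+
  have "\<bar>G ?u - G z\<bar> \<le> C * (b + 2) ^ k * \<bar>?u - z\<bar>" by (rule G_lip[OF b(1,2)])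
  also have "\<dots> \<le> C * (b + 2) ^ k * (1 / ?Q)" using z uv(3) C b(3) by (intro mult_left_mono) auto
  finally have "\<bar>G ?u - G z\<bar> \<le> C * (b + 2) ^ k / ?Q" by simp
  moreover have "\<bar>?d - g n ?u\<bar> \<le> C' * (b + 1) ^ k / ?Q"
    using step_error[of "int m" b n] b(3) m by simp
  ultimately have "\<bar>?d - G z\<bar> \<le> e + (C' * (b + 1) ^ k + C * (b + 2) ^ k) / ?Q"
    using e[OF b(1)] unfolding add_divide_distrib by linarith
  then have "\<bar>?d - G z\<bar> / ?Q \<le> (e + (C' * (b + 1) ^ k + C * (b + 2) ^ k) / ?Q) / ?Q" using q by (intro divide_right_mono) auto
  moreover have "(H n (int (Suc m)) - H n (int m)) / ?Q ^ Suc (Suc k) - (F ?v - F ?u) = (?d - G z) / ?Q"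
    unfolding z(3) uv(3) by (simp add: diff_divide_distrib add.commute mult.commute)
  ultimately show ?thesis using q by (simp only: abs_divide)
qed

text \<open>At most b q steps, each with the error (e + E / q) / q of \<open>F_step\<close>, leave a
  total error of b (e + E / q). This is small once \<open>g n\<close> is uniformly close to
  \<open>G\<close> on [-b, b].\<close>

lemma h_tendsto: "(\<lambda>n. H n \<lceil>s * real (p ^ n)\<rceil> / real (p ^ n) ^ Suc (Suc k)) \<longlonglongrightarrow> F s"
proof (cases "s \<ge> 0")
  case False
  have "H n \<lceil>s * real (p ^ n)\<rceil> = 0" for n
  proof -
    have "s * real (p ^ n) \<le> 0" using False pn(2)[of n] by (simp add: mult_nonpos_nonneg)
    then show ?thesis by (intro H0) (simp add: ceiling_le_iff)
  qed
  then show ?thesis using False by (simp add: F_def)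
next
  case s: True
  define b where "b = s + 1"
  have b: "b > 0" using s by (simp add: b_def)
  define E where "E = C' * (b + 1) ^ k + C * (b + 2) ^ k"
  let ?q = "\<lambda>n. real (p ^ n)" and ?N = "\<lambda>n. \<lceil>s * real (p ^ n)\<rceil>"
  let ?D = "\<lambda>n m. H n (int m) / ?q n ^ Suc (Suc k) - F (real m / ?q n)"
  have key: "\<bar>?D n m\<bar> \<le> real m * ((e + E / ?q n) / ?q n)"
    if e: "\<And>t. \<bar>t\<bar> \<le> b \<Longrightarrow> \<bar>g n t - G t\<bar> \<le> e" and m: "real m \<le> b * ?q n" for n m e
    using m
  proof (induction m)
    case 0 then show ?case using H0 by (simp add: F_def)
  next
    case (Suc m)
    let ?x = "(H n (int (Suc m)) - H n (int m)) / ?q n ^ Suc (Suc k) - (F (real (Suc m) / ?q n) - F (real m / ?q n))"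
    have "\<bar>?x\<bar> \<le> (e + E / ?q n) / ?q n" unfolding E_def by (rule F_step[OF e Suc.prems])
    moreover have "\<bar>?D n m\<bar> \<le> real m * ((e + E / ?q n) / ?q n)" using Suc by simp
    moreover have "?D n (Suc m) = ?D n m + ?x" unfolding diff_divide_distrib by linarith
    ultimately show ?case unfolding of_nat_Suc distrib_right by linarith
  qed
  have "(\<lambda>n. ?D n (nat (?N n))) \<longlonglongrightarrow> 0"
  proof (rule tendstoI)
    fix \<epsilon> :: real assume \<epsilon>: "\<epsilon> > 0"
    define e where "e = \<epsilon> / (4 * b)"
    have e: "e > 0" using \<epsilon> b by (simp add: e_def)
    have "\<forall>\<^sub>F n in sequentially. \<forall>t\<in>{- b..b}. dist (g n t) (G t) < e" by (rule uniform_limitD[OF uniform e]) simp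
    moreover have "\<forall>\<^sub>F n in sequentially. E / ?q n < e" using order_tendstoD(2)[OF inverse_pn] e by blast
    ultimately show "\<forall>\<^sub>F n in sequentially. dist (?D n (nat (?N n))) 0 < \<epsilon>"
    proof eventually_elim
      case (elim n)
      let ?m = "nat (?N n)"
      have q: "?q n \<ge> 1" "?q n > 0" using pn by auto
      have m: "real ?m \<le> b * ?q n"
      proof -
        have "0 \<le> s * ?q n" using s q by simp
        then have "real ?m \<le> s * ?q n + 1 * ?q n" using q by linarith
        then show ?thesis by (simp add: b_def distrib_right)
      qed
      have "\<bar>g n t - G t\<bar> \<le> e" if "\<bar>t\<bar> \<le> b" for t
        using bspec[OF elim(1), of t] that unfolding dist_real_def atLeastAtMost_iff by linarith
      then have "\<bar>?D n ?m\<bar> \<le> real ?m * ((e + E / ?q n) / ?q n)" by (rule key[OF _ m])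
      also have "\<dots> \<le> b * ?q n * ((e + e) / ?q n)"
        using m elim(2) e q b by (intro order_trans[OF mult_left_mono[OF divide_right_mono] mult_right_mono]) auto
      also have "\<dots> = \<epsilon> / 2" using q b by (simp add: e_def)
      finally show ?case using \<epsilon> by (simp add: dist_real_def)
    qed
  qed
  moreover have "int (nat (?N n)) = ?N n" for n
  proof -
    have "0 \<le> s * ?q n" using s by simp
    then show ?thesis by simp
  qed
  then have "real (nat (?N n)) = real_of_int (?N n)" "int (nat (?N n)) = ?N n" for n by (metis of_int_of_nat_eq)+
  moreover have "(\<lambda>n. F (real_of_int (?N n) / ?q n)) \<longlonglongrightarrow> F s"
  proof (rule isCont_tendsto_compose[where g = F])
    show "isCont F s" using F_derivative has_vector_derivative_continuous by blast
    have "(\<lambda>n. real_of_int (?N n) / ?q n - s) \<longlonglongrightarrow> 0"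
      by (rule Lim_null_comparison[OF _ inverse_pn[of 1]]) (simp only: real_norm_def ceiling_close eventually_True)
    then show "(\<lambda>n. real_of_int (?N n) / ?q n) \<longlonglongrightarrow> s" by (rule LIM_zero_cancel)
  qed
  ultimately show ?thesis using tendsto_add by fastforce
qed

end

end

end

section \<open>Convergence for graded modules\<close>

lemma approx_real:
  assumes "approx k f g" and fin: "\<And>q j. f q j \<noteq> \<infinity>" "\<And>q j. g q j \<noteq> \<infinity>"
  shows "\<exists>C\<ge>0. \<forall>q j. q \<ge> 1 \<longrightarrow>
    \<bar>real (the_enat (f q j)) - real (the_enat (g q j))\<bar> \<le> C * (\<bar>real_of_int j\<bar> + real q) ^ k"
proof -
  obtain C D where C: "\<And>q j. q \<ge> 1 \<Longrightarrow> f q j \<le> g q j + enat (C * (nat \<bar>j\<bar> + q) ^ k)"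
    and D: "\<And>q j. q \<ge> 1 \<Longrightarrow> g q j \<le> f q j + enat (D * (nat \<bar>j\<bar> + q) ^ k)"
    using assms(1) unfolding approx_def ale_def by blast
  have "\<bar>real (the_enat (f q j)) - real (the_enat (g q j))\<bar> \<le> real (C + D) * (\<bar>real_of_int j\<bar> + real q) ^ k" if q: "q \<ge> 1" for q j
  proof -
    obtain x y where xy: "f q j = enat x" "g q j = enat y" using fin[of q j] by auto
    let ?b = "(nat \<bar>j\<bar> + q) ^ k"
    have "x \<le> y + C * ?b" "y \<le> x + D * ?b"
      using C[OF q, of j] D[OF q, of j] unfolding xy plus_enat_simps enat_ord_simps by auto
    then have "x \<le> y + (C + D) * ?b" "y \<le> x + (C + D) * ?b" unfolding distrib_right by linarith+
    then have "real x \<le> real y + real ((C + D) * ?b)" "real y \<le> real x + real ((C + D) * ?b)" by linarith+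
    moreover have "real ((C + D) * ?b) = real (C + D) * (\<bar>real_of_int j\<bar> + real q) ^ k" by simp
    ultimately show ?thesis unfolding xy by simp
  qed
  then show ?thesis by (intro exI[of _ "real (C + D)"]) auto
qed

lemma sum_list_enat: "(\<Sum>x\<leftarrow>L. enat (f x)) = enat (\<Sum>x\<leftarrow>L. f x)"
  by (induction L) (auto simp: zero_enat_def)

lemma sum_list_real: "real (\<Sum>x\<leftarrow>L. f x) = (\<Sum>x\<leftarrow>L. real (f x))"
  by (induction L) auto

lemma convergent_sum_list: "(\<And>x. x \<in> set L \<Longrightarrow> convergent (\<lambda>n. f x n :: real)) \<Longrightarrow> convergent (\<lambda>n. \<Sum>x\<leftarrow>L. f x n)"
  by (induction L) (auto intro: convergent_add convergent_const)

lemma sum_list_divide: "(\<Sum>x\<leftarrow>L. f x) / (c :: real) = (\<Sum>x\<leftarrow>L. f x / c)"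
  by (induction L) (auto simp: add_divide_distrib)

context fring_ideal begin

definition rl :: "nat \<Rightarrow> (int \<Rightarrow> 'r set) \<Rightarrow> (int \<Rightarrow> 'r set) \<Rightarrow> int \<Rightarrow> real" where
  "rl q N Z j = real (the_enat (\<phi> 1 q N Z j))"

definition \<kappa>r :: real where "\<kappa>r = real (the_enat \<kappa>)"

lemma \<kappa>_enat: "\<kappa> = enat (the_enat \<kappa>)" using \<kappa>_finite by auto

lemma \<kappa>r_pos: "\<kappa>r > 0"
  unfolding \<kappa>r_def using \<kappa>_pos \<kappa>_enat by (metis gr0I of_nat_0_less_iff zero_enat_def)

lemma \<kappa>_power: "\<kappa> ^ e = enat (the_enat \<kappa> ^ e)"
proof (induction e)
  case (Suc e)
  have "\<kappa> ^ Suc e = enat (the_enat \<kappa>) * enat (the_enat \<kappa> ^ e)" using Suc \<kappa>_enat by simp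
  then show ?case by simp
qed (simp add: one_enat_def)

lemma two_le_p: "2 \<le> p" using prime_ge_2_nat[OF prime_p] .

lemma p_pow_ge1: "p ^ n \<ge> 1" using two_le_p by simp

text \<open>Passing from \<open>q\<close> to \<open>q * p ^ e\<close> replaces a module by its pushforward, up to the factor
  \<open>\<kappa> ^ e\<close> for the restriction of scalars.\<close>

lemma decomposition_real:
  assumes g: "gm 1 N Z" and f: "fg 1 N Z" and c: "cover (Suc k) B (p ^ e) (\<lambda>j. N (int (p ^ e) * j)) (\<lambda>j. Z (int (p ^ e) * j))"
    and B: "topset (Suc k) B" and A: "finite A" "\<And>P. P \<in> A \<Longrightarrow> hp P" "B \<subseteq> A" "\<And>P P'. P \<in> B \<Longrightarrow> P' \<in> A \<Longrightarrow> P' \<le> P \<Longrightarrow> P' = P"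
    and kill: "\<And>i r j x. r \<in> R i \<Longrightarrow> \<forall>P\<in>A. r \<in> P i \<Longrightarrow> x \<in> N (int (p ^ e) * j) \<Longrightarrow> r ^ (p ^ e) * x \<in> Z (int (p ^ e) * (i + j))"
    and fin: "\<And>q j. \<phi> 1 q N Z j \<noteq> \<infinity>" and finP: "\<And>P q j. P \<in> B \<Longrightarrow> \<phi> 1 q R P j \<noteq> \<infinity>"
  shows "\<exists>L C. set L \<subseteq> B \<and> C \<ge> 0 \<and> (\<forall>n j. \<bar>\<kappa>r ^ e * rl (p ^ (n + e)) N Z (int (p ^ e) * j) - (\<Sum>P\<leftarrow>L. rl (p ^ n) R P j)\<bar>
    \<le> C * (\<bar>real_of_int j\<bar> + real (p ^ n)) ^ k)"
proof -
  let ?N = "\<lambda>j. N (int (p ^ e) * j)" and ?Z = "\<lambda>j. Z (int (p ^ e) * j)"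
  have gt: "gm (p ^ e) ?N ?Z" using gm_twist[OF g, of e] by simp
  have "fg (p ^ e) ?N ?Z" using fg_twist[OF f g ppow_1, of e] by simp
  then have nt: "noeth (p ^ e) ?N ?Z" by (rule fg_noeth[OF _ ppow_power gmD(2)[OF gt]])
  obtain L where L: "set L \<subseteq> B" "approx k (\<lambda>q. \<phi> (p ^ e) q ?N ?Z) (\<lambda>q j. \<Sum>P\<leftarrow>L. \<phi> 1 q R P j)"
    using decomposition[OF gt nt ppow_power c B A kill] by blast
  have tw: "\<phi> (p ^ e) q ?N ?Z j = enat (the_enat \<kappa> ^ e * the_enat (\<phi> 1 (q * p ^ e) N Z (int (p ^ e) * j)))" for q j
  proof -
    have "\<phi> 1 (q * p ^ e) N Z (int (p ^ e) * j) = enat (the_enat (\<phi> 1 (q * p ^ e) N Z (int (p ^ e) * j)))"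
      using fin[of "q * p ^ e" "int (p ^ e) * j"] by auto
    from \<phi>_twist[OF g ppow_1 this] show ?thesis by (simp add: \<kappa>_power)
  qed
  have sm: "(\<Sum>P\<leftarrow>L. \<phi> 1 q R P j) = enat (\<Sum>P\<leftarrow>L. the_enat (\<phi> 1 q R P j))" for q j
  proof -
    have "(\<Sum>P\<leftarrow>L. \<phi> 1 q R P j) = (\<Sum>P\<leftarrow>L. enat (the_enat (\<phi> 1 q R P j)))"
    proof (rule arg_cong[where f = sum_list], rule map_cong[OF refl])
      fix P assume "P \<in> set L"
      then show "\<phi> 1 q R P j = enat (the_enat (\<phi> 1 q R P j))"
        using finP[of P q j] L(1) by (cases "\<phi> 1 q R P j") auto
    qed
    then show ?thesis by (simp only: sum_list_enat)
  qed
  have f1: "\<phi> (p ^ e) q ?N ?Z j \<noteq> \<infinity>" and f2: "(\<Sum>P\<leftarrow>L. \<phi> 1 q R P j) \<noteq> \<infinity>" for q j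
    unfolding tw sm by simp_all
  from approx_real[OF L(2) f1 f2] obtain C where C0: "C \<ge> 0" "\<forall>q j. q \<ge> 1 \<longrightarrow>
    \<bar>real (the_enat (\<phi> (p ^ e) q ?N ?Z j)) - real (the_enat (\<Sum>P\<leftarrow>L. \<phi> 1 q R P j))\<bar> \<le> C * (\<bar>real_of_int j\<bar> + real q) ^ k"
    by (elim exE conjE) (rule that)
  note C = C0(1) C0(2)[rule_format]
  have "\<bar>\<kappa>r ^ e * rl (p ^ (n + e)) N Z (int (p ^ e) * j) - (\<Sum>P\<leftarrow>L. rl (p ^ n) R P j)\<bar>
    \<le> C * (\<bar>real_of_int j\<bar> + real (p ^ n)) ^ k" for n j
    using C(2)[OF p_pow_ge1, of n j] unfolding tw sm the_enat.simps sum_list_real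
    by (simp add: rl_def \<kappa>r_def power_add)
  then show ?thesis using L(1) C(1) by blast
qed

section \<open>Convergence for R / P and for general modules\<close>

lemma shift_real:
  assumes g: "gm 1 N Z" and n: "noeth 1 N Z" and c: "cover (Suc k) B 1 N Z" and B: "topset (Suc k) B"
  shows "\<exists>C\<ge>0. \<forall>n j. \<bar>rl (p ^ n) N Z (j + a) - rl (p ^ n) N Z j\<bar> \<le> C * (\<bar>real_of_int j\<bar> + real (p ^ n)) ^ k"
proof -
  have fin: "\<phi> 1 q N Z j \<noteq> \<infinity>" for q j using \<phi>_finite[OF g n ppow_1 c B] by (metis enat_ile enat.distinct(1))
  have "approx k (\<lambda>q. \<phi> 1 q N Z) (\<lambda>q j. \<phi> 1 q N Z (j - (- a)))"
    by (rule approx_shift_all[OF shift[OF g n ppow_1 c B]])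
  then have "approx k (\<lambda>q j. \<phi> 1 q N Z (j + a)) (\<lambda>q. \<phi> 1 q N Z)" by (simp add: approx_sym)
  from approx_real[OF this fin fin] obtain C where "C \<ge> 0" "\<And>q j. q \<ge> 1 \<Longrightarrow>
     \<bar>real (the_enat (\<phi> 1 q N Z (j + a))) - real (the_enat (\<phi> 1 q N Z j))\<bar> \<le> C * (\<bar>real_of_int j\<bar> + real q) ^ k" by blast
  then show ?thesis unfolding rl_def using p_pow_ge1 by blast
qed

lemma bound_real:
  assumes g: "gm 1 N Z" and n: "noeth 1 N Z" and c: "cover (Suc k) B 1 N Z" and B: "topset (Suc k) B"
  shows "\<exists>A\<ge>0. \<forall>n j. \<bar>rl n N Z j\<bar> \<le> A * (\<bar>real_of_int j\<bar> + 1) ^ Suc k"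
proof -
  obtain C where C: "\<And>q j. \<phi> 1 q N Z j \<le> enat (C * (nat \<bar>j\<bar> + 1) ^ Suc k)"
    using \<phi>_finite[OF g n ppow_1 c B] by blast
  have "\<bar>rl q N Z j\<bar> \<le> real C * (\<bar>real_of_int j\<bar> + 1) ^ Suc k" for q j
  proof -
    obtain x where x: "\<phi> 1 q N Z j = enat x" using C[of q j] enat_ile by blast
    then have "x \<le> C * (nat \<bar>j\<bar> + 1) ^ Suc k" using C[of q j] by (simp del: power_Suc)
    then have "real x \<le> real (C * (nat \<bar>j\<bar> + 1) ^ Suc k)" using of_nat_le_iff by blast
    also have "\<dots> = real C * (\<bar>real_of_int j\<bar> + 1) ^ Suc k" by (simp add: add.commute del: power_Suc)
    finally show ?thesis unfolding rl_def x by simp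
  qed
  then show ?thesis by (intro exI[of _ "real C"]) auto
qed

lemma prime_facts:
  assumes B: "topset D B" and P: "P \<in> B"
  shows "gm 1 R P" "noeth 1 R P" "cover D {P} 1 R P" "topset D {P}" "fg 1 R P"
proof -
  have hP: "hp P" using B P by (auto simp: topset_def)
  note Pc = hpD(1)[OF hP]
  show gP: "gm 1 R P" by (rule gmI[OF cl_R hpD(1,2)[OF hP]])
  have KP: "(\<lambda>_. K) \<le> P" by (simp add: le_fun_def cl_K[OF Pc])
  show "noeth 1 R P" by (rule noeth_sub[OF noeth_R KP order_refl])
  show "fg 1 R P" by (rule fg_mono[OF fg_R KP])
  show "topset D {P}" using B P by (auto simp: topset_def)
  have "P \<le> annN 1 R P"
  proof (rule le_funI, rule subsetI)
    fix i r assume r: "r \<in> P i"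
    have "r * x \<in> P (i + j)" if "x \<in> R j" for x j
      using hpD(5)[OF hP that r] by (simp add: mult.commute add.commute)
    then show "r \<in> annN 1 R P i" using r hpD(2)[OF hP] by (auto simp: annN_def)
  qed
  then show "cover D {P} 1 R P" by (rule cover_prime[OF B P])
qed

text \<open>\<open>P\<close> kills the pushforward of R / P and is its only possible component of
  top dimension. So \<open>decomposition_real\<close> yields copies of R / P itself, and the
  recursion closes up with their number as its factor.\<close>

lemma prime_convergent:
  assumes B: "topset (Suc k) B" and P: "P \<in> B"
  shows "convergent (\<lambda>n. rl (p ^ n) R P \<lfloor>s * real (p ^ n)\<rfloor> / real (p ^ n) ^ Suc k)"
proof -
  note pf = prime_facts[OF B P]
  have hP: "hp P" using B P by (auto simp: topset_def)
  have fin: "\<phi> 1 q R P j \<noteq> \<infinity>" for q j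
    using \<phi>_finite[OF pf(1,2) ppow_1 pf(3,4)] by (metis enat_ile enat.distinct(1))
  obtain C where C: "C \<ge> 0" "\<And>n j. \<bar>rl (p ^ n) R P (j + 1) - rl (p ^ n) R P j\<bar> \<le> C * (\<bar>real_of_int j\<bar> + real (p ^ n)) ^ k"
    using shift_real[OF pf(1-4), of 1] by blast
  obtain A where A: "A \<ge> 0" "\<And>n j. \<bar>rl n R P j\<bar> \<le> A * (\<bar>real_of_int j\<bar> + 1) ^ Suc k"
    using bound_real[OF pf(1-4)] by blast
  have kill: "r ^ p * x \<in> P (int p * (i + j))" if r: "r \<in> P i" and x: "x \<in> R (int p * j)" for r x i j
  proof -
    have "r \<in> R i" using r hpD(2)[OF hP] by blast
    have "(r ^ (p - 1) * x) * r \<in> P ((int (p - 1) * i + int p * j) + i)"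
      by (rule hpD(5)[OF hP R_mult[OF power_R[OF \<open>r \<in> R i\<close>] x] r])
    moreover have "(r ^ (p - 1) * x) * r = r ^ p * x"
      using two_le_p by (cases p) (auto simp: mult_ac)
    moreover have "(int (p - 1) * i + int p * j) + i = int p * (i + j)"
      using two_le_p by (simp add: of_nat_diff algebra_simps)
    ultimately show ?thesis by simp
  qed
  have "P \<le> annN (p ^ 1) (\<lambda>j. R (int (p ^ 1) * j)) (\<lambda>j. P (int (p ^ 1) * j))"
  proof (rule le_funI, rule subsetI)
    fix i r assume r: "r \<in> P i"
    then have "r \<in> R i" using hpD(2)[OF hP] by blast
    then show "r \<in> annN (p ^ 1) (\<lambda>j. R (int (p ^ 1) * j)) (\<lambda>j. P (int (p ^ 1) * j)) i"
      using kill[OF r] by (simp add: annN_def)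
  qed
  from cover_prime[OF B P this]
  have cv: "cover (Suc k) {P} (p ^ 1) (\<lambda>j. R (int (p ^ 1) * j)) (\<lambda>j. P (int (p ^ 1) * j))" .
  have "\<exists>L D. set L \<subseteq> {P} \<and> D \<ge> 0 \<and> (\<forall>n j. \<bar>\<kappa>r ^ 1 * rl (p ^ (n + 1)) R P (int (p ^ 1) * j) - (\<Sum>P\<leftarrow>L. rl (p ^ n) R P j)\<bar>
    \<le> D * (\<bar>real_of_int j\<bar> + real (p ^ n)) ^ k)"
  proof (rule decomposition_real[OF pf(1,5) cv pf(4), where A = "{P}"])
    show "r ^ (p ^ 1) * x \<in> P (int (p ^ 1) * (i + j))"
      if "r \<in> R i" "\<forall>P\<in>{P}. r \<in> P i" "x \<in> R (int (p ^ 1) * j)" for i r j x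
      using kill[of r i x j] that by simp
    show "hp P'" if "P' \<in> {P}" for P' using that hP by simp
    show "P'' = P'" if "P' \<in> {P}" "P'' \<in> {P}" for P' P'' using that by simp
    show "\<phi> 1 q R P' j \<noteq> \<infinity>" if "P' \<in> {P}" for P' q j using that fin by simp
    show "\<phi> 1 q R P j \<noteq> \<infinity>" for q j by (rule fin)
  qed auto
  then obtain L D where L0: "set L \<subseteq> {P}" "D \<ge> 0" "\<forall>n j. \<bar>\<kappa>r ^ 1 * rl (p ^ (n + 1)) R P (int (p ^ 1) * j) - (\<Sum>P\<leftarrow>L. rl (p ^ n) R P j)\<bar>
    \<le> D * (\<bar>real_of_int j\<bar> + real (p ^ n)) ^ k" by (elim exE conjE) (rule that)
  note L = L0(1,2) L0(3)[rule_format]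
  have sl: "(\<Sum>P\<leftarrow>L. rl q R P j) = real (length L) * rl q R P j" for q j
    using L(1) by (induction L) (auto simp: algebra_simps)
  interpret D: density_seq p k "\<lambda>n. rl (p ^ n) R P" C
    by standard (use two_le_p C in auto)
  have "convergent (\<lambda>n. D.g n s)"
    by (rule D.recursive_convergent[OF A(2) A(1) _ \<kappa>r_pos L(2), of "real (length L)"])
      (use L(3) in \<open>simp_all add: sl\<close>)
  then show ?thesis by (simp add: D.g_def)
qed

context
  fixes M :: "int \<Rightarrow> 'r set" and k :: nat
  assumes M: "cl 1 M" and fgM: "fg 1 M (\<lambda>_. K)"
    and dimM: "\<And>P. hp P \<Longrightarrow> annN 1 M (\<lambda>_. K) \<le> P \<Longrightarrow> cb (Suc (Suc k)) P"
begin

lemma K_cl: "cl 1 (\<lambda>_. K)" by (rule cl_Kfam) simp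

lemma gmM: "gm 1 M (\<lambda>_. K)" by (rule gmI[OF M K_cl cl_K[OF M]])

lemma noethM: "noeth 1 M (\<lambda>_. K)" by (rule fg_noeth[OF fgM ppow_1 K_cl])

lemma module_primes:
  "\<exists>A e. finite A \<and> (\<forall>P\<in>A. hp P) \<and> (\<forall>P\<in>A. \<forall>P'\<in>A. P \<le> P' \<longrightarrow> P = P') \<and>
    topset (Suc k) {P \<in> A. \<not> cb (Suc k) P} \<and> cover (Suc k) {P \<in> A. \<not> cb (Suc k) P} 1 M (\<lambda>_. K) \<and>
    (\<forall>i r. r \<in> R i \<longrightarrow> (\<forall>P\<in>A. r \<in> P i) \<longrightarrow> r ^ (p ^ e) \<in> annN 1 M (\<lambda>_. K) (int (p ^ e) * i))"
  by (rule minimal_primes[OF gmM noethM dimM])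

text \<open>The p^e-th powers of elements lying in all minimal primes kill M, so the e-th
  pushforward is a module over the reduced ring and \<open>decomposition_real\<close> applies. Its
  level n + e is a sum of terms for primes at level n, each convergent after normalization.\<close>

lemma module_convergent: "convergent (\<lambda>n. rl (p ^ n) M (\<lambda>_. K) \<lfloor>s * real (p ^ n)\<rfloor> / real (p ^ n) ^ Suc k)"
proof -
  from module_primes
  obtain A e where A0: "finite A" "\<forall>P\<in>A. hp P" "\<forall>P\<in>A. \<forall>P'\<in>A. P \<le> P' \<longrightarrow> P = P'"
    "topset (Suc k) {P \<in> A. \<not> cb (Suc k) P}" "cover (Suc k) {P \<in> A. \<not> cb (Suc k) P} 1 M (\<lambda>_. K)"
    "\<forall>i r. r \<in> R i \<longrightarrow> (\<forall>P\<in>A. r \<in> P i) \<longrightarrow> r ^ (p ^ e) \<in> annN 1 M (\<lambda>_. K) (int (p ^ e) * i)"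
    by (elim exE conjE) (rule that)
  note A = A0(1) A0(2)[rule_format] A0(3)[rule_format] A0(4,5)
  define B where "B = {P \<in> A. \<not> cb (Suc k) P}"
  note B = A(4)[folded B_def] and cv = A(5)[folded B_def]
  have fin: "\<phi> 1 q M (\<lambda>_. K) j \<noteq> \<infinity>" for q j
    using \<phi>_finite[OF gmM noethM ppow_1 cv B] by (metis enat_ile enat.distinct(1))
  have finP: "\<phi> 1 q R P j \<noteq> \<infinity>" if "P \<in> B" for P q j
    using \<phi>_finite[OF prime_facts(1,2)[OF B that] ppow_1 prime_facts(3,4)[OF B that]] by (metis enat_ile enat.distinct(1))
  obtain C where C: "C \<ge> 0" "\<And>n j. \<bar>rl (p ^ n) M (\<lambda>_. K) (j + 1) - rl (p ^ n) M (\<lambda>_. K) j\<bar> \<le> C * (\<bar>real_of_int j\<bar> + real (p ^ n)) ^ k"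
    using shift_real[OF gmM noethM cv B, of 1] by blast
  have "annN 1 M (\<lambda>_. K) \<le> annN (p ^ e) (\<lambda>j. M (int (p ^ e) * j)) (\<lambda>j. K)"
  proof (rule le_funI, rule subsetI)
    fix i r assume r: "r \<in> annN 1 M (\<lambda>_. K) i"
    have "r ^ (p ^ e) * x \<in> K" if x: "x \<in> M j" for x j
    proof -
      have "r * x \<in> K" using r x by (auto simp: annN_def)
      then have "r ^ (p ^ e - 1) * (r * x) \<in> K" by (rule K_ideal)
      moreover have "r ^ (p ^ e - 1) * (r * x) = r ^ (p ^ e) * x"
        using p_pow_ge1[of e] by (cases "p ^ e") (auto simp: mult_ac)
      ultimately show ?thesis by simp
    qed
    then show "r \<in> annN (p ^ e) (\<lambda>j. M (int (p ^ e) * j)) (\<lambda>j. K) i" using r by (auto simp: annN_def)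
  qed
  then have cvt: "cover (Suc k) B (p ^ e) (\<lambda>j. M (int (p ^ e) * j)) (\<lambda>j. K)"
    using cv unfolding cover_def by (meson order_trans)
  have kill: "r ^ (p ^ e) * x \<in> K" if "r \<in> R i" "\<forall>P\<in>A. r \<in> P i" "x \<in> M (int (p ^ e) * j)" for i r j x
    using A0(6)[rule_format, OF that(1)] that(2,3) by (auto simp: annN_def)
  have minB: "P' = P" if "P \<in> B" "P' \<in> A" "P' \<le> P" for P P'
    using A(3)[OF that(2) _ that(3)] that(1) by (auto simp: B_def)
  have BA: "B \<subseteq> A" by (auto simp: B_def)
  have "\<exists>L D. set L \<subseteq> B \<and> D \<ge> 0 \<and>
    (\<forall>n j. \<bar>\<kappa>r ^ e * rl (p ^ (n + e)) M (\<lambda>_. K) (int (p ^ e) * j) - (\<Sum>P\<leftarrow>L. rl (p ^ n) R P j)\<bar>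
      \<le> D * (\<bar>real_of_int j\<bar> + real (p ^ n)) ^ k)"
    by (rule decomposition_real[OF gmM fgM cvt B A(1,2) BA minB kill fin finP])
  then obtain L D where L0: "set L \<subseteq> B" "D \<ge> 0"
    "\<forall>n j. \<bar>\<kappa>r ^ e * rl (p ^ (n + e)) M (\<lambda>_. K) (int (p ^ e) * j) - (\<Sum>P\<leftarrow>L. rl (p ^ n) R P j)\<bar>
      \<le> D * (\<bar>real_of_int j\<bar> + real (p ^ n)) ^ k"
    by (elim exE conjE) (rule that)
  note L = L0(1,2) L0(3)[rule_format]
  interpret D: density_seq p k "\<lambda>n. rl (p ^ n) M (\<lambda>_. K)" C
    by standard (use two_le_p C in auto)
  obtain D' where D': "\<And>n. \<bar>\<kappa>r ^ e * real (p ^ e) ^ Suc k * D.g (n + e) s -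
      (\<Sum>P\<leftarrow>L. rl (p ^ n) R P \<lfloor>s * real (p ^ n)\<rfloor>) / real (p ^ n) ^ Suc k\<bar> \<le> D' / real (p ^ n)"
    using D.twist_step[of "\<kappa>r ^ e" e "\<lambda>n j. \<Sum>P\<leftarrow>L. rl (p ^ n) R P j", OF L(3) _ L(2)] \<kappa>r_pos by auto
  define S where "S n = (\<Sum>P\<leftarrow>L. rl (p ^ n) R P \<lfloor>s * real (p ^ n)\<rfloor>) / real (p ^ n) ^ Suc k" for n
  have "convergent S"
    unfolding S_def sum_list_divide using L(1) by (intro convergent_sum_list prime_convergent[OF B]) auto
  then obtain l where l: "S \<longlonglongrightarrow> l" by (auto simp: convergent_def)
  define c where "c = \<kappa>r ^ e * real (p ^ e) ^ Suc k"
  have c: "c > 0" unfolding c_def using \<kappa>r_pos two_le_p by (intro mult_pos_pos zero_less_power) auto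
  have "(\<lambda>n. c * D.g (n + e) s - S n) \<longlonglongrightarrow> 0"
    by (rule Lim_null_comparison[OF _ D.inverse_pn[of D']]) (use D' in \<open>auto simp: S_def c_def\<close>)
  from tendsto_add[OF this l] have "(\<lambda>n. c * D.g (n + e) s) \<longlonglongrightarrow> l" by simp
  from tendsto_divide[OF this tendsto_const[of c]] have "(\<lambda>n. D.g (n + e) s) \<longlonglongrightarrow> l / c" using c by simp
  then have "(\<lambda>n. D.g n s) \<longlonglongrightarrow> l / c" by (rule LIMSEQ_offset)
  then show ?thesis unfolding convergent_def D.g_def by blast
qed

lemma quotient_shift:
  assumes Z: "cl 1 Z" "Z \<le> M"
  shows "\<exists>C\<ge>0. \<forall>n j. \<bar>rl (p ^ n) M Z (j + a) - rl (p ^ n) M Z j\<bar> \<le> C * (\<bar>real_of_int j\<bar> + real (p ^ n)) ^ k"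
    and "\<exists>A\<ge>0. \<forall>q j. \<bar>rl q M Z j\<bar> \<le> A * (\<bar>real_of_int j\<bar> + 1) ^ Suc k"
    and "\<phi> 1 q M Z j \<noteq> \<infinity>"
proof -
  from module_primes
  obtain A where A: "topset (Suc k) {P \<in> A. \<not> cb (Suc k) P}" "cover (Suc k) {P \<in> A. \<not> cb (Suc k) P} 1 M (\<lambda>_. K)"
    by (elim exE conjE) (rule that)
  have KZ: "(\<lambda>_. K) \<le> Z" by (simp add: le_fun_def cl_K[OF Z(1)])
  have g: "gm 1 M Z" unfolding gm_def using M Z by blast
  note n = noeth_sub[OF noethM KZ order_refl] and cv = cover_mono[OF A(2) KZ order_refl]
  show "\<exists>C\<ge>0. \<forall>n j. \<bar>rl (p ^ n) M Z (j + a) - rl (p ^ n) M Z j\<bar> \<le> C * (\<bar>real_of_int j\<bar> + real (p ^ n)) ^ k"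
    by (rule shift_real[OF g n cv A(1)])
  show "\<exists>A\<ge>0. \<forall>q j. \<bar>rl q M Z j\<bar> \<le> A * (\<bar>real_of_int j\<bar> + 1) ^ Suc k"
    by (rule bound_real[OF g n cv A(1)])
  show "\<phi> 1 q M Z j \<noteq> \<infinity>" using \<phi>_finite[OF g n ppow_1 cv A(1)] by (metis enat_ile enat.distinct(1))
qed

subsection \<open>The submodules generated in bounded degrees\<close>

text \<open>The submodule generated by the elements of degree at most i. The degree c part of m^j M
  is \<open>hul (c - j) c\<close>: a generator of degree at most c - j needs a factor of degree at
  least j to reach degree c.\<close>

definition hul :: "int \<Rightarrow> int \<Rightarrow> 'r set" where
  "hul i j = \<Inter>{U j | U. cl 1 U \<and> (\<forall>c\<le>i. M c \<subseteq> U c)}"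

lemma cl_hul: "cl 1 (hul i)"
  unfolding cl_def
proof (intro conjI allI ballI)
  fix j
  show "sgp (hul i j)" unfolding sgp_def
  proof (intro conjI ballI)
    show "0 \<in> hul i j" unfolding hul_def by (rule InterI, clarify, rule sgp_zero, rule cl_sgp)
    fix x y assume x: "x \<in> hul i j" and y: "y \<in> hul i j"
    show "x - y \<in> hul i j" unfolding hul_def
    proof (rule InterI, clarify)
      fix U assume U: "cl 1 U" "\<forall>c\<le>i. M c \<subseteq> U c"
      then have "x \<in> U j" "y \<in> U j" using x y unfolding hul_def by blast+
      then show "x - y \<in> U j" by (rule sgp_diff[OF cl_sgp[OF U(1)]])
    qed
  qed
  show "K \<subseteq> hul i j" unfolding hul_def by (rule Inter_greatest, clarify, rule subsetD, rule cl_K)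
  fix l r x assume r: "r \<in> R l" and x: "x \<in> hul i j"
  show "r ^ 1 * x \<in> hul i (l + j)" unfolding hul_def
  proof safe
    fix U assume U: "cl 1 U" "\<forall>c\<le>i. M c \<subseteq> U c"
    then have "x \<in> U j" using x by (auto simp: hul_def)
    from cl_mult[OF U(1) r this] show "r ^ 1 * x \<in> U (l + j)" .
  qed
qed

lemma hul_le: "cl 1 U \<Longrightarrow> (\<And>c. c \<le> i \<Longrightarrow> M c \<subseteq> U c) \<Longrightarrow> hul i j \<subseteq> U j"
  unfolding hul_def by (intro Inter_lower) blast

lemma hul_gen: "c \<le> i \<Longrightarrow> M c \<subseteq> hul i c"
  by (auto simp: hul_def)

lemma hul_M: "hul i \<le> M" by (intro le_funI hul_le M order_refl)

lemma degree_range: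
  "\<exists>a b. a \<le> b \<and> (\<forall>j<a. M j = K) \<and> (\<forall>i\<ge>b. hul i = M)"
proof -
  obtain G where G: "finite G" "\<forall>ga\<in>G. fst ga \<in> M (snd ga)"
    "\<And>U. cl 1 U \<Longrightarrow> (\<lambda>_. K) \<le> U \<Longrightarrow> (\<forall>ga\<in>G. fst ga \<in> U (snd ga)) \<Longrightarrow> M \<le> U"
    using fgM unfolding fg_def by blast
  \<comment> \<open>Inserting 0 gives a \<le> 0 \<le> b even when there are no generators.\<close>
  define a where "a = Min (insert 0 (snd ` G))"
  define b where "b = Max (insert 0 (snd ` G))"
  have ab: "a \<le> snd ga" "snd ga \<le> b" if "ga \<in> G" for ga using that G(1) by (auto simp: a_def b_def)
  have "a \<le> 0" "0 \<le> b" using G(1) by (auto simp: a_def b_def)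
  define U where "U j = (if j < a then K else M j)" for j
  have "cl 1 U" unfolding cl_def
  proof (intro conjI allI ballI)
    fix j show "sgp (U j)" "K \<subseteq> U j" using sgp_K cl_sgp[OF M] cl_K[OF M] by (auto simp: U_def)
    fix i r x assume r: "r \<in> R i" and x: "x \<in> U j"
    have KU: "K \<subseteq> U (i + j)" using cl_K[OF M] by (auto simp: U_def)
    show "r ^ 1 * x \<in> U (i + j)"
    proof (cases "i < 0 \<or> j < a")
      case True
      then have "r * x \<in> K" using r x R_neg[of i] K_ideal K_ideal' by (auto simp: U_def)
      then show ?thesis using KU by auto
    next
      case False
      then have "\<not> i + j < a" by linarith
      then show ?thesis using cl_mult[OF M r, of x j] x False by (auto simp: U_def)
    qed
  qed
  moreover have "(\<lambda>_. K) \<le> U" using cl_K[OF M] by (auto simp: U_def le_fun_def)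
  moreover have "\<forall>ga\<in>G. fst ga \<in> U (snd ga)" using G(2) ab(1) by (force simp: U_def)
  ultimately have "M \<le> U" by (rule G(3))
  then have "M j = K" if "j < a" for j using that cl_K[OF M, of j] by (auto simp: U_def le_fun_def dest!: spec[of _ j])
  moreover have "hul i = M" if "i \<ge> b" for i
  proof (rule antisym[OF hul_M])
    show "M \<le> hul i"
    proof (rule G(3)[OF cl_hul])
      show "(\<lambda>_. K) \<le> hul i" by (simp add: le_fun_def cl_K[OF cl_hul])
      show "\<forall>ga\<in>G. fst ga \<in> hul i (snd ga)" using G(2) ab(2) hul_gen[of _ i] that by (meson order_trans subsetD)
    qed
  qed
  ultimately show ?thesis using \<open>a \<le> 0\<close> \<open>0 \<le> b\<close> by (intro exI[of _ a] exI[of _ b]) auto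
qed

text \<open>The length of M / (m^j + J^[q]) M, summed over the degrees c. With \<open>a\<close> and
  \<open>b\<close> from \<open>degree_range\<close>, M vanishes below \<open>a\<close>, and from
  degree j + b on the hull is all of M.\<close>

definition hh :: "int \<Rightarrow> int \<Rightarrow> nat \<Rightarrow> int \<Rightarrow> real" where
  "hh a b q j = (\<Sum>c\<in>{a..<j + b}. rl q M (hul (c - j)) c)"

lemma rl_hul_zero: "c \<le> i \<Longrightarrow> rl q M (hul i) c = 0"
proof -
  assume c: "c \<le> i"
  have g: "gm 1 M (hul i)" unfolding gm_def using M cl_hul hul_M by blast
  have "M c \<subseteq> JN 1 q M (hul i) c" using hul_gen[OF c] JN_Z[OF g] by blast
  then have "JN 1 q M (hul i) c = M c" using JN_N[OF g] by blast
  then show ?thesis by (simp add: rl_def \<phi>_def len_same zero_enat_def)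
qed

lemma hh_zero: "j \<le> 0 \<Longrightarrow> hh a b q j = 0"
  unfolding hh_def by (intro sum.neutral ballI rl_hul_zero) simp

text \<open>Passing from j to j + 1 lowers the index of the hull in degree c from c - j to c - j -
  1, which matters only for a \<le> c - j \<le> b. Each of these boundedly many terms is moved to
  degree j at the cost of a shift estimate. There the sum over the indices telescopes from the zero
  hull to the whole of M and leaves the length of M / J^[q] M in degree j.\<close>

lemma hh_diff:
  assumes ab: "a \<le> b" "\<And>j. j < a \<Longrightarrow> M j = K" "\<And>i. i \<ge> b \<Longrightarrow> hul i = M"
  shows "\<exists>C\<ge>0. \<forall>n j. \<bar>hh a b (p ^ n) (j + 1) - hh a b (p ^ n) j - rl (p ^ n) M (\<lambda>_. K) j\<bar>
    \<le> C * (\<bar>real_of_int j\<bar> + real (p ^ n)) ^ k"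
proof -
  define \<eta> where "\<eta> n i c = rl (p ^ n) M (hul i) c" for n i c
  have lowK: "hul i = (\<lambda>_. K)" if "i < a" for i
  proof (rule antisym)
    show "hul i \<le> (\<lambda>_. K)" by (rule le_funI, rule hul_le[OF K_cl]) (use ab(2) that in auto)
    show "(\<lambda>_. K) \<le> hul i" by (simp add: le_fun_def cl_K[OF cl_hul])
  qed
  have top0: "\<eta> n i c = 0" if "i \<ge> b" for n i c
    unfolding \<eta>_def ab(3)[OF that] rl_def using \<phi>_zero[OF M] by (simp add: zero_enat_def)
  define N where "N = nat (b - a)"
  have N: "b = a + int N" using ab(1) by (simp add: N_def)
  have "\<exists>C. \<forall>m x. C m x \<ge> 0 \<and> (\<forall>n j. \<bar>\<eta> n m (j + x) - \<eta> n m j\<bar> \<le> C m x * (\<bar>real_of_int j\<bar> + real (p ^ n)) ^ k)"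
    using quotient_shift(1)[OF cl_hul hul_M] unfolding \<eta>_def by (intro choice allI) blast
  then obtain C where C: "\<And>m x. C m x \<ge> 0" "\<And>m x n j. \<bar>\<eta> n m (j + x) - \<eta> n m j\<bar> \<le> C m x * (\<bar>real_of_int j\<bar> + real (p ^ n)) ^ k"
    by blast
  define D where "D = (\<Sum>m<Suc N. C (a - 1 + int m) (a + int m) + C (a + int m) (a + int m))"
  have D0: "D \<ge> 0" unfolding D_def using C(1) by (intro sum_nonneg add_nonneg_nonneg)
  obtain A where A: "A \<ge> 0" "\<And>q j. \<bar>rl q M (\<lambda>_. K) j\<bar> \<le> A * (\<bar>real_of_int j\<bar> + 1) ^ Suc k"
    using quotient_shift(2)[OF K_cl] cl_K[OF M] by (auto simp: le_fun_def)
  \<comment> \<open>This covers negative j: there \<open>hh\<close> is 0 at j and j + 1, while M may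
    live in the finitely many negative degrees from \<open>a\<close> on.\<close>
  define A' where "A' = A * (\<bar>real_of_int a\<bar> + 1) ^ Suc k"
  have A'0: "A' \<ge> 0" using A(1) by (simp add: A'_def)
  have "\<bar>hh a b (p ^ n) (j + 1) - hh a b (p ^ n) j - rl (p ^ n) M (\<lambda>_. K) j\<bar> \<le> (D + A') * (\<bar>real_of_int j\<bar> + real (p ^ n)) ^ k" for n j
  proof (cases "j < 0")
    case True
    have ge1: "(\<bar>real_of_int j\<bar> + real (p ^ n)) ^ k \<ge> 1" using p_pow_ge1[of n] by (intro one_le_power) linarith
    have "\<bar>rl (p ^ n) M (\<lambda>_. K) j\<bar> \<le> A'"
    proof (cases "j < a")
      case True
      have "JN 1 (p ^ n) M (\<lambda>_. K) j = K"
        using JN_N[OF gmM, of "p ^ n" j] JN_K[OF gmM, of "p ^ n" j] ab(2)[OF True] by auto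
      then show ?thesis using A'0 by (simp add: rl_def \<phi>_def ab(2)[OF True] len_same zero_enat_def)
    next
      case False
      have "A * (\<bar>real_of_int j\<bar> + 1) ^ Suc k \<le> A'" unfolding A'_def
        using False \<open>j < 0\<close> A(1) by (intro mult_left_mono power_mono) auto
      then show ?thesis using A(2)[of "p ^ n" j] by linarith
    qed
    also have "A' * 1 \<le> (D + A') * (\<bar>real_of_int j\<bar> + real (p ^ n)) ^ k"
      using D0 A'0 ge1 by (intro mult_mono) auto
    finally show ?thesis using hh_zero[of "j + 1"] hh_zero[of j] True by simp
  next
    case False
    have h1: "hh a b (p ^ n) (j + 1) = (\<Sum>c\<in>{a..<j + 1 + b}. \<eta> n (c - j - 1) c)"
      by (simp add: hh_def \<eta>_def algebra_simps)
    have "hh a b (p ^ n) j = (\<Sum>c\<in>{a..<j + b}. \<eta> n (c - j) c)" by (simp add: hh_def \<eta>_def)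
    also have "\<dots> = (\<Sum>c\<in>{a..<j + 1 + b}. \<eta> n (c - j) c)"
      by (rule sum.mono_neutral_left) (auto intro!: top0)
    finally have "hh a b (p ^ n) (j + 1) - hh a b (p ^ n) j = (\<Sum>c\<in>{a..<j + 1 + b}. \<eta> n (c - j - 1) c - \<eta> n (c - j) c)"
      using h1 by (simp add: sum_subtractf)
    also have "\<dots> = (\<Sum>c\<in>{j + a..<j + 1 + b}. \<eta> n (c - j - 1) c - \<eta> n (c - j) c)"
    proof (rule sum.mono_neutral_right)
      show "\<forall>c\<in>{a..<j + 1 + b} - {j + a..<j + 1 + b}. \<eta> n (c - j - 1) c - \<eta> n (c - j) c = 0"
      proof
        fix c assume "c \<in> {a..<j + 1 + b} - {j + a..<j + 1 + b}"
        then have "c - j < a" "c - j - 1 < a" by auto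
        then show "\<eta> n (c - j - 1) c - \<eta> n (c - j) c = 0" by (simp add: \<eta>_def lowK)
      qed
    qed (use False in auto)
    also have "\<dots> = (\<Sum>m<Suc N. \<eta> n (a - 1 + int m) (j + (a + int m)) - \<eta> n (a + int m) (j + (a + int m)))"
      by (rule sum.reindex_bij_witness[where i = "\<lambda>m. j + a + int m" and j = "\<lambda>c. nat (c - j - a)"])
        (auto simp: N algebra_simps)
    finally have 1: "hh a b (p ^ n) (j + 1) - hh a b (p ^ n) j =
      (\<Sum>m<Suc N. \<eta> n (a - 1 + int m) (j + (a + int m)) - \<eta> n (a + int m) (j + (a + int m)))" .
    \<comment> \<open>At index a - 1 the hull is \<open>K\<close> and at index a + N = b it is M,
      where the length is 0.\<close>
    have "(\<Sum>m<Suc N. \<eta> n (a - 1 + int m) j - \<eta> n (a - 1 + int (Suc m)) j) = \<eta> n (a - 1 + int 0) j - \<eta> n (a - 1 + int (Suc N)) j"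
      by (rule sum_lessThan_telescope')
    also have "\<dots> = rl (p ^ n) M (\<lambda>_. K) j" using top0[of "a - 1 + int (Suc N)"] lowK[of "a - 1"] by (simp add: \<eta>_def N)
    finally have 2: "rl (p ^ n) M (\<lambda>_. K) j = (\<Sum>m<Suc N. \<eta> n (a - 1 + int m) j - \<eta> n (a + int m) j)" by (simp add: algebra_simps)
    let ?x = "(\<bar>real_of_int j\<bar> + real (p ^ n)) ^ k"
    have "\<bar>hh a b (p ^ n) (j + 1) - hh a b (p ^ n) j - rl (p ^ n) M (\<lambda>_. K) j\<bar> =
      \<bar>\<Sum>m<Suc N. (\<eta> n (a - 1 + int m) (j + (a + int m)) - \<eta> n (a + int m) (j + (a + int m))) - (\<eta> n (a - 1 + int m) j - \<eta> n (a + int m) j)\<bar>"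
      unfolding 1 2 sum_subtractf ..
    also have "\<dots> \<le> (\<Sum>m<Suc N. C (a - 1 + int m) (a + int m) * ?x + C (a + int m) (a + int m) * ?x)"
    proof (rule order_trans[OF sum_abs sum_mono])
      fix m
      show "\<bar>\<eta> n (a - 1 + int m) (j + (a + int m)) - \<eta> n (a + int m) (j + (a + int m)) - (\<eta> n (a - 1 + int m) j - \<eta> n (a + int m) j)\<bar> \<le>
        C (a - 1 + int m) (a + int m) * ?x + C (a + int m) (a + int m) * ?x"
        using C(2)[of n "a - 1 + int m" j "a + int m"] C(2)[of n "a + int m" j "a + int m"] by linarith
    qed
    also have "\<dots> = D * ?x" unfolding D_def sum_distrib_right by (simp add: distrib_right)
    also have "\<dots> \<le> (D + A') * ?x" using A'0 by (intro mult_right_mono) auto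
    finally show ?thesis .
  qed
  then show ?thesis using D0 A'0 by (intro exI[of _ "D + A'"]) auto
qed

end

end

section \<open>Graded totals\<close>

inductive_set tot :: "'r::ab_group_add set \<Rightarrow> (int \<Rightarrow> 'r set) \<Rightarrow> 'r set" for K U where
  tot_K: "x \<in> K \<Longrightarrow> x \<in> tot K U"
| tot_gen: "x \<in> U j \<Longrightarrow> x \<in> tot K U"
| tot_diff: "x \<in> tot K U \<Longrightarrow> y \<in> tot K U \<Longrightarrow> x - y \<in> tot K U"

lemma sgp_tot: "sgp K \<Longrightarrow> sgp (tot K U)"
  using tot_K[OF sgp_zero, of K U] tot_diff by (auto simp: sgp_def[of "tot K U"])

lemma tot_least:
  assumes "sgp C" "K \<subseteq> C" "\<And>j. U j \<subseteq> C" shows "tot K U \<subseteq> C"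
proof
  fix x assume "x \<in> tot K U"
  then show "x \<in> C" by induction (use assms sgp_diff in auto)
qed

lemma tot_mono: "sgp K \<Longrightarrow> (\<And>j. U j \<subseteq> V j) \<Longrightarrow> tot K U \<subseteq> tot K V"
  by (rule tot_least[OF sgp_tot]) (auto intro: tot_K tot_gen)

lemma tot_rep: "f \<in> tot K U \<Longrightarrow> sgp K \<Longrightarrow> (\<And>j. sgp (U j)) \<Longrightarrow> \<exists>I h. finite I \<and> (\<forall>i\<in>I. h i \<in> U i) \<and> f - (\<Sum>i\<in>I. h i) \<in> K"
proof (induction rule: tot.induct)
  case (tot_K x)
  then show ?case by (intro exI[of _ "{}"]) auto
next
  case (tot_gen x j)
  then show ?case by (intro exI[of _ "{j}"] exI[of _ "\<lambda>_. x"]) (auto simp: sgp_zero)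
next
  case (tot_diff x y)
  obtain I h where h: "finite I" "\<forall>i\<in>I. h i \<in> U i" "x - (\<Sum>i\<in>I. h i) \<in> K" using tot_diff by blast
  obtain J l where l: "finite J" "\<forall>i\<in>J. l i \<in> U i" "y - (\<Sum>i\<in>J. l i) \<in> K" using tot_diff by blast
  define m where "m i = (if i \<in> I then h i else 0) - (if i \<in> J then l i else 0)" for i
  have "(\<Sum>i\<in>I \<union> J. if i \<in> I then h i else 0) = (\<Sum>i\<in>I. h i)"
    by (rule sum.mono_neutral_cong_right) (use h l in auto)
  moreover have "(\<Sum>i\<in>I \<union> J. if i \<in> J then l i else 0) = (\<Sum>i\<in>J. l i)"
    by (rule sum.mono_neutral_cong_right) (use h l in auto)
  ultimately have "(\<Sum>i\<in>I \<union> J. m i) = (\<Sum>i\<in>I. h i) - (\<Sum>i\<in>J. l i)" by (simp add: m_def sum_subtractf)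
  then have "(x - y) - (\<Sum>i\<in>I \<union> J. m i) = (x - (\<Sum>i\<in>I. h i)) - (y - (\<Sum>i\<in>J. l i))" by simp
  then have "(x - y) - (\<Sum>i\<in>I \<union> J. m i) \<in> K" using sgp_diff[OF tot_diff.prems(1) h(3) l(3)] by (simp only:)
  moreover have "\<forall>i\<in>I \<union> J. m i \<in> U i"
    using h(2) l(2) tot_diff.prems by (auto simp: m_def intro!: sgp_diff sgp_minus sgp_zero)
  ultimately show ?case using h(1) l(1) by blast
qed

text \<open>The sum of the family is direct modulo \<open>K\<close>.\<close>

definition indep :: "'r::ab_group_add set \<Rightarrow> (int \<Rightarrow> 'r set) \<Rightarrow> bool" where
  "indep K N \<longleftrightarrow> (\<forall>I h. finite I \<longrightarrow> (\<forall>i\<in>I. h i \<in> N i) \<longrightarrow> (\<Sum>i\<in>I. h i) \<in> K \<longrightarrow> (\<forall>i\<in>I. h i \<in> K))"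

text \<open>Directness applies after the terms of equal degree have been collected. The arbitrary
  index set with its degree function \<open>\<delta>\<close> allows for products, whose terms are
  indexed by pairs.\<close>

lemma component:
  assumes ind: "indep K N" and K: "sgp K" and N: "\<And>i. sgp (N i)"
    and U: "\<And>i. sgp (U i)" "\<And>i. K \<subseteq> U i" "\<And>i. U i \<subseteq> N i"
    and t: "finite L" "\<And>l. l \<in> L \<Longrightarrow> t l \<in> N (\<delta> l)" "(\<Sum>l\<in>L. t l) \<in> tot K U"
  shows "(\<Sum>l\<in>{l \<in> L. \<delta> l = c}. t l) \<in> U c"
proof -
  obtain I h where h: "finite I" "\<forall>i\<in>I. h i \<in> U i" "(\<Sum>l\<in>L. t l) - (\<Sum>i\<in>I. h i) \<in> K"
    using tot_rep[OF t(3) K U(1)] by blast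
  define T where "T i = (\<Sum>l\<in>{l \<in> L. \<delta> l = i}. t l)" for i
  define h' where "h' i = (if i \<in> I then h i else 0)" for i
  define B where "B = insert c (\<delta> ` L \<union> I)"
  have B: "finite B" "\<delta> ` L \<subseteq> B" "I \<subseteq> B" using t(1) h(1) by (auto simp: B_def)
  have TN: "T i \<in> N i" for i unfolding T_def by (rule sgp_sum[OF N]) (use t(2) in auto)
  have hU: "h' i \<in> U i" for i using h(2) sgp_zero[OF U(1)] by (auto simp: h'_def)
  have "(\<Sum>i\<in>B. T i) = (\<Sum>l\<in>L. t l)"
    unfolding T_def by (rule sum.group[OF t(1) B(1,2)])
  moreover have "(\<Sum>i\<in>B. h' i) = (\<Sum>i\<in>I. h i)"
    unfolding h'_def by (rule sum.mono_neutral_cong_right[OF B(1,3)]) auto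
  ultimately have "(\<Sum>i\<in>B. T i - h' i) \<in> K" using h(3) by (simp add: sum_subtractf)
  moreover have "\<forall>i\<in>B. T i - h' i \<in> N i" using TN hU U(3) sgp_diff[OF N] by blast
  moreover have "c \<in> B" by (simp add: B_def)
  ultimately have "T c - h' c \<in> K" using ind[unfolded indep_def, rule_format, of B "\<lambda>i. T i - h' i" c] B(1) by blast
  then have "(T c - h' c) + h' c \<in> U c" using U hU by (intro sgp_add) auto
  then show ?thesis by (simp add: T_def)
qed

lemma tot_Int_component:
  assumes "indep K N" "sgp K" "\<And>i. sgp (N i)" "\<And>i. sgp (U i)" "\<And>i. K \<subseteq> U i" "\<And>i. U i \<subseteq> N i"
  shows "tot K U \<inter> N j = U j"
proof
  show "tot K U \<inter> N j \<subseteq> U j"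
    using component[OF assms, of "{0 :: nat}" "\<lambda>_. f" "\<lambda>_. j" j for f] by auto
qed (use assms(6) in \<open>auto intro: tot_gen\<close>)

lemma tot_mult:
  fixes K :: "'r::comm_ring_1 set"
  assumes K: "\<And>k r. k \<in> K \<Longrightarrow> r * k \<in> K" and m: "\<And>i j a b. a \<in> U i \<Longrightarrow> b \<in> V j \<Longrightarrow> a * b \<in> tot K W"
    and f: "f \<in> tot K U" and g: "g \<in> tot K V"
  shows "f * g \<in> tot K W"
proof -
  have 1: "a * g \<in> tot K W" if "a \<in> U i" for a i
    using g by induction (use m[OF that] K in \<open>auto simp: right_diff_distrib intro: tot_K tot_diff\<close>)
  show ?thesis
    using f by induction (use 1 K[of _ g] in \<open>auto simp: left_diff_distrib mult.commute[of _ g] right_diff_distrib intro: tot_K tot_diff\<close>)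
qed

context fring begin

text \<open>A maximal finitely generated subfamily is the whole family.\<close>

lemma noeth_generators:
  assumes n: "noeth 1 N (\<lambda>_. K)" and U: "cl 1 U" "U \<le> N"
  shows "\<exists>G. finite G \<and> (\<forall>ga\<in>G. fst ga \<in> U (snd ga)) \<and> U = spn 1 X G"
proof -
  define Pr where "Pr V \<longleftrightarrow> (\<exists>G. finite G \<and> (\<forall>ga\<in>G. fst ga \<in> U (snd ga)) \<and> V = spn 1 X G)" for V
  have PrU: "cl 1 V \<and> (\<lambda>_. K) \<le> V \<and> V \<le> U" if PV: "Pr V" for V
  proof -
    obtain G where G: "\<forall>ga\<in>G. fst ga \<in> U (snd ga)" "V = spn 1 X G" using PV by (auto simp: Pr_def)
    have V: "cl 1 V" unfolding G(2) by (rule clx_cl[OF clx_spn ppow_1])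
    moreover have "V \<le> U" unfolding G(2) by (rule spn_le[OF cl_clx[OF U(1)]]) (use G in auto)
    ultimately show ?thesis by (simp add: le_fun_def cl_K[OF V])
  qed
  then have PrN: "cl 1 V \<and> (\<lambda>_. K) \<le> V \<and> V \<le> N" if "Pr V" for V
    using that U(2) order_trans by blast
  have "Pr (spn 1 X {})" unfolding Pr_def by (intro exI[of _ "{}"]) auto
  have "\<exists>V. Pr V \<and> (\<forall>V'. Pr V' \<longrightarrow> V \<le> V' \<longrightarrow> V' = V)"
    by (rule noeth_maximal[where P = Pr, OF n _ \<open>Pr (spn 1 X {})\<close>]) (rule PrN)
  then obtain V where V: "Pr V" and max: "\<forall>V'. Pr V' \<longrightarrow> V \<le> V' \<longrightarrow> V' = V" by blast
  obtain G where G: "finite G" "\<forall>ga\<in>G. fst ga \<in> U (snd ga)" "V = spn 1 X G" using V by (auto simp: Pr_def)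
  have "U \<le> V"
  proof (rule ccontr)
    assume "\<not> U \<le> V"
    then obtain j u where u: "u \<in> U j" "u \<notin> V j" by (auto simp: le_fun_def)
    define V' where "V' = spn 1 X (insert (u, j) G)"
    have "Pr V'" unfolding Pr_def V'_def by (intro exI[of _ "insert (u, j) G"]) (use G u in auto)
    moreover have "V \<le> V'" unfolding G(3) V'_def
      by (rule spn_le[OF clx_spn]) (metis insertCI prod.collapse spn_gen)
    ultimately have "V' = V" using max by blast
    moreover have "u \<in> V' j" unfolding V'_def by (rule spn_gen) simp
    ultimately show False using u by simp
  qed
  then have "U = V" using PrU[OF V] by (intro antisym) auto
  then show ?thesis using G by blast
qed

end

locale graded_total = fring_ideal R K p X Y F
  for R :: "int \<Rightarrow> 'r::comm_ring_1 set" and K :: "'r set" and p :: nat and X Y :: "'r set"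
    and F :: "('r \<times> int) set" +
  fixes Rt Mt :: "'r set" and M :: "int \<Rightarrow> 'r set"
  assumes Rt: "Rt = tot K R" and Mt: "Mt = tot K M" and M_cl: "cl 1 M"
    and M_indep: "indep K M"
begin

definition kR :: "'r set \<Rightarrow> bool" where
  "kR W \<longleftrightarrow> sgp W \<and> (\<forall>r\<in>Rt. \<forall>x\<in>W. r * x \<in> W)"

lemma kR_I:
  assumes W: "sgp W" "K \<subseteq> W" and m: "\<And>i r x. r \<in> R i \<Longrightarrow> x \<in> W \<Longrightarrow> r * x \<in> W" shows "kR W"
  unfolding kR_def
proof (intro conjI ballI W(1))
  fix r x assume "r \<in> Rt" and x: "x \<in> W"
  then have "r \<in> tot K R" using Rt by simp
  then show "r * x \<in> W"
  proof induction
    case (tot_K r) then show ?case using W K_ideal' by blast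
  next
    case (tot_gen r j) then show ?case using m x by blast
  next
    case (tot_diff r s) then show ?case using sgp_diff[OF W(1)] by (simp add: left_diff_distrib)
  qed
qed

lemma R_Rt: "R i \<subseteq> Rt" unfolding Rt by (auto intro: tot_gen)

lemma kR_mult: "kR W \<Longrightarrow> r \<in> Rt \<Longrightarrow> x \<in> W \<Longrightarrow> r * x \<in> W" by (simp add: kR_def)

lemma kR_multR: "kR W \<Longrightarrow> r \<in> R i \<Longrightarrow> x \<in> W \<Longrightarrow> r * x \<in> W" using R_Rt by (auto simp: kR_def)

lemma kR_sgp: "kR W \<Longrightarrow> sgp W" by (simp add: kR_def)

lemma KR_sublattice: "sublattice kR"
proof
  fix A B assume A: "kR A" and B: "kR B"
  show "kR (A \<inter> B)" using A B by (auto simp: kR_def intro: sgp_Int)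
  have "r * x \<in> A + B" if r: "r \<in> Rt" and x: "x \<in> A + B" for r x
  proof -
    obtain a b where ab: "a \<in> A" "b \<in> B" "x = a + b" using x by (rule set_plus_elim)
    have "r * a \<in> A" "r * b \<in> B" using ab r A B by (auto simp: kR_def)
    then show ?thesis unfolding ab(3) distrib_left by (rule set_plus_intro)
  qed
  then show "kR (A + B)" using A B by (auto simp: kR_def intro: sgp_plus)
qed (simp add: kR_def)

lemma kR_cl: "kR W \<Longrightarrow> K \<subseteq> W \<Longrightarrow> cl 1 (\<lambda>_. W)"
  by (simp add: cl_def kR_sgp kR_multR)

lemma kR_kst: "kR W \<Longrightarrow> kst 1 (W \<inter> M m)"
  using cl_kst[OF M_cl, of m] R_Rt[of 0] by (auto simp: kR_def kst_def intro: sgp_Int)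

lemma kR_tot:
  assumes U: "cl 1 U" shows "kR (tot K U)"
proof -
  have "r * x \<in> tot K U" if "r \<in> tot K R" "x \<in> tot K U" for r x
  proof (rule tot_mult[OF K_ideal _ that])
    fix i j a b assume "a \<in> R i" "b \<in> U j"
    then show "a * b \<in> tot K U" using cl_mult[OF U, of a i b j] by (auto intro: tot_gen)
  qed
  then show ?thesis using Rt sgp_tot[OF sgp_K, of U] by (unfold kR_def) blast
qed

lemma tot_Int: "cl 1 U \<Longrightarrow> U \<le> M \<Longrightarrow> tot K U \<inter> M j = U j"
  by (rule tot_Int_component[OF M_indep sgp_K cl_sgp[OF M_cl] cl_sgp cl_K]) (auto simp: le_fun_def)

lemma Rt_rep:
  assumes "r \<in> Rt" shows "\<exists>n h. (\<forall>i<n. h i \<in> R (int i)) \<and> r - (\<Sum>i<n. h i) \<in> K"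
proof -
  obtain I h where h: "finite I" "\<forall>i\<in>I. h i \<in> R i" "r - (\<Sum>i\<in>I. h i) \<in> K"
    using tot_rep[of r K R] assms sgp_K sgp_R Rt by blast
  let ?P = "{i \<in> I. 0 \<le> i}" and ?N = "{i \<in> I. i < 0}"
  have "(\<Sum>i\<in>I. h i) = (\<Sum>i\<in>?P. h i) + (\<Sum>i\<in>?N. h i)"
  proof -
    have e: "I = ?P \<union> ?N" by auto
    have "sum h (?P \<union> ?N) = sum h ?P + sum h ?N" by (intro sum.union_disjoint finite_subset[OF _ h(1)] Collect_restrict) fastforce
    then show ?thesis unfolding e[symmetric] .
  qed
  moreover have "(\<Sum>i\<in>?N. h i) \<in> K" by (rule sgp_sum[OF sgp_K]) (use h(2) R_neg in auto)
  ultimately have 1: "r - (\<Sum>i\<in>?P. h i) \<in> K"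
    using sgp_add[OF sgp_K h(3), of "\<Sum>i\<in>?N. h i"] by simp
  define n where "n = nat (Max (insert 0 I)) + 1"
  define l where "l i = (if int i \<in> I then h (int i) else 0)" for i
  have "(\<Sum>i<n. l i) = (\<Sum>i\<in>{i. i < n \<and> int i \<in> I}. h (int i))"
    unfolding l_def by (subst sum.inter_filter[symmetric]) (simp_all add: lessThan_def conj_commute)
  also have "\<dots> = (\<Sum>i\<in>?P. h i)"
  proof (rule sum.reindex_bij_witness[where i = nat and j = int])
    fix i assume i: "i \<in> ?P"
    then have "i \<le> Max (insert 0 I)" using h(1) by simp
    then show "nat i \<in> {i. i < n \<and> int i \<in> I}" using i by (simp add: n_def)
  qed auto
  finally have "(\<Sum>i<n. l i) = (\<Sum>i\<in>?P. h i)" .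
  moreover have "\<forall>i<n. l i \<in> R (int i)" using h(2) by (auto simp: l_def sgp_zero[OF sgp_R])
  ultimately show ?thesis using 1 by metis
qed

subsection \<open>Length of a graded quotient\<close>

context
  fixes W :: "int \<Rightarrow> 'r set" assumes W: "cl 1 W" "W \<le> M"
begin

text \<open>Interpolates between \<open>W\<close> and \<open>M\<close>: consecutive truncations
  differ in a single degree, which reduces lengths over the whole ring to lengths over k.\<close>

definition trunc :: "int \<Rightarrow> int \<Rightarrow> 'r set" where
  "trunc m c = (if c \<ge> m then M c else W c)"

lemma cl_trunc: "cl 1 (trunc m)"
  unfolding cl_def
proof (intro conjI allI ballI)
  fix j show "sgp (trunc m j)" "K \<subseteq> trunc m j"
    using cl_sgp[OF M_cl] cl_sgp[OF W(1)] cl_K[OF M_cl] cl_K[OF W(1)] by (auto simp: trunc_def)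
  fix i r x assume r: "r \<in> R i" and x: "x \<in> trunc m j"
  have K: "K \<subseteq> trunc m (i + j)" using cl_K[OF M_cl] cl_K[OF W(1)] by (auto simp: trunc_def)
  have WM: "W (i + j) \<subseteq> M (i + j)" using W(2) by (simp add: le_fun_def)
  show "r ^ 1 * x \<in> trunc m (i + j)"
  proof (cases "i < 0")
    case True
    then have "r * x \<in> K" using r R_neg K_ideal' by simp
    then show ?thesis using K by auto
  next
    case False
    then show ?thesis using x cl_mult[OF M_cl r, of x j] cl_mult[OF W(1) r, of x j] WM by (auto simp: trunc_def split: if_splits)
  qed
qed

lemma trunc_M: "trunc m \<le> M" using W(2) by (auto simp: trunc_def le_fun_def)

text \<open>Elements of positive degree send degree m into the truncation at m + 1. So every
  k-subspace between \<open>W m\<close> and \<open>M m\<close> becomes a submodule once that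
  truncation is added, and no other submodules lie between.\<close>

lemma len_trunc: "len kR (tot K (trunc (m + 1))) (tot K (trunc m)) = len (kst 1) (W m) (M m)"
proof (rule antisym)
  interpret L: sublattice kR by (rule KR_sublattice)
  let ?V = "tot K (trunc (m + 1))" and ?V' = "tot K (trunc m)"
  have kV: "kR ?V" "kR ?V'" by (rule kR_tot[OF cl_trunc])+
  have VV': "?V \<subseteq> ?V'" using W(2) by (intro tot_mono[OF sgp_K]) (auto simp: trunc_def le_fun_def)
  have MV': "M m \<subseteq> ?V'" by (auto intro!: tot_gen[of _ _ m] simp: trunc_def)
  have VM: "?V \<inter> M m = W m" using tot_Int[OF cl_trunc trunc_M, of "m + 1" m] by (simp add: trunc_def)
  have V'_eq: "?V' \<subseteq> M m + ?V"
  proof (rule tot_least)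
    show "sgp (M m + ?V)" by (intro sgp_plus cl_sgp[OF M_cl] sgp_tot[OF sgp_K])
    show "K \<subseteq> M m + ?V" using subset_plus_left[OF sgp_tot[OF sgp_K], of "M m" "trunc (m + 1)"] cl_K[OF M_cl, of m] by blast
    fix j
    show "trunc m j \<subseteq> M m + ?V"
    proof (cases "j = m")
      case True
      then show ?thesis using subset_plus_left[OF sgp_tot[OF sgp_K], of "M m" "trunc (m + 1)"] by (simp add: trunc_def)
    next
      case False
      then have "trunc m j = trunc (m + 1) j" by (auto simp: trunc_def)
      then have "trunc m j \<subseteq> ?V" by (auto intro: tot_gen)
      then show ?thesis using subset_plus_right[OF cl_sgp[OF M_cl], of ?V m] by blast
    qed
  qed
  show "len kR ?V ?V' \<le> len (kst 1) (W m) (M m)"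
  proof (rule len_mono_map[where F = "\<lambda>U. U \<inter> M m"])
    fix U assume U: "kR U" "?V \<subseteq> U" "U \<subseteq> ?V'"
    show "kst 1 (U \<inter> M m) \<and> W m \<subseteq> U \<inter> M m \<and> U \<inter> M m \<subseteq> M m"
      using kR_kst[OF U(1), of m] VM U(2) by blast
  next
    fix U U' assume U: "kR U" "kR U'" "?V \<subseteq> U" "U \<subset> U'" "U' \<subseteq> ?V'"
    have e: "A = A \<inter> M m + ?V" if "kR A" "?V \<subseteq> A" "A \<subseteq> ?V'" for A
    proof -
      have "A \<inter> (M m + ?V) = A \<inter> M m + ?V" by (rule modular_law[OF kR_sgp[OF that(1)] that(2)])
      then show ?thesis using that V'_eq by blast
    qed
    have "U = U \<inter> M m + ?V" "U' = U' \<inter> M m + ?V" using e[of U] e[of U'] U by auto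
    then have "U \<inter> M m \<noteq> U' \<inter> M m" using U(4) by (metis psubset_eq)
    then show "U \<inter> M m \<subset> U' \<inter> M m" using U(4) by auto
  qed
  show "len (kst 1) (W m) (M m) \<le> len kR ?V ?V'"
  proof (rule len_mono_map[where F = "\<lambda>D. ?V + D"])
    fix D assume D: "kst 1 D" "W m \<subseteq> D" "D \<subseteq> M m"
    have sD: "sgp D" by (rule L_sgp[OF D(1)])
    have sVD: "sgp (?V + D)" by (intro sgp_plus sgp_tot[OF sgp_K] sD)
    have V_VD: "?V \<subseteq> ?V + D" by (rule subset_plus_left[OF sD])
    have D_VD: "D \<subseteq> ?V + D" by (rule subset_plus_right[OF sgp_tot[OF sgp_K]])
    have "kR (?V + D)"
    proof (rule kR_I[OF sVD])
      show "K \<subseteq> ?V + D" using V_VD by (auto intro: tot_K)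
      fix i r x assume r: "r \<in> R i" and "x \<in> ?V + D"
      then obtain v d where vd: "v \<in> ?V" "d \<in> D" "x = v + d" by (auto elim!: set_plus_elim)
      have "r * v \<in> ?V" by (rule kR_multR[OF kV(1) r vd(1)])
      moreover have "r * d \<in> ?V + D"
      proof -
        consider "i < 0" | "i = 0" | "i > 0" by linarith
        then show ?thesis
        proof cases
          case 1
          then have "r * d \<in> K" using r R_neg K_ideal' by simp
          then show ?thesis using V_VD by (auto intro: tot_K)
        next
          case 2
          then have "r ^ 1 * d \<in> D" using kst_mult[OF D(1), of r d] r vd by simp
          then show ?thesis using D_VD by auto
        next
          case 3
          have "r ^ 1 * d \<in> M (i + m)" using cl_mult[OF M_cl r, of d m] D(3) vd by blast
          then have "r * d \<in> trunc (m + 1) (i + m)" using 3 by (simp add: trunc_def)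
          then show ?thesis using V_VD by (auto intro: tot_gen)
        qed
      qed
      ultimately show "r * x \<in> ?V + D" using sgp_add[OF sVD, of "r * v" "r * d"] V_VD by (auto simp: vd distrib_left)
    qed
    moreover have "?V + D \<subseteq> ?V'" using VV' MV' D(3) by (intro plus_subset sgp_tot[OF sgp_K]) auto
    ultimately show "kR (?V + D) \<and> ?V \<subseteq> ?V + D \<and> ?V + D \<subseteq> ?V'" using V_VD by blast
  next
    fix D D' assume D: "kst 1 D" "kst 1 D'" "W m \<subseteq> D" "D \<subset> D'" "D' \<subseteq> M m"
    have e: "M m \<inter> (?V + A) = A" if "kst 1 A" "W m \<subseteq> A" "A \<subseteq> M m" for A
    proof -
      have "M m \<inter> (?V + A) = M m \<inter> ?V + A" by (rule modular_law[OF cl_sgp[OF M_cl] that(3)])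
      also have "M m \<inter> ?V = W m" using VM by blast
      also have "W m + A = A" using plus_absorb[OF L_sgp[OF that(1)] cl_sgp[OF W(1)] that(2)] by (simp add: add.commute)
      finally show ?thesis .
    qed
    have "M m \<inter> (?V + D) = D" "M m \<inter> (?V + D') = D'" using e[of D] e[of D'] D by auto
    then have "?V + D \<noteq> ?V + D'" using D(4) by (metis psubset_eq)
    moreover have "?V + D \<subseteq> ?V + D'" using D(4) by (intro set_plus_mono2) auto
    ultimately show "?V + D \<subset> ?V + D'" by blast
  qed
qed

lemma len_total:
  assumes a: "\<And>c. c < a \<Longrightarrow> M c = K" and b: "\<And>c. c \<ge> b \<Longrightarrow> M c \<subseteq> W c" and ab: "a \<le> b"
  shows "len kR (tot K W) Mt = (\<Sum>c\<in>{a..<b}. len (kst 1) (W c) (M c))"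
proof -
  interpret L: sublattice kR by (rule KR_sublattice)
  have k: "kR (tot K (trunc m))" for m by (rule kR_tot[OF cl_trunc])
  have le: "tot K (trunc (m + 1)) \<subseteq> tot K (trunc m)" for m
    using W(2) by (intro tot_mono[OF sgp_K]) (auto simp: trunc_def le_fun_def)
  have *: "len kR (tot K (trunc (a + int m))) (tot K (trunc a)) = (\<Sum>c\<in>{a..<a + int m}. len (kst 1) (W c) (M c)) \<and>
     tot K (trunc (a + int m)) \<subseteq> tot K (trunc a)" for m
  proof (induction m)
    case (Suc m)
    have e: "{a..<a + int (Suc m)} = insert (a + int m) {a..<a + int m}" by auto
    have s: "a + int (Suc m) = (a + int m) + 1" by simp
    have "len kR (tot K (trunc (a + int (Suc m)))) (tot K (trunc a)) =
       len kR (tot K (trunc (a + int m + 1))) (tot K (trunc (a + int m))) + len kR (tot K (trunc (a + int m))) (tot K (trunc a))"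
      unfolding s by (rule L.len_add[OF k k k le]) (use Suc in blast)
    moreover have "tot K (trunc (a + int (Suc m))) \<subseteq> tot K (trunc a)" unfolding s using Suc le[of "a + int m"] by blast
    ultimately show ?case unfolding e using Suc by (simp del: One_nat_def add: len_trunc)
  qed (simp add: len_same)
  have "W c = K" if "c < a" for c using a[OF that] cl_K[OF W(1), of c] W(2) by (auto simp: le_fun_def)
  then have 1: "trunc a = M" using a by (intro ext) (simp add: trunc_def)
  have 2: "trunc b = W" using b W(2) by (intro ext) (auto simp: trunc_def le_fun_def)
  show ?thesis using *[of "nat (b - a)"] ab by (simp add: 1 2 Mt)
qed

end

subsection \<open>Products of ideals with the module\<close>

definition ism :: "'r set \<Rightarrow> 'r set" where
  "ism I = \<Inter>{W. kR W \<and> K \<subseteq> W \<and> (\<forall>a\<in>I. \<forall>x\<in>Mt. a * x \<in> W)}"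

text \<open>The ideal of elements of degree at least j; \<open>Ra_ideal_power\<close> identifies it
  with the j-th power of the maximal ideal.\<close>

definition RG :: "int \<Rightarrow> 'r set" where
  "RG j = tot K (\<lambda>i. if i \<ge> j then R i else K)"

definition Jq :: "nat \<Rightarrow> 'r set" where
  "Jq q = \<Inter>{W. kR W \<and> K \<subseteq> W \<and> (\<forall>fe\<in>F. fst fe ^ q \<in> W)}"

lemma kR_Inter: "(\<And>W. W \<in> S \<Longrightarrow> kR W) \<Longrightarrow> kR (\<Inter>S)"
  unfolding kR_def sgp_def by blast

lemma kR_ism: "kR (ism I)" unfolding ism_def by (rule kR_Inter) blast

lemma ism_least: "kR W \<Longrightarrow> K \<subseteq> W \<Longrightarrow> (\<And>a x. a \<in> I \<Longrightarrow> x \<in> Mt \<Longrightarrow> a * x \<in> W) \<Longrightarrow> ism I \<subseteq> W"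
  unfolding ism_def by (rule Inter_lower) blast

lemma ism_mem: "a \<in> I \<Longrightarrow> x \<in> Mt \<Longrightarrow> a * x \<in> ism I"
  unfolding ism_def by blast

lemma K_ism: "K \<subseteq> ism I" unfolding ism_def by blast

lemma kR_Jq: "kR (Jq q)" unfolding Jq_def by (rule kR_Inter) blast

lemma K_Jq: "K \<subseteq> Jq q" unfolding Jq_def by blast

lemma Jq_mem: "fe \<in> F \<Longrightarrow> fst fe ^ q \<in> Jq q" unfolding Jq_def by blast

lemma Jq_least: "kR W \<Longrightarrow> K \<subseteq> W \<Longrightarrow> (\<And>fe. fe \<in> F \<Longrightarrow> fst fe ^ q \<in> W) \<Longrightarrow> Jq q \<subseteq> W"
  unfolding Jq_def by (rule Inter_lower) blast

lemma cl_RG: "cl 1 (\<lambda>i. if i \<ge> j then R i else K)"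
  unfolding cl_def
proof (intro conjI allI ballI)
  fix c show "sgp (if c \<ge> j then R c else K)" "K \<subseteq> (if c \<ge> j then R c else K)" using sgp_R sgp_K K_R by auto
  fix i r x assume r: "r \<in> R i" and x: "x \<in> (if c \<ge> j then R c else K)"
  show "r ^ 1 * x \<in> (if i + c \<ge> j then R (i + c) else K)"
  proof (cases "i < 0 \<or> c < j")
    case True
    then have "r * x \<in> K" using r x R_neg[of i] K_ideal K_ideal' by auto
    then show ?thesis using K_R by auto
  next
    case False
    then show ?thesis using R_mult[OF r, of x c] x by auto
  qed
qed

lemma kR_RG: "kR (RG j)" unfolding RG_def by (rule kR_tot[OF cl_RG])

lemma K_RG: "K \<subseteq> RG j" by (auto simp: RG_def intro: tot_K)

lemma R_RG: "i \<ge> j \<Longrightarrow> R i \<subseteq> RG j" by (auto simp: RG_def intro: tot_gen[of _ _ i])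

lemma RG_least: "sgp W \<Longrightarrow> K \<subseteq> W \<Longrightarrow> (\<And>i. i \<ge> j \<Longrightarrow> R i \<subseteq> W) \<Longrightarrow> RG j \<subseteq> W"
  unfolding RG_def by (rule tot_least) auto

lemma RG_Rt: "RG j \<subseteq> Rt"
  unfolding Rt RG_def using K_R by (intro tot_mono[OF sgp_K]) auto

lemma RG_nonpos: "j \<le> 0 \<Longrightarrow> RG j = Rt"
  unfolding Rt RG_def using R_neg by (intro arg_cong[where f = "tot K"] ext) auto

lemma RG_mult:
  assumes "a \<in> RG i" "b \<in> RG j" shows "a * b \<in> RG (i + j)"
  unfolding RG_def
proof (rule tot_mult[OF K_ideal _ assms[unfolded RG_def]])
  fix c l a b assume "a \<in> (if c \<ge> i then R c else K)" "b \<in> (if l \<ge> j then R l else K)"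
  then have "a * b \<in> K \<or> i \<le> c \<and> j \<le> l \<and> a * b \<in> R (c + l)"
    using R_mult K_ideal K_ideal' by (auto split: if_splits)
  then show "a * b \<in> tot K (\<lambda>c. if c \<ge> i + j then R c else K)" by (auto intro: tot_K tot_gen[of _ _ "c + l"])
qed

lemma Mt_kR: "kR Mt" unfolding Mt by (rule kR_tot[OF M_cl])

lemma mult_Mt:
  assumes W: "kR W" "K \<subseteq> W" and m: "\<And>c x. x \<in> M c \<Longrightarrow> a * x \<in> W" and x: "x \<in> Mt"
  shows "a * x \<in> W"
  using x unfolding Mt
proof induction
  case (tot_K x) then show ?case using W K_ideal by blast
next
  case (tot_gen x j) then show ?case by (rule m)
next
  case (tot_diff x y) then show ?case using sgp_diff[OF kR_sgp[OF W(1)]] by (simp add: right_diff_distrib)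
qed

lemma ism_Jq:
  fixes q :: nat
  defines "W \<equiv> \<lambda>c. JN 1 q M (\<lambda>_. K) c"
  shows "ism (Jq q) = tot K W" and "cl 1 W" and "W \<le> M"
proof -
  have g: "gm 1 M (\<lambda>_. K)" by (rule gmI[OF M_cl cl_Kfam cl_K[OF M_cl]]) simp
  show Wc: "cl 1 W" unfolding cl_def
  proof (intro conjI allI ballI)
    fix j show "sgp (W j)" "K \<subseteq> W j" unfolding W_def by (rule JN_sgp[OF g], rule JN_K[OF g])
    fix i r x assume r: "r \<in> R i" and x: "x \<in> W j"
    obtain z c where zc: "z \<in> K" "\<forall>fe\<in>F. c fe \<in> M (j - int q * snd fe)" "x = z + (\<Sum>fe\<in>F. fst fe ^ (q * 1) * c fe)"
      using JN_memD[OF x[unfolded W_def]] by blast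
    have "r * z + (\<Sum>fe\<in>F. fst fe ^ (q * 1) * (r * c fe)) \<in> W (i + j)" unfolding W_def
    proof (rule JN_memI[OF K_ideal[OF zc(1)]])
      fix fe assume "fe \<in> F"
      then show "r * c fe \<in> M (i + j - int q * snd fe)"
        using cl_mult'[OF M_cl r, of "c fe" "j - int q * snd fe" "i + j - int q * snd fe"] zc(2) by simp
    qed
    then show "r ^ 1 * x \<in> W (i + j)" by (simp add: zc(3) distrib_left sum_distrib_left mult.left_commute)
  qed
  show WM: "W \<le> M" unfolding W_def by (intro le_funI JN_N[OF g])
  show "ism (Jq q) = tot K W"
  proof
    have kt: "kR (tot K W)" by (rule kR_tot[OF Wc])
    have Kt: "K \<subseteq> tot K W" by (auto intro: tot_K)
    show "ism (Jq q) \<subseteq> tot K W"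
    proof (rule ism_least[OF kt Kt])
      fix a x assume a: "a \<in> Jq q" and x: "x \<in> Mt"
      have "Jq q \<subseteq> {a. a * x \<in> tot K W}"
      proof (rule Jq_least)
        show "kR {a. a * x \<in> tot K W}" using kt unfolding kR_def sgp_def by (auto simp: left_diff_distrib mult.assoc)
        show "K \<subseteq> {a. a * x \<in> tot K W}" using Kt K_ideal' by blast
        fix fe assume fe: "fe \<in> F"
        have "fst fe ^ q * x \<in> tot K W"
        proof (rule mult_Mt[OF kt Kt _ x])
          fix c y assume y: "y \<in> M c"
          have "fst fe ^ (q * 1) * y \<in> W (c + int q * snd fe)" unfolding W_def
            by (rule JN_F[OF g fe]) (use y in simp)
          then show "fst fe ^ q * y \<in> tot K W" by (auto intro: tot_gen)
        qed
        then show "fst fe ^ q \<in> {a. a * x \<in> tot K W}" by simp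
      qed
      then show "a * x \<in> tot K W" using a by blast
    qed
    show "tot K W \<subseteq> ism (Jq q)"
    proof (rule tot_least[OF kR_sgp[OF kR_ism] K_ism])
      fix j show "W j \<subseteq> ism (Jq q)" unfolding W_def
      proof (rule JN_subset[OF kR_sgp[OF kR_ism] K_ism])
        fix fe x assume fe: "fe \<in> F" and x: "x \<in> M (j - int q * snd fe)"
        have "fst fe ^ q * x \<in> ism (Jq q)"
          by (rule ism_mem[OF Jq_mem[OF fe]]) (use x in \<open>auto simp: Mt intro: tot_gen\<close>)
        then show "fst fe ^ (q * 1) * x \<in> ism (Jq q)" by simp
      qed
    qed
  qed
qed

end

locale graded_density = graded_total R K p X Y F Rt Mt M
  for R :: "int \<Rightarrow> 'r::comm_ring_1 set" and K :: "'r set" and p :: nat and X Y :: "'r set"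
    and F :: "('r \<times> int) set" and Rt Mt :: "'r set" and M :: "int \<Rightarrow> 'r set" +
  fixes k :: nat
  assumes fgM: "fg 1 M (\<lambda>_. K)"
    and dimM: "\<And>P. hp P \<Longrightarrow> annN 1 M (\<lambda>_. K) \<le> P \<Longrightarrow> cb (Suc (Suc k)) P"
begin

lemma hul:
  shows "cl 1 (hul M i)" and "hul M i \<le> M" and "c \<le> i \<Longrightarrow> M c \<subseteq> hul M i c"
    and "cl 1 U \<Longrightarrow> (\<And>c. c \<le> i \<Longrightarrow> M c \<subseteq> U c) \<Longrightarrow> hul M i j \<subseteq> U j"
proof -
  show "cl 1 (hul M i)" by (rule cl_hul[OF M_cl fgM]) (rule dimM)
  show "hul M i \<le> M" by (rule hul_M[OF M_cl fgM]) (rule dimM)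
  show "c \<le> i \<Longrightarrow> M c \<subseteq> hul M i c" by (rule hul_gen[OF M_cl fgM]) (rule dimM)
  assume U: "cl 1 U" "\<And>c. c \<le> i \<Longrightarrow> M c \<subseteq> U c"
  show "hul M i j \<subseteq> U j" by (rule hul_le[OF M_cl fgM _ U]) (rule dimM)
qed

lemma gm_hul: "gm 1 M (hul M i)"
  unfolding gm_def using M_cl hul(1,2) by blast

lemma hul_mono: "i \<le> i' \<Longrightarrow> hul M i j \<subseteq> hul M i' j"
  by (rule hul(4)[OF hul(1)], rule hul(3)) simp

text \<open>\<open>U b\<close> consists of the elements that everything in \<open>R\<close> of
  degree at least c - b multiplies into \<open>ism I\<close>. It contains \<open>M b\<close> when b
  \<le> c - j, since such multipliers have degree at least j. In degree c, multiplication by 1 gives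
  membership in \<open>ism I\<close>.\<close>

lemma hul_ism:
  assumes I: "RG j \<subseteq> I" shows "hul M (c - j) c \<subseteq> ism I"
proof -
  define U where "U b = {u. \<forall>l. \<forall>r\<in>R l. c \<le> l + b \<longrightarrow> r * u \<in> ism I}" for b
  have "cl 1 U" unfolding cl_def
  proof (intro conjI allI ballI)
    fix b show "sgp (U b)" unfolding sgp_def U_def
      using sgp_zero[OF kR_sgp[OF kR_ism]] sgp_diff[OF kR_sgp[OF kR_ism]] by (auto simp: right_diff_distrib)
    show "K \<subseteq> U b" unfolding U_def using K_ism K_ideal by blast
    fix i r x assume r: "r \<in> R i" and x: "x \<in> U b"
    have "s * (r * x) \<in> ism I" if s: "s \<in> R l" "c \<le> l + (i + b)" for s l
    proof -
      have "c \<le> (l + i) + b" using s(2) by simp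
      then have "(s * r) * x \<in> ism I" using x R_mult[OF s(1) r] unfolding U_def by blast
      then show ?thesis by (simp add: mult.assoc)
    qed
    then show "r ^ 1 * x \<in> U (i + b)" by (simp add: U_def)
  qed
  moreover have "M b \<subseteq> U b" if b: "b \<le> c - j" for b
  proof -
    have "r * x \<in> ism I" if x: "x \<in> M b" and r: "r \<in> R l" "c \<le> l + b" for x r l
    proof (rule ism_mem)
      have "j \<le> l" using r(2) b by linarith
      then show "r \<in> I" using R_RG[of j l] r(1) I by blast
      show "x \<in> Mt" using x by (auto simp: Mt intro: tot_gen)
    qed
    then show ?thesis by (auto simp: U_def)
  qed
  ultimately have "hul M (c - j) c \<subseteq> U c" by (rule hul(4))
  moreover have "x \<in> ism I" if "x \<in> U c" for x
    using that one_R unfolding U_def by (metis (mono_tags, lifting) add_0 mem_Collect_eq mult_1 order_refl)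
  ultimately show ?thesis by blast
qed

text \<open>The index of the hull moves with the degree, so closedness of \<open>W\<close> combines
  closedness of each hull with \<open>hul_mono\<close>.\<close>

lemma ism_RG_Jq:
  fixes q :: nat and j :: int
  defines "W \<equiv> \<lambda>c. JN 1 q M (hul M (c - j)) c"
  shows "ism (RG j + Jq q) = tot K W" and "cl 1 W" and "W \<le> M"
proof -
  show Wc: "cl 1 W" unfolding cl_def
  proof (intro conjI allI ballI)
    fix b show "sgp (W b)" "K \<subseteq> W b" unfolding W_def by (rule JN_sgp[OF gm_hul], rule JN_K[OF gm_hul])
    fix i r x assume r: "r \<in> R i" and x: "x \<in> W b"
    show "r ^ 1 * x \<in> W (i + b)"
    proof (cases "i < 0")
      case True
      then have "r * x \<in> K" using r R_neg K_ideal' by simp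
      then show ?thesis using JN_K[OF gm_hul] by (auto simp: W_def)
    next
      case False
      obtain z c where zc: "z \<in> hul M (b - j) b" "\<forall>fe\<in>F. c fe \<in> M (b - int q * snd fe)" "x = z + (\<Sum>fe\<in>F. fst fe ^ (q * 1) * c fe)"
        using JN_memD[OF x[unfolded W_def]] by blast
      have "r * z \<in> hul M (b - j) (i + b)" using cl_mult[OF hul(1) r zc(1)] by simp
      then have rz: "r * z \<in> hul M (i + b - j) (i + b)" using hul_mono[of "b - j" "i + b - j"] False by auto
      have "r * z + (\<Sum>fe\<in>F. fst fe ^ (q * 1) * (r * c fe)) \<in> W (i + b)" unfolding W_def
      proof (rule JN_memI[where Z = "hul M (i + b - j)" and j = "i + b", OF rz])
        fix fe assume "fe \<in> F"
        then show "r * c fe \<in> M (i + b - int q * snd fe)"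
          using cl_mult'[OF M_cl r, of "c fe" "b - int q * snd fe" "i + b - int q * snd fe"] zc(2) by simp
      qed
      then show ?thesis by (simp add: zc(3) distrib_left sum_distrib_left mult.left_commute)
    qed
  qed
  show WM: "W \<le> M" unfolding W_def by (intro le_funI JN_N[OF gm_hul])
  let ?I = "RG j + Jq q"
  have RI: "RG j \<subseteq> ?I" by (rule subset_plus_left[OF kR_sgp[OF kR_Jq]])
  have JI: "Jq q \<subseteq> ?I" by (rule subset_plus_right[OF kR_sgp[OF kR_RG]])
  show "ism ?I = tot K W"
  proof
    have kt: "kR (tot K W)" by (rule kR_tot[OF Wc])
    have Kt: "K \<subseteq> tot K W" by (auto intro: tot_K)
    have J: "ism (Jq q) \<subseteq> tot K W" unfolding ism_Jq(1)
    proof (rule tot_mono[OF sgp_K])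
      fix c show "JN 1 q M (\<lambda>_. K) c \<subseteq> W c" unfolding W_def
        by (rule JN_subset[OF JN_sgp[OF gm_hul] JN_K[OF gm_hul]]) (rule JN_F[OF gm_hul])
    qed
    show "ism ?I \<subseteq> tot K W"
    proof (rule ism_least[OF kt Kt])
      fix a x assume a: "a \<in> ?I" and x: "x \<in> Mt"
      obtain r b where rb: "r \<in> RG j" "b \<in> Jq q" "a = r + b" using a by (rule set_plus_elim)
      have "b * x \<in> tot K W" using ism_mem[OF rb(2) x] J by blast
      moreover have "RG j \<subseteq> {a. a * x \<in> tot K W}"
      proof (rule RG_least)
        show "sgp {a. a * x \<in> tot K W}" using kt unfolding kR_def sgp_def by (auto simp: left_diff_distrib)
        show "K \<subseteq> {a. a * x \<in> tot K W}" using Kt K_ideal' by blast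
        fix i assume i: "j \<le> i"
        have "r * x \<in> tot K W" if r: "r \<in> R i" for r
        proof (rule mult_Mt[OF kt Kt _ x])
          fix c y assume y: "y \<in> M c"
          then have "y \<in> hul M (i + c - j) c" using hul(3)[of c "i + c - j"] i by auto
          then have "r * y \<in> hul M (i + c - j) (i + c)" using cl_mult[OF hul(1) r] by fastforce
          then have "r * y \<in> W (i + c)" using JN_Z[OF gm_hul] unfolding W_def by blast
          then show "r * y \<in> tot K W" by (rule tot_gen)
        qed
        then show "R i \<subseteq> {a. a * x \<in> tot K W}" by blast
      qed
      ultimately show "a * x \<in> tot K W" using rb sgp_add[OF sgp_tot[OF sgp_K], of "r * x" W "b * x"] by (auto simp: distrib_right)
    qed
    show "tot K W \<subseteq> ism ?I"
    proof (rule tot_least[OF kR_sgp[OF kR_ism] K_ism])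
      fix c show "W c \<subseteq> ism ?I"
      proof
        fix x assume "x \<in> W c"
        then obtain z e where ze: "z \<in> hul M (c - j) c" "\<forall>fe\<in>F. e fe \<in> M (c - int q * snd fe)" "x = z + (\<Sum>fe\<in>F. fst fe ^ (q * 1) * e fe)"
          unfolding W_def using JN_memD by blast
        have "fst fe ^ (q * 1) * e fe \<in> ism ?I" if fe: "fe \<in> F" for fe
        proof -
          have "fst fe ^ q * e fe \<in> ism ?I"
            by (rule ism_mem) (use Jq_mem[OF fe, of q] JI ze(2) fe in \<open>auto simp: Mt intro: tot_gen\<close>)
          then show ?thesis by simp
        qed
        moreover have "z \<in> ism ?I" using hul_ism[OF RI] ze(1) by blast
        ultimately show "x \<in> ism ?I" unfolding ze(3)
          by (intro sgp_add[OF kR_sgp[OF kR_ism]] sgp_sum[OF kR_sgp[OF kR_ism]])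
      qed
    qed
  qed
qed

lemma len_ism_RG_Jq:
  assumes ab: "a \<le> b" "\<forall>j<a. M j = K" "\<forall>i\<ge>b. hul M i = M"
  shows "real (the_enat (len kR (ism (RG j + Jq q)) Mt)) = hh M a b q j"
proof -
  define W where "W c = JN 1 q M (hul M (c - j)) c" for c
  \<comment> \<open>\<open>len_total\<close> wants an upper bound not below \<open>a\<close>; if j +
    b is smaller than \<open>a\<close>, both ranges of summation are empty.\<close>
  define b' where "b' = max a (j + b)"
  have "len kR (tot K W) Mt = (\<Sum>c\<in>{a..<b'}. len (kst 1) (W c) (M c))"
  proof (rule len_total)
    show "cl 1 W" "W \<le> M" using ism_RG_Jq(2,3)[where q = q and j = j] by (simp_all add: W_def[abs_def])
    fix c assume "b' \<le> c"
    then have "hul M (c - j) = M" using ab(3) by (simp add: b'_def)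
    then show "M c \<subseteq> W c" unfolding W_def using JN_Z[OF gm_hul, of "c - j" c q] by simp
  qed (use ab in \<open>auto simp: b'_def\<close>)
  also have "\<dots> = (\<Sum>c\<in>{a..<b'}. \<phi> 1 q M (hul M (c - j)) c)" by (simp add: \<phi>_def W_def)
  also have "\<dots> = (\<Sum>c\<in>{a..<j + b}. \<phi> 1 q M (hul M (c - j)) c)"
    by (rule sum.cong) (auto simp: b'_def)
  also have "\<dots> = of_nat (\<Sum>c\<in>{a..<j + b}. the_enat (\<phi> 1 q M (hul M (c - j)) c))"
    unfolding of_nat_sum
  proof (rule sum.cong[OF refl])
    fix c
    have "\<phi> 1 q M (hul M (c - j)) c \<noteq> \<infinity>"
      by (rule quotient_shift(3)[OF M_cl fgM _ hul(1,2)]) (rule dimM)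
    then show "\<phi> 1 q M (hul M (c - j)) c = of_nat (the_enat (\<phi> 1 q M (hul M (c - j)) c))"
      by (auto simp: of_nat_eq_enat)
  qed
  finally have "len kR (tot K W) Mt = enat (\<Sum>c\<in>{a..<j + b}. the_enat (\<phi> 1 q M (hul M (c - j)) c))"
    by (simp only: of_nat_eq_enat)
  moreover have "ism (RG j + Jq q) = tot K W" using ism_RG_Jq(1)[of j q] by (simp add: W_def[abs_def])
  moreover have "hh M a b q j = (\<Sum>c\<in>{a..<j + b}. rl q M (hul M (c - j)) c)"
    by (rule hh_def[OF M_cl fgM]) (rule dimM)
  ultimately show ?thesis by (simp add: rl_def)
qed

end

section \<open>Presenting a graded ring and module inside a commutative ring type\<close>

lemma direct_sum_exists:
  assumes "direct_sum_decomposition G A" "x \<in> carrier G"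
  shows "\<exists>I c. finite I \<and> (\<forall>i. c i \<in> A i) \<and> x = finsum G c I"
proof -
  have "\<exists>!c. (\<forall>i. c i \<in> A i) \<and> finite {i. c i \<noteq> \<zero>\<^bsub>G\<^esub>} \<and> x = finsum G c {i. c i \<noteq> \<zero>\<^bsub>G\<^esub>}"
    using assms unfolding direct_sum_decomposition_def by blast
  then show ?thesis by blast
qed

lemma direct_sum_indep:
  assumes G: "abelian_group G" and D: "direct_sum_decomposition G A"
    and I: "finite I" "\<And>i. i \<in> I \<Longrightarrow> c i \<in> A i" "finsum G c I = \<zero>\<^bsub>G\<^esub>" and i: "i \<in> I"
  shows "c i = \<zero>\<^bsub>G\<^esub>"
proof -
  interpret abelian_group G by fact
  have A: "additive_subgroup (A j) G" for j using D by (auto simp: direct_sum_decomposition_def)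
  have Ac: "A j \<subseteq> carrier G" and zA: "\<zero>\<^bsub>G\<^esub> \<in> A j" for j
    using additive_subgroup.a_subset[OF A] additive_subgroup.zero_closed[OF A] by auto
  define e where "e j = (if j \<in> I then c j else \<zero>\<^bsub>G\<^esub>)" for j
  let ?P = "\<lambda>e. (\<forall>j. e j \<in> A j) \<and> finite {j. e j \<noteq> \<zero>\<^bsub>G\<^esub>} \<and> \<zero>\<^bsub>G\<^esub> = finsum G e {j. e j \<noteq> \<zero>\<^bsub>G\<^esub>}"
  have sub: "{j. e j \<noteq> \<zero>\<^bsub>G\<^esub>} \<subseteq> I" by (auto simp: e_def)
  have "finsum G e {j. e j \<noteq> \<zero>\<^bsub>G\<^esub>} = finsum G c I"
  proof (rule add.finprod_mono_neutral_cong_left[OF I(1) sub])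
    show "c \<in> I \<rightarrow> carrier G" using I(2) Ac by blast
  qed (auto simp: e_def split: if_splits)
  then have "\<zero>\<^bsub>G\<^esub> = finsum G e {j. e j \<noteq> \<zero>\<^bsub>G\<^esub>}" using I(3) by simp
  moreover have "\<forall>j. e j \<in> A j" using I(2) zA by (simp add: e_def)
  ultimately have Pe: "?P e" using finite_subset[OF sub I(1)] by blast
  have P0: "?P (\<lambda>_. \<zero>\<^bsub>G\<^esub>)" using zA by simp
  have "\<exists>!e. ?P e" using D zero_closed unfolding direct_sum_decomposition_def by blast
  then obtain u where u: "\<forall>y. ?P y \<longrightarrow> y = u" by (elim ex1E) blast
  have "e = (\<lambda>_. \<zero>\<^bsub>G\<^esub>)" using mp[OF spec[OF u] Pe] mp[OF spec[OF u] P0] by (rule trans[OF _ sym])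
  then show ?thesis using i by (metis e_def)
qed

text \<open>The pair \<open>(e1, e2)\<close> is a surjective ring homomorphism onto the idealization of \<open>M\<close>, in which
  \<open>R\<close> and \<open>M\<close> sit as the elements with vanishing second and first component.\<close>

locale realization = graded_module R Rg M Mg
  for R :: "('a, 'r) ring_scheme" (structure) and Rg :: "nat \<Rightarrow> 'a set"
    and M :: "('a, 'b, 'm) module_scheme" (structure) and Mg :: "int \<Rightarrow> 'b set" +
  fixes p :: nat and e1 :: "'c::comm_ring_1 \<Rightarrow> 'a" and e2 :: "'c \<Rightarrow> 'b"
    and K :: "'c set" and RR MM :: "int \<Rightarrow> 'c set" and Rt Mt :: "'c set"
  assumes std: "standard_graded_ring R Rg" and char: "ring_char R = p" "p > 0"
    and Ff: "F_finite R p"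
    and e1_closed [simp]: "e1 f \<in> carrier R" and e2_closed [simp]: "e2 f \<in> carrier M"
    and e1_add: "e1 (f + g) = e1 f \<oplus>\<^bsub>R\<^esub> e1 g" and e2_add: "e2 (f + g) = e2 f \<oplus>\<^bsub>M\<^esub> e2 g"
    and e1_mult: "e1 (f * g) = e1 f \<otimes>\<^bsub>R\<^esub> e1 g"
    and e2_mult: "e2 (f * g) = (e1 f \<odot>\<^bsub>M\<^esub> e2 g) \<oplus>\<^bsub>M\<^esub> (e1 g \<odot>\<^bsub>M\<^esub> e2 f)"
    and e1_one: "e1 1 = \<one>\<^bsub>R\<^esub>" and e2_one: "e2 1 = \<zero>\<^bsub>M\<^esub>"
    and e_surj: "a \<in> carrier R \<Longrightarrow> x \<in> carrier M \<Longrightarrow> \<exists>f. e1 f = a \<and> e2 f = x"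
    and K_eq: "K = {f. e1 f = \<zero>\<^bsub>R\<^esub> \<and> e2 f = \<zero>\<^bsub>M\<^esub>}"
    and RR_eq: "RR i = {f. e2 f = \<zero>\<^bsub>M\<^esub> \<and> e1 f \<in> (if i < 0 then {\<zero>\<^bsub>R\<^esub>} else Rg (nat i))}"
    and MM_eq: "MM j = {f. e1 f = \<zero>\<^bsub>R\<^esub> \<and> e2 f \<in> Mg j}"
    and Rt_eq: "Rt = {f. e2 f = \<zero>\<^bsub>M\<^esub>}" and Mt_eq: "Mt = {f. e1 f = \<zero>\<^bsub>R\<^esub>}"
begin

section \<open>Translation between the given structures and the ring type\<close>

lemma M_minus_eq_zero [simp]:
  assumes "x \<in> carrier M" "y \<in> carrier M" shows "x \<ominus>\<^bsub>M\<^esub> y = \<zero>\<^bsub>M\<^esub> \<longleftrightarrow> x = y"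
proof
  assume "x \<ominus>\<^bsub>M\<^esub> y = \<zero>\<^bsub>M\<^esub>"
  then have "x \<oplus>\<^bsub>M\<^esub> \<ominus>\<^bsub>M\<^esub> y = y \<oplus>\<^bsub>M\<^esub> \<ominus>\<^bsub>M\<^esub> y" using assms by (simp add: M.minus_eq M.r_neg)
  then show "x = y" using assms by simp
qed (use assms in \<open>simp add: M.minus_eq M.r_neg\<close>)

lemma e_zero [simp]: "e1 0 = \<zero>\<^bsub>R\<^esub>" "e2 0 = \<zero>\<^bsub>M\<^esub>"
proof -
  have "e1 0 \<oplus>\<^bsub>R\<^esub> e1 0 = e1 0" using e1_add[of 0 0] by simp
  then show "e1 0 = \<zero>\<^bsub>R\<^esub>" using R.add.l_cancel_one[of "e1 0" "e1 0"] by simp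
  have "e2 0 \<oplus>\<^bsub>M\<^esub> e2 0 = e2 0" using e2_add[of 0 0] by simp
  then show "e2 0 = \<zero>\<^bsub>M\<^esub>" using M.add.l_cancel_one[of "e2 0" "e2 0"] by simp
qed

lemma e1_minus: "e1 (- f) = \<ominus>\<^bsub>R\<^esub> e1 f"
  using e1_add[of "- f" f] R.minus_equality[of "e1 (- f)" "e1 f"] by simp

lemma e2_minus: "e2 (- f) = \<ominus>\<^bsub>M\<^esub> e2 f"
  using e2_add[of "- f" f] M.minus_equality[of "e2 (- f)" "e2 f"] by simp

lemma e1_diff: "e1 (f - g) = e1 f \<ominus>\<^bsub>R\<^esub> e1 g"
  using e1_add[of f "- g"] by (simp add: e1_minus R.minus_eq)

lemma e2_diff: "e2 (f - g) = e2 f \<ominus>\<^bsub>M\<^esub> e2 g"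
  using e2_add[of f "- g"] by (simp add: e2_minus M.minus_eq)

lemma e1_power: "e1 (f ^ n) = e1 f [^]\<^bsub>R\<^esub> n"
proof (induction n)
  case (Suc n)
  then show ?case by (simp add: e1_mult e1_one R.m_comm)
qed (simp add: e1_one)

lemma e1_sum: "finite I \<Longrightarrow> e1 (\<Sum>i\<in>I. f i) = finsum R (\<lambda>i. e1 (f i)) I"
  by (induction I rule: finite_induct) (auto simp: e1_add)

lemma e2_sum: "finite I \<Longrightarrow> e2 (\<Sum>i\<in>I. f i) = finsum M (\<lambda>i. e2 (f i)) I"
  by (induction I rule: finite_induct) (auto simp: e2_add)

lemma K_cong: "f - g \<in> K \<longleftrightarrow> e1 f = e1 g \<and> e2 f = e2 g"
  by (simp add: K_eq e1_diff e2_diff)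

lemma K_I: "e1 f = e1 g \<Longrightarrow> e2 f = e2 g \<Longrightarrow> f - g \<in> K" by (simp add: K_cong)

lemma sgp_Kz: "sgp K"
  by (auto simp: sgp_def K_eq e1_diff e2_diff)

lemma resp: "sgp W \<Longrightarrow> K \<subseteq> W \<Longrightarrow> f \<in> W \<Longrightarrow> e1 f = e1 g \<Longrightarrow> e2 f = e2 g \<Longrightarrow> g \<in> W"
  using sgp_add[of W "g - f" f] K_I[of g f] by auto

lemma sgp_Rt: "sgp Rt" by (auto simp: sgp_def Rt_eq e2_diff)

lemma sgp_Mt: "sgp Mt" by (auto simp: sgp_def Mt_eq e1_diff)

lemma Rt_mult: "f \<in> Rt \<Longrightarrow> g \<in> Rt \<Longrightarrow> f * g \<in> Rt"
  by (simp add: Rt_eq e2_mult)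

lemma K_idealz: "k \<in> K \<Longrightarrow> r * k \<in> K"
  by (simp add: K_eq e1_mult e2_mult)

lemma Rt_ex: "a \<in> carrier R \<Longrightarrow> \<exists>f\<in>Rt. e1 f = a"
  using e_surj[of a "\<zero>\<^bsub>M\<^esub>"] by (auto simp: Rt_eq)

lemma Mt_ex: "x \<in> carrier M \<Longrightarrow> \<exists>f\<in>Mt. e2 f = x"
  using e_surj[of "\<zero>\<^bsub>R\<^esub>" x] by (auto simp: Mt_eq)

lemma Rg_sub: "additive_subgroup (Rg i) R" and Mg_sub: "additive_subgroup (Mg j) M"
  using ring_decomposition module_decomposition by (auto simp: direct_sum_decomposition_def)

lemma Rg_carrier: "Rg i \<subseteq> carrier R" and Mg_carrier: "Mg j \<subseteq> carrier M"
  using additive_subgroup.a_subset[OF Rg_sub] additive_subgroup.a_subset[OF Mg_sub] by auto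

lemma additive_subgroup_diff:
  assumes "additive_subgroup A G" "abelian_group G" "x \<in> A" "y \<in> A" shows "x \<ominus>\<^bsub>G\<^esub> y \<in> A"
  using assms by (simp add: a_minus_def additive_subgroup.a_closed additive_subgroup.a_inv_closed)

lemma sgp_RR: "sgp (RR i)"
  using additive_subgroup_diff[OF Rg_sub R.abelian_group_axioms] additive_subgroup.zero_closed[OF Rg_sub]
  by (auto simp: sgp_def RR_eq e1_diff e2_diff split: if_splits)

lemma sgp_MM: "sgp (MM i)"
  using additive_subgroup_diff[OF Mg_sub M.abelian_group_axioms] additive_subgroup.zero_closed[OF Mg_sub]
  by (auto simp: sgp_def MM_eq e1_diff e2_diff)

lemma K_RR: "K \<subseteq> RR i"
  using additive_subgroup.zero_closed[OF Rg_sub] by (auto simp: K_eq RR_eq)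

lemma K_MM: "K \<subseteq> MM i"
  using additive_subgroup.zero_closed[OF Mg_sub] by (auto simp: K_eq MM_eq)

lemma RR_neg: "i < 0 \<Longrightarrow> RR i = K" by (auto simp: RR_eq K_eq)

lemma RR_Rt: "RR i \<subseteq> Rt" by (auto simp: RR_eq Rt_eq)

lemma MM_Mt: "MM i \<subseteq> Mt" by (auto simp: MM_eq Mt_eq)

lemma RR_mult: "r \<in> RR i \<Longrightarrow> s \<in> RR j \<Longrightarrow> r * s \<in> RR (i + j)"
proof -
  assume r: "r \<in> RR i" and s: "s \<in> RR j"
  show ?thesis
  proof (cases "i < 0 \<or> j < 0")
    case True
    then have "r * s \<in> K"
      using r s RR_neg K_idealz[of s r] K_idealz[of r s] by (auto simp: mult.commute)
    then show ?thesis using K_RR by blast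
  next
    case False
    then show ?thesis using r s mult_degree[of "e1 r" "nat i" "e1 s" "nat j"]
      by (auto simp: RR_eq e1_mult e2_mult nat_add_distrib)
  qed
qed

lemma MM_mult: "r \<in> RR i \<Longrightarrow> x \<in> MM j \<Longrightarrow> r * x \<in> MM (i + j)"
proof -
  assume r: "r \<in> RR i" and x: "x \<in> MM j"
  show ?thesis
  proof (cases "i < 0")
    case True
    then have "r * x \<in> K" using r RR_neg K_idealz[of r x] by (auto simp: mult.commute)
    then show ?thesis using K_MM by blast
  next
    case False
    have "e2 (r * x) = e1 r \<odot>\<^bsub>M\<^esub> e2 x" "e1 (r * x) = \<zero>\<^bsub>R\<^esub>"
      using r x by (auto simp: RR_eq MM_eq e1_mult e2_mult)
    then show ?thesis using r x False smult_degree[of "e1 r" "nat i" "e2 x" j] by (auto simp: RR_eq MM_eq)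
  qed
qed

lemma tot_RR: "Rt = tot K RR"
proof
  show "tot K RR \<subseteq> Rt" by (rule tot_least[OF sgp_Rt]) (use K_RR RR_Rt in blast)+
  show "Rt \<subseteq> tot K RR"
  proof
    fix f assume f: "f \<in> Rt"
    obtain I c where c: "finite I" "\<forall>i. c i \<in> Rg i" "e1 f = finsum R c I"
      using direct_sum_exists[OF ring_decomposition e1_closed[of f]] by blast
    have "\<forall>i. \<exists>g\<in>Rt. e1 g = c i" using c(2) Rg_carrier Rt_ex by blast
    then obtain g where g: "\<And>i. g i \<in> Rt" "\<And>i. e1 (g i) = c i" by metis
    have "g i \<in> RR (int i)" for i using g[of i] c(2) by (simp add: RR_eq Rt_eq)
    then have "(\<Sum>i\<in>I. g i) \<in> tot K RR" by (intro sgp_sum[OF sgp_tot[OF sgp_Kz]] tot_gen)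
    moreover have "(\<Sum>i\<in>I. g i) \<in> Rt" by (intro sgp_sum[OF sgp_Rt] g)
    ultimately show "f \<in> tot K RR"
      using f c(1,3) by (intro resp[OF sgp_tot[OF sgp_Kz] _ \<open>(\<Sum>i\<in>I. g i) \<in> tot K RR\<close>]) (auto simp: e1_sum g Rt_eq intro: tot_K)
  qed
qed

lemma tot_MM: "Mt = tot K MM"
proof
  show "tot K MM \<subseteq> Mt" by (rule tot_least[OF sgp_Mt]) (use K_MM MM_Mt in blast)+
  show "Mt \<subseteq> tot K MM"
  proof
    fix f assume f: "f \<in> Mt"
    obtain I c where c: "finite I" "\<forall>i. c i \<in> Mg i" "e2 f = finsum M c I"
      using direct_sum_exists[OF module_decomposition e2_closed[of f]] by blast
    have "\<forall>i. \<exists>g\<in>Mt. e2 g = c i" using c(2) Mg_carrier Mt_ex by blast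
    then obtain g where g: "\<And>i. g i \<in> Mt" "\<And>i. e2 (g i) = c i" by metis
    have "g i \<in> MM i" for i using g[of i] c(2) by (simp add: MM_eq Mt_eq)
    then have "(\<Sum>i\<in>I. g i) \<in> tot K MM" by (intro sgp_sum[OF sgp_tot[OF sgp_Kz]] tot_gen)
    moreover have "(\<Sum>i\<in>I. g i) \<in> Mt" by (intro sgp_sum[OF sgp_Mt] g)
    ultimately show "f \<in> tot K MM"
      using f c(1,3) by (intro resp[OF sgp_tot[OF sgp_Kz] _ \<open>(\<Sum>i\<in>I. g i) \<in> tot K MM\<close>]) (auto simp: e2_sum g Mt_eq intro: tot_K)
  qed
qed

lemma indep_MM: "indep K MM"
  unfolding indep_def
proof (intro allI impI ballI)
  fix I h i assume I: "finite I" "\<forall>i\<in>I. h i \<in> MM i" "(\<Sum>i\<in>I. h i) \<in> K" and i: "i \<in> I"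
  have "e2 (h i) = \<zero>\<^bsub>M\<^esub>"
  proof (rule direct_sum_indep[OF M.abelian_group_axioms module_decomposition I(1) _ _ i])
    show "finsum M (\<lambda>i. e2 (h i)) I = \<zero>\<^bsub>M\<^esub>" using I(3) e2_sum[OF I(1), of h] by (simp add: K_eq)
  qed (use I(2) in \<open>auto simp: MM_eq\<close>)
  then show "h i \<in> K" using I(2) i by (simp add: K_eq MM_eq)
qed

lemma indep_RR: "indep K RR"
  unfolding indep_def
proof (intro allI impI ballI)
  fix I h i assume I: "finite I" "\<forall>i\<in>I. h i \<in> RR i" "(\<Sum>i\<in>I. h i) \<in> K" and i: "i \<in> I"
  show "h i \<in> K"
  proof (cases "i < 0")
    case True
    then show ?thesis using I(2) i RR_neg by auto
  next
    case False
    define J where "J = {i \<in> I. 0 \<le> i}"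
    have J: "finite J" "J \<subseteq> I" "inj_on nat J" using I(1) by (auto simp: J_def inj_on_def intro: finite_subset)
    have "finsum R (\<lambda>n. e1 (h (int n))) (nat ` J) = finsum R (\<lambda>j. e1 (h (int (nat j)))) J"
      by (rule R.finsum_reindex[OF _ J(3)]) auto
    also have "\<dots> = finsum R (\<lambda>j. e1 (h j)) J"
      by (rule R.finsum_cong') (auto simp: J_def)
    also have "\<dots> = finsum R (\<lambda>j. e1 (h j)) I"
    proof (rule R.add.finprod_mono_neutral_cong_left[OF I(1) J(2)])
      fix j assume "j \<in> I - J"
      then have "h j \<in> RR j" "j < 0" using I(2) by (auto simp: J_def)
      then show "e1 (h j) = \<zero>\<^bsub>R\<^esub>" by (simp add: RR_eq)
    qed auto
    also have "\<dots> = \<zero>\<^bsub>R\<^esub>" using I(3) e1_sum[OF I(1), of h] by (simp add: K_eq)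
    finally have s: "finsum R (\<lambda>n. e1 (h (int n))) (nat ` J) = \<zero>\<^bsub>R\<^esub>" .
    have "e1 (h (int (nat i))) = \<zero>\<^bsub>R\<^esub>"
    proof (rule direct_sum_indep[OF R.abelian_group_axioms ring_decomposition _ _ s])
      show "nat i \<in> nat ` J" using i False by (simp add: J_def)
      fix n assume "n \<in> nat ` J"
      then have "int n \<in> I" by (auto simp: J_def)
      then show "e1 (h (int n)) \<in> Rg n" using I(2) by (auto simp: RR_eq dest!: bspec[of I _ "int n"])
    qed (use J in auto)
    then have "e1 (h i) = \<zero>\<^bsub>R\<^esub>" using False by simp
    then show ?thesis using I(2) i by (simp add: K_eq RR_eq)
  qed
qed

section \<open>The field in degree zero and the characteristic\<close>

lemma subfield_Rg: "subfield (Rg 0) R"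
  using standard_graded_ring.degree_zero_field[OF std] .

lemma one_notin_K: "1 \<notin> K"
  using subfieldE(6)[OF subfield_Rg] by (simp add: K_eq e1_one)

lemma one_RR: "1 \<in> RR 0"
  using one_degree by (simp add: RR_eq e1_one e2_one)

lemma inv_RR:
  assumes r: "r \<in> RR 0" "r \<notin> K" shows "\<exists>s\<in>RR 0. r * s - 1 \<in> K"
proof -
  have "e1 r \<in> Rg 0 - {\<zero>\<^bsub>R\<^esub>}" using r by (auto simp: RR_eq K_eq)
  note iv = R.subfield_m_inv[OF subfield_Rg this]
  obtain s where s: "s \<in> Rt" "e1 s = inv\<^bsub>R\<^esub> (e1 r)" using Rt_ex iv(1) Rg_carrier by blast
  have "s \<in> RR 0" using s iv(1) by (simp add: RR_eq Rt_eq)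
  moreover have "e1 r \<otimes>\<^bsub>R\<^esub> e1 s = \<one>\<^bsub>R\<^esub>" using iv(2) s(2) by simp
  then have "r * s - 1 \<in> K" using r(1) s(1) by (intro K_I) (simp_all add: e1_mult e2_mult e1_one e2_one RR_eq Rt_eq)
  ultimately show ?thesis by blast
qed

lemma e1_of_nat: "e1 (of_nat n) = [n] \<cdot>\<^bsub>R\<^esub> \<one>\<^bsub>R\<^esub>" "e2 (of_nat n) = \<zero>\<^bsub>M\<^esub>"
proof (induction n)
  case (Suc n)
  { case 1 show ?case using Suc by (simp add: e1_add e1_one R.add.nat_pow_Suc R.a_comm) }
  { case 2 show ?case using Suc by (simp add: e2_add e2_one) }
qed simp_all

lemma of_nat_K: "of_nat n \<in> K \<longleftrightarrow> p dvd n"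
proof -
  have "of_nat n \<in> K \<longleftrightarrow> [n] \<cdot>\<^bsub>R\<^esub> \<one>\<^bsub>R\<^esub> = \<zero>\<^bsub>R\<^esub>" by (simp add: K_eq e1_of_nat)
  also have "\<dots> \<longleftrightarrow> p dvd n"
    using R.add.pow_eq_id[of "\<one>\<^bsub>R\<^esub>" n] char(1) by (simp add: ring_char_def)
  finally show ?thesis .
qed

lemma of_nat_RR: "of_nat n \<in> RR 0"
  by (induction n) (use sgp_zero[OF sgp_RR] sgp_add[OF sgp_RR one_RR] in auto)

text \<open>Integer multiples of 1 lie in the field in degree 0, so a product of two of them
  vanishes only if a factor does.\<close>

lemma prime_char: "prime p"
proof -
  have p1: "p \<noteq> 1" using of_nat_K[of 1] one_notin_K by auto
  show ?thesis
  proof (rule prime_elem_nat_iff[THEN iffD1], rule prime_elemI)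
    fix a b assume "p dvd a * b"
    then have ab: "of_nat a * of_nat b \<in> K" using of_nat_K[of "a * b"] by simp
    show "p dvd a \<or> p dvd b"
    proof (cases "of_nat a \<in> K")
      case False
      then obtain s where s: "of_nat a * s - 1 \<in> K" using inv_RR[OF of_nat_RR] by blast
      have "s * (of_nat a * of_nat b) - of_nat b * (of_nat a * s - 1) \<in> K"
        by (intro sgp_diff[OF sgp_Kz] K_idealz ab s)
      then show ?thesis using of_nat_K by (simp add: algebra_simps)
    qed (use of_nat_K in simp)
  qed (use char(2) p1 in auto)
qed

sublocale frobenius_mod K p
proof
  show "sgp K" by (rule sgp_Kz)
  show "k \<in> K \<Longrightarrow> r * k \<in> K" for k r by (rule K_idealz)
  show "prime p" by (rule prime_char)
  show "of_nat p \<in> K" by (simp add: of_nat_K)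
qed

text \<open>\<open>A n\<close> consists of the elements of degree n reached from \<open>RR 0\<close>
  by n rounds of multiplying by \<open>X\<close> and adding. These families are closed under
  products, so their total contains the generated ring and hence everything; directness of the
  grading then gives \<open>A n\<close> = \<open>RR n\<close>.\<close>

lemma generators_RR:
  "\<exists>X. finite X \<and> X \<subseteq> RR 1 \<and> (\<forall>i r. 0 \<le> i \<longrightarrow> r \<in> RR (i + 1) \<longrightarrow> (\<exists>c. (\<forall>x\<in>X. c x \<in> RR i) \<and> r - (\<Sum>x\<in>X. c x * x) \<in> K))"
proof -
  obtain X0 where X0: "finite X0" "X0 \<subseteq> Rg 1" "generate_ring R (Rg 0 \<union> X0) = carrier R"
    using standard_graded_ring.degree_one_generated[OF std] by blast
  have "\<forall>a\<in>X0. \<exists>f\<in>Rt. e1 f = a" using X0(2) Rg_carrier[of 1] Rt_ex by blast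
  then obtain l where l: "\<And>a. a \<in> X0 \<Longrightarrow> l a \<in> Rt" "\<And>a. a \<in> X0 \<Longrightarrow> e1 (l a) = a" by metis
  define X where "X = l ` X0"
  have X: "finite X" "X \<subseteq> RR 1" using X0 l by (auto simp: X_def RR_eq Rt_eq)
  define A where "A = rec_nat (RR 0) (\<lambda>n S. {f \<in> RR (int (Suc n)). \<exists>c. (\<forall>x\<in>X. c x \<in> S) \<and> f - (\<Sum>x\<in>X. c x * x) \<in> K})"
  have A0: "A 0 = RR 0" by (simp add: A_def)
  have AS: "A (Suc n) = {f \<in> RR (int (Suc n)). \<exists>c. (\<forall>x\<in>X. c x \<in> A n) \<and> f - (\<Sum>x\<in>X. c x * x) \<in> K}" for n
    by (simp add: A_def)
  have ARR: "A n \<subseteq> RR (int n)" for n by (cases n) (auto simp: A0 AS)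
  have A_grp: "sgp (A n) \<and> K \<subseteq> A n" for n
  proof (induction n)
    case 0 then show ?case using sgp_RR K_RR by (simp add: A0)
  next
    case (Suc n)
    have "f \<in> A (Suc n)" if f: "f \<in> K" for f unfolding AS
      using Suc f K_RR sgp_zero by (auto intro!: exI[of _ "\<lambda>_. 0"])
    moreover have "f - g \<in> A (Suc n)" if fg: "f \<in> A (Suc n)" "g \<in> A (Suc n)" for f g
    proof -
      obtain c where c: "\<forall>x\<in>X. c x \<in> A n" "f - (\<Sum>x\<in>X. c x * x) \<in> K" using fg(1) unfolding AS by blast
      obtain d where d: "\<forall>x\<in>X. d x \<in> A n" "g - (\<Sum>x\<in>X. d x * x) \<in> K" using fg(2) unfolding AS by blast
      have "f - g - (\<Sum>x\<in>X. (c x - d x) * x) = (f - (\<Sum>x\<in>X. c x * x)) - (g - (\<Sum>x\<in>X. d x * x))"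
        by (simp add: left_diff_distrib sum_subtractf)
      then have "f - g - (\<Sum>x\<in>X. (c x - d x) * x) \<in> K" using sgp_diff[OF sgp_K c(2) d(2)] by (simp only:)
      moreover have "\<forall>x\<in>X. c x - d x \<in> A n" using c(1) d(1) Suc sgp_diff by blast
      moreover have "f - g \<in> RR (int (Suc n))" using fg ARR sgp_diff[OF sgp_RR] by blast
      ultimately show ?thesis unfolding AS by (intro CollectI conjI exI[of _ "\<lambda>x. c x - d x"])
    qed
    ultimately show ?case unfolding sgp_def using sgp_zero[OF sgp_K] by blast
  qed
  have A0_mult: "f * g \<in> A n" if f: "f \<in> RR 0" and g: "g \<in> A n" for f g n
    using g
  proof (induction n arbitrary: g)
    case 0 then show ?case using RR_mult[OF f, of g 0] by (simp add: A0)
  next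
    case (Suc n)
    obtain c where c: "\<forall>x\<in>X. c x \<in> A n" "g - (\<Sum>x\<in>X. c x * x) \<in> K" using Suc.prems unfolding AS by blast
    have "f * g - (\<Sum>x\<in>X. (f * c x) * x) = f * (g - (\<Sum>x\<in>X. c x * x))"
      by (simp add: right_diff_distrib sum_distrib_left mult.assoc)
    then have "f * g - (\<Sum>x\<in>X. (f * c x) * x) \<in> K" using K_ideal[OF c(2)] by (simp only:)
    moreover have "f * g \<in> RR (int (Suc n))" using RR_mult[OF f, of g "int (Suc n)"] subsetD[OF ARR Suc.prems] by simp
    moreover have "\<forall>x\<in>X. f * c x \<in> A n" using Suc.IH c(1) by blast
    ultimately show ?case unfolding AS by (intro CollectI conjI exI[of _ "\<lambda>x. f * c x"])
  qed
  have A_mult: "f * g \<in> A (m + n)" if f: "f \<in> A m" and g: "g \<in> A n" for f g m n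
    using f
  proof (induction m arbitrary: f)
    case 0 then show ?case using A0_mult g by (simp add: A0)
  next
    case (Suc m)
    obtain c where c: "\<forall>x\<in>X. c x \<in> A m" "f - (\<Sum>x\<in>X. c x * x) \<in> K" using Suc.prems unfolding AS by blast
    have "f * g - (\<Sum>x\<in>X. (c x * g) * x) = (f - (\<Sum>x\<in>X. c x * x)) * g"
      by (simp add: left_diff_distrib sum_distrib_right mult.assoc mult.commute[of g])
    then have "f * g - (\<Sum>x\<in>X. (c x * g) * x) \<in> K" using K_ideal'[OF c(2)] by (simp only:)
    moreover have "f * g \<in> RR (int (Suc (m + n)))"
      using RR_mult[OF subsetD[OF ARR Suc.prems] subsetD[OF ARR g]] by (simp add: algebra_simps)
    moreover have "\<forall>x\<in>X. c x * g \<in> A (m + n)" using Suc.IH c(1) by blast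
    ultimately have "f * g \<in> A (Suc (m + n))" unfolding AS by (intro CollectI conjI exI[of _ "\<lambda>x. c x * g"])
    then show ?case by simp
  qed
  have XA: "x \<in> A 1" if x: "x \<in> X" for x
  proof -
    have "(\<Sum>y\<in>X. (if y = x then 1 else 0) * y) = x" using x X(1) by (simp add: if_distrib[of "\<lambda>c. c * _"] cong: if_cong)
    then show ?thesis unfolding One_nat_def AS using x X(2) sgp_zero[OF sgp_RR] sgp_zero[OF sgp_K] one_RR
      by (auto simp: A0 intro!: exI[of _ "\<lambda>y. if y = x then 1 else 0"])
  qed
  define AA where "AA i = (if i < 0 then K else A (nat i))" for i :: int
  have AA: "sgp (AA i)" "K \<subseteq> AA i" "AA i \<subseteq> RR i" for i
    using A_grp[of "nat i"] ARR[of "nat i"] sgp_K K_RR by (auto simp: AA_def)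
  have sT: "sgp (tot K AA)" by (rule sgp_tot[OF sgp_K])
  have KT: "K \<subseteq> tot K AA" by (auto intro: tot_K)
  have A_T: "A n \<subseteq> tot K AA" for n by (auto simp: AA_def intro: tot_gen[of _ _ "int n"])
  have AA_T: "a * b \<in> tot K AA" if "a \<in> AA i" "b \<in> AA j" for a b i j
    using that A_mult[of a "nat i" b "nat j"] A_T K_ideal[of b a] K_ideal'[of a b] KT
    by (auto simp: AA_def split: if_splits)
  note T_mult = tot_mult[OF K_ideal AA_T]
  have gen: "\<exists>f\<in>tot K AA. f \<in> Rt \<and> e1 f = a" if "a \<in> generate_ring R (Rg 0 \<union> X0)" for a
    using that
  proof induction
    case one then show ?case using one_RR A_T[of 0] by (intro bexI[of _ 1]) (auto simp: A0 e1_one Rt_eq e2_one)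
  next
    case (incl h)
    then show ?case
    proof
      assume h: "h \<in> Rg 0"
      obtain f where f: "f \<in> Rt" "e1 f = h" using Rt_ex h Rg_carrier by blast
      then have "f \<in> A 0" using h by (simp add: A0 RR_eq Rt_eq)
      then show ?thesis using A_T f by blast
    next
      assume h: "h \<in> X0"
      then have "l h \<in> tot K AA" using XA[of "l h"] A_T[of 1] by (auto simp: X_def)
      then show ?thesis using l[OF h] by blast
    qed
  next
    case (a_inv h)
    then obtain f where f: "f \<in> tot K AA" "f \<in> Rt" "e1 f = h" by blast
    then show ?case by (intro bexI[of _ "- f"] sgp_minus[OF sT]) (auto simp: e1_minus intro: sgp_minus[OF sgp_Rt])
  next
    case (eng_add h k)
    then obtain f g where f: "f \<in> tot K AA" "f \<in> Rt" "e1 f = h" "g \<in> tot K AA" "g \<in> Rt" "e1 g = k" by blast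
    then show ?case by (intro bexI[of _ "f + g"] sgp_add[OF sT]) (auto simp: e1_add intro: sgp_add[OF sgp_Rt])
  next
    case (eng_mult h k)
    then obtain f g where f: "f \<in> tot K AA" "f \<in> Rt" "e1 f = h" "g \<in> tot K AA" "g \<in> Rt" "e1 g = k" by blast
    then show ?case by (intro bexI[of _ "f * g"] T_mult) (auto simp: e1_mult intro: Rt_mult)
  qed
  have "\<exists>c. (\<forall>x\<in>X. c x \<in> RR i) \<and> r - (\<Sum>x\<in>X. c x * x) \<in> K" if i: "0 \<le> i" and r: "r \<in> RR (i + 1)" for i r
  proof -
    obtain f where f: "f \<in> tot K AA" "f \<in> Rt" "e1 f = e1 r" using gen[of "e1 r"] X0(3) by auto
    have rT: "r \<in> tot K AA" by (rule resp[OF sT KT f(1) f(3)]) (use f(2) r in \<open>auto simp: Rt_eq RR_eq\<close>)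
    have "r \<in> AA (i + 1)" using tot_Int_component[OF indep_RR sgp_K sgp_RR AA] r rT by blast
    then have "r \<in> A (Suc (nat i))" using i by (simp add: AA_def nat_add_distrib)
    then obtain c where "\<forall>x\<in>X. c x \<in> A (nat i)" "r - (\<Sum>x\<in>X. c x * x) \<in> K" unfolding AS by blast
    then show ?thesis using ARR[of "nat i"] i by (intro exI[of _ c]) auto
  qed
  then show ?thesis using X by blast
qed

text \<open>\<open>P\<close> is the irrelevant ideal. Taking degree zero parts modulo it projects
  the ring onto k.\<close>

lemma degree_zero_part:
  defines "P \<equiv> tot K (\<lambda>i. if i \<ge> 1 then RR i else K)"
  shows "f \<in> Rt \<Longrightarrow> \<exists>g\<in>RR 0. f - g \<in> P" and "f \<in> Rt \<Longrightarrow> g \<in> P \<Longrightarrow> f * g \<in> P"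
    and "sgp P" and "K \<subseteq> P" and "P \<subseteq> Rt" and "RR 0 \<inter> P \<subseteq> K"
proof -
  let ?U = "\<lambda>i::int. if i \<ge> 1 then RR i else K"
  show sP: "sgp P" unfolding P_def by (rule sgp_tot[OF sgp_K])
  show KP: "K \<subseteq> P" unfolding P_def by (auto intro: tot_K)
  show "P \<subseteq> Rt" unfolding P_def tot_RR by (rule tot_mono[OF sgp_K]) (use K_RR in auto)
  have RP: "RR i \<subseteq> P" if "i \<ge> 1" for i unfolding P_def using that by (auto intro!: tot_gen[of _ _ i])
  show "\<exists>g\<in>RR 0. f - g \<in> P" if f: "f \<in> Rt"
    using f unfolding tot_RR
  proof induction
    case (tot_K x) then show ?case using KP sgp_zero[OF sgp_RR] by (intro bexI[of _ 0]) auto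
  next
    case (tot_gen x j)
    consider "j < 0" | "j = 0" | "j \<ge> 1" by linarith
    then show ?case
    proof cases
      case 1 then show ?thesis using tot_gen RR_neg KP sgp_zero[OF sgp_RR] by (intro bexI[of _ 0]) auto
    next
      case 2 then show ?thesis using tot_gen sgp_zero[OF sP] by (intro bexI[of _ x]) auto
    next
      case 3 then show ?thesis using tot_gen RP[of j] sgp_zero[OF sgp_RR] by (intro bexI[of _ 0]) auto
    qed
  next
    case (tot_diff x y)
    then obtain g h where gh: "g \<in> RR 0" "x - g \<in> P" "h \<in> RR 0" "y - h \<in> P" by blast
    have "(x - g) - (y - h) \<in> P" by (rule sgp_diff[OF sP gh(2,4)])
    then show ?case using sgp_diff[OF sgp_RR gh(1,3)] by (intro bexI[of _ "g - h"]) (auto simp: algebra_simps)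
  qed
  show "f * g \<in> P" if f: "f \<in> Rt" and g: "g \<in> P"
    unfolding P_def
  proof (rule tot_mult[OF K_ideal _ f[unfolded tot_RR] g[unfolded P_def]])
    fix i j a b assume "a \<in> RR i" "b \<in> ?U j"
    then have "a * b \<in> K \<or> a * b \<in> ?U (i + j)"
      using RR_mult[of a i b j] RR_neg[of i] K_ideal[of b a] K_ideal'[of a b] by (auto split: if_splits)
    then show "a * b \<in> tot K ?U" by (auto intro: tot_K tot_gen)
  qed
  have "P \<inter> RR 0 = ?U 0" unfolding P_def
    by (rule tot_Int_component[OF indep_RR sgp_K sgp_RR]) (use sgp_K sgp_RR K_RR in auto)
  then show "RR 0 \<inter> P \<subseteq> K" by auto
qed

text \<open>F-finiteness passes from \<open>R\<close> to its quotient k: generators and coefficients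
  of the Frobenius pushforward are replaced by their degree zero parts, and the error lies both in
  \<open>RR 0\<close> and in the irrelevant ideal, hence in \<open>K\<close>.\<close>

lemma frobenius_generators:
  "\<exists>Y. finite Y \<and> Y \<subseteq> RR 0 \<and> (\<forall>r. r \<in> RR 0 \<longrightarrow> (\<exists>c. (\<forall>y\<in>Y. c y \<in> RR 0) \<and> r - (\<Sum>y\<in>Y. c y ^ p * y) \<in> K))"
proof -
  define P where "P = tot K (\<lambda>i. if i \<ge> 1 then RR i else K)"
  note D = degree_zero_part[folded P_def]
  obtain Y0 where Y0: "finite Y0" "Y0 \<subseteq> carrier R"
    "\<And>y. y \<in> carrier R \<Longrightarrow> \<exists>c \<in> Y0 \<rightarrow> carrier R. y = (\<Oplus>\<^bsub>R\<^esub>x \<in> Y0. c x [^]\<^bsub>R\<^esub> p \<otimes>\<^bsub>R\<^esub> x)"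
    using Ff unfolding F_finite_def finite_ring_hom_def by blast
  have "\<forall>a\<in>carrier R. \<exists>f\<in>Rt. e1 f = a" using Rt_ex by blast
  then obtain l where l: "\<And>a. a \<in> carrier R \<Longrightarrow> l a \<in> Rt" "\<And>a. a \<in> carrier R \<Longrightarrow> e1 (l a) = a" by metis
  have "\<forall>f\<in>Rt. \<exists>g\<in>RR 0. f - g \<in> P" using D(1) by blast
  then obtain \<epsilon> where e: "\<And>f. f \<in> Rt \<Longrightarrow> \<epsilon> f \<in> RR 0" "\<And>f. f \<in> Rt \<Longrightarrow> f - \<epsilon> f \<in> P" by metis
  define y where "y x = \<epsilon> (l x)" for x
  define Y where "Y = y ` Y0"
  have Y: "finite Y" "Y \<subseteq> RR 0" using Y0 l e by (auto simp: Y_def y_def)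
  have "\<exists>c. (\<forall>y\<in>Y. c y \<in> RR 0) \<and> r - (\<Sum>y\<in>Y. c y ^ p * y) \<in> K" if r: "r \<in> RR 0" for r
  proof -
    obtain c where c: "c \<in> Y0 \<rightarrow> carrier R" "e1 r = (\<Oplus>\<^bsub>R\<^esub>x \<in> Y0. c x [^]\<^bsub>R\<^esub> p \<otimes>\<^bsub>R\<^esub> x)"
      using Y0(3)[of "e1 r"] by auto
    define a where "a x = \<epsilon> (l (c x))" for x
    have cl: "l (c x) \<in> Rt" "e1 (l (c x)) = c x" "l x \<in> Rt" "e1 (l x) = x" if "x \<in> Y0" for x
      using that c(1) l Y0(2) by auto
    have aR: "a x \<in> RR 0" if "x \<in> Y0" for x using e(1)[OF cl(1)[OF that]] by (simp add: a_def)
    have yR: "y x \<in> RR 0" if "x \<in> Y0" for x using e(1)[OF cl(3)[OF that]] by (simp add: y_def)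
    have pw: "f ^ n \<in> Rt" if "f \<in> Rt" for f n
      by (induction n) (use one_RR RR_Rt Rt_mult that in auto)
    have pwR: "f ^ n \<in> RR 0" if "f \<in> RR 0" for f n
    proof (induction n)
      case (Suc n) then show ?case using RR_mult[OF that Suc] by simp
    qed (simp add: one_RR)
    have pd: "f ^ n - g ^ n \<in> P" if f: "f \<in> Rt" and g: "g \<in> Rt" and fg: "f - g \<in> P" for f g n
    proof (induction n)
      case (Suc n)
      have "f * (f ^ n - g ^ n) + g ^ n * (f - g) \<in> P" by (intro sgp_add[OF D(3)] D(2) f pw g Suc fg)
      then show ?case by (simp add: algebra_simps)
    qed (simp add: sgp_zero[OF D(3)])
    have step: "l (c x) ^ p * l x - a x ^ p * y x \<in> P" if x: "x \<in> Y0" for x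
    proof -
      have aRt: "a x \<in> Rt" using aR[OF x] RR_Rt by blast
      have "l x * (l (c x) ^ p - a x ^ p) + a x ^ p * (l x - y x) \<in> P"
        using e(2)[OF cl(1)[OF x]] e(2)[OF cl(3)[OF x]]
        by (intro sgp_add[OF D(3)] D(2) pd pw cl x aRt) (auto simp: a_def y_def)
      then show ?thesis by (simp add: algebra_simps)
    qed
    define S where "S = (\<Sum>x\<in>Y0. l (c x) ^ p * l x)"
    define S' where "S' = (\<Sum>x\<in>Y0. a x ^ p * y x)"
    have S_Rt: "S \<in> Rt" unfolding S_def by (intro sgp_sum[OF sgp_Rt] Rt_mult pw cl)
    have "e1 S = e1 r" unfolding S_def e1_sum[OF Y0(1)] c(2)
      by (rule R.finsum_cong') (use Y0(2) c(1) in \<open>auto simp: e1_mult e1_power cl\<close>)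
    then have "r - S \<in> K" using S_Rt r by (intro K_I) (auto simp: Rt_eq RR_eq)
    then have rS: "r - S \<in> P" using D(4) by blast
    have "S - S' \<in> P" unfolding S_def S'_def sum_subtractf[symmetric] by (intro sgp_sum[OF D(3)] step)
    then have "r - S' \<in> P" using sgp_add[OF D(3) rS, of "S - S'"] by simp
    moreover have "r - S' \<in> RR 0" unfolding S'_def
    proof (intro sgp_diff[OF sgp_RR] r sgp_sum[OF sgp_RR])
      fix x assume "x \<in> Y0"
      then show "a x ^ p * y x \<in> RR 0" using RR_mult[OF pwR[OF aR] yR, of x x] by simp
    qed
    ultimately have 1: "r - S' \<in> K" using D(6) by blast
    \<comment> \<open>Different generators may have the same degree zero part. Their coefficients
      are added up, which is compatible with p-th powers modulo \<open>K\<close>.\<close>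
    define b where "b z = (\<Sum>x\<in>{x \<in> Y0. y x = z}. a x)" for z
    have "S' = (\<Sum>z\<in>Y. \<Sum>x\<in>{x \<in> Y0. y x = z}. a x ^ p * y x)"
      unfolding S'_def Y_def by (rule sum.image_gen[OF Y0(1)])
    also have "\<dots> = (\<Sum>z\<in>Y. (\<Sum>x\<in>{x \<in> Y0. y x = z}. a x ^ p) * z)"
      unfolding sum_distrib_right by (intro sum.cong refl) auto
    finally have "S' - (\<Sum>z\<in>Y. b z ^ p * z) = (\<Sum>z\<in>Y. ((\<Sum>x\<in>{x \<in> Y0. y x = z}. a x ^ p) - b z ^ p) * z)"
      by (simp add: left_diff_distrib sum_subtractf)
    also have "\<dots> \<in> K"
    proof (intro sgp_sum[OF sgp_K] K_ideal')
      fix z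
      show "(\<Sum>x\<in>{x \<in> Y0. y x = z}. a x ^ p) - b z ^ p \<in> K" unfolding b_def
        by (rule K_sym, rule frobenius_sum[OF ppow_p]) (use Y0(1) in simp)
    qed
    finally have "r - (\<Sum>z\<in>Y. b z ^ p * z) \<in> K" using K_trans[OF 1] by blast
    moreover have "b z \<in> RR 0" for z unfolding b_def by (intro sgp_sum[OF sgp_RR] aR) auto
    ultimately show ?thesis by blast
  qed
  then show ?thesis using Y by blast
qed

lemma fring_exists: "\<exists>X Y. fring RR K p X Y"
proof -
  obtain X where X: "finite X" "X \<subseteq> RR 1"
    "\<forall>i r. 0 \<le> i \<longrightarrow> r \<in> RR (i + 1) \<longrightarrow> (\<exists>c. (\<forall>x\<in>X. c x \<in> RR i) \<and> r - (\<Sum>x\<in>X. c x * x) \<in> K)"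
    using generators_RR by blast
  obtain Y where Y: "finite Y" "Y \<subseteq> RR 0"
    "\<forall>r. r \<in> RR 0 \<longrightarrow> (\<exists>c. (\<forall>y\<in>Y. c y \<in> RR 0) \<and> r - (\<Sum>y\<in>Y. c y ^ p * y) \<in> K)"
    using frobenius_generators by blast
  have "fring RR K p X Y"
    by unfold_locales
      (fact sgp_RR K_RR RR_neg one_RR one_notin_K RR_mult inv_RR X(1,2) X(3)[rule_format] Y(1,2) Y(3)[rule_format])+
  then show ?thesis by blast
qed

end

locale presented = realization R Rg M Mg p e1 e2 K RR MM Rt Mt + T: fring RR K p X Y
  for R :: "('a, 'r) ring_scheme" (structure) and Rg :: "nat \<Rightarrow> 'a set"
    and M :: "('a, 'b, 'm) module_scheme" (structure) and Mg :: "int \<Rightarrow> 'b set"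
    and p :: nat and e1 :: "'c::comm_ring_1 \<Rightarrow> 'a" and e2 :: "'c \<Rightarrow> 'b"
    and K :: "'c set" and RR MM :: "int \<Rightarrow> 'c set" and Rt Mt :: "'c set" and X Y :: "'c set"
begin

lemma cl_MM: "T.cl 1 MM"
  unfolding T.cl_def
proof (intro conjI allI ballI)
  fix j show "sgp (MM j)" "K \<subseteq> MM j" by (rule sgp_MM, rule K_MM)
  fix i r x assume "r \<in> RR i" "x \<in> MM j"
  then show "r ^ 1 * x \<in> MM (i + j)" by (simp add: MM_mult)
qed

text \<open>The list of ideal generators is empty here: generators of \<open>J\<close> are produced
  only later, by \<open>homogeneous_ideal_generators\<close>, which rests on this instance.\<close>

sublocale E: graded_total RR K p X Y "{}" Rt Mt MM
  by unfold_locales (simp_all add: tot_RR[symmetric] tot_MM[symmetric] cl_MM indep_MM del: One_nat_def)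

section \<open>Correspondence of ideals and submodules\<close>

definition Ra :: "'a set \<Rightarrow> 'c set" where "Ra A = {f \<in> Rt. e1 f \<in> A}"

definition Ma :: "'b set \<Rightarrow> 'c set" where "Ma B = {f \<in> Mt. e2 f \<in> B}"

lemma e1_Ra: assumes "A \<subseteq> carrier R" shows "e1 ` Ra A = A"
proof
  show "A \<subseteq> e1 ` Ra A"
  proof
    fix a assume a: "a \<in> A"
    obtain f where "f \<in> Rt" "e1 f = a" using Rt_ex subsetD[OF assms a] by blast
    then show "a \<in> e1 ` Ra A" using a by (auto simp: Ra_def)
  qed
qed (auto simp: Ra_def)

lemma e2_Ma: assumes "B \<subseteq> carrier M" shows "e2 ` Ma B = B"
proof
  show "B \<subseteq> e2 ` Ma B"
  proof
    fix x assume x: "x \<in> B"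
    obtain f where "f \<in> Mt" "e2 f = x" using Mt_ex subsetD[OF assms x] by blast
    then show "x \<in> e2 ` Ma B" using x by (auto simp: Ma_def)
  qed
qed (auto simp: Ma_def)

lemma Ra_e1:
  assumes W: "sgp W" "K \<subseteq> W" "W \<subseteq> Rt" shows "Ra (e1 ` W) = W"
proof
  show "W \<subseteq> Ra (e1 ` W)" using W(3) by (auto simp: Ra_def)
  show "Ra (e1 ` W) \<subseteq> W"
  proof
    fix f assume "f \<in> Ra (e1 ` W)"
    then obtain g where g: "f \<in> Rt" "g \<in> W" "e1 f = e1 g" by (auto simp: Ra_def)
    then have "e2 g = e2 f" using W(3) by (auto simp: Rt_eq)
    then show "f \<in> W" using resp[OF W(1,2) g(2)] g(3) by simp
  qed
qed

lemma Ma_e2: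
  assumes W: "sgp W" "K \<subseteq> W" "W \<subseteq> Mt" shows "Ma (e2 ` W) = W"
proof
  show "W \<subseteq> Ma (e2 ` W)" using W(3) by (auto simp: Ma_def)
  show "Ma (e2 ` W) \<subseteq> W"
  proof
    fix f assume "f \<in> Ma (e2 ` W)"
    then obtain g where g: "f \<in> Mt" "g \<in> W" "e2 f = e2 g" by (auto simp: Ma_def)
    then have "e1 g = e1 f" using W(3) by (auto simp: Mt_eq)
    then show "f \<in> W" using resp[OF W(1,2) g(2)] g(3) by simp
  qed
qed

lemma smult_e: "f \<in> Rt \<Longrightarrow> x \<in> Mt \<Longrightarrow> e2 (f * x) = e1 f \<odot>\<^bsub>M\<^esub> e2 x"
  by (simp add: Rt_eq Mt_eq e2_mult)

lemma kR_Rt: "E.kR Rt" unfolding E.kR_def using sgp_Rt Rt_mult by blast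

lemma K_Rt: "K \<subseteq> Rt" and K_Mt: "K \<subseteq> Mt" by (auto simp: K_eq Rt_eq Mt_eq)

lemma kR_Ra:
  assumes A: "ideal A R" shows "E.kR (Ra A)" "K \<subseteq> Ra A"
proof -
  interpret ideal A R by fact
  have "f - g \<in> Ra A" if "f \<in> Ra A" "g \<in> Ra A" for f g
    using that sgp_diff[OF sgp_Rt] additive_subgroup_diff[OF additive_subgroup_axioms R.abelian_group_axioms]
    by (simp add: Ra_def e1_diff)
  moreover have "0 \<in> Ra A" using sgp_zero[OF sgp_Rt] zero_closed by (simp add: Ra_def)
  ultimately show "E.kR (Ra A)"
    unfolding E.kR_def sgp_def using Rt_mult I_l_closed by (auto simp: Ra_def e1_mult)
  show "K \<subseteq> Ra A" using K_Rt zero_closed by (auto simp: Ra_def K_eq)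
qed

lemma ideal_e1:
  assumes W: "E.kR W" "W \<subseteq> Rt" shows "ideal (e1 ` W) R"
proof (rule idealI)
  show "ring R" by (rule R.ring_axioms)
  note sW = E.kR_sgp[OF W(1)]
  show "subgroup (e1 ` W) (add_monoid R)"
  proof (rule R.add.subgroupI)
    show "e1 ` W \<noteq> {}" using sgp_zero[OF sW] by blast
    show "\<ominus>\<^bsub>R\<^esub> a \<in> e1 ` W" if "a \<in> e1 ` W" for a
      using that by (elim imageE) (simp only: e1_minus[symmetric] imageI sgp_minus[OF sW])
    show "a \<oplus>\<^bsub>R\<^esub> b \<in> e1 ` W" if "a \<in> e1 ` W" "b \<in> e1 ` W" for a b
      using that by (elim imageE) (simp only: e1_add[symmetric] imageI sgp_add[OF sW])
  qed auto
  show 1: "x \<otimes>\<^bsub>R\<^esub> a \<in> e1 ` W" if a: "a \<in> e1 ` W" and x: "x \<in> carrier R" for a x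
  proof -
    obtain f g where fg: "f \<in> W" "a = e1 f" "g \<in> Rt" "e1 g = x" using a Rt_ex[OF x] by blast
    have "g * f \<in> W" using E.kR_mult[OF W(1) fg(3,1)] .
    then show ?thesis using fg e1_mult[of g f] by (metis imageI)
  qed
  show "a \<otimes>\<^bsub>R\<^esub> x \<in> e1 ` W" if a: "a \<in> e1 ` W" and x: "x \<in> carrier R" for a x
  proof -
    have "a \<in> carrier R" using a by auto
    then show ?thesis using 1[OF a x] x by (simp add: R.m_comm)
  qed
qed

lemma kR_Ma:
  assumes B: "submodule B R M" shows "E.kR (Ma B)" "K \<subseteq> Ma B"
proof -
  have sB: "additive_subgroup B M" using B by (simp add: additive_subgroup_def submodule_def)
  have "f - g \<in> Ma B" if "f \<in> Ma B" "g \<in> Ma B" for f g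
    using that sgp_diff[OF sgp_Mt] additive_subgroup_diff[OF sB M.abelian_group_axioms]
    by (simp add: Ma_def e2_diff)
  moreover have "0 \<in> Ma B" using sgp_zero[OF sgp_Mt] additive_subgroup.zero_closed[OF sB] by (simp add: Ma_def)
  moreover have "f * x \<in> Ma B" if "f \<in> Rt" "x \<in> Ma B" for f x
    using that E.kR_mult[OF E.Mt_kR, of f x] submodule.smult_closed[OF B] by (simp add: Ma_def smult_e)
  ultimately show "E.kR (Ma B)" unfolding E.kR_def sgp_def by blast
  show "K \<subseteq> Ma B" using K_Mt additive_subgroup.zero_closed[OF sB] by (auto simp: Ma_def K_eq)
qed

lemma submodule_e2:
  assumes W: "E.kR W" "W \<subseteq> Mt" shows "submodule (e2 ` W) R M"
proof (rule submoduleI)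
  note sW = E.kR_sgp[OF W(1)]
  show "\<zero>\<^bsub>M\<^esub> \<in> e2 ` W" using sgp_zero[OF sW] by (metis e_zero(2) imageI)
  show "\<ominus>\<^bsub>M\<^esub> a \<in> e2 ` W" if "a \<in> e2 ` W" for a
    using that by (elim imageE) (simp only: e2_minus[symmetric] imageI sgp_minus[OF sW])
  show "a \<oplus>\<^bsub>M\<^esub> b \<in> e2 ` W" if "a \<in> e2 ` W" "b \<in> e2 ` W" for a b
    using that by (elim imageE) (simp only: e2_add[symmetric] imageI sgp_add[OF sW])
  show "a \<odot>\<^bsub>M\<^esub> x \<in> e2 ` W" if a: "a \<in> carrier R" and x: "x \<in> e2 ` W" for a x
  proof -
    obtain f g where fg: "f \<in> W" "x = e2 f" "g \<in> Rt" "e1 g = a" using x Rt_ex[OF a] by blast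
    have "g * f \<in> W" using E.kR_mult[OF W(1) fg(3,1)] .
    moreover have "e2 (g * f) = a \<odot>\<^bsub>M\<^esub> x" using smult_e[OF fg(3), of f] fg W(2) by auto
    ultimately show ?thesis by (metis imageI)
  qed
qed auto

lemma Ma_ideal_smult:
  assumes I: "I \<subseteq> carrier R" shows "Ma (ideal_smult R I M) = E.ism (Ra I)"
proof
  have sM: "E.ism (Ra I) \<subseteq> Mt"
    by (rule E.ism_least[OF E.Mt_kR K_Mt]) (auto simp: Ra_def intro: E.kR_mult[OF E.Mt_kR])
  have sub: "submodule (e2 ` E.ism (Ra I)) R M" by (rule submodule_e2[OF E.kR_ism sM])
  have "{a \<odot>\<^bsub>M\<^esub> x | a x. a \<in> I \<and> x \<in> carrier M} \<subseteq> e2 ` E.ism (Ra I)"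
  proof clarify
    fix a x assume a: "a \<in> I" and x: "x \<in> carrier M"
    obtain f where f: "f \<in> Rt" "e1 f = a" using Rt_ex a I by blast
    obtain g where g: "g \<in> Mt" "e2 g = x" using Mt_ex x by blast
    have "f * g \<in> E.ism (Ra I)" by (rule E.ism_mem) (use f g a in \<open>auto simp: Ra_def\<close>)
    then show "a \<odot>\<^bsub>M\<^esub> x \<in> e2 ` E.ism (Ra I)" using smult_e[OF f(1) g(1)] f g by (metis imageI)
  qed
  then have "ideal_smult R I M \<subseteq> e2 ` E.ism (Ra I)" using sub unfolding ideal_smult_def by blast
  then have "Ma (ideal_smult R I M) \<subseteq> Ma (e2 ` E.ism (Ra I))" by (auto simp: Ma_def)
  then show "Ma (ideal_smult R I M) \<subseteq> E.ism (Ra I)"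
    using Ma_e2[OF E.kR_sgp[OF E.kR_ism] E.K_ism sM] by simp
  show "E.ism (Ra I) \<subseteq> Ma (ideal_smult R I M)"
  proof
    fix f assume f: "f \<in> E.ism (Ra I)"
    have "e2 f \<in> N" if N: "submodule N R M" "{a \<odot>\<^bsub>M\<^esub> x | a x. a \<in> I \<and> x \<in> carrier M} \<subseteq> N" for N
    proof -
      have "E.ism (Ra I) \<subseteq> Ma N"
      proof (rule E.ism_least[OF kR_Ma[OF N(1)]])
        fix a x assume a: "a \<in> Ra I" and x: "x \<in> Mt"
        have "e1 a \<odot>\<^bsub>M\<^esub> e2 x \<in> N" using N(2) a e2_closed[of x] unfolding Ra_def by blast
        then show "a * x \<in> Ma N" using a x E.kR_mult[OF E.Mt_kR, of a x] by (simp add: Ma_def Ra_def smult_e)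
      qed
      then show ?thesis using f by (auto simp: Ma_def)
    qed
    then show "f \<in> Ma (ideal_smult R I M)" using f sM by (auto simp: Ma_def ideal_smult_def)
  qed
qed

lemma submodule_ideal_smult: "I \<subseteq> carrier R \<Longrightarrow> submodule (ideal_smult R I M) R M"
proof -
  assume I: "I \<subseteq> carrier R"
  have sM: "E.ism (Ra I) \<subseteq> Mt"
    by (rule E.ism_least[OF E.Mt_kR K_Mt]) (auto simp: Ra_def intro: E.kR_mult[OF E.Mt_kR])
  have "submodule (carrier M) R M" using submodule_e2[OF E.Mt_kR order_refl] e2_Ma[OF order_refl]
    by (simp add: Ma_def)
  then have "ideal_smult R I M \<subseteq> carrier M" unfolding ideal_smult_def using I by (intro Inter_lower) auto
  then have "e2 ` E.ism (Ra I) = ideal_smult R I M" using e2_Ma Ma_ideal_smult[OF I] by metis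
  then show ?thesis using submodule_e2[OF E.kR_ism sM] by simp
qed

lemma Ra_set_add:
  assumes A: "ideal A R" and B: "ideal B R" shows "Ra (A <+>\<^bsub>R\<^esub> B) = Ra A + Ra B"
proof
  show "Ra A + Ra B \<subseteq> Ra (A <+>\<^bsub>R\<^esub> B)"
  proof
    fix f assume "f \<in> Ra A + Ra B"
    then obtain a b where ab: "a \<in> Ra A" "b \<in> Ra B" "f = a + b" by (rule set_plus_elim)
    then show "f \<in> Ra (A <+>\<^bsub>R\<^esub> B)" using sgp_add[OF sgp_Rt] by (auto simp: Ra_def e1_add set_add_def')
  qed
  show "Ra (A <+>\<^bsub>R\<^esub> B) \<subseteq> Ra A + Ra B"
  proof
    fix f assume "f \<in> Ra (A <+>\<^bsub>R\<^esub> B)"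
    then obtain a b where ab: "f \<in> Rt" "a \<in> A" "b \<in> B" "e1 f = a \<oplus>\<^bsub>R\<^esub> b" by (auto simp: Ra_def set_add_def')
    have "a \<in> carrier R" using ideal.Icarr[OF A] ab by blast
    then obtain g where g: "g \<in> Rt" "e1 g = a" using Rt_ex by blast
    have "b \<in> carrier R" using ideal.Icarr[OF B] ab by blast
    then have "e1 (f - g) = b"
      using ab(4) g \<open>a \<in> carrier R\<close> by (simp add: e1_diff R.minus_eq R.a_comm[of a b] R.a_assoc R.r_neg)
    then have "f - g \<in> Ra B" using ab(1,3) g sgp_diff[OF sgp_Rt] by (simp add: Ra_def)
    moreover have "g \<in> Ra A" using g ab by (simp add: Ra_def)
    ultimately have "g + (f - g) \<in> Ra A + Ra B" by (rule set_plus_intro[rotated])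
    then show "f \<in> Ra A + Ra B" by simp
  qed
qed

section \<open>Homogeneous ideals and generators\<close>

lemma homogeneous_ideal_le:
  assumes J: "homogeneous_ideal R Rg J" and W: "E.kR W" "K \<subseteq> W"
    and h: "\<And>i f. f \<in> RR i \<Longrightarrow> e1 f \<in> J \<Longrightarrow> f \<in> W"
  shows "Ra J \<subseteq> W"
proof -
  interpret E: sublattice E.kR by (rule E.KR_sublattice)
  have kW: "E.kR (W \<inter> Rt)" by (rule E.L_Int[OF W(1) kR_Rt])
  have "Idl\<^bsub>R\<^esub> {x \<in> J. \<exists>i. x \<in> Rg i} \<subseteq> e1 ` (W \<inter> Rt)"
  proof (rule R.genideal_minimal[OF ideal_e1[OF kW]], safe)
    fix x i assume x: "x \<in> J" "x \<in> Rg i"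
    obtain f where f: "f \<in> Rt" "e1 f = x" using Rt_ex x(2) Rg_carrier by blast
    then have "f \<in> RR (int i)" using x(2) by (simp add: RR_eq Rt_eq)
    then show "x \<in> e1 ` (W \<inter> Rt)" using h f x(1) by blast
  qed
  then have "J \<subseteq> e1 ` (W \<inter> Rt)" using J unfolding homogeneous_ideal_def by blast
  then have "Ra J \<subseteq> Ra (e1 ` (W \<inter> Rt))" by (auto simp: Ra_def)
  also have "\<dots> = W \<inter> Rt" by (rule Ra_e1[OF E.kR_sgp[OF kW]]) (use W(2) K_Rt in auto)
  finally show ?thesis by blast
qed

lemma homogeneous_ideal_generators:
  assumes J: "homogeneous_ideal R Rg J"
  shows "\<exists>F. finite F \<and> (\<forall>fe\<in>F. fst fe \<in> RR (snd fe) \<and> e1 (fst fe) \<in> J) \<and>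
    (\<forall>W. E.kR W \<longrightarrow> K \<subseteq> W \<longrightarrow> (\<forall>fe\<in>F. fst fe \<in> W) \<longrightarrow> Ra J \<subseteq> W)"
proof -
  have iJ: "ideal J R" using J by (simp add: homogeneous_ideal_def)
  define JJ where "JJ i = Ra J \<inter> RR i" for i
  have JJ: "T.cl 1 JJ" unfolding JJ_def by (rule T.cl_Int[OF E.kR_cl[OF kR_Ra[OF iJ]] T.cl_R])
  have "JJ \<le> RR" by (auto simp: JJ_def le_fun_def)
  then obtain F where F: "finite F" "\<forall>fe\<in>F. fst fe \<in> JJ (snd fe)" "JJ = T.spn 1 X F"
    using T.noeth_generators[OF T.noeth_R JJ] by blast
  have "Ra J \<subseteq> W" if W: "E.kR W" "K \<subseteq> W" and g: "\<forall>fe\<in>F. fst fe \<in> W" for W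
  proof (rule homogeneous_ideal_le[OF J W])
    have "T.cl 1 (\<lambda>j. W \<inter> RR j)" by (rule T.cl_Int[OF E.kR_cl[OF W] T.cl_R])
    then have "T.spn 1 X F \<le> (\<lambda>j. W \<inter> RR j)"
      by (intro T.spn_le T.cl_clx) (use F(2) g in \<open>auto simp: JJ_def\<close>)
    then have le: "JJ i \<subseteq> W" for i using F(3) by (auto simp: le_fun_def)
    fix i f assume "f \<in> RR i" "e1 f \<in> J"
    then have "f \<in> JJ i" using RR_Rt by (auto simp: JJ_def Ra_def)
    then show "f \<in> W" using le by blast
  qed
  moreover have "fst fe \<in> RR (snd fe) \<and> e1 (fst fe) \<in> J" if "fe \<in> F" for fe
    using F(2) that by (auto simp: JJ_def Ra_def)
  ultimately show ?thesis using F(1) by blast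
qed

text \<open>Outside \<open>K\<close>, degree zero elements are units, so a proper homogeneous ideal
  lies in the ideal of positive degree elements. That ideal is proper, and maximality gives
  equality.\<close>

lemma Ra_maximal:
  assumes m: "maximalideal \<mm> R" and h: "homogeneous_ideal R Rg \<mm>"
  shows "Ra \<mm> = E.RG 1"
proof -
  interpret m: maximalideal \<mm> R by fact
  have le: "Ra \<mm> \<subseteq> E.RG 1"
  proof (rule homogeneous_ideal_le[OF h E.kR_RG E.K_RG])
    fix i f assume f: "f \<in> RR i" "e1 f \<in> \<mm>"
    show "f \<in> E.RG 1"
    proof (cases "1 \<le> i")
      case True then show ?thesis using E.R_RG f(1) by blast
    next
      case False
      have "f \<in> K"
      proof (rule ccontr)
        assume nK: "f \<notin> K"
        then have "i = 0" using False f(1) RR_neg[of i] by (cases "i < 0") auto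
        then obtain s where s: "s \<in> RR 0" "f * s - 1 \<in> K" using inv_RR[of f] f nK by blast
        have "e1 f \<otimes>\<^bsub>R\<^esub> e1 s = \<one>\<^bsub>R\<^esub>" using s(2) by (simp add: K_cong e1_mult e1_one)
        then have "\<one>\<^bsub>R\<^esub> \<in> \<mm>" using m.I_r_closed[OF f(2) e1_closed[of s]] by simp
        then show False using m.one_imp_carrier m.I_notcarr by simp
      qed
      then show ?thesis using E.K_RG by blast
    qed
  qed
  have "e1 1 \<notin> e1 ` E.RG 1"
  proof
    assume "e1 1 \<in> e1 ` E.RG 1"
    then have "1 \<in> Ra (e1 ` E.RG 1)" using one_RR RR_Rt by (auto simp: Ra_def)
    then have "1 \<in> E.RG 1" using Ra_e1[OF E.kR_sgp[OF E.kR_RG] E.K_RG E.RG_Rt] by simp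
    then have "1 \<in> RR 0 \<inter> tot K (\<lambda>i. if i \<ge> 1 then RR i else K)" using one_RR by (simp add: E.RG_def)
    then show False using degree_zero_part(6) one_notin_K by blast
  qed
  then have "e1 ` E.RG 1 \<noteq> carrier R" using e1_closed by blast
  moreover have "\<mm> \<subseteq> e1 ` E.RG 1"
    using image_mono[OF le, of e1] e1_Ra[of \<mm>] m.a_subset by simp
  moreover have "e1 ` E.RG 1 \<subseteq> carrier R" by auto
  ultimately have "e1 ` E.RG 1 = \<mm>" using m.I_maximal[OF ideal_e1[OF E.kR_RG E.RG_Rt]] by blast
  moreover have "Ra (e1 ` E.RG 1) = E.RG 1" by (rule Ra_e1[OF E.kR_sgp[OF E.kR_RG] E.K_RG E.RG_Rt])
  ultimately show ?thesis by simp
qed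

text \<open>Since the ring is generated in degree one, an element of degree at least n + 1 is a sum
  of products of elements of degree at least n with elements of \<open>X\<close>.\<close>

lemma Ra_ideal_power:
  assumes m: "maximalideal \<mm> R" and h: "homogeneous_ideal R Rg \<mm>"
  shows "Ra (ideal_power R \<mm> j) = E.RG j" and "ideal (ideal_power R \<mm> j) R"
proof -
  have im: "ideal \<mm> R" using h by (simp add: homogeneous_ideal_def)
  have *: "Ra (\<mm> [^]\<^bsub>ideals_set R\<^esub> n) = E.RG (int n) \<and> ideal (\<mm> [^]\<^bsub>ideals_set R\<^esub> n) R" for n :: nat
  proof (induction n)
    case 0
    have "\<mm> [^]\<^bsub>ideals_set R\<^esub> (0::nat) = carrier R" by (simp add: ideals_set_def nat_pow_def)
    then show ?case using E.RG_nonpos[of 0] R.oneideal by (auto simp: Ra_def)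
  next
    case (Suc n)
    let ?I = "\<mm> [^]\<^bsub>ideals_set R\<^esub> n"
    have e: "\<mm> [^]\<^bsub>ideals_set R\<^esub> (Suc n) = ideal_prod R ?I \<mm>" by (simp add: ideals_set_def nat_pow_def)
    have I: "ideal ?I R" "Ra ?I = E.RG (int n)" using Suc by auto
    have P: "ideal (ideal_prod R ?I \<mm>) R" by (rule R.ideal_prod_is_ideal[OF I(1) im])
    note kP = kR_Ra[OF P]
    have memI: "f * g \<in> Ra (ideal_prod R ?I \<mm>)" if f: "f \<in> E.RG (int n)" and g: "g \<in> E.RG 1" for f g
    proof -
      have "f \<in> Ra ?I" "g \<in> Ra \<mm>" using f g I(2) Ra_maximal[OF m h] by auto
      then show ?thesis using Rt_mult by (auto simp: Ra_def e1_mult intro: ideal_prod.prod)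
    qed
    have "E.RG (int n + 1) \<subseteq> Ra (ideal_prod R ?I \<mm>)"
    proof (rule E.RG_least[OF E.kR_sgp[OF kP(1)] kP(2)])
      fix i :: int assume i: "int n + 1 \<le> i"
      show "RR i \<subseteq> Ra (ideal_prod R ?I \<mm>)"
      proof
        fix r assume r: "r \<in> RR i"
        obtain c where c: "\<forall>x\<in>X. c x \<in> RR (i - 1)" "r - (\<Sum>x\<in>X. c x * x) \<in> K"
          using T.gen_R[of "i - 1" r] r i by auto
        have "(\<Sum>x\<in>X. c x * x) \<in> Ra (ideal_prod R ?I \<mm>)"
        proof (rule sgp_sum[OF E.kR_sgp[OF kP(1)]])
          fix x assume x: "x \<in> X"
          have "c x \<in> E.RG (int n)" using E.R_RG[of "int n" "i - 1"] c(1) x i by auto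
          moreover have "x \<in> E.RG 1" using E.R_RG[of 1 1] T.X_R x by auto
          ultimately show "c x * x \<in> Ra (ideal_prod R ?I \<mm>)" by (rule memI)
        qed
        then have "(\<Sum>x\<in>X. c x * x) + (r - (\<Sum>x\<in>X. c x * x)) \<in> Ra (ideal_prod R ?I \<mm>)"
          using c(2) kP(2) by (intro sgp_add[OF E.kR_sgp[OF kP(1)]]) auto
        then show "r \<in> Ra (ideal_prod R ?I \<mm>)" by simp
      qed
    qed
    moreover have "Ra (ideal_prod R ?I \<mm>) \<subseteq> E.RG (int n + 1)"
    proof
      fix f assume "f \<in> Ra (ideal_prod R ?I \<mm>)"
      then have f: "f \<in> Rt" "e1 f \<in> ideal_prod R ?I \<mm>" by (auto simp: Ra_def)
      from f(2) have "e1 f \<in> e1 ` E.RG (int n + 1)"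
      proof (induction rule: ideal_prod.induct)
        case (prod i j)
        have "i \<in> e1 ` Ra ?I" "j \<in> e1 ` Ra \<mm>"
          using prod e1_Ra[of ?I] e1_Ra[of \<mm>] additive_subgroup.a_subset[OF ideal.axioms(1)[OF I(1)]]
            additive_subgroup.a_subset[OF ideal.axioms(1)[OF im]] by auto
        then obtain a b where "a \<in> E.RG (int n)" "b \<in> E.RG 1" "i = e1 a" "j = e1 b"
          using I(2) Ra_maximal[OF m h] by auto
        then show ?case using E.RG_mult[of a "int n" b 1] e1_mult[of a b] by (metis imageI)
      next
        case (sum a b)
        from sum.IH show ?case
          by (elim imageE) (simp only: e1_add[symmetric] imageI sgp_add[OF E.kR_sgp[OF E.kR_RG]])
      qed
      then have "f \<in> Ra (e1 ` E.RG (int n + 1))" using f(1) by (simp add: Ra_def)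
      then show "f \<in> E.RG (int n + 1)" using Ra_e1[OF E.kR_sgp[OF E.kR_RG] E.K_RG E.RG_Rt] by simp
    qed
    ultimately show ?case unfolding e using P by (simp add: add.commute)
  qed
  show "ideal (ideal_power R \<mm> j) R" using * by (simp add: ideal_power_def)
  show "Ra (ideal_power R \<mm> j) = E.RG j"
  proof (cases "j \<le> 0")
    case True
    then show ?thesis using *[of 0] E.RG_nonpos[of j] E.RG_nonpos[of 0] by (simp add: ideal_power_def)
  next
    case False then show ?thesis using *[of "nat j"] by (simp add: ideal_power_def)
  qed
qed

text \<open>The homogeneous components of the given generators generate M as a graded
  module.\<close>

lemma fg_MM:
  assumes "finitely_generated_module R M" shows "T.fg 1 MM (\<lambda>_. K)"
proof -
  obtain X0 where X0: "finite X0" "X0 \<subseteq> carrier M"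
    "\<And>x. x \<in> carrier M \<Longrightarrow> \<exists>c \<in> X0 \<rightarrow> carrier R. x = (\<Oplus>\<^bsub>M\<^esub>v \<in> X0. c v \<odot>\<^bsub>M\<^esub> v)"
    using assms unfolding finitely_generated_module_def by blast
  have "\<forall>v\<in>X0. \<exists>f\<in>Mt. e2 f = v" using X0(2) Mt_ex by blast
  then obtain l where l: "\<And>v. v \<in> X0 \<Longrightarrow> l v \<in> Mt" "\<And>v. v \<in> X0 \<Longrightarrow> e2 (l v) = v" by metis
  have "\<forall>v\<in>X0. \<exists>I h. finite I \<and> (\<forall>i\<in>I. h i \<in> MM i) \<and> l v - (\<Sum>i\<in>I. h i) \<in> K"
    using tot_rep[of _ K MM] sgp_K sgp_MM l(1) tot_MM by blast
  then obtain I h where h: "\<And>v. v \<in> X0 \<Longrightarrow> finite (I v)" "\<And>v i. v \<in> X0 \<Longrightarrow> i \<in> I v \<Longrightarrow> h v i \<in> MM i"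
    "\<And>v. v \<in> X0 \<Longrightarrow> l v - (\<Sum>i\<in>I v. h v i) \<in> K" by metis
  define G where "G = (\<Union>v\<in>X0. (\<lambda>i. (h v i, i)) ` I v)"
  have "MM \<le> U" if U: "T.cl 1 U" "\<forall>ga\<in>G. fst ga \<in> U (snd ga)" for U
  proof -
    define V where "V j = U j \<inter> MM j" for j
    have V: "T.cl 1 V" unfolding V_def by (rule T.cl_Int[OF U(1) cl_MM])
    have VM: "V \<le> MM" by (auto simp: V_def le_fun_def)
    note kV = E.kR_tot[OF V] and sV = sgp_tot[OF sgp_K, of V]
    have KV: "K \<subseteq> tot K V" by (auto intro: tot_K)
    have lV: "l v \<in> tot K V" if v: "v \<in> X0" for v
    proof -
      have "h v i \<in> V i" if "i \<in> I v" for i using U(2) h(2) v that by (force simp: V_def G_def)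
      then have "(\<Sum>i\<in>I v. h v i) \<in> tot K V" by (intro sgp_sum[OF sV] tot_gen)
      then have "(\<Sum>i\<in>I v. h v i) + (l v - (\<Sum>i\<in>I v. h v i)) \<in> tot K V"
        using h(3)[OF v] KV by (intro sgp_add[OF sV]) auto
      then show ?thesis by simp
    qed
    show "MM \<le> U"
    proof (rule le_funI, rule subsetI)
      fix j x assume x: "x \<in> MM j"
      obtain c where c: "c \<in> X0 \<rightarrow> carrier R" "e2 x = (\<Oplus>\<^bsub>M\<^esub>v \<in> X0. c v \<odot>\<^bsub>M\<^esub> v)" using X0(3)[of "e2 x"] by auto
      have "\<forall>v\<in>X0. \<exists>f\<in>Rt. e1 f = c v" using c(1) Rt_ex by blast
      then obtain r where r: "\<And>v. v \<in> X0 \<Longrightarrow> r v \<in> Rt" "\<And>v. v \<in> X0 \<Longrightarrow> e1 (r v) = c v" by metis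
      define g where "g = (\<Sum>v\<in>X0. r v * l v)"
      have g: "g \<in> tot K V" unfolding g_def by (intro sgp_sum[OF sV] E.kR_mult[OF kV] r lV)
      have "e2 g = e2 x" unfolding g_def e2_sum[OF X0(1)] c(2)
        by (rule M.finsum_cong') (use X0(2) c(1) r l in \<open>auto simp: smult_e\<close>)
      moreover have "g \<in> Mt" unfolding g_def by (intro sgp_sum[OF sgp_Mt] E.kR_mult[OF E.Mt_kR] r l)
      ultimately have "x \<in> tot K V" using x by (intro resp[OF sV KV g]) (auto simp: Mt_eq MM_eq)
      then show "x \<in> U j" using E.tot_Int[OF V VM, of j] x by (auto simp: V_def)
    qed
  qed
  moreover have "finite G" "\<forall>ga\<in>G. fst ga \<in> MM (snd ga)" using X0(1) h by (auto simp: G_def)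
  ultimately show ?thesis unfolding T.fg_def by blast
qed

subsection \<open>Dimension\<close>

lemma tot_Int_RR: "T.cl 1 C \<Longrightarrow> C \<le> RR \<Longrightarrow> tot K C \<inter> RR j = C j"
  by (rule tot_Int_component[OF indep_RR sgp_K sgp_RR T.cl_sgp T.cl_K]) (auto simp: le_fun_def)

text \<open>In a representation modulo \<open>tot K C\<close> with as few components as possible,
  the last one lies outside \<open>C\<close>; otherwise it could be dropped.\<close>

lemma top_component:
  assumes C: "T.cl 1 C" and a: "a \<in> Rt" "a \<notin> tot K C"
  shows "\<exists>m h. (\<forall>i\<le>m. h i \<in> RR (int i)) \<and> h m \<notin> C (int m) \<and> a - (\<Sum>i\<le>m. h i) \<in> tot K C"
proof -
  let ?P = "\<lambda>n. \<exists>h. (\<forall>i<n. h i \<in> RR (int i)) \<and> a - (\<Sum>i<n. h i) \<in> tot K C"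
  have "\<exists>n. ?P n" using E.Rt_rep[OF a(1)] by (blast intro: tot_K)
  then obtain n where n: "?P n" "\<forall>k<n. \<not> ?P k" unfolding exists_least_iff[of ?P] by blast
  obtain h where h: "\<forall>i<n. h i \<in> RR (int i)" "a - (\<Sum>i<n. h i) \<in> tot K C" using n(1) by blast
  have "n \<noteq> 0" using h(2) a(2) by (cases n) auto
  then obtain m where m: "n = Suc m" using not0_implies_Suc by blast
  have "h m \<notin> C (int m)"
  proof
    assume "h m \<in> C (int m)"
    then have "h m \<in> tot K C" by (rule tot_gen)
    then have "(a - (\<Sum>i<n. h i)) + h m \<in> tot K C" using h(2) by (intro sgp_add[OF sgp_tot[OF sgp_K]])
    then have "?P m" using h(1) by (intro exI[of _ h]) (auto simp: m)
    then show False using n(2) m by blast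
  qed
  then show ?thesis using h by (intro exI[of _ m] exI[of _ h]) (auto simp: m lessThan_Suc_atMost)
qed

text \<open>Modulo the total ideal, a and b may be cut off after their highest components outside
  \<open>C\<close>. The highest component of the product is then the product of these two.\<close>

lemma hp_prime:
  assumes hp: "T.hp C" and a: "a \<in> Rt" and b: "b \<in> Rt" and ab: "a * b \<in> tot K C"
  shows "a \<in> tot K C \<or> b \<in> tot K C"
proof (rule ccontr)
  note C = T.hpD[OF hp]
  note kW = E.kR_tot[OF C(1)] and sW = sgp_tot[OF sgp_K, of C]
  assume "\<not> ?thesis"
  then have n: "a \<notin> tot K C" "b \<notin> tot K C" by auto
  obtain m h where h: "\<forall>i\<le>m. h i \<in> RR (int i)" "h m \<notin> C (int m)" "a - (\<Sum>i\<le>m. h i) \<in> tot K C"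
    using top_component[OF C(1) a n(1)] by blast
  obtain l g where g: "\<forall>i\<le>l. g i \<in> RR (int i)" "g l \<notin> C (int l)" "b - (\<Sum>i\<le>l. g i) \<in> tot K C"
    using top_component[OF C(1) b n(2)] by blast
  let ?A = "\<Sum>i\<le>m. h i" and ?B = "\<Sum>j\<le>l. g j"
  have A: "?A \<in> Rt" by (intro sgp_sum[OF sgp_Rt]) (use h(1) RR_Rt in blast)
  have "b * (a - ?A) + ?A * (b - ?B) \<in> tot K C"
    by (intro sgp_add[OF sW] E.kR_mult[OF kW] A b h(3) g(3))
  then have "a * b - (b * (a - ?A) + ?A * (b - ?B)) \<in> tot K C" by (rule sgp_diff[OF sW ab])
  then have "?A * ?B \<in> tot K C" by (simp add: algebra_simps)
  then have "(\<Sum>x\<in>{..m} \<times> {..l}. h (fst x) * g (snd x)) \<in> tot K C"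
    by (simp add: sum_product sum.cartesian_product split_def)
  then have "(\<Sum>x\<in>{x \<in> {..m} \<times> {..l}. int (fst x) + int (snd x) = int m + int l}. h (fst x) * g (snd x)) \<in> C (int m + int l)"
    by (intro component[OF indep_RR sgp_K sgp_RR T.cl_sgp[OF C(1)] T.cl_K[OF C(1)] C(2)] RR_mult) (use h(1) g(1) in auto)
  moreover have "{x \<in> {..m} \<times> {..l}. int (fst x) + int (snd x) = int m + int l} = {(m, l)}" by auto
  ultimately have "h m * g l \<in> C (int m + int l)" by simp
  then show False using C(4)[of "h m" "int m" "g l" "int l"] h g by auto
qed

lemma annihilator_eq: "annihilator R M = e1 ` {f \<in> Rt. \<forall>x\<in>Mt. f * x \<in> K}"
proof -
  have "f * x \<in> K \<longleftrightarrow> e1 f \<odot>\<^bsub>M\<^esub> e2 x = \<zero>\<^bsub>M\<^esub>" if "f \<in> Rt" "x \<in> Mt" for f x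
    using smult_e[OF that] that by (simp add: K_eq e1_mult Mt_eq)
  then have "(\<forall>x\<in>Mt. f * x \<in> K) \<longleftrightarrow> (\<forall>x\<in>carrier M. e1 f \<odot>\<^bsub>M\<^esub> x = \<zero>\<^bsub>M\<^esub>)" if "f \<in> Rt" for f
    using that Mt_ex by (metis e2_closed)
  then have "{f \<in> Rt. \<forall>x\<in>Mt. f * x \<in> K} = Ra (annihilator R M)" by (auto simp: Ra_def annihilator_def)
  then show ?thesis using e1_Ra[of "annihilator R M"] by (auto simp: annihilator_def)
qed

lemma ideal_annihilator: "ideal (annihilator R M) R"
  unfolding annihilator_eq
proof (rule ideal_e1)
  have "(r * s) * x \<in> K" if "s * x \<in> K" for r s x using K_ideal[OF that, of r] by (simp add: mult.assoc)
  then show "E.kR {f \<in> Rt. \<forall>x\<in>Mt. f * x \<in> K}"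
    unfolding E.kR_def sgp_def using sgp_zero[OF sgp_Rt] sgp_zero[OF sgp_K] sgp_diff[OF sgp_Rt] sgp_diff[OF sgp_K] Rt_mult
    by (auto simp: left_diff_distrib)
qed auto

text \<open>Multiplying a homogeneous x by the components of an annihilating element gives terms of
  different degrees, so every component annihilates x.\<close>

lemma annihilator_le:
  assumes "T.annN 1 MM (\<lambda>_. K) \<le> P" shows "annihilator R M \<subseteq> e1 ` tot K P"
  unfolding annihilator_eq
proof (rule image_mono, safe)
  fix f assume f: "f \<in> Rt" "\<forall>x\<in>Mt. f * x \<in> K"
  obtain n h where h: "\<forall>i<n. h i \<in> RR (int i)" "f - (\<Sum>i<n. h i) \<in> K" using E.Rt_rep[OF f(1)] by blast
  have "h i \<in> T.annN 1 MM (\<lambda>_. K) (int i)" if i: "i < n" for i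
  proof -
    have "h i * x \<in> K" if x: "x \<in> MM j" for j x
    proof -
      have "f * x - x * (f - (\<Sum>i<n. h i)) \<in> K"
        by (rule sgp_diff[OF sgp_K _ K_ideal[OF h(2)]]) (use f(2) x MM_Mt in auto)
      then have "(\<Sum>i<n. h i * x) \<in> K" by (simp add: algebra_simps sum_distrib_left)
      then have "(\<Sum>i<n. h i * x) \<in> tot K (\<lambda>_. K)" by (rule tot_K)
      then have "(\<Sum>l\<in>{l \<in> {..<n}. int l + j = int i + j}. h l * x) \<in> K"
        by (intro component[OF indep_MM sgp_K sgp_MM sgp_K _ K_MM] MM_mult) (use h(1) x in auto)
      moreover have "{l \<in> {..<n}. int l + j = int i + j} = {i}" using i by auto
      ultimately show ?thesis by simp
    qed
    then show ?thesis using h(1) i by (simp add: T.annN_def)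
  qed
  then have "(\<Sum>i<n. h i) \<in> tot K P"
    using assms by (intro sgp_sum[OF sgp_tot[OF sgp_K]] tot_gen) (auto simp: le_fun_def)
  then have "(\<Sum>i<n. h i) + (f - (\<Sum>i<n. h i)) \<in> tot K P" by (rule sgp_add[OF sgp_tot[OF sgp_K] _ tot_K[OF h(2)]])
  then show "f \<in> tot K P" by simp
qed

text \<open>Totals and images turn a chain of homogeneous primes above the annihilator into an
  equally long chain of primes of the quotient ring whose Krull dimension is d.\<close>

lemma dim_bound:
  assumes d: "module_dim R M = enat d" and P: "T.hp P" "T.annN 1 MM (\<lambda>_. K) \<le> P"
  shows "T.cb d P"
  unfolding T.cb_def
proof (intro allI impI)
  fix n and C :: "nat \<Rightarrow> int \<Rightarrow> 'c set"
  assume C0: "C 0 = P" and hpC: "\<forall>i\<le>n. T.hp (C i)" and mono: "\<forall>i<n. C i < C (Suc i)"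
  define A where "A = annihilator R M"
  have A: "ideal A R" unfolding A_def by (rule ideal_annihilator)
  interpret A: ideal A R by fact
  have leC: "P \<le> C i" if "i \<le> n" for i
    using that by (induction i) (use C0 mono in \<open>auto simp: Suc_le_eq intro: order_trans less_imp_le\<close>)
  have AC: "A \<subseteq> e1 ` tot K (C i)" if "i \<le> n" for i
    using annihilator_le[of "C i"] P(2) leC[OF that] by (auto simp: A_def)
  define Q where "Q i = (+>\<^bsub>R\<^esub>) A ` (e1 ` tot K (C i))" for i
  have clC: "T.cl 1 (C i)" "C i \<le> RR" if "i \<le> n" for i using hpC that by (auto simp: T.hp_def)
  have sub: "tot K (C i) \<subseteq> Rt" if "i \<le> n" for i
    unfolding tot_RR by (rule tot_mono[OF sgp_K]) (use clC[OF that] in \<open>auto simp: le_fun_def\<close>)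
  note kC = E.kR_tot[OF clC(1)]
  have idC: "ideal (e1 ` tot K (C i)) R" if "i \<le> n" for i by (rule ideal_e1[OF kC[OF that] sub[OF that]])
  have mem: "A +>\<^bsub>R\<^esub> e1 f \<in> Q i \<longleftrightarrow> f \<in> tot K (C i)" if i: "i \<le> n" and f: "f \<in> Rt" for i f
  proof
    assume "A +>\<^bsub>R\<^esub> e1 f \<in> Q i"
    then obtain g where g: "g \<in> tot K (C i)" "A +>\<^bsub>R\<^esub> e1 f = A +>\<^bsub>R\<^esub> e1 g" by (auto simp: Q_def)
    have "e1 f \<in> A +>\<^bsub>R\<^esub> e1 g" using A.a_rcos_self[of "e1 f"] g(2) by simp
    then obtain a where a: "a \<in> A" "e1 f = a \<oplus>\<^bsub>R\<^esub> e1 g" by (auto simp: a_r_coset_def')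
    have "e1 f \<in> e1 ` tot K (C i)" unfolding a(2)
      by (rule additive_subgroup.a_closed[OF ideal.axioms(1)[OF idC[OF i]]]) (use a g AC[OF i] in auto)
    then have "f \<in> Ra (e1 ` tot K (C i))" using f by (simp add: Ra_def)
    then show "f \<in> tot K (C i)" using Ra_e1[OF sgp_tot[OF sgp_K] _ sub[OF i]] by (auto intro: tot_K)
  qed (auto simp: Q_def)
  have car: "\<exists>f\<in>Rt. x = A +>\<^bsub>R\<^esub> e1 f" if "x \<in> carrier (R Quot A)" for x
    using that Rt_ex by (auto simp: FactRing_def A_RCOSETS_def')
  have prime: "primeideal (Q i) (R Quot A)" if i: "i \<le> n" for i
  proof (rule primeidealI)
    show "ideal (Q i) (R Quot A)" unfolding Q_def by (rule R.ring_ideal_imp_quot_ideal[OF A idC[OF i]])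
    show "cring (R Quot A)" by (rule A.quotient_is_cring[OF R.cring_axioms])
    have "1 \<in> Rt" using one_RR RR_Rt by blast
    moreover have "1 \<notin> tot K (C i)"
    proof
      assume "1 \<in> tot K (C i)"
      then have "1 \<in> C i 0" using tot_Int_RR[OF clC[OF i], of 0] one_RR by blast
      then show False using hpC i T.hpD(3) by blast
    qed
    ultimately have "A +>\<^bsub>R\<^esub> e1 1 \<notin> Q i" using mem[OF i] by blast
    moreover have "A +>\<^bsub>R\<^esub> e1 1 \<in> carrier (R Quot A)" by (auto simp: FactRing_def A_RCOSETS_def')
    ultimately show "carrier (R Quot A) \<noteq> Q i" by blast
    fix x y assume x: "x \<in> carrier (R Quot A)" and y: "y \<in> carrier (R Quot A)" and xy: "x \<otimes>\<^bsub>R Quot A\<^esub> y \<in> Q i"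
    obtain f g where fg: "f \<in> Rt" "x = A +>\<^bsub>R\<^esub> e1 f" "g \<in> Rt" "y = A +>\<^bsub>R\<^esub> e1 g" using car[OF x] car[OF y] by blast
    have "x \<otimes>\<^bsub>R Quot A\<^esub> y = A +>\<^bsub>R\<^esub> e1 (f * g)"
      unfolding fg(2,4) using A.rcoset_mult_add[of "e1 f" "e1 g"] by (simp add: FactRing_def e1_mult)
    then have "f * g \<in> tot K (C i)" using xy mem[OF i Rt_mult[OF fg(1,3)]] by simp
    then have "f \<in> tot K (C i) \<or> g \<in> tot K (C i)" using hp_prime fg(1,3) hpC i by blast
    then show "x \<in> Q i \<or> y \<in> Q i" using mem[OF i] fg by auto
  qed
  have strict: "Q i \<subset> Q (Suc i)" if i: "i < n" for i
  proof -
    have le: "C i \<le> C (Suc i)" "C i \<noteq> C (Suc i)" using mono i by auto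
    have "tot K (C i) \<subseteq> tot K (C (Suc i))" using le(1) by (intro tot_mono[OF sgp_K]) (auto simp: le_fun_def)
    then have "Q i \<subseteq> Q (Suc i)" by (auto simp: Q_def)
    moreover have "\<not> C (Suc i) \<le> C i" using le by auto
    then obtain j f where f: "f \<in> C (Suc i) j" "f \<notin> C i j" by (auto simp: le_fun_def)
    have fR: "f \<in> RR j" using f(1) clC(2)[of "Suc i"] i by (auto simp: le_fun_def)
    have "f \<notin> tot K (C i)" using tot_Int_RR[OF clC, of i j] f(2) fR i by auto
    moreover have "f \<in> tot K (C (Suc i))" using f(1) by (rule tot_gen)
    ultimately show ?thesis using mem[of i f] mem[of "Suc i" f] fR RR_Rt i by (metis Suc_leI less_imp_le psubsetI subsetD)
  qed
  have "enat n \<le> krull_dim (R Quot A)"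
    unfolding krull_dim_def by (rule Sup_upper) (use prime strict in blast)
  then show "n \<le> d" using d by (simp add: module_dim_def A_def)
qed

end

subsection \<open>Lengths of quotient modules\<close>

lemma module_length_len: "module_length R M = len (\<lambda>N. submodule N R M) {} UNIV"
  by (simp add: module_length_def len_def)

context presented begin

lemma coset_eq:
  assumes H: "additive_subgroup H M" and u: "u \<in> carrier M" and v: "v \<in> carrier M"
  shows "H +>\<^bsub>M\<^esub> u = H +>\<^bsub>M\<^esub> v \<longleftrightarrow> u \<ominus>\<^bsub>M\<^esub> v \<in> H"
proof -
  interpret H: abelian_subgroup H M by (rule abelian_subgroupI3[OF H M.abelian_group_axioms])
  show ?thesis
  proof
    assume "H +>\<^bsub>M\<^esub> u = H +>\<^bsub>M\<^esub> v"
    then have "u \<in> H +>\<^bsub>M\<^esub> v" using H.a_rcos_self[OF u] by simp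
    then obtain h where h: "h \<in> H" "u = h \<oplus>\<^bsub>M\<^esub> v" by (auto simp: a_r_coset_def')
    have "h \<in> carrier M" using h(1) H.a_subset by blast
    then have "u \<ominus>\<^bsub>M\<^esub> v = h" using h(2) v by (simp add: M.minus_eq M.a_assoc M.r_neg)
    then show "u \<ominus>\<^bsub>M\<^esub> v \<in> H" using h(1) by simp
  next
    assume d: "u \<ominus>\<^bsub>M\<^esub> v \<in> H"
    have "u = (u \<ominus>\<^bsub>M\<^esub> v) \<oplus>\<^bsub>M\<^esub> v" using u v by (simp add: M.minus_eq M.a_assoc M.l_neg)
    then have "u \<in> H +>\<^bsub>M\<^esub> v" using d by (auto simp: a_r_coset_def')
    then show "H +>\<^bsub>M\<^esub> u = H +>\<^bsub>M\<^esub> v" using M.a_repr_independence[OF _ v H.a_subgroup] by simp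
  qed
qed

text \<open>The correspondence theorem in a form that serves twice: with all of \<open>Rt\<close>
  acting on the whole quotient, and with \<open>RR 0\<close> acting on one graded piece.\<close>

lemma quotient_length:
  assumes H: "additive_subgroup H M" and N: "additive_subgroup N M" and P: "P \<subseteq> Rt"
    and HP: "\<And>r x. r \<in> P \<Longrightarrow> x \<in> H \<Longrightarrow> e1 r \<odot>\<^bsub>M\<^esub> x \<in> H"
    and NP: "\<And>r x. r \<in> P \<Longrightarrow> x \<in> N \<Longrightarrow> e1 r \<odot>\<^bsub>M\<^esub> x \<in> N"
  shows "module_length (R\<lparr>carrier := e1 ` P\<rparr>)
      ((quotient_module M H)\<lparr>carrier := (\<lambda>x. H +>\<^bsub>M\<^esub> x) ` N\<rparr>) =
    len (\<lambda>U. sgp U \<and> (\<forall>r\<in>P. \<forall>x\<in>U. r * x \<in> U)) (Ma H \<inter> Ma N) (Ma N)"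
    (is "module_length ?R ?Q = len ?L ?B ?A")
proof -
  interpret H: abelian_subgroup H M by (rule abelian_subgroupI3[OF H M.abelian_group_axioms])
  interpret N: additive_subgroup N M by fact
  define \<pi> where "\<pi> x = H +>\<^bsub>M\<^esub> x" for x
  have Nc: "x \<in> carrier M" if "x \<in> N" for x using that N.a_subset by blast
  have Hc: "x \<in> carrier M" if "x \<in> H" for x using that H.a_subset by blast
  have carQ: "carrier (add_monoid ?Q) = \<pi> ` N" by (simp add: \<pi>_def)
  have oneQ: "one (add_monoid ?Q) = \<pi> \<zero>\<^bsub>M\<^esub>" using H.a_subset by (simp add: quotient_module_def \<pi>_def)
  have mulQ: "mult (add_monoid ?Q) (\<pi> u) (\<pi> v) = \<pi> (u \<oplus>\<^bsub>M\<^esub> v)" if "u \<in> carrier M" "v \<in> carrier M" for u v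
    using H.a_rcos_sum[OF that] by (simp add: quotient_module_def \<pi>_def)
  have pi_eq: "\<pi> u = \<pi> v \<longleftrightarrow> u \<ominus>\<^bsub>M\<^esub> v \<in> H" if "u \<in> carrier M" "v \<in> carrier M" for u v
    using coset_eq[OF H that] by (simp add: \<pi>_def)
  have pi0: "\<pi> u = \<pi> \<zero>\<^bsub>M\<^esub> \<longleftrightarrow> u \<in> H" if "u \<in> carrier M" for u
    using pi_eq[OF that, of "\<zero>\<^bsub>M\<^esub>"] that M.minus_equality[of "\<zero>\<^bsub>M\<^esub>" "\<zero>\<^bsub>M\<^esub>"] by (simp add: M.minus_eq)
  \<comment> \<open>\<open>m_inv\<close> is a definite description in a record not yet known to be a
    group, so existence and uniqueness of the inverse are checked directly.\<close>
  have invQ: "inv\<^bsub>add_monoid ?Q\<^esub> (\<pi> u) = \<pi> (\<ominus>\<^bsub>M\<^esub> u)" if u: "u \<in> N" for u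
    unfolding m_inv_def
  proof (rule the_equality)
    show "\<pi> (\<ominus>\<^bsub>M\<^esub> u) \<in> carrier (add_monoid ?Q) \<and> mult (add_monoid ?Q) (\<pi> u) (\<pi> (\<ominus>\<^bsub>M\<^esub> u)) = one (add_monoid ?Q) \<and>
        mult (add_monoid ?Q) (\<pi> (\<ominus>\<^bsub>M\<^esub> u)) (\<pi> u) = one (add_monoid ?Q)"
      unfolding carQ oneQ
      using u Nc[OF u] mulQ[of u "\<ominus>\<^bsub>M\<^esub> u"] mulQ[of "\<ominus>\<^bsub>M\<^esub> u" u] by (simp add: M.r_neg M.l_neg)
    fix y assume y: "y \<in> carrier (add_monoid ?Q) \<and> mult (add_monoid ?Q) (\<pi> u) y = one (add_monoid ?Q) \<and>
        mult (add_monoid ?Q) y (\<pi> u) = one (add_monoid ?Q)"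
    then have "y \<in> \<pi> ` N" unfolding carQ by blast
    then obtain v where v: "v \<in> N" "y = \<pi> v" by blast
    have "\<pi> (v \<oplus>\<^bsub>M\<^esub> u) = \<pi> \<zero>\<^bsub>M\<^esub>"
      using y unfolding v(2) oneQ using mulQ[OF Nc[OF v(1)] Nc[OF u]] by simp
    then have "v \<oplus>\<^bsub>M\<^esub> u \<in> H" using pi0[of "v \<oplus>\<^bsub>M\<^esub> u"] Nc u v(1) by simp
    then have "v \<ominus>\<^bsub>M\<^esub> (\<ominus>\<^bsub>M\<^esub> u) \<in> H" using Nc u v(1) by (simp add: M.minus_eq)
    then show "y = \<pi> (\<ominus>\<^bsub>M\<^esub> u)" using pi_eq[of v "\<ominus>\<^bsub>M\<^esub> u"] Nc u v by simp
  qed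
  have smQ: "e1 r \<odot>\<^bsub>?Q\<^esub> (\<pi> u) = \<pi> (e1 r \<odot>\<^bsub>M\<^esub> u)" if r: "r \<in> P" and u: "u \<in> carrier M" for r u
  proof -
    have "\<pi> (e1 r \<odot>\<^bsub>M\<^esub> x) = \<pi> (e1 r \<odot>\<^bsub>M\<^esub> u)" if x: "x \<in> \<pi> u" for x
    proof -
      obtain h where h: "h \<in> H" "x = h \<oplus>\<^bsub>M\<^esub> u" using x by (auto simp: \<pi>_def a_r_coset_def')
      have c: "e1 r \<odot>\<^bsub>M\<^esub> h \<in> carrier M" "e1 r \<odot>\<^bsub>M\<^esub> u \<in> carrier M" using Hc h(1) u by auto
      have "e1 r \<odot>\<^bsub>M\<^esub> x \<ominus>\<^bsub>M\<^esub> e1 r \<odot>\<^bsub>M\<^esub> u = e1 r \<odot>\<^bsub>M\<^esub> h"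
        using c Hc[OF h(1)] u unfolding h(2) by (simp add: smult_r_distr M.minus_eq M.a_assoc M.r_neg)
      then have "e1 r \<odot>\<^bsub>M\<^esub> x \<ominus>\<^bsub>M\<^esub> e1 r \<odot>\<^bsub>M\<^esub> u \<in> H" using HP[OF r h(1)] by simp
      then show ?thesis using Hc h u by (subst pi_eq) auto
    qed
    moreover have "u \<in> \<pi> u" unfolding \<pi>_def by (rule H.a_rcos_self[OF u])
    moreover have "e1 r \<odot>\<^bsub>?Q\<^esub> (\<pi> u) = (\<Union>x\<in>\<pi> u. \<pi> (e1 r \<odot>\<^bsub>M\<^esub> x))" by (simp add: quotient_module_def \<pi>_def)
    ultimately show ?thesis by blast
  qed
  have sN: "sgp (Ma N)"
    using sgp_zero[OF sgp_Mt] sgp_diff[OF sgp_Mt] additive_subgroup_diff[OF N M.abelian_group_axioms] N.zero_closed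
    by (simp add: sgp_def Ma_def e2_diff)
  have MaN: "x \<in> Mt" "e2 x \<in> N" if "x \<in> Ma N" for x using that by (auto simp: Ma_def)
  have ex: "\<exists>f\<in>Ma N. e2 f = u" if "u \<in> N" for u using Mt_ex[OF Nc[OF that]] that by (auto simp: Ma_def)
  have sub: "V \<subseteq> \<pi> ` N" if "submodule V ?R ?Q" for V
    using subgroup.subset[OF submodule.axioms(1)[OF that]] carQ by metis
  show ?thesis
    unfolding module_length_len
  proof (rule antisym)
    show "len (\<lambda>N. submodule N ?R ?Q) {} UNIV \<le> len ?L ?B ?A"
    proof (rule len_mono_map[where F = "\<lambda>V. {f \<in> Ma N. \<pi> (e2 f) \<in> V}"])
      fix V assume sV: "submodule V ?R ?Q"
      define W where "W = {f \<in> Ma N. \<pi> (e2 f) \<in> V}"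
      interpret V: subgroup V "add_monoid ?Q" by (rule submodule.axioms(1)[OF sV])
      have z: "\<pi> \<zero>\<^bsub>M\<^esub> \<in> V" using V.one_closed unfolding oneQ .
      have "f - g \<in> W" if fg: "f \<in> W" "g \<in> W" for f g
      proof -
        have N2: "e2 f \<in> N" "e2 g \<in> N" using fg MaN by (auto simp: W_def)
        have "\<pi> (\<ominus>\<^bsub>M\<^esub> e2 g) \<in> V" using V.m_inv_closed[of "\<pi> (e2 g)"] fg(2) unfolding invQ[OF N2(2)] by (simp add: W_def)
        then have "\<pi> (e2 f \<oplus>\<^bsub>M\<^esub> \<ominus>\<^bsub>M\<^esub> e2 g) \<in> V"
          using V.m_closed[of "\<pi> (e2 f)" "\<pi> (\<ominus>\<^bsub>M\<^esub> e2 g)"] fg(1) mulQ[of "e2 f" "\<ominus>\<^bsub>M\<^esub> e2 g"] by (simp add: W_def)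
        then show ?thesis using sgp_diff[OF sN, of f g] fg by (simp add: W_def e2_diff M.minus_eq)
      qed
      moreover have "0 \<in> W" using z sgp_zero[OF sN] by (simp add: W_def)
      moreover have "r * x \<in> W" if r: "r \<in> P" and x: "x \<in> W" for r x
      proof -
        have x': "x \<in> Ma N" "\<pi> (e2 x) \<in> V" using x by (auto simp: W_def)
        have rx: "e2 (r * x) = e1 r \<odot>\<^bsub>M\<^esub> e2 x" using smult_e P r MaN(1)[OF x'(1)] by blast
        have "e1 r \<odot>\<^bsub>?Q\<^esub> \<pi> (e2 x) \<in> V" using submodule.smult_closed[OF sV, of "e1 r" "\<pi> (e2 x)"] r x'(2) by simp
        then have "\<pi> (e2 (r * x)) \<in> V" unfolding rx using smQ[OF r, of "e2 x"] by simp
        moreover have "r * x \<in> Ma N"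
          using NP[OF r MaN(2)[OF x'(1)]] E.kR_mult[OF E.Mt_kR, of r x] r P MaN(1)[OF x'(1)] rx by (auto simp: Ma_def)
        ultimately show ?thesis by (simp add: W_def)
      qed
      moreover have "\<pi> (e2 f) \<in> V" if "e2 f \<in> H" for f using pi0[of "e2 f"] that z by simp
      then have "?B \<subseteq> W" by (auto simp: W_def Ma_def)
      moreover have "W \<subseteq> ?A" by (auto simp: W_def)
      ultimately show "?L {f \<in> Ma N. \<pi> (e2 f) \<in> V} \<and> ?B \<subseteq> {f \<in> Ma N. \<pi> (e2 f) \<in> V} \<and> {f \<in> Ma N. \<pi> (e2 f) \<in> V} \<subseteq> ?A"
        unfolding W_def[symmetric] sgp_def by blast
    next
      fix V V' assume V: "submodule V' ?R ?Q" "V \<subset> V'"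
      then obtain u where u: "u \<in> N" "\<pi> u \<in> V'" "\<pi> u \<notin> V" using sub by blast
      obtain f where "f \<in> Ma N" "e2 f = u" using ex[OF u(1)] by blast
      then show "{f \<in> Ma N. \<pi> (e2 f) \<in> V} \<subset> {f \<in> Ma N. \<pi> (e2 f) \<in> V'}" using u V(2) by blast
    qed
    show "len ?L ?B ?A \<le> len (\<lambda>N. submodule N ?R ?Q) {} UNIV"
    proof (rule len_mono_map[where F = "\<lambda>W. (\<lambda>f. \<pi> (e2 f)) ` W"])
      fix W assume W: "?L W" "?B \<subseteq> W" "W \<subseteq> ?A"
      define V where "V = (\<lambda>f. \<pi> (e2 f)) ` W"
      have "submodule V ?R ?Q"
      proof (rule submodule.intro)
        have sW: "sgp W" and WA: "W \<subseteq> Ma N" using W by auto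
        show "subgroup V (add_monoid ?Q)"
        proof
          show "V \<subseteq> carrier (add_monoid ?Q)" unfolding carQ V_def using WA MaN by blast
          show "one (add_monoid ?Q) \<in> V" unfolding oneQ V_def using sgp_zero[OF sW] by (metis e_zero(2) imageI)
          fix x assume "x \<in> V"
          then obtain f where f: "f \<in> W" "x = \<pi> (e2 f)" by (auto simp: V_def)
          have "inv\<^bsub>add_monoid ?Q\<^esub> x = \<pi> (e2 (- f))" using invQ[OF MaN(2), of f] f WA by (auto simp: e2_minus)
          then show "inv\<^bsub>add_monoid ?Q\<^esub> x \<in> V" using sgp_minus[OF sW f(1)] by (auto simp: V_def)
          fix y assume "y \<in> V"
          then obtain g where g: "g \<in> W" "y = \<pi> (e2 g)" by (auto simp: V_def)
          have "mult (add_monoid ?Q) x y = \<pi> (e2 (f + g))" using mulQ[of "e2 f" "e2 g"] f g by (simp add: e2_add)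
          then show "mult (add_monoid ?Q) x y \<in> V" using sgp_add[OF sW f(1) g(1)] by (auto simp: V_def)
        qed
        show "submodule_axioms V ?R ?Q"
        proof
          fix a x assume a: "a \<in> carrier ?R" and "x \<in> V"
          then obtain f r where f: "f \<in> W" "x = \<pi> (e2 f)" "r \<in> P" "a = e1 r" by (auto simp: V_def)
          have "r * f \<in> W" using W f by blast
          moreover have "e2 (r * f) = e1 r \<odot>\<^bsub>M\<^esub> e2 f" using smult_e f(1,3) P WA MaN(1) by blast
          ultimately show "a \<odot>\<^bsub>?Q\<^esub> x \<in> V" using smQ[OF f(3), of "e2 f"] f by (metis V_def e2_closed imageI)
        qed
      qed
      then show "submodule ((\<lambda>f. \<pi> (e2 f)) ` W) ?R ?Q \<and> {} \<subseteq> (\<lambda>f. \<pi> (e2 f)) ` W \<and> (\<lambda>f. \<pi> (e2 f)) ` W \<subseteq> UNIV"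
        by (simp add: V_def)
    next
      fix W W' assume W: "?L W" "?B \<subseteq> W" "W \<subset> W'" "W' \<subseteq> ?A"
      obtain f where f: "f \<in> W'" "f \<notin> W" using W(3) by blast
      have "\<pi> (e2 f) \<noteq> \<pi> (e2 g)" if g: "g \<in> W" for g
      proof
        assume "\<pi> (e2 f) = \<pi> (e2 g)"
        then have "e2 (f - g) \<in> H" by (simp add: pi_eq e2_diff)
        moreover have "f - g \<in> Ma N" by (rule sgp_diff[OF sN]) (use W f g in auto)
        ultimately have "f - g \<in> W" using W(2) by (auto simp: Ma_def)
        then show False using sgp_cong[of W f g] W(1) f(2) g by blast
      qed
      then show "(\<lambda>f. \<pi> (e2 f)) ` W \<subset> (\<lambda>f. \<pi> (e2 f)) ` W'" using W(3) f(1) by blast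
    qed
  qed
qed

lemma length_degree_part:
  assumes H: "submodule H R M"
  shows "module_length (R\<lparr>carrier := Rg 0\<rparr>) (quotient_degree_part M Mg H j) = len (T.kst 1) (Ma H \<inter> MM j) (MM j)"
proof -
  have sH: "additive_subgroup H M" using H by (simp add: additive_subgroup_def submodule_def)
  have e: "e1 ` RR 0 = Rg 0"
  proof
    show "e1 ` RR 0 \<subseteq> Rg 0" by (auto simp: RR_eq)
    show "Rg 0 \<subseteq> e1 ` RR 0"
    proof
      fix a assume a: "a \<in> Rg 0"
      obtain f where "f \<in> Rt" "e1 f = a" using Rt_ex a Rg_carrier by blast
      then show "a \<in> e1 ` RR 0" using a by (auto simp: RR_eq Rt_eq intro!: image_eqI[of _ _ f])
    qed
  qed
  have m: "Ma (Mg j) = MM j" unfolding Ma_def by (auto simp: MM_eq Mt_eq)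
  have "module_length (R\<lparr>carrier := e1 ` RR 0\<rparr>) ((quotient_module M H)\<lparr>carrier := (\<lambda>x. H +>\<^bsub>M\<^esub> x) ` Mg j\<rparr>) =
    len (\<lambda>U. sgp U \<and> (\<forall>r\<in>RR 0. \<forall>x\<in>U. r * x \<in> U)) (Ma H \<inter> Ma (Mg j)) (Ma (Mg j))"
  proof (rule quotient_length[OF sH Mg_sub RR_Rt])
    show "e1 r \<odot>\<^bsub>M\<^esub> x \<in> H" if "x \<in> H" for r x using submodule.smult_closed[OF H _ that] by simp
    show "e1 r \<odot>\<^bsub>M\<^esub> x \<in> Mg j" if "r \<in> RR 0" "x \<in> Mg j" for r x
      using smult_degree[of "e1 r" 0 x j] that by (simp add: RR_eq)
  qed
  moreover have "(\<lambda>U. sgp U \<and> (\<forall>r\<in>RR 0. \<forall>x\<in>U. r * x \<in> U)) = T.kst 1"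
    by (intro ext) (simp add: T.kst_def)
  ultimately show ?thesis by (simp only: e m quotient_degree_part_def)
qed

lemma length_quotient:
  assumes H: "submodule H R M"
  shows "module_length R (quotient_module M H) = len E.kR (Ma H) Mt"
proof -
  have sH: "additive_subgroup H M" using H by (simp add: additive_subgroup_def submodule_def)
  have sM: "additive_subgroup (carrier M) M" by (intro additive_subgroup.intro M.add.subgroup_self)
  have e: "e1 ` Rt = carrier R" using Rt_ex by fastforce
  have m: "Ma (carrier M) = Mt" by (simp add: Ma_def)
  have "module_length (R\<lparr>carrier := e1 ` Rt\<rparr>) ((quotient_module M H)\<lparr>carrier := (\<lambda>x. H +>\<^bsub>M\<^esub> x) ` carrier M\<rparr>) =
    len (\<lambda>U. sgp U \<and> (\<forall>r\<in>Rt. \<forall>x\<in>U. r * x \<in> U)) (Ma H \<inter> Ma (carrier M)) (Ma (carrier M))"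
    by (rule quotient_length[OF sH sM order_refl]) (use submodule.smult_closed[OF H] in auto)
  moreover have "(\<lambda>U. sgp U \<and> (\<forall>r\<in>Rt. \<forall>x\<in>U. r * x \<in> U)) = E.kR"
    by (intro ext) (simp add: E.kR_def)
  moreover have "(quotient_module M H)\<lparr>carrier := (\<lambda>x. H +>\<^bsub>M\<^esub> x) ` carrier M\<rparr> = quotient_module M H"
    by (auto simp: quotient_module_def A_RCOSETS_def')
  moreover have "Ma H \<inter> Mt = Ma H" by (auto simp: Ma_def)
  ultimately show ?thesis by (simp only: e m) simp
qed

end

section \<open>The theorem\<close>

locale presented_ideal = presented R Rg M Mg p e1 e2 K RR MM Rt Mt X Y
  for R :: "('a, 'r) ring_scheme" (structure) and Rg :: "nat \<Rightarrow> 'a set"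
    and M :: "('a, 'b, 'm) module_scheme" (structure) and Mg :: "int \<Rightarrow> 'b set"
    and p :: nat and e1 :: "'c::comm_ring_1 \<Rightarrow> 'a" and e2 :: "'c \<Rightarrow> 'b"
    and K :: "'c set" and RR MM :: "int \<Rightarrow> 'c set" and Rt Mt :: "'c set" and X Y :: "'c set" +
  fixes J :: "'a set" and F :: "('c \<times> int) set"
  assumes J: "homogeneous_ideal R Rg J" and finite_F: "finite F"
    and F_RR: "fe \<in> F \<Longrightarrow> fst fe \<in> RR (snd fe)" and F_J: "fe \<in> F \<Longrightarrow> e1 (fst fe) \<in> J"
    and F_gen: "E.kR W \<Longrightarrow> K \<subseteq> W \<Longrightarrow> \<forall>fe\<in>F. fst fe \<in> W \<Longrightarrow> Ra J \<subseteq> W"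
begin

sublocale G: graded_total RR K p X Y F Rt Mt MM
  by unfold_locales (use finite_F F_RR in \<open>simp_all add: tot_RR[symmetric] tot_MM[symmetric] cl_MM indep_MM del: One_nat_def\<close>)

lemma ideal_J: "ideal J R" using J by (simp add: homogeneous_ideal_def)

lemma J_carrier: "J \<subseteq> carrier R" by (rule additive_subgroup.a_subset[OF ideal.axioms(1)[OF ideal_J]])

lemma frobenius_image_carrier: "(\<lambda>x. x [^]\<^bsub>R\<^esub> (q::nat)) ` J \<subseteq> carrier R"
  using J_carrier by auto

lemma ideal_frobenius_power: "ideal (frobenius_power R J q) R"
  unfolding frobenius_power_def by (rule R.genideal_ideal[OF frobenius_image_carrier])

text \<open>The Frobenius power uses the q-th powers of all elements of \<open>J\<close>,
  \<open>Jq\<close> only those of the generators. The elements whose q-th power lies in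
  \<open>Jq\<close> form an ideal, because q-th powers are additive modulo \<open>K\<close>; it
  contains \<open>F\<close> and hence \<open>J\<close>.\<close>

lemma Ra_frobenius_power: "Ra (frobenius_power R J (p ^ n)) = G.Jq (p ^ n)"
proof
  let ?q = "p ^ n" and ?I = "frobenius_power R J (p ^ n)"
  have Jq_Rt: "G.Jq ?q \<subseteq> Rt"
  proof (rule G.Jq_least[OF kR_Rt K_Rt])
    fix fe assume "fe \<in> F"
    then show "fst fe ^ ?q \<in> Rt" using T.power_R[OF F_RR, of fe ?q] RR_Rt by blast
  qed
  show "G.Jq ?q \<subseteq> Ra ?I"
  proof (rule G.Jq_least[OF kR_Ra[OF ideal_frobenius_power]])
    fix fe assume fe: "fe \<in> F"
    have "e1 (fst fe) [^]\<^bsub>R\<^esub> ?q \<in> ?I"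
      unfolding frobenius_power_def using R.genideal_self[OF frobenius_image_carrier] F_J[OF fe] by blast
    moreover have "fst fe ^ ?q \<in> Rt" using T.power_R[OF F_RR[OF fe], of ?q] RR_Rt by blast
    ultimately show "fst fe ^ ?q \<in> Ra ?I" by (simp add: Ra_def e1_power)
  qed
  define A where "A = {a \<in> Rt. a ^ ?q \<in> G.Jq ?q}"
  have sJ: "sgp (G.Jq ?q)" by (rule E.kR_sgp[OF G.kR_Jq])
  have pq: "ppow ?q" by (rule ppow_power)
  have Rt_pow: "r ^ m \<in> Rt" if "r \<in> Rt" for r and m :: nat
    by (induction m) (use that one_RR RR_Rt Rt_mult in auto)
  have "a - b \<in> A" if ab: "a \<in> A" "b \<in> A" for a b
  proof -
    have "a ^ ?q - b ^ ?q \<in> G.Jq ?q" by (rule sgp_diff[OF sJ]) (use ab in \<open>auto simp: A_def\<close>)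
    moreover have "(a - b) ^ ?q - (a ^ ?q - b ^ ?q) \<in> G.Jq ?q" using frobenius_diff[OF pq] G.K_Jq by blast
    ultimately have "(a - b) ^ ?q \<in> G.Jq ?q" using sgp_cong[OF sJ] by blast
    then show ?thesis using ab sgp_diff[OF sgp_Rt] by (simp add: A_def)
  qed
  moreover have KA: "K \<subseteq> A"
    using power_K[OF _ ppow_pos[OF pq]] K_Rt G.K_Jq by (auto simp: A_def)
  moreover have "r * a \<in> A" if "r \<in> Rt" "a \<in> A" for r a
    using that Rt_mult E.kR_mult[OF G.kR_Jq[of ?q] Rt_pow] by (simp add: A_def power_mult_distrib)
  ultimately have "E.kR A" unfolding E.kR_def sgp_def using sgp_zero[OF sgp_K] by blast
  moreover have "\<forall>fe\<in>F. fst fe \<in> A" using F_RR RR_Rt G.Jq_mem unfolding A_def by blast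
  ultimately have RaJ: "Ra J \<subseteq> A" using KA by (intro F_gen)
  have "?I \<subseteq> e1 ` G.Jq ?q"
    unfolding frobenius_power_def
  proof (rule R.genideal_minimal[OF ideal_e1[OF G.kR_Jq Jq_Rt]], rule image_subsetI)
    fix x assume x: "x \<in> J"
    obtain f where f: "f \<in> Rt" "e1 f = x" using Rt_ex x J_carrier by blast
    then have "f ^ ?q \<in> G.Jq ?q" using RaJ x by (auto simp: Ra_def A_def)
    then show "x [^]\<^bsub>R\<^esub> ?q \<in> e1 ` G.Jq ?q" unfolding f(2)[symmetric] e1_power[symmetric] by (rule imageI)
  qed
  then have "Ra ?I \<subseteq> Ra (e1 ` G.Jq ?q)" by (auto simp: Ra_def)
  then show "Ra ?I \<subseteq> G.Jq ?q" using Ra_e1[OF sJ G.K_Jq Jq_Rt] by simp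
qed

text \<open>Writing the dimension as k + 2 turns the normalizing exponents d and d - 1 into
  successors and the error exponent d - 2 into \<open>k\<close>. What remains is to recognize
  \<open>g_tilde\<close> as \<open>S.g\<close> and \<open>h_seq\<close> as values of
  \<open>H\<close>.\<close>

lemma density:
  assumes m: "maximalideal \<mm> R" "homogeneous_ideal R Rg \<mm>"
    and fg: "finitely_generated_module R M" and dim: "module_dim R M = enat (Suc (Suc k))"
  defines "g \<equiv> g_tilde R Rg M Mg J p (Suc k)"
  shows "(\<forall>S. compact S \<longrightarrow> uniformly_convergent_on S g) \<and>
     continuous_on UNIV (\<lambda>s. lim (\<lambda>n. g n s)) \<and>
     h_fun R M \<mm> J p (Suc (Suc k)) C1_differentiable_on UNIV \<and>
     (\<forall>s. density_exists R M \<mm> J p (Suc (Suc k)) s) \<and>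
     (\<forall>s. deriv (h_fun R M \<mm> J p (Suc (Suc k))) s = density_fun R M \<mm> J p (Suc (Suc k)) s \<and>
          density_fun R M \<mm> J p (Suc (Suc k)) s = lim (\<lambda>n. g n s))"
proof -
  note fgM = fg_MM[OF fg]
  note dimM = dim_bound[OF dim]
  interpret D: graded_density RR K p X Y F Rt Mt MM k
    by unfold_locales (rule fgM, rule dimM)
  have "\<exists>a b. a \<le> b \<and> (\<forall>j<a. MM j = K) \<and> (\<forall>i\<ge>b. G.hul MM i = MM)"
    by (rule G.degree_range[OF cl_MM fgM]) (rule dimM)
  then obtain a b where ab: "a \<le> b" "\<forall>j<a. MM j = K" "\<forall>i\<ge>b. G.hul MM i = MM" by blast
  define \<psi> where "\<psi> n j = G.rl (p ^ n) MM (\<lambda>_. K) j" for n j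
  define H where "H n j = G.hh MM a b (p ^ n) j" for n j
  have "\<exists>C\<ge>0. \<forall>n j. \<bar>\<psi> n (j + 1) - \<psi> n j\<bar> \<le> C * (\<bar>real_of_int j\<bar> + real (p ^ n)) ^ k"
    unfolding \<psi>_def by (rule G.quotient_shift(1)[OF cl_MM fgM _ T.cl_Kfam]) (use dimM K_MM in \<open>auto simp: le_fun_def\<close>)
  then obtain C where C: "0 \<le> C" "\<And>n j. \<bar>\<psi> n (j + 1) - \<psi> n j\<bar> \<le> C * (\<bar>real_of_int j\<bar> + real (p ^ n)) ^ k" by blast
  have "\<exists>C\<ge>0. \<forall>n j. \<bar>H n (j + 1) - H n j - \<psi> n j\<bar> \<le> C * (\<bar>real_of_int j\<bar> + real (p ^ n)) ^ k"
    unfolding H_def \<psi>_def by (rule G.hh_diff[OF cl_MM fgM]) (use dimM ab in auto)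
  then obtain C' where C': "0 \<le> C'" "\<And>n j. \<bar>H n (j + 1) - H n j - \<psi> n j\<bar> \<le> C' * (\<bar>real_of_int j\<bar> + real (p ^ n)) ^ k" by blast
  have H0: "H n j = 0" if "j \<le> 0" for n j
    unfolding H_def by (rule G.hh_zero[OF cl_MM fgM _ that]) (rule dimM)
  interpret S: density_seq p k \<psi> C
    by unfold_locales (use G.two_le_p C in auto)
  have conv: "convergent (\<lambda>n. S.g n s)" for s
    unfolding S.g_def \<psi>_def by (rule G.module_convergent[OF cl_MM fgM]) (rule dimM)
  have frob: "frobenius_power R J q \<subseteq> carrier R" for q
    by (rule additive_subgroup.a_subset[OF ideal.axioms(1)[OF ideal_frobenius_power]])
  have g: "g n s = S.g n s" for n s
  proof -
    let ?N = "ideal_smult R (frobenius_power R J (p ^ n)) M" and ?j = "\<lfloor>s * real (p ^ n)\<rfloor>"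
    have "Ma ?N = G.ism (G.Jq (p ^ n))"
      using Ma_ideal_smult[OF frob] Ra_frobenius_power by simp
    then have "Ma ?N \<inter> MM ?j = G.JN 1 (p ^ n) MM (\<lambda>_. K) ?j"
      unfolding G.ism_Jq(1) using G.tot_Int[OF G.ism_Jq(2,3)] by simp
    then have "module_length (R\<lparr>carrier := Rg 0\<rparr>) (quotient_degree_part M Mg ?N ?j) = G.\<phi> 1 (p ^ n) MM (\<lambda>_. K) ?j"
      unfolding length_degree_part[OF submodule_ideal_smult[OF frob]] G.\<phi>_def by simp
    then show ?thesis by (simp add: g_def g_tilde_def S.g_def \<psi>_def G.rl_def)
  qed
  have h: "h_seq R M \<mm> J p n s = H n \<lceil>s * real (p ^ n)\<rceil>" for n s
  proof -
    let ?j = "\<lceil>s * real (p ^ n)\<rceil>"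
    let ?I = "ideal_power R \<mm> ?j <+>\<^bsub>R\<^esub> frobenius_power R J (p ^ n)"
    note im = Ra_ideal_power[OF m, of ?j]
    have "?I \<subseteq> carrier R"
      using R.add_ideals[OF im(2) ideal_frobenius_power] by (simp add: additive_subgroup.a_subset ideal.axioms(1))
    moreover have "Ra ?I = G.RG ?j + G.Jq (p ^ n)"
      using Ra_set_add[OF im(2) ideal_frobenius_power] im(1) Ra_frobenius_power by simp
    ultimately have "module_length R (quotient_module M (ideal_smult R ?I M)) = len G.kR (G.ism (G.RG ?j + G.Jq (p ^ n))) Mt"
      using length_quotient[OF submodule_ideal_smult] Ma_ideal_smult by simp
    then show ?thesis unfolding h_seq_def H_def using D.len_ism_RG_Jq[OF ab] by simp
  qed
  have fs: "f_seq R M \<mm> J p n s = H n (\<lceil>s * real (p ^ n)\<rceil> + 1) - H n \<lceil>s * real (p ^ n)\<rceil>" for n s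
  proof -
    have "(s + 1 / real (p ^ n)) * real (p ^ n) = s * real (p ^ n) + 1"
      using S.pn(2)[of n] by (simp add: distrib_right)
    then show ?thesis by (simp add: f_seq_def h)
  qed
  note ctx = conv H0 C'(2,1)
  have G: "lim (\<lambda>n. g n s) = S.G s" for s by (simp add: g S.G_def)
  have hf: "h_fun R M \<mm> J p (Suc (Suc k)) = S.F"
    unfolding h_fun_def h by (intro ext limI S.h_tendsto[OF ctx])
  have ft: "(\<lambda>n. f_seq R M \<mm> J p n s / real (p ^ n) ^ (Suc (Suc k) - 1)) \<longlonglongrightarrow> S.G s" for s
    using S.density_tendsto[OF ctx] by (simp add: fs)
  have gS: "g = S.g" by (intro ext g)
  have dv: "(h_fun R M \<mm> J p (Suc (Suc k)) has_vector_derivative S.G s) (at s)" for s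
    unfolding hf by (rule S.F_derivative[OF ctx])
  show ?thesis
  proof (intro conjI allI impI)
    show "uniformly_convergent_on S' g" if "compact S'" for S'
      unfolding gS uniformly_convergent_on_def using S.uniform[OF conv that] by blast
    show "continuous_on UNIV (\<lambda>s. lim (\<lambda>n. g n s))"
      unfolding G by (rule S.G_cont[OF conv])
    show "h_fun R M \<mm> J p (Suc (Suc k)) C1_differentiable_on UNIV"
      unfolding C1_differentiable_on_def using dv S.G_cont[OF conv] by blast
    fix s
    show "density_exists R M \<mm> J p (Suc (Suc k)) s"
      unfolding density_exists_def convergent_def using ft by blast
    have D: "density_fun R M \<mm> J p (Suc (Suc k)) s = S.G s"
      unfolding density_fun_def by (rule limI[OF ft])
    show "deriv (h_fun R M \<mm> J p (Suc (Suc k))) s = density_fun R M \<mm> J p (Suc (Suc k)) s"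
      unfolding D by (rule DERIV_imp_deriv) (use dv in \<open>simp add: has_real_derivative_iff_has_vector_derivative\<close>)
    show "density_fun R M \<mm> J p (Suc (Suc k)) s = lim (\<lambda>n. g n s)" unfolding D G ..
  qed
qed

end

text \<open>The monoid ring \<open>\<int>[\<nat>\<^bsup>(R \<times> M)\<^esup>]\<close> maps onto the idealization; a monomial is
  sent to the product of its variables, where the pair \<open>(a, x)\<close> stands for \<open>a + x\<close>.\<close>

lemma presentation_exists:
  assumes "graded_module R Rg M Mg"
  obtains e1 :: "(('a \<times> 'b) multiset \<Rightarrow>\<^sub>0 int) \<Rightarrow> 'a" and e2 :: "(('a \<times> 'b) multiset \<Rightarrow>\<^sub>0 int) \<Rightarrow> 'b" where
    "\<And>f. e1 f \<in> carrier R" "\<And>f. e2 f \<in> carrier M"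
    "\<And>f g. e1 (f + g) = e1 f \<oplus>\<^bsub>R\<^esub> e1 g" "\<And>f g. e2 (f + g) = e2 f \<oplus>\<^bsub>M\<^esub> e2 g"
    "\<And>f g. e1 (f * g) = e1 f \<otimes>\<^bsub>R\<^esub> e1 g"
    "\<And>f g. e2 (f * g) = (e1 f \<odot>\<^bsub>M\<^esub> e2 g) \<oplus>\<^bsub>M\<^esub> (e1 g \<odot>\<^bsub>M\<^esub> e2 f)"
    "e1 1 = \<one>\<^bsub>R\<^esub>" "e2 1 = \<zero>\<^bsub>M\<^esub>"
    "\<And>a x. a \<in> carrier R \<Longrightarrow> x \<in> carrier M \<Longrightarrow> \<exists>f. e1 f = a \<and> e2 f = x"
proof -
  interpret graded_module R Rg M Mg by fact
  define C where "C = carrier R \<times> carrier M"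
  define mul where "mul v w = (fst v \<otimes>\<^bsub>R\<^esub> fst w, (fst v \<odot>\<^bsub>M\<^esub> snd w) \<oplus>\<^bsub>M\<^esub> (fst w \<odot>\<^bsub>M\<^esub> snd v))" for v w
  \<comment> \<open>Pairs outside the carriers are ignored. This makes \<open>op\<close> total and
    commuting on the whole type, as folding over multisets requires.\<close>
  define op where "op v w = (if v \<in> C \<and> w \<in> C then mul v w else w)" for v w
  have mul_C: "mul v w \<in> C" if "v \<in> C" "w \<in> C" for v w using that by (auto simp: C_def mul_def)
  have mul_left: "mul u (mul v w) = mul v (mul u w)" if "u \<in> C" "v \<in> C" "w \<in> C" for u v w
    using that by (auto simp: C_def mul_def smult_r_distr smult_l_distr smult_assoc1[symmetric] R.m_ac M.a_ac)
  have mul_assoc: "mul (mul u v) w = mul u (mul v w)" if "u \<in> C" "v \<in> C" "w \<in> C" for u v w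
    using that by (auto simp: C_def mul_def smult_r_distr smult_l_distr smult_assoc1[symmetric] R.m_ac M.a_ac)
  interpret op: comp_fun_commute op
    by standard (auto simp: op_def mul_C mul_left)
  define ev where "ev = fold_mset op (\<one>\<^bsub>R\<^esub>, \<zero>\<^bsub>M\<^esub>)"
  have ev_C: "ev m \<in> C" for m
  proof (induction m)
    case (add v m)
    then show ?case by (simp add: ev_def op_def mul_C)
  qed (simp add: ev_def C_def)
  have one_mul: "mul (\<one>\<^bsub>R\<^esub>, \<zero>\<^bsub>M\<^esub>) v = v" if "v \<in> C" for v using that by (auto simp: C_def mul_def)
  have ev_add: "ev (m + n) = mul (ev m) (ev n)" for m n
  proof (induction m)
    case empty
    then show ?case using one_mul[OF ev_C] by (simp add: ev_def)
  next
    case (add v m)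
    then show ?case using ev_C[of m] ev_C[of n] by (simp add: ev_def op_def mul_C mul_assoc)
  qed
  have ev_sub: "(fst \<circ> ev) ` UNIV \<subseteq> carrier (add_monoid R)" "(snd \<circ> ev) ` UNIV \<subseteq> carrier (add_monoid M)"
    using ev_C by (auto simp: C_def mem_Times_iff)
  \<comment> \<open>Additively the monoid ring is the free abelian group on the multisets, so the
    universal property extends \<open>ev\<close>; multiplicativity then has to be checked on
    monomials only.\<close>
  obtain e1 where e1: "e1 \<in> hom (free_Abelian_group UNIV) (add_monoid R)" "\<And>m. e1 (frag_of m) = fst (ev m)"
    using comm_group.free_Abelian_group_universal[OF R.a_comm_group ev_sub(1)] by auto
  obtain e2 where e2: "e2 \<in> hom (free_Abelian_group UNIV) (add_monoid M)" "\<And>m. e2 (frag_of m) = snd (ev m)"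
    using comm_group.free_Abelian_group_universal[OF M.a_comm_group ev_sub(2)] by auto
  have cl [simp]: "e1 f \<in> carrier R" "e2 f \<in> carrier M" for f
    using hom_in_carrier[OF e1(1), of f] hom_in_carrier[OF e2(1), of f] by auto
  have add: "e1 (f + g) = e1 f \<oplus>\<^bsub>R\<^esub> e1 g" "e2 (f + g) = e2 f \<oplus>\<^bsub>M\<^esub> e2 g" for f g
    using hom_mult[OF e1(1), of f g] hom_mult[OF e2(1), of f g] by auto
  have zero: "e1 0 = \<zero>\<^bsub>R\<^esub>" "e2 0 = \<zero>\<^bsub>M\<^esub>"
    using add[of 0 0] by (auto simp: R.add.l_cancel_one M.add.l_cancel_one)
  have minus: "e1 (- f) = \<ominus>\<^bsub>R\<^esub> e1 f" "e2 (- f) = \<ominus>\<^bsub>M\<^esub> e2 f" for f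
    using add[of "- f" f] by (auto simp: zero R.minus_equality M.minus_equality)
  have diff: "e1 (f - g) = e1 f \<oplus>\<^bsub>R\<^esub> \<ominus>\<^bsub>R\<^esub> e1 g" "e2 (f - g) = e2 f \<oplus>\<^bsub>M\<^esub> \<ominus>\<^bsub>M\<^esub> e2 g" for f g
    using add[of f "- g"] by (simp_all add: minus)
  define pr where "pr f g \<longleftrightarrow> e1 (f * g) = e1 f \<otimes>\<^bsub>R\<^esub> e1 g \<and>
       e2 (f * g) = (e1 f \<odot>\<^bsub>M\<^esub> e2 g) \<oplus>\<^bsub>M\<^esub> (e1 g \<odot>\<^bsub>M\<^esub> e2 f)" for f g
  have pr_sym: "pr g f" if "pr f g" for f g
    using that by (simp add: pr_def mult.commute R.m_comm M.a_comm)
  have pr_diff: "pr (f - f') g" if "pr f g" "pr f' g" for f f' g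
    using that by (simp add: pr_def left_diff_distrib diff R.l_distr R.l_minus smult_l_distr smult_r_distr
        smult_l_minus smult_r_minus M.minus_add M.a_ac)
  have pr_zero: "pr 0 g" for g by (simp add: pr_def zero)
  have pr_mono: "pr (frag_of m) (frag_of n)" for m n
    by (simp add: pr_def mult_single e1(2) e2(2) ev_add mul_def)
  have pr_frag: "pr f (frag_of n)" for f n
    using subset_UNIV by (induction f rule: frag_induction) (auto intro: pr_zero pr_mono pr_diff)
  have "pr f g" for f g
    using subset_UNIV[of "Poly_Mapping.keys g"]
  proof (induction g rule: frag_induction)
    case (diff g h)
    show ?case by (rule pr_sym[OF pr_diff[OF pr_sym[OF diff(1)] pr_sym[OF diff(2)]]])
  qed (simp_all add: pr_frag pr_sym[OF pr_zero])
  then have mult: "e1 (f * g) = e1 f \<otimes>\<^bsub>R\<^esub> e1 g"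
    "e2 (f * g) = (e1 f \<odot>\<^bsub>M\<^esub> e2 g) \<oplus>\<^bsub>M\<^esub> (e1 g \<odot>\<^bsub>M\<^esub> e2 f)" for f g
    unfolding pr_def by blast+
  have one: "e1 1 = \<one>\<^bsub>R\<^esub>" "e2 1 = \<zero>\<^bsub>M\<^esub>"
    using e1(2)[of "{#}"] e2(2)[of "{#}"] by (simp_all add: ev_def single_one[symmetric] del: single_one)
  have "\<exists>f. e1 f = a \<and> e2 f = x" if "a \<in> carrier R" "x \<in> carrier M" for a x
  proof -
    have "ev {#(a, x)#} = (a, x)" using that by (simp add: ev_def op_def C_def mul_def)
    then show ?thesis using e1(2) e2(2) by (metis fst_conv snd_conv)
  qed
  then show thesis by (rule that[OF cl add mult one])
qed

theorem theorem6p10: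
  fixes R :: "('a, 'r) ring_scheme" and Rg :: "nat \<Rightarrow> 'a set"
    and M :: "('a, 'b, 'm) module_scheme" and Mg :: "int \<Rightarrow> 'b set"
    and \<mm> J :: "'a set" and p d :: nat
  assumes "standard_graded_ring R Rg"
    and "ring_char R = p" and "p > 0"
    and "F_finite R p"
    and "maximalideal \<mm> R" and "homogeneous_ideal R Rg \<mm>"
    and "homogeneous_ideal R Rg J" and "J \<noteq> carrier R"
    and "graded_module R Rg M Mg"
    and "finitely_generated_module R M"
    and "module_dim R M = enat d" and "d \<ge> 2"
  shows
    "(\<forall>K. compact K \<longrightarrow> uniformly_convergent_on K (g_tilde R Rg M Mg J p (d - 1))) \<and>
     continuous_on UNIV (\<lambda>s. lim (\<lambda>n. g_tilde R Rg M Mg J p (d - 1) n s)) \<and>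
     h_fun R M \<mm> J p d C1_differentiable_on UNIV \<and>
     (\<forall>s. density_exists R M \<mm> J p d s) \<and>
     (\<forall>s. deriv (h_fun R M \<mm> J p d) s = density_fun R M \<mm> J p d s \<and>
          density_fun R M \<mm> J p d s = lim (\<lambda>n. g_tilde R Rg M Mg J p (d - 1) n s))"
proof -
  obtain e1 :: "(('a \<times> 'b) multiset \<Rightarrow>\<^sub>0 int) \<Rightarrow> 'a" and e2 :: "(('a \<times> 'b) multiset \<Rightarrow>\<^sub>0 int) \<Rightarrow> 'b" where
    e: "\<And>f. e1 f \<in> carrier R" "\<And>f. e2 f \<in> carrier M"
      "\<And>f g. e1 (f + g) = e1 f \<oplus>\<^bsub>R\<^esub> e1 g" "\<And>f g. e2 (f + g) = e2 f \<oplus>\<^bsub>M\<^esub> e2 g"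
      "\<And>f g. e1 (f * g) = e1 f \<otimes>\<^bsub>R\<^esub> e1 g"
      "\<And>f g. e2 (f * g) = (e1 f \<odot>\<^bsub>M\<^esub> e2 g) \<oplus>\<^bsub>M\<^esub> (e1 g \<odot>\<^bsub>M\<^esub> e2 f)"
      "e1 1 = \<one>\<^bsub>R\<^esub>" "e2 1 = \<zero>\<^bsub>M\<^esub>"
      "\<And>a x. a \<in> carrier R \<Longrightarrow> x \<in> carrier M \<Longrightarrow> \<exists>f. e1 f = a \<and> e2 f = x"
    by (rule presentation_exists[OF assms(9)]) (rule that; assumption)
  define K where "K = {f. e1 f = \<zero>\<^bsub>R\<^esub> \<and> e2 f = \<zero>\<^bsub>M\<^esub>}"
  define RR where "RR i = {f. e2 f = \<zero>\<^bsub>M\<^esub> \<and> e1 f \<in> (if i < 0 then {\<zero>\<^bsub>R\<^esub>} else Rg (nat i))}" for i :: int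
  define MM where "MM j = {f. e1 f = \<zero>\<^bsub>R\<^esub> \<and> e2 f \<in> Mg j}" for j
  define Rt where "Rt = {f. e2 f = \<zero>\<^bsub>M\<^esub>}"
  define Mt where "Mt = {f. e1 f = \<zero>\<^bsub>R\<^esub>}"
  have "realization R Rg M Mg p e1 e2 K RR MM Rt Mt"
    by (intro realization.intro realization_axioms.intro assms e K_def RR_def MM_def Rt_def Mt_def)
  then interpret Z: realization R Rg M Mg p e1 e2 K RR MM Rt Mt .
  obtain X Y where "fring RR K p X Y" using Z.fring_exists by blast
  then interpret Z: presented R Rg M Mg p e1 e2 K RR MM Rt Mt X Y
    by (intro presented.intro Z.realization_axioms)
  obtain F where F: "finite F" "\<forall>fe\<in>F. fst fe \<in> RR (snd fe) \<and> e1 (fst fe) \<in> J"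
      "\<forall>W. Z.E.kR W \<longrightarrow> K \<subseteq> W \<longrightarrow> (\<forall>fe\<in>F. fst fe \<in> W) \<longrightarrow> Z.Ra J \<subseteq> W"
    using Z.homogeneous_ideal_generators[OF assms(7)] by blast
  interpret Z: presented_ideal R Rg M Mg p e1 e2 K RR MM Rt Mt X Y J F
    by unfold_locales (use assms(7) F in auto)
  obtain k where k: "d = Suc (Suc k)" using \<open>d \<ge> 2\<close> by (metis add_2_eq_Suc le_Suc_ex)
  show ?thesis
    using Z.density[OF assms(5,6,10), of k] assms(11) unfolding k by simp
qed

end
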